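(* Assume $\mathsf{ZFC}$ is consistent. Then $\mathsf{MA}_{\aleph_1}(\mathrm{Knaster})$ + "every Aronszajn tree is special" does not imply $\mathsf{BA}_{\rm Lip}(2^\omega)$; that is, $\mathsf{ZFC}+\mathsf{MA}_{\aleph_1}(\mathrm{Knaster})$ + "every Aronszajn tree is special" does not prove $\mathsf{BA}_{\rm Lip}(2^\omega)$.
   Context: On $2^\omega$ use the metric $d(x,y)=2^{-k}$ where $k$ is least with $x(k)\neq y(k)$ (and $d(x,x)=0$). Lipschitz always means with constant $1$: $f:2^\omega\to 2^\omega$ is Lipschitz if for all $x,y$ and all $k<\omega$, $x\upharpoonright k=y\upharpoonright k$ implies $f(x)\upharpoonright k=f(y)\upharpoonright k$. A subset of a topological space is $\aleph_1$-dense if its intersection with every non-empty open set has size exactly $\aleph_1$. $\mathsf{BA}_{\rm Lip}(2^\omega)$ is the statement: for all $\aleph_1$-dense $A,B\subseteq 2^\omega$ there is a Lipschitz $f:2^\omega\to2^\omega$ such that $f\upharpoonright A$ is injective and $f``A\subseteq B$. A partial order $\mathbb P$ is Knaster if every uncountable $A\subseteq\mathbb P$ contains an uncountable $B\subseteq A$ of pairwise compatible elements. $\mathsf{MA}_{\aleph_1}(\mathrm{Knaster})$: for every Knaster $\mathbb P$ and every family of at most $\aleph_1$ many dense subsets of $\mathbb P$ there is a filter on $\mathbb P$ meeting all of them. A tree $T$ of height $\omega_1$ is special if there is a function $f:T\to\omega$ which is injective on chains. *)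

theory Defs
  imports Main
begin

section \<open>First-order logic over the language of set theory\<close>

text \<open>Variables are de Bruijn indices. The language has no function symbols, so the only terms
  are variables, and a substitution is a map \<open>nat \<Rightarrow> nat\<close>.\<close>

datatype fm = Mem nat nat | Equ nat nat | Bot | Imp fm fm | Forall fm

primrec subst :: "(nat \<Rightarrow> nat) \<Rightarrow> fm \<Rightarrow> fm" where
  "subst f (Mem i j) = Mem (f i) (f j)"
| "subst f (Equ i j) = Equ (f i) (f j)"
| "subst f Bot = Bot"
| "subst f (Imp p q) = Imp (subst f p) (subst f q)"
| "subst f (Forall p) = Forall (subst (case_nat 0 (\<lambda>i. Suc (f i))) p)"

text \<open>Classical natural deduction with equality. Formulas in the context may have free
  variables, so \<open>ForallI\<close> shifts the context to make index \<open>0\<close> fresh.\<close>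

inductive proves :: "fm set \<Rightarrow> fm \<Rightarrow> bool"  (infix "\<turnstile>" 50) where
  Hyp: "p \<in> \<Gamma> \<Longrightarrow> \<Gamma> \<turnstile> p"
| ImpI: "insert p \<Gamma> \<turnstile> q \<Longrightarrow> \<Gamma> \<turnstile> Imp p q"
| ImpE: "\<Gamma> \<turnstile> Imp p q \<Longrightarrow> \<Gamma> \<turnstile> p \<Longrightarrow> \<Gamma> \<turnstile> q"
| Contr: "insert (Imp p Bot) \<Gamma> \<turnstile> Bot \<Longrightarrow> \<Gamma> \<turnstile> p"
| ForallI: "subst Suc ` \<Gamma> \<turnstile> p \<Longrightarrow> \<Gamma> \<turnstile> Forall p"
| ForallE: "\<Gamma> \<turnstile> Forall p \<Longrightarrow> \<Gamma> \<turnstile> subst (case_nat i (\<lambda>j. j)) p"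
| EquI: "\<Gamma> \<turnstile> Equ i i"
| EquE: "\<Gamma> \<turnstile> Equ i j \<Longrightarrow> \<Gamma> \<turnstile> subst (case_nat i (\<lambda>k. k)) p
           \<Longrightarrow> \<Gamma> \<turnstile> subst (case_nat j (\<lambda>k. k)) p"

definition consistent :: "fm set \<Rightarrow> bool" where
  "consistent \<Gamma> \<longleftrightarrow> \<not> \<Gamma> \<turnstile> Bot"

text \<open>All free variables of \<open>p\<close> are below \<open>fv_bound p\<close>.\<close>

primrec fv_bound :: "fm \<Rightarrow> nat" where
  "fv_bound (Mem i j) = max (Suc i) (Suc j)"
| "fv_bound (Equ i j) = max (Suc i) (Suc j)"
| "fv_bound Bot = 0"
| "fv_bound (Imp p q) = max (fv_bound p) (fv_bound q)"
| "fv_bound (Forall p) = fv_bound p - 1"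

definition closure :: "fm \<Rightarrow> fm" where
  "closure p = (Forall ^^ fv_bound p) p"


section \<open>Writing formulas with named variables\<close>

text \<open>A \<open>form\<close> is a formula that still has to be told the number \<open>d\<close> of quantifiers enclosing
  it. A variable is represented by its level, the number of quantifiers enclosing its own
  quantifier; below \<open>d\<close> quantifiers, level \<open>x\<close> is the de Bruijn index \<open>d - Suc x\<close>. Hence bound
  variables can be written as HOL-bound variables, and applying a \<open>form\<close> to \<open>0\<close> yields the actual
  formula.\<close>

type_synonym form = "nat \<Rightarrow> fm"

definition mem_f :: "nat \<Rightarrow> nat \<Rightarrow> form"  (infix "\<^bold>\<in>" 55) where
  "(x \<^bold>\<in> y) = (\<lambda>d. Mem (d - Suc x) (d - Suc y))"

definition eq_f :: "nat \<Rightarrow> nat \<Rightarrow> form"  (infix "\<^bold>=" 55) where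
  "(x \<^bold>= y) = (\<lambda>d. Equ (d - Suc x) (d - Suc y))"

definition imp_f :: "form \<Rightarrow> form \<Rightarrow> form"  (infixr "\<^bold>\<longrightarrow>" 25) where
  "(P \<^bold>\<longrightarrow> Q) = (\<lambda>d. Imp (P d) (Q d))"

definition not_f :: "form \<Rightarrow> form"  ("\<^bold>\<not> _" [40] 40) where
  "(\<^bold>\<not> P) = (\<lambda>d. Imp (P d) Bot)"

definition and_f :: "form \<Rightarrow> form \<Rightarrow> form"  (infixr "\<^bold>\<and>" 35) where
  "(P \<^bold>\<and> Q) = (\<^bold>\<not> (P \<^bold>\<longrightarrow> \<^bold>\<not> Q))"

definition or_f :: "form \<Rightarrow> form \<Rightarrow> form"  (infixr "\<^bold>\<or>" 30) where
  "(P \<^bold>\<or> Q) = (\<^bold>\<not> P \<^bold>\<longrightarrow> Q)"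

definition iff_f :: "form \<Rightarrow> form \<Rightarrow> form"  (infix "\<^bold>\<longleftrightarrow>" 25) where
  "(P \<^bold>\<longleftrightarrow> Q) = ((P \<^bold>\<longrightarrow> Q) \<^bold>\<and> (Q \<^bold>\<longrightarrow> P))"

definition all_f :: "(nat \<Rightarrow> form) \<Rightarrow> form"  (binder "\<^bold>\<forall>" 10) where
  "(\<^bold>\<forall>x. P x) = (\<lambda>d. Forall (P d (Suc d)))"

definition ex_f :: "(nat \<Rightarrow> form) \<Rightarrow> form"  (binder "\<^bold>\<exists>" 10) where
  "(\<^bold>\<exists>x. P x) = (\<^bold>\<not> (\<^bold>\<forall>x. \<^bold>\<not> P x))"

definition ball_f :: "nat \<Rightarrow> (nat \<Rightarrow> form) \<Rightarrow> form" where
  "ball_f A P = (\<^bold>\<forall>x. x \<^bold>\<in> A \<^bold>\<longrightarrow> P x)"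

definition bex_f :: "nat \<Rightarrow> (nat \<Rightarrow> form) \<Rightarrow> form" where
  "bex_f A P = (\<^bold>\<exists>x. x \<^bold>\<in> A \<^bold>\<and> P x)"

syntax
  "_ball_f" :: "[pttrn, nat, form] \<Rightarrow> form"  ("(3\<^bold>\<forall>_\<^bold>\<in>_./ _)" [0, 0, 10] 10)
  "_bex_f" :: "[pttrn, nat, form] \<Rightarrow> form"  ("(3\<^bold>\<exists>_\<^bold>\<in>_./ _)" [0, 0, 10] 10)
translations
  "\<^bold>\<forall>x\<^bold>\<in>A. P" \<rightleftharpoons> "CONST ball_f A (\<lambda>x. P)"
  "\<^bold>\<exists>x\<^bold>\<in>A. P" \<rightleftharpoons> "CONST bex_f A (\<lambda>x. P)"

text \<open>An arbitrary formula \<open>p\<close> with designated variables of index \<open>0\<close> (and \<open>1\<close>) replaced by \<open>x\<close>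
  (and \<open>y\<close>). Its remaining variables are parameters, left free: below \<open>d\<close> quantifiers, the
  indices from \<open>d\<close> on are free.\<close>

definition holds1 :: "fm \<Rightarrow> nat \<Rightarrow> form" where
  "holds1 p x = (\<lambda>d. subst (case_nat (d - Suc x) (\<lambda>i. d + i)) p)"

definition holds2 :: "fm \<Rightarrow> nat \<Rightarrow> nat \<Rightarrow> form" where
  "holds2 p x y = (\<lambda>d. subst (case_nat (d - Suc x) (case_nat (d - Suc y) (\<lambda>i. d + i))) p)"


section \<open>Basic set theory\<close>

definition is_empty :: "nat \<Rightarrow> form" where
  "is_empty e = (\<^bold>\<forall>x. \<^bold>\<not> x \<^bold>\<in> e)"

definition subset_f :: "nat \<Rightarrow> nat \<Rightarrow> form"  (infix "\<^bold>\<subseteq>" 55) where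
  "(A \<^bold>\<subseteq> B) = (\<^bold>\<forall>x\<^bold>\<in>A. x \<^bold>\<in> B)"

definition is_inter :: "nat \<Rightarrow> nat \<Rightarrow> nat \<Rightarrow> form" where
  "is_inter I A B = (\<^bold>\<forall>x. x \<^bold>\<in> I \<^bold>\<longleftrightarrow> x \<^bold>\<in> A \<^bold>\<and> x \<^bold>\<in> B)"

definition is_upair :: "nat \<Rightarrow> nat \<Rightarrow> nat \<Rightarrow> form" where
  "is_upair p a b = (\<^bold>\<forall>x. x \<^bold>\<in> p \<^bold>\<longleftrightarrow> x \<^bold>= a \<^bold>\<or> x \<^bold>= b)"

definition is_pair :: "nat \<Rightarrow> nat \<Rightarrow> nat \<Rightarrow> form" where
  "is_pair p a b = (\<^bold>\<exists>s. \<^bold>\<exists>t. is_upair s a a \<^bold>\<and> is_upair t a b \<^bold>\<and> is_upair p s t)"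

text \<open>\<open>(a, b) \<in> R\<close>; for a function \<open>R\<close> this says \<open>R(a) = b\<close>.\<close>

definition rel :: "nat \<Rightarrow> nat \<Rightarrow> nat \<Rightarrow> form" where
  "rel R a b = (\<^bold>\<exists>p\<^bold>\<in>R. is_pair p a b)"

definition is_succ :: "nat \<Rightarrow> nat \<Rightarrow> form" where
  "is_succ s x = (\<^bold>\<forall>y. y \<^bold>\<in> s \<^bold>\<longleftrightarrow> y \<^bold>\<in> x \<^bold>\<or> y \<^bold>= x)"

definition is_fun :: "nat \<Rightarrow> nat \<Rightarrow> nat \<Rightarrow> form" where
  "is_fun f A B = ((\<^bold>\<forall>p\<^bold>\<in>f. \<^bold>\<exists>x\<^bold>\<in>A. \<^bold>\<exists>y\<^bold>\<in>B. is_pair p x y) \<^bold>\<and>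
     (\<^bold>\<forall>x\<^bold>\<in>A. \<^bold>\<exists>y. rel f x y \<^bold>\<and> (\<^bold>\<forall>z. rel f x z \<^bold>\<longrightarrow> z \<^bold>= y)))"

definition inj_on_f :: "nat \<Rightarrow> nat \<Rightarrow> form" where
  "inj_on_f f A = (\<^bold>\<forall>x\<^bold>\<in>A. \<^bold>\<forall>y\<^bold>\<in>A. \<^bold>\<forall>z. rel f x z \<^bold>\<and> rel f y z \<^bold>\<longrightarrow> x \<^bold>= y)"

definition is_bij :: "nat \<Rightarrow> nat \<Rightarrow> nat \<Rightarrow> form" where
  "is_bij f A B = (is_fun f A B \<^bold>\<and> inj_on_f f A \<^bold>\<and> (\<^bold>\<forall>y\<^bold>\<in>B. \<^bold>\<exists>x\<^bold>\<in>A. rel f x y))"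

definition is_restriction :: "nat \<Rightarrow> nat \<Rightarrow> nat \<Rightarrow> form" where
  "is_restriction r f A = (\<^bold>\<forall>p. p \<^bold>\<in> r \<^bold>\<longleftrightarrow> p \<^bold>\<in> f \<^bold>\<and> (\<^bold>\<exists>x\<^bold>\<in>A. \<^bold>\<exists>y. is_pair p x y))"

text \<open>Under Foundation, a transitive set linearly ordered by membership is well-ordered by it.\<close>

definition is_ordinal :: "nat \<Rightarrow> form" where
  "is_ordinal a = ((\<^bold>\<forall>x\<^bold>\<in>a. x \<^bold>\<subseteq> a) \<^bold>\<and> (\<^bold>\<forall>x\<^bold>\<in>a. \<^bold>\<forall>y\<^bold>\<in>a. x \<^bold>\<in> y \<^bold>\<or> x \<^bold>= y \<^bold>\<or> y \<^bold>\<in> x))"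

definition is_limit :: "nat \<Rightarrow> form" where
  "is_limit a = (is_ordinal a \<^bold>\<and> \<^bold>\<not> is_empty a \<^bold>\<and> (\<^bold>\<forall>x\<^bold>\<in>a. \<^bold>\<exists>y\<^bold>\<in>a. x \<^bold>\<in> y))"

definition is_omega :: "nat \<Rightarrow> form" where
  "is_omega w = (is_limit w \<^bold>\<and> (\<^bold>\<forall>x\<^bold>\<in>w. \<^bold>\<not> is_limit x))"

definition lepoll_f :: "nat \<Rightarrow> nat \<Rightarrow> form" where
  "lepoll_f A B = (\<^bold>\<exists>f. is_fun f A B \<^bold>\<and> inj_on_f f A)"

definition countable_f :: "nat \<Rightarrow> form" where
  "countable_f A = (\<^bold>\<exists>w. is_omega w \<^bold>\<and> lepoll_f A w)"

definition is_omega1 :: "nat \<Rightarrow> form" where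
  "is_omega1 u = (is_ordinal u \<^bold>\<and> \<^bold>\<not> countable_f u \<^bold>\<and> (\<^bold>\<forall>x\<^bold>\<in>u. countable_f x))"

definition size_aleph1 :: "nat \<Rightarrow> form" where
  "size_aleph1 A = (\<^bold>\<exists>u. is_omega1 u \<^bold>\<and> (\<^bold>\<exists>f. is_bij f A u))"

definition size_le_aleph1 :: "nat \<Rightarrow> form" where
  "size_le_aleph1 A = (\<^bold>\<exists>u. is_omega1 u \<^bold>\<and> lepoll_f A u)"


section \<open>The axioms of ZFC\<close>

definition Extensionality :: form where
  "Extensionality = (\<^bold>\<forall>x. \<^bold>\<forall>y. (\<^bold>\<forall>z. z \<^bold>\<in> x \<^bold>\<longleftrightarrow> z \<^bold>\<in> y) \<^bold>\<longrightarrow> x \<^bold>= y)"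

definition Foundation :: form where
  "Foundation = (\<^bold>\<forall>x. \<^bold>\<not> is_empty x \<^bold>\<longrightarrow> (\<^bold>\<exists>y\<^bold>\<in>x. \<^bold>\<forall>z\<^bold>\<in>y. \<^bold>\<not> z \<^bold>\<in> x))"

definition Pairing :: form where
  "Pairing = (\<^bold>\<forall>x. \<^bold>\<forall>y. \<^bold>\<exists>p. is_upair p x y)"

definition Union_ax :: form where
  "Union_ax = (\<^bold>\<forall>F. \<^bold>\<exists>U. \<^bold>\<forall>x. x \<^bold>\<in> U \<^bold>\<longleftrightarrow> (\<^bold>\<exists>y\<^bold>\<in>F. x \<^bold>\<in> y))"

definition Powerset :: form where
  "Powerset = (\<^bold>\<forall>x. \<^bold>\<exists>P. \<^bold>\<forall>y. y \<^bold>\<in> P \<^bold>\<longleftrightarrow> y \<^bold>\<subseteq> x)"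

definition Infinity :: form where
  "Infinity = (\<^bold>\<exists>I. (\<^bold>\<exists>e\<^bold>\<in>I. is_empty e) \<^bold>\<and> (\<^bold>\<forall>x\<^bold>\<in>I. \<^bold>\<exists>s\<^bold>\<in>I. is_succ s x))"

definition Choice :: form where
  "Choice = (\<^bold>\<forall>F. (\<^bold>\<forall>x\<^bold>\<in>F. \<^bold>\<not> is_empty x) \<^bold>\<longrightarrow>
     (\<^bold>\<exists>U. \<^bold>\<exists>f. is_fun f F U \<^bold>\<and> (\<^bold>\<forall>x\<^bold>\<in>F. \<^bold>\<forall>y. rel f x y \<^bold>\<longrightarrow> y \<^bold>\<in> x)))"

definition Separation :: "fm \<Rightarrow> form" where
  "Separation p = (\<^bold>\<forall>a. \<^bold>\<exists>b. \<^bold>\<forall>x. x \<^bold>\<in> b \<^bold>\<longleftrightarrow> x \<^bold>\<in> a \<^bold>\<and> holds1 p x)"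

definition Replacement :: "fm \<Rightarrow> form" where
  "Replacement p = (\<^bold>\<forall>a. (\<^bold>\<forall>x\<^bold>\<in>a. \<^bold>\<forall>y. \<^bold>\<forall>z. holds2 p x y \<^bold>\<and> holds2 p x z \<^bold>\<longrightarrow> y \<^bold>= z) \<^bold>\<longrightarrow>
     (\<^bold>\<exists>b. \<^bold>\<forall>y. y \<^bold>\<in> b \<^bold>\<longleftrightarrow> (\<^bold>\<exists>x\<^bold>\<in>a. holds2 p x y)))"

definition ZFC :: "fm set" where
  "ZFC = {Extensionality 0, Foundation 0, Pairing 0, Union_ax 0, Powerset 0, Infinity 0, Choice 0}
     \<union> {closure (Separation p 0) | p. True} \<union> {closure (Replacement p 0) | p. True}"


section \<open>The Lipschitz Baumgartner axiom on Cantor space\<close>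

definition is_two :: "nat \<Rightarrow> form" where
  "is_two t = (\<^bold>\<forall>x. x \<^bold>\<in> t \<^bold>\<longleftrightarrow> is_empty x \<^bold>\<or> (\<^bold>\<exists>e. is_empty e \<^bold>\<and> is_succ x e))"

definition is_cantor_space :: "nat \<Rightarrow> form" where
  "is_cantor_space C = (\<^bold>\<exists>w. \<^bold>\<exists>t. is_omega w \<^bold>\<and> is_two t \<^bold>\<and> (\<^bold>\<forall>x. x \<^bold>\<in> C \<^bold>\<longleftrightarrow> is_fun x w t))"

definition differ_at :: "nat \<Rightarrow> nat \<Rightarrow> nat \<Rightarrow> form" where
  "differ_at x y k = (\<^bold>\<exists>u. \<^bold>\<exists>v. rel x k u \<^bold>\<and> rel y k v \<^bold>\<and> \<^bold>\<not> u \<^bold>= v)"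

definition least_difference :: "nat \<Rightarrow> nat \<Rightarrow> nat \<Rightarrow> form" where
  "least_difference x y k = (differ_at x y k \<^bold>\<and> (\<^bold>\<forall>j\<^bold>\<in>k. \<^bold>\<not> differ_at x y j))"

text \<open>\<open>d(x, y) < 2^{-n}\<close>: either \<open>x = y\<close> and there is no \<open>k\<close> as below, or \<open>d(x, y) = 2^{-k}\<close> with
  \<open>n < k\<close>. The balls of radius \<open>2^{-n}\<close> suffice to define the metric topology.\<close>

definition dist_less :: "nat \<Rightarrow> nat \<Rightarrow> nat \<Rightarrow> form" where
  "dist_less x y n = (\<^bold>\<forall>k. least_difference x y k \<^bold>\<longrightarrow> n \<^bold>\<in> k)"

definition open_in_cantor :: "nat \<Rightarrow> nat \<Rightarrow> form" where
  "open_in_cantor C U = (U \<^bold>\<subseteq> C \<^bold>\<and>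
     (\<^bold>\<exists>w. is_omega w \<^bold>\<and> (\<^bold>\<forall>x\<^bold>\<in>U. \<^bold>\<exists>n\<^bold>\<in>w. \<^bold>\<forall>y\<^bold>\<in>C. dist_less x y n \<^bold>\<longrightarrow> y \<^bold>\<in> U)))"

definition aleph1_dense :: "nat \<Rightarrow> nat \<Rightarrow> form" where
  "aleph1_dense C A = (A \<^bold>\<subseteq> C \<^bold>\<and>
     (\<^bold>\<forall>U. open_in_cantor C U \<^bold>\<and> \<^bold>\<not> is_empty U \<^bold>\<longrightarrow> (\<^bold>\<exists>I. is_inter I A U \<^bold>\<and> size_aleph1 I)))"

definition eq_restriction :: "nat \<Rightarrow> nat \<Rightarrow> nat \<Rightarrow> form" where
  "eq_restriction x y k = (\<^bold>\<exists>r. is_restriction r x k \<^bold>\<and> is_restriction r y k)"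

definition lipschitz_f :: "nat \<Rightarrow> nat \<Rightarrow> form" where
  "lipschitz_f C f = (is_fun f C C \<^bold>\<and> (\<^bold>\<exists>w. is_omega w \<^bold>\<and>
     (\<^bold>\<forall>x\<^bold>\<in>C. \<^bold>\<forall>y\<^bold>\<in>C. \<^bold>\<forall>fx. \<^bold>\<forall>fy. rel f x fx \<^bold>\<and> rel f y fy \<^bold>\<longrightarrow>
       (\<^bold>\<forall>k\<^bold>\<in>w. eq_restriction x y k \<^bold>\<longrightarrow> eq_restriction fx fy k))))"

definition BA_Lip :: form where
  "BA_Lip = (\<^bold>\<exists>C. is_cantor_space C \<^bold>\<and>
     (\<^bold>\<forall>A. \<^bold>\<forall>B. aleph1_dense C A \<^bold>\<and> aleph1_dense C B \<^bold>\<longrightarrow>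
       (\<^bold>\<exists>f. lipschitz_f C f \<^bold>\<and> inj_on_f f A \<^bold>\<and> (\<^bold>\<forall>x\<^bold>\<in>A. \<^bold>\<forall>y. rel f x y \<^bold>\<longrightarrow> y \<^bold>\<in> B))))"


section \<open>Martin's axiom for Knaster partial orders\<close>

text \<open>\<open>rel R p q\<close> is \<open>p \<le> q\<close>, i.e. \<open>p\<close> is stronger than \<open>q\<close>. Partial orders are non-empty, as
  always in forcing; otherwise there would be no filter.\<close>

definition partial_order_f :: "nat \<Rightarrow> nat \<Rightarrow> form" where
  "partial_order_f P R = (\<^bold>\<not> is_empty P \<^bold>\<and>
     (\<^bold>\<forall>p\<^bold>\<in>P. rel R p p) \<^bold>\<and>
     (\<^bold>\<forall>p\<^bold>\<in>P. \<^bold>\<forall>q\<^bold>\<in>P. rel R p q \<^bold>\<and> rel R q p \<^bold>\<longrightarrow> p \<^bold>= q) \<^bold>\<and>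
     (\<^bold>\<forall>p\<^bold>\<in>P. \<^bold>\<forall>q\<^bold>\<in>P. \<^bold>\<forall>r\<^bold>\<in>P. rel R p q \<^bold>\<and> rel R q r \<^bold>\<longrightarrow> rel R p r))"

definition compatible_f :: "nat \<Rightarrow> nat \<Rightarrow> nat \<Rightarrow> nat \<Rightarrow> form" where
  "compatible_f P R p q = (\<^bold>\<exists>r\<^bold>\<in>P. rel R r p \<^bold>\<and> rel R r q)"

definition knaster :: "nat \<Rightarrow> nat \<Rightarrow> form" where
  "knaster P R = (\<^bold>\<forall>A. A \<^bold>\<subseteq> P \<^bold>\<and> \<^bold>\<not> countable_f A \<^bold>\<longrightarrow>
     (\<^bold>\<exists>B. B \<^bold>\<subseteq> A \<^bold>\<and> \<^bold>\<not> countable_f B \<^bold>\<and> (\<^bold>\<forall>p\<^bold>\<in>B. \<^bold>\<forall>q\<^bold>\<in>B. compatible_f P R p q)))"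

definition dense_f :: "nat \<Rightarrow> nat \<Rightarrow> nat \<Rightarrow> form" where
  "dense_f P R D = (D \<^bold>\<subseteq> P \<^bold>\<and> (\<^bold>\<forall>p\<^bold>\<in>P. \<^bold>\<exists>q\<^bold>\<in>D. rel R q p))"

definition filter_f :: "nat \<Rightarrow> nat \<Rightarrow> nat \<Rightarrow> form" where
  "filter_f P R G = (G \<^bold>\<subseteq> P \<^bold>\<and> \<^bold>\<not> is_empty G \<^bold>\<and>
     (\<^bold>\<forall>p\<^bold>\<in>G. \<^bold>\<forall>q\<^bold>\<in>P. rel R p q \<^bold>\<longrightarrow> q \<^bold>\<in> G) \<^bold>\<and>
     (\<^bold>\<forall>p\<^bold>\<in>G. \<^bold>\<forall>q\<^bold>\<in>G. \<^bold>\<exists>r\<^bold>\<in>G. rel R r p \<^bold>\<and> rel R r q))"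

definition MA_Knaster :: form where
  "MA_Knaster = (\<^bold>\<forall>P. \<^bold>\<forall>R. partial_order_f P R \<^bold>\<and> knaster P R \<^bold>\<longrightarrow>
     (\<^bold>\<forall>F. size_le_aleph1 F \<^bold>\<and> (\<^bold>\<forall>D\<^bold>\<in>F. dense_f P R D) \<^bold>\<longrightarrow>
       (\<^bold>\<exists>G. filter_f P R G \<^bold>\<and> (\<^bold>\<forall>D\<^bold>\<in>F. \<^bold>\<exists>p\<^bold>\<in>D. p \<^bold>\<in> G))))"


section \<open>Special Aronszajn trees\<close>

definition is_predecessors :: "nat \<Rightarrow> nat \<Rightarrow> nat \<Rightarrow> nat \<Rightarrow> form" where
  "is_predecessors T R t D = (\<^bold>\<forall>s. s \<^bold>\<in> D \<^bold>\<longleftrightarrow> s \<^bold>\<in> T \<^bold>\<and> rel R s t)"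

definition chain_f :: "nat \<Rightarrow> nat \<Rightarrow> nat \<Rightarrow> form" where
  "chain_f T R C = (C \<^bold>\<subseteq> T \<^bold>\<and> (\<^bold>\<forall>s\<^bold>\<in>C. \<^bold>\<forall>t\<^bold>\<in>C. rel R s t \<^bold>\<or> s \<^bold>= t \<^bold>\<or> rel R t s))"

text \<open>\<open>R\<close> is the strict tree order; sets of predecessors are well-ordered.\<close>

definition tree_f :: "nat \<Rightarrow> nat \<Rightarrow> form" where
  "tree_f T R = (
     (\<^bold>\<forall>t\<^bold>\<in>T. \<^bold>\<not> rel R t t) \<^bold>\<and>
     (\<^bold>\<forall>r\<^bold>\<in>T. \<^bold>\<forall>s\<^bold>\<in>T. \<^bold>\<forall>t\<^bold>\<in>T. rel R r s \<^bold>\<and> rel R s t \<^bold>\<longrightarrow> rel R r t) \<^bold>\<and>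
     (\<^bold>\<forall>t\<^bold>\<in>T. \<^bold>\<exists>D. is_predecessors T R t D \<^bold>\<and> chain_f T R D \<^bold>\<and>
       (\<^bold>\<forall>X. X \<^bold>\<subseteq> D \<^bold>\<and> \<^bold>\<not> is_empty X \<^bold>\<longrightarrow> (\<^bold>\<exists>m\<^bold>\<in>X. \<^bold>\<forall>s\<^bold>\<in>X. m \<^bold>= s \<^bold>\<or> rel R m s))))"

text \<open>The height of a node is the order type of its set of predecessors.\<close>

definition node_height :: "nat \<Rightarrow> nat \<Rightarrow> nat \<Rightarrow> nat \<Rightarrow> form" where
  "node_height T R t a = (is_ordinal a \<^bold>\<and>
     (\<^bold>\<exists>D. \<^bold>\<exists>f. is_predecessors T R t D \<^bold>\<and> is_bij f D a \<^bold>\<and>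
       (\<^bold>\<forall>r\<^bold>\<in>D. \<^bold>\<forall>s\<^bold>\<in>D. \<^bold>\<forall>fr. \<^bold>\<forall>fs. rel f r fr \<^bold>\<and> rel f s fs \<^bold>\<longrightarrow> (rel R r s \<^bold>\<longleftrightarrow> fr \<^bold>\<in> fs))))"

definition is_level :: "nat \<Rightarrow> nat \<Rightarrow> nat \<Rightarrow> nat \<Rightarrow> form" where
  "is_level T R a L = (\<^bold>\<forall>t. t \<^bold>\<in> L \<^bold>\<longleftrightarrow> t \<^bold>\<in> T \<^bold>\<and> node_height T R t a)"

text \<open>The height of a tree is the least ordinal whose level is empty.\<close>

definition tree_height :: "nat \<Rightarrow> nat \<Rightarrow> nat \<Rightarrow> form" where
  "tree_height T R h = (is_ordinal h \<^bold>\<and>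
     (\<^bold>\<exists>L. is_level T R h L \<^bold>\<and> is_empty L) \<^bold>\<and>
     (\<^bold>\<forall>a\<^bold>\<in>h. \<^bold>\<exists>L. is_level T R a L \<^bold>\<and> \<^bold>\<not> is_empty L))"

definition aronszajn_tree :: "nat \<Rightarrow> nat \<Rightarrow> form" where
  "aronszajn_tree T R = (tree_f T R \<^bold>\<and>
     (\<^bold>\<exists>u. is_omega1 u \<^bold>\<and> tree_height T R u \<^bold>\<and>
       (\<^bold>\<forall>a\<^bold>\<in>u. \<^bold>\<exists>L. is_level T R a L \<^bold>\<and> countable_f L)) \<^bold>\<and>
     (\<^bold>\<forall>C. chain_f T R C \<^bold>\<longrightarrow> countable_f C))"

definition special_tree :: "nat \<Rightarrow> nat \<Rightarrow> form" where
  "special_tree T R = (\<^bold>\<exists>w. is_omega w \<^bold>\<and>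
     (\<^bold>\<exists>f. is_fun f T w \<^bold>\<and> (\<^bold>\<forall>C. chain_f T R C \<^bold>\<longrightarrow> inj_on_f f C)))"

definition Aronszajn_special :: form where
  "Aronszajn_special = (\<^bold>\<forall>T. \<^bold>\<forall>R. aronszajn_tree T R \<^bold>\<longrightarrow> special_tree T R)"

end

(* Let M be a countable model of ZFC. It may be ill-founded, so its generic extensions are built as
quotients of M itself, all of whose elements serve as names. In M we iterate forcings on the set of
countable ordinals with finite supports. The first om1 coordinates add Cohen reals, whose indices are
split into two uncountable sets IA and IB. A later order is admitted only if the iteration remains good:
in every uncountable family of conditions paired with indices (i, k) in IA x IB, injectively in both
coordinates, two have a common extension deciding that the reals of i, i' agree for longer than those of
k, k'. By a Delta-system argument goodness survives limits, hence in the extension no Lipschitz map is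
injective from the reals of IA into those of IB. The bookkeeping gives Martin's axiom in the extension
for all orders that are thin, that is, cannot destroy this property. Knaster orders are thin; since the
property is an open one, so are the orders specializing Aronszajn trees by finite functions, by
Baumgartner's ultrafilter argument. *)

theory Submission
  imports Defs "HOL-Library.Countable_Set"
begin

text \<open>The graph of an injective Lipschitz map from the one set into the other is injective in
  both coordinates and has no two points that agree longer on the left than on the right. So it is
  enough that uncountable sets of this kind stay excluded. Goodness speaks of conditions paired with
  indices because this form survives restriction to an earlier stage and can be strengthened at the
  next coordinate. It contains the countable chain condition, since any uncountable set of
  conditions can be labelled with distinct indices. Admission of an order is settled in the ground
  model, from a name and a condition; for a thin order of the extension a suitable condition lies in
  the generic filter, and the bookkeeping offers the two together. As the model may be ill-founded,
  induction, separation and recursion in it hold only for predicates definable with parameters, so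
  every predicate used inside a model comes with a proof of definability, mostly found by the rules
  \<open>dfn\<close>. The type \<open>U\<close> is countable, so a descending sequence of conditions
  can meet all dense sets of a model, and infinite, so an extension can be put on it again.\<close>

notation iff (infixr "<->" 25)

section \<open>Satisfaction, substitution and soundness\<close>

datatype U = U nat

instance U :: countable by countable_datatype
instance fm :: countable by countable_datatype

text \<open>Equality is a parameter \<open>Q\<close>, so that truth can be computed in term models
  and on names before their congruences are factored out.\<close>

primrec satq :: "('a => 'a => bool) => ('a => 'a => bool) => (nat => 'a) => fm => bool" where
 "satq R Q e (Mem i j) = R (e i) (e j)"
| "satq R Q e (Equ i j) = Q (e i) (e j)"
| "satq R Q e Bot = False"
| "satq R Q e (Imp p q) = (satq R Q e p-->satq R Q e q)"
| "satq R Q e (Forall p) = (ALL x. satq R Q (case_nat x e) p)"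

abbreviation sat :: "('a => 'a => bool) => (nat => 'a) => fm => bool" where
 "sat R \<equiv> satq R (=)"

abbreviation lift :: "(nat => nat) => nat => nat" where
 "lift f \<equiv> case_nat 0 (%i. Suc (f i))"

lemma case_nat_comp_lift: "(%i. case_nat x e (lift f i)) = case_nat x (%i. e (f i))"
 by (rule ext) (auto split: nat.split)

lemma satq_subst: "satq R Q e (subst f p) = satq R Q (%i. e (f i)) p"
proof (induction p arbitrary: e f)
 case (Forall p)
 then show ?case by (simp add: case_nat_comp_lift)
qed auto

lemma subst_subst: "subst g (subst f p) = subst (g \<circ> f) p"
proof (induction p arbitrary: g f)
 case (Forall p)
 have "lift g \<circ> lift f = lift (g \<circ> f)"
  by (rule ext) (auto split: nat.split)
 then show ?case using Forall by (simp add: comp_def)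
qed auto

lemma subst_cong: "(!!i. i < fv_bound p==>f i = g i)==>subst f p = subst g p"
proof (induction p arbitrary: f g)
 case (Forall p)
 have "subst (lift f) p = subst (lift g) p"
 proof (rule Forall.IH)
  fix i assume "i < fv_bound p"
  then show "lift f i = lift g i" using Forall.prems by (cases i) auto
 qed
 then show ?case by simp
next
 case (Imp p q)
 have "subst f p = subst g p" by (rule Imp.IH(1)) (use Imp.prems in simp)
 moreover have "subst f q = subst g q" by (rule Imp.IH(2)) (use Imp.prems in simp)
 ultimately show ?case by simp
qed simp_all

lemma subst_id: "subst (%i. i) p = p"
proof (induction p)
 case (Forall p)
 have "lift (%i. i) = (%i. i)" by (rule ext) (auto split: nat.split)
 then show ?case using Forall by simp
qed auto

lemma subst_sentence: "fv_bound p = 0==>subst f p = p"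
 using subst_cong[of p f "%i. i"] subst_id by simp

theorem soundness:
 assumes "\<Gamma> \<turnstile> p" "!!q. q : \<Gamma> ==> sat E e q"
 shows "sat E e p"
 using assms
proof (induction arbitrary: e rule: proves.induct)
 case (Contr p \<Gamma>)
 then show ?case by (metis insert_iff satq.simps(3,4))
next
 case (ForallI \<Gamma> p)
 show ?case
 proof (simp, rule allI)
  fix x
  show "sat E (case_nat x e) p"
   by (rule ForallI.IH) (use ForallI.prems in \<open>auto simp: satq_subst\<close>)
 qed
next
 case (ForallE \<Gamma> p i)
 have "(%k. e (case_nat i (%j. j) k)) = case_nat (e i) e" by (rule ext) (auto split: nat.split)
 then show ?case using ForallE by (simp add: satq_subst)
next
 case (EquE \<Gamma> i j p)
 have "(%k. e (case_nat i (%j. j) k)) = case_nat (e i) e" for i by (rule ext) (auto split: nat.split)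
 then show ?case using EquE.IH[of e] EquE.prems by (simp add: satq_subst)
qed auto

section \<open>Structural properties of derivations\<close>

lemma proves_mono: "\<Gamma> \<turnstile> p ==> \<Gamma> \<subseteq> \<Delta> ==> \<Delta> \<turnstile> p"
proof (induction arbitrary: \<Delta> rule: proves.induct)
 case (ImpI p \<Gamma> q)
 then show ?case by (meson insert_mono proves.ImpI)
next
 case (Contr p \<Gamma>)
 then show ?case by (meson insert_mono proves.Contr)
next
 case (ForallI \<Gamma> p)
 then show ?case by (meson image_mono proves.ForallI)
next
 case (EquE \<Gamma> i j p)
 then show ?case using proves.EquE[of \<Delta> i j p] by blast
next
 case (ImpE \<Gamma> p q)
 then show ?case using proves.ImpE[of \<Delta> p q] by blast
qed (auto intro: proves.Hyp proves.ForallE proves.EquI)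

lemma proves_subst: "\<Gamma> \<turnstile> p==>subst f ` \<Gamma> \<turnstile> subst f p"
proof (induction arbitrary: f rule: proves.induct)
 case (ForallI \<Gamma> p)
 have "lift f \<circ> Suc = Suc \<circ> f" by (rule ext) simp
 then have "subst (lift f) ` subst Suc ` \<Gamma> = subst Suc ` subst f ` \<Gamma>"
  by (simp add: image_image subst_subst)
 then show ?case using ForallI.IH[of "lift f"] by (simp add: proves.ForallI)
next
 case (ForallE \<Gamma> p i)
 have "f \<circ> case_nat i (%j. j) = case_nat (f i) (%j. j) \<circ> lift f"
  by (rule ext) (auto split: nat.split)
 then show ?case using proves.ForallE[of "subst f ` \<Gamma>" "subst (lift f) p" "f i"] ForallE.IH[of f]
  by (simp add: subst_subst)
next
 case (EquE \<Gamma> i j p)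
 have *: "f \<circ> case_nat i (%j. j) = case_nat (f i) (%j. j) \<circ> lift f" for i
  by (rule ext) (auto split: nat.split)
 show ?case using proves.EquE[of "subst f ` \<Gamma>" "f i" "f j" "subst (lift f) p"] EquE.IH[of f]
  by (simp add: subst_subst *)
next
 case (ImpE \<Gamma> p q)
 then show ?case by (metis proves.ImpE subst.simps(4))
qed (auto intro: proves.Hyp proves.ImpI proves.Contr proves.EquI)

lemma proves_finite: "\<Gamma> \<turnstile> p==>EX \<Delta>. finite \<Delta> & \<Delta> \<subseteq> \<Gamma> & \<Delta> \<turnstile> p"
proof (induction rule: proves.induct)
 case (Hyp p \<Gamma>)
 then show ?case by (intro exI[of _ "{p}"]) (auto intro: proves.Hyp)
next
 case (ImpI p \<Gamma> q)
 then obtain \<Delta> where d: "finite \<Delta>" "\<Delta> \<subseteq> insert p \<Gamma>" "\<Delta> \<turnstile> q" by auto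
 then have "insert p (\<Delta> - {p}) \<turnstile> q" by (auto intro: proves_mono)
 then show ?case using d by (intro exI[of _ "\<Delta> - {p}"]) (auto intro: proves.ImpI)
next
 case (ImpE \<Gamma> p q)
 then obtain \<Delta> \<Delta>' where d: "finite \<Delta>" "\<Delta> \<subseteq> \<Gamma>" "\<Delta> \<turnstile> Imp p q" "finite \<Delta>'" "\<Delta>' \<subseteq> \<Gamma>" "\<Delta>' \<turnstile> p" by auto
 then have "\<Delta> \<union> \<Delta>' \<turnstile> q" by (meson proves.ImpE proves_mono sup_ge1 sup_ge2)
 then show ?case using d by (intro exI[of _ "\<Delta> \<union> \<Delta>'"]) auto
next
 case (Contr p \<Gamma>)
 then obtain \<Delta> where d: "finite \<Delta>" "\<Delta> \<subseteq> insert (Imp p Bot) \<Gamma>" "\<Delta> \<turnstile> Bot" by auto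
 then have "insert (Imp p Bot) (\<Delta> - {Imp p Bot}) \<turnstile> Bot" by (auto intro: proves_mono)
 then show ?case using d by (intro exI[of _ "\<Delta> - {Imp p Bot}"]) (auto intro: proves.Contr)
next
 case (ForallI \<Gamma> p)
 then obtain \<Delta> where d: "finite \<Delta>" "\<Delta> \<subseteq> subst Suc ` \<Gamma>" "\<Delta> \<turnstile> p" by auto
 then obtain \<Delta>' where "finite \<Delta>'" "\<Delta>' \<subseteq> \<Gamma>" "\<Delta> = subst Suc ` \<Delta>'" by (meson finite_subset_image)
 then show ?case using d by (auto intro: proves.ForallI)
next
 case (ForallE \<Gamma> p i)
 then obtain \<Delta> where "finite \<Delta>" "\<Delta> \<subseteq> \<Gamma>" "\<Delta> \<turnstile> Forall p" by auto
 then show ?case using proves.ForallE[of \<Delta> p i] by blast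
next
 case (EquI \<Gamma> i)
 show ?case by (intro exI[of _ "{}"]) (auto intro: proves.EquI)
next
 case (EquE \<Gamma> i j p)
 then obtain \<Delta> \<Delta>' where d: "finite \<Delta>" "\<Delta> \<subseteq> \<Gamma>" "\<Delta> \<turnstile> Equ i j" "finite \<Delta>'" "\<Delta>' \<subseteq> \<Gamma>" "\<Delta>' \<turnstile> subst (case_nat i (%k. k)) p" by auto
 then have "\<Delta> \<union> \<Delta>' \<turnstile> Equ i j" "\<Delta> \<union> \<Delta>' \<turnstile> subst (case_nat i (%k. k)) p" by (meson proves_mono sup_ge1 sup_ge2)+
 then have "\<Delta> \<union> \<Delta>' \<turnstile> subst (case_nat j (%k. k)) p" by (rule proves.EquE)
 then show ?case using d by (intro exI[of _ "\<Delta> \<union> \<Delta>'"]) auto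
qed

section \<open>Henkin axioms and maximal consistent sets\<close>

lemma botE: "\<Gamma> \<turnstile> Bot ==> \<Gamma> \<turnstile> p"
 by (rule Contr) (auto intro: proves_mono)

abbreviation inst :: "nat => fm => fm" where
 "inst k p \<equiv> subst (case_nat k (%j. j)) p"

text \<open>The renaming that sends \<open>k\<close> to 0 and shifts every other index acts on the
  context like \<open>Suc\<close>, because \<open>k\<close> lies above all its free variables, and
  it turns the instance back into \<open>p\<close>. Then \<open>ForallI\<close> applies.\<close>

lemma generalize_fresh:
 assumes "\<Gamma> \<turnstile> inst k p" "!!q. q : \<Gamma> ==> fv_bound q \<le> k" "fv_bound (Forall p) \<le> k"
 shows "\<Gamma> \<turnstile> Forall p"
proof (rule ForallI)
 define f where "f i = (if i = k then 0 else Suc i)" for i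
 have "subst f q = subst Suc q" if "q : \<Gamma>" for q
  by (rule subst_cong) (use assms(2)[OF that] in \<open>auto simp: f_def\<close>)
 moreover have "subst f (inst k p) = subst (%i. i) p"
  unfolding subst_subst
 proof (rule subst_cong)
  fix i assume "i < fv_bound p"
  then show "(f \<circ> case_nat k (%j. j)) i = i" using assms(3) by (cases i) (auto simp: f_def)
 qed
 ultimately show "subst Suc ` \<Gamma> \<turnstile> p"
  using proves_subst[OF assms(1), of f] by (simp add: subst_id)
qed

text \<open>A refutation of the Henkin implication proves its premise classically; the premise
  generalises because \<open>k\<close> is fresh, and the universal formula so obtained proves the
  implication itself. Free variables play the part of Henkin constants.\<close>

lemma consistent_henkin:
 assumes "consistent \<Gamma>" "!!q. q : \<Gamma> ==> fv_bound q \<le> k" "fv_bound (Forall p) \<le> k"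
 shows "consistent (insert (Imp (inst k p) (Forall p)) \<Gamma>)"
proof (rule ccontr)
 let ?H = "Imp (inst k p) (Forall p)"
 let ?n = "Imp (inst k p) Bot"
 assume "~consistent (insert ?H \<Gamma>)"
 then have nH: "\<Gamma> \<turnstile> Imp ?H Bot" by (auto simp: consistent_def intro: ImpI)
 have "insert (inst k p) (insert ?n \<Gamma>) \<turnstile> ?n" "insert (inst k p) (insert ?n \<Gamma>) \<turnstile> inst k p"
  by (rule Hyp, simp)+
 then have "insert (inst k p) (insert ?n \<Gamma>) \<turnstile> Forall p"
  using ImpE botE by blast
 then have 1: "insert ?n \<Gamma> \<turnstile> ?H" by (rule ImpI)
 have "insert ?n \<Gamma> \<turnstile> Imp ?H Bot" by (rule proves_mono[OF nH]) auto
 then have "insert ?n \<Gamma> \<turnstile> Bot" using 1 by (rule ImpE)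
 then have "\<Gamma> \<turnstile> inst k p" by (rule Contr)
 then have "\<Gamma> \<turnstile> Forall p" using assms(2,3) by (rule generalize_fresh)
 then have "insert (inst k p) \<Gamma> \<turnstile> Forall p" by (rule proves_mono) auto
 then have "\<Gamma> \<turnstile> ?H" by (rule ImpI)
 with nH have "\<Gamma> \<turnstile> Bot" by (rule ImpE)
 then show False using assms(1) by (simp add: consistent_def)
qed

lemma consistent_chain_Union:
 assumes "subset.chain A C" "C ~= {}" "!!X. X : C==>consistent X"
 shows "consistent (\<Union>C)"
proof (rule ccontr)
 assume "~consistent (\<Union>C)"
 then obtain \<Delta> where d: "finite \<Delta>" "\<Delta> \<subseteq> \<Union>C" "\<Delta> \<turnstile> Bot"
  using proves_finite unfolding consistent_def by blast
 obtain X where "X : C" "\<Delta> \<subseteq> X"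
  using finite_subset_Union_chain[OF d(1,2) assms(2,1)] by blast
 then show False using assms(3) d(3) proves_mono unfolding consistent_def by blast
qed

definition fresh :: "fm set => fm => nat" where
 "fresh S p = (SOME k. fv_bound p \<le> k&(ALL q:S. fv_bound q \<le> k))"

lemma fresh:
 assumes "finite S"
 shows "fv_bound p \<le> fresh S p" "q : S==>fv_bound q \<le> fresh S p"
proof -
 have "EX k. fv_bound p \<le> k&(ALL q:S. fv_bound q \<le> k)"
  by (rule exI[of _ "Max (fv_bound ` insert p S)"]) (use assms in auto)
 from someI_ex[OF this] show "fv_bound p \<le> fresh S p" "q : S==>fv_bound q \<le> fresh S p"
  unfolding fresh_def by auto
qed

text \<open>Stage \<open>n\<close> treats the formula with code \<open>n\<close>. All stages are
  finite, so there is always a variable above those already in use.\<close>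

primrec henkin :: "nat => fm set" where
 "henkin 0 = {}"
| "henkin (Suc n) = henkin n \<union>
   {Imp (inst (fresh (henkin n) (Forall p)) p) (Forall p) | p. from_nat n = Forall p}"

lemma finite_henkin: "finite (henkin n)"
proof (induction n)
 case (Suc n)
 have "{Imp (inst (fresh (henkin n) (Forall p)) p) (Forall p) | p. from_nat n = Forall p}
   \<subseteq> (%q. case q of Forall p => Imp (inst (fresh (henkin n) (Forall p)) p) (Forall p) | _ => q) ` {from_nat n}"
  by (cases "from_nat n :: fm") auto
 then show ?case using Suc finite_subset by auto
qed simp

lemma henkin_mono: "m \<le> n==>henkin m \<subseteq> henkin n"
 by (rule lift_Suc_mono_le) auto

lemma henkin_witness: "EX k n. Imp (inst k p) (Forall p) : henkin n"
proof -
 have "from_nat (to_nat (Forall p)) = Forall p" by simp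
 then have "Imp (inst (fresh (henkin (to_nat (Forall p))) (Forall p)) p) (Forall p) : henkin (Suc (to_nat (Forall p)))"
  by auto
 then show ?thesis by blast
qed

lemma consistent_henkins:
 assumes "consistent \<Gamma>" "!!q. q : \<Gamma> ==> fv_bound q = 0"
 shows "consistent (\<Gamma> \<union> (\<Union>n. henkin n))"
proof -
 have c: "consistent (\<Gamma> \<union> henkin n)" for n
 proof (induction n)
  case (Suc n)
  show ?case
  proof (cases "EX p. from_nat n = Forall p")
   case True
   then obtain p where p: "from_nat n = Forall p" by blast
   \<comment> \<open>Members of \<open>\<Gamma>\<close> are sentences, so freshness for the earlier
     Henkin axioms is freshness for the whole context.\<close>
   have "consistent (insert (Imp (inst (fresh (henkin n) (Forall p)) p) (Forall p)) (\<Gamma> \<union> henkin n))"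
    using fresh[OF finite_henkin] assms(2)
    by (intro consistent_henkin[OF Suc]) fastforce+
   moreover have "\<Gamma> \<union> henkin (Suc n) = insert (Imp (inst (fresh (henkin n) (Forall p)) p) (Forall p)) (\<Gamma> \<union> henkin n)"
    using p by auto
   ultimately show ?thesis by simp
  next
   case False
   then have "henkin (Suc n) = henkin n" by auto
   then show ?thesis using Suc by simp
  qed
 qed (use assms in simp)
 have "consistent (\<Union>(range (%n. \<Gamma> \<union> henkin n)))"
 proof (rule consistent_chain_Union[of UNIV])
  have "\<Gamma> \<union> henkin m \<subseteq> \<Gamma> \<union> henkin n | \<Gamma> \<union> henkin n \<subseteq> \<Gamma> \<union> henkin m" for m n
   using henkin_mono[of m n] henkin_mono[of n m] nat_le_linear[of m n] by blast
  then show "subset.chain UNIV (range (%n. \<Gamma> \<union> henkin n))"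
   unfolding subset_chain_def by blast
 qed (use c in auto)
 moreover have "\<Union>(range (%n. \<Gamma> \<union> henkin n)) = \<Gamma> \<union> (\<Union>n. henkin n)" by auto
 ultimately show ?thesis by simp
qed

lemma lindenbaum:
 assumes "consistent \<Gamma>"
 shows "EX \<Delta>. \<Gamma> \<subseteq> \<Delta> & consistent \<Delta> & (ALL X. \<Delta> \<subseteq> X-->consistent X-->X = \<Delta>)"
proof -
 let ?A = "{X. \<Gamma> \<subseteq> X&consistent X}"
 have "EX M:?A. ALL X:?A. M \<subseteq> X-->X = M"
 proof (rule subset_Zorn_nonempty)
  show "?A ~= {}" using assms by auto
  fix C assume C: "C ~= {}" "subset.chain ?A C"
  then have s: "X : C==>X : ?A" for X by (auto simp: subset_chain_def)
  then have "consistent (\<Union>C)" using C by (intro consistent_chain_Union) auto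
  moreover obtain X where "X : C" using C(1) by auto
  then have "\<Gamma> \<subseteq> \<Union>C" using s[of X] by auto
  ultimately show "\<Union>C : ?A" by simp
 qed
 then obtain M where M: "M : ?A" "!!X. X : ?A==>M \<subseteq> X==>X = M" by auto
 then have "X = M" if "M \<subseteq> X" "consistent X" for X using that by (intro M(2)) auto
 then show ?thesis using M(1) by auto
qed

text \<open>The elements are the variables themselves, with membership and equality read off a
  maximal consistent set. Equality is only a congruence at this point; the quotient is taken once
  the axioms have shown it to be infinite.\<close>

theorem model_existence_prestructure:
 assumes "consistent \<Gamma>" "!!q. q : \<Gamma> ==> fv_bound q = 0"
 shows "EX R Q :: nat => nat => bool. equivp Q&(ALL a b c d. Q a b-->Q c d-->R a c-->R b d) &
   (ALL p:\<Gamma>. ALL e. satq R Q e p)"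
proof -
 obtain \<Delta> where d: "\<Gamma> \<union> (\<Union>n. henkin n) \<subseteq> \<Delta>" "consistent \<Delta>" "!!X. \<Delta> \<subseteq> X==>consistent X==>X = \<Delta>"
  using lindenbaum[OF consistent_henkins[OF assms]] by blast
 have neg: "Imp p Bot : \<Delta>" if "p \<notin> \<Delta>" for p
 proof -
  have "~consistent (insert p \<Delta>)" using d(3)[of "insert p \<Delta>"] that by blast
  then have 1: "\<Delta> \<turnstile> Imp p Bot" by (auto simp: consistent_def intro: ImpI)
  have "consistent (insert (Imp p Bot) \<Delta>)"
   using 1 d(2) ImpE ImpI unfolding consistent_def by blast
  then show ?thesis using d(3)[of "insert (Imp p Bot) \<Delta>"] by blast
 qed
 have ded: "p : \<Delta>" if "\<Delta> \<turnstile> p" for p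
 proof (rule ccontr)
  assume "p \<notin> \<Delta>"
  then have "\<Delta> \<turnstile> Imp p Bot" using neg Hyp by blast
  then show False using that d(2) ImpE unfolding consistent_def by blast
 qed
 have bot: "Bot \<notin> \<Delta>" using d(2) Hyp unfolding consistent_def by blast
 have imp: "Imp p q : \<Delta> <-> (p : \<Delta> --> q : \<Delta>)" for p q
 proof
  assume "Imp p q : \<Delta>" then show "p : \<Delta> --> q : \<Delta>" using ded ImpE Hyp by blast
 next
  assume a: "p : \<Delta> --> q : \<Delta>"
  show "Imp p q : \<Delta>"
  proof (cases "p : \<Delta>")
   case True
   then have "insert p \<Delta> \<turnstile> q" using a by (auto intro: Hyp)
   then show ?thesis using ded ImpI by blast
  next
   case False
   then have "insert p \<Delta> \<turnstile> Imp p Bot" using neg by (auto intro: Hyp)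
   moreover have "insert p \<Delta> \<turnstile> p" by (auto intro: Hyp)
   ultimately have "insert p \<Delta> \<turnstile> q" using ImpE botE by blast
   then show ?thesis using ded ImpI by blast
  qed
 qed
 have all: "Forall p : \<Delta> <-> (ALL k. inst k p : \<Delta>)" for p
 proof
  assume "Forall p : \<Delta>" then show "ALL k. inst k p : \<Delta>" using ded ForallE Hyp by blast
 next
  assume a: "ALL k. inst k p : \<Delta>"
  obtain k n where "Imp (inst k p) (Forall p) : henkin n" using henkin_witness by blast
  then have "Imp (inst k p) (Forall p) : \<Delta>" using d(1) by auto
  then show "Forall p : \<Delta>" using a imp by blast
 qed
 have eqE: "inst j p : \<Delta>" if "Equ i j : \<Delta>" "inst i p : \<Delta>" for i j p
  using EquE[of \<Delta> i j p] that ded Hyp by blast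
 define R where "R i j<->Mem i j : \<Delta>" for i j
 define Q where "Q i j<->Equ i j : \<Delta>" for i j
 have refl: "Q i i" for i unfolding Q_def using ded EquI by blast
 have sym: "Q j i" if "Q i j" for i j
  using eqE[of i j "Equ 0 (Suc i)"] that refl[of i] unfolding Q_def by simp
 have trans: "Q i k" if "Q i j" "Q j k" for i j k
  using eqE[of j k "Equ (Suc i) 0"] that unfolding Q_def by simp
 have "equivp Q" using refl sym trans by (intro equivpI reflpI sympI transpI) blast+
 moreover have "R b d" if "Q a b" "Q c d" "R a c" for a b c d
 proof -
  have "R b c" using eqE[of a b "Mem 0 (Suc c)"] that unfolding Q_def R_def by simp
  then show ?thesis using eqE[of c d "Mem (Suc b) 0"] that unfolding Q_def R_def by simp
 qed
 moreover have "satq R Q e p<->subst e p : \<Delta>" for e p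
 proof (induction p arbitrary: e)
  case (Forall p)
  have "inst k (subst (lift e) p) = subst (case_nat k e) p" for k
  proof -
   have "case_nat k (%j. j) \<circ> lift e = case_nat k e" by (rule ext) (auto split: nat.split)
   then show ?thesis by (simp add: subst_subst)
  qed
  then show ?case using Forall all by simp
 qed (auto simp: R_def Q_def bot imp)
 moreover have "subst e p : \<Delta>" if "p : \<Gamma>" for e p
  using assms(2)[OF that] that d(1) by (auto simp: subst_sentence)
 ultimately show ?thesis by blast
qed

section \<open>Quotients and the countable model\<close>

lemma satq_quotient:
 assumes "surj v" "!!a b. Q a b<->v a = v b" "!!a b. R a b<->E (v a) (v b)"
 shows "satq R Q e p = sat E (%i. v (e i)) p"
proof (induction p arbitrary: e)
 case (Forall p)
 have *: "(%i. v (case_nat x e i)) = case_nat (v x) (%i. v (e i))" for x by (rule ext) (auto split: nat.split)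
 have "(ALL x. sat E (%i. v (case_nat x e i)) p)<->(ALL y. sat E (case_nat y (%i. v (e i))) p)"
  unfolding * using assms(1) by (metis surj_def)
 then show ?case using Forall by (simp only: satq.simps)
qed (auto simp: assms)

text \<open>With infinitely many classes the numbering of classes is onto the whole type, so
  quantifiers over \<open>U\<close> range exactly over classes.\<close>

lemma quotient_structure:
 fixes R Q :: "'a :: countable => 'a => bool"
 assumes "equivp Q" "!!a b c d. Q a b==>Q c d==>R a c==>R b d" "infinite (range Q)"
 shows "EX (v :: 'a => U) E. surj v&(ALL a b. Q a b<->v a = v b)&(ALL a b. R a b<->E (v a) (v b))"
proof -
 define v where "v a = U (to_nat_on (range Q) (Q a))" for a
 define E where "E x y<->(EX a b. v a = x&v b = y&R a b)" for x y
 have b: "bij_betw (to_nat_on (range Q)) (range Q) UNIV"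
  by (rule to_nat_on_infinite) (use assms(3) in auto)
 have s: "surj v"
 proof (unfold surj_def, rule allI)
  fix y show "EX x. y = v x"
  proof (cases y)
   case (U n)
   then obtain z where "z : range Q" "to_nat_on (range Q) z = n"
    using b unfolding bij_betw_def by (metis UNIV_I imageE)
   then show ?thesis using U unfolding v_def by auto
  qed
 qed
 have vq: "Q a b<->v a = v b" for a b
 proof -
  have "Q a b<->Q a = Q b" using assms(1) by (simp add: equivp_def)
  also have "\<dots> <-> to_nat_on (range Q) (Q a) = to_nat_on (range Q) (Q b)"
   using b unfolding bij_betw_def by (metis inj_on_eq_iff rangeI)
  finally show ?thesis by (simp add: v_def)
 qed
 have "R a b<->E (v a) (v b)" for a b
  unfolding E_def using assms(2) vq by blast
 then show ?thesis using s vq by blast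
qed

text \<open>Taking singletons induces an injective map on classes that misses the class of the empty
  set \<open>o'\<close>; on a finite set of classes it would be onto.\<close>

lemma infinite_quotient:
 assumes "equivp Q" "!!a b c d. Q a b==>Q c d==>R a c==>R b d"
  "!!x. EX p. ALL z. R z p<->Q z x" "!!z. ~R z o'"
 shows "infinite (range Q)"
proof
 assume fin: "finite (range Q)"
 obtain s where s: "!!x z. R z (s x)<->Q z x" using assms(3) by metis
 have Q: "Q a b<->Q a = Q b" for a b using assms(1) by (simp add: equivp_def)
 define f where "f C = Q (s (SOME x. Q x = C))" for C
 have rep: "Q (SOME x. Q x = C) = C" if "C : range Q" for C
  using that by (metis (mono_tags, lifting) imageE someI_ex)
 have "inj_on f (range Q)"
 proof (rule inj_onI)
  fix C D assume CD: "C : range Q" "D : range Q" "f C = f D"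
  let ?x = "SOME x. Q x = C" and ?y = "SOME x. Q x = D"
  have "Q (s ?x) (s ?y)" using CD(3) Q by (simp add: f_def)
  moreover have "R ?x (s ?x)" "Q ?x ?x" using s Q by auto
  ultimately have "R ?x (s ?y)" using assms(2) by blast
  then have "Q ?x = Q ?y" using s Q by blast
  then show "C = D" using rep CD by simp
 qed
 moreover have "f ` range Q \<subseteq> range Q" by (auto simp: f_def)
 ultimately have "f ` range Q = range Q" using fin by (simp add: endo_inj_surj)
 then obtain x where "Q o' = Q (s x)" unfolding f_def by (metis (no_types, lifting) imageE rangeI)
 then have "Q (s x) o'" "R x (s x)" "Q x x" using Q s by auto
 then show False using assms(2,4) by blast
qed

lemma fv_bound_closure: "fv_bound (closure p) = 0"
proof -
 have "fv_bound ((Forall ^^ n) p) = fv_bound p - n" for n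
  by (induction n) auto
 then show ?thesis by (simp add: closure_def)
qed

lemma fv_bound_ZFC: "q : ZFC==>fv_bound q = 0"
 unfolding ZFC_def
 by (auto simp: fv_bound_closure Extensionality_def Foundation_def Pairing_def Union_ax_def Powerset_def
  Infinity_def Choice_def all_f_def ex_f_def imp_f_def mem_f_def eq_f_def iff_f_def and_f_def or_f_def not_f_def
  ball_f_def bex_f_def is_empty_def is_upair_def subset_f_def is_succ_def is_fun_def rel_def is_pair_def)

lemma satq_closure:
 assumes "!!e. satq R Q e (closure p)"
 shows "satq R Q e p"
proof -
 have "(ALL e. satq R Q e ((Forall ^^ n) p))-->(ALL e. satq R Q e p)" for n
 proof (induction n)
  case (Suc n)
  have "satq R Q e ((Forall ^^ n) p)" if "ALL e. satq R Q e ((Forall ^^ Suc n) p)" for e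
  proof -
   have "satq R Q (case_nat (e 0) (%i. e (Suc i))) ((Forall ^^ n) p)" using that by simp
   moreover have "case_nat (e 0) (%i. e (Suc i)) = e" by (rule ext) (auto split: nat.split)
   ultimately show ?thesis by simp
  qed
  then show ?case using Suc by blast
 qed simp
 then show ?thesis using assms unfolding closure_def by blast
qed

text \<open>Pairing provides the singletons and Separation by a false formula the empty set, both
  read in the structure before the quotient is formed.\<close>

lemma infinite_quotient_ZFC:
 assumes "equivp Q" "!!a b c d. Q a b==>Q c d==>R a c==>R b d" "!!p e. p : ZFC==>satq R Q e p"
 shows "infinite (range Q)"
proof -
 define e :: "nat => 'a" where "e = undefined"
 have "satq R Q e (Pairing 0)" using assms(3) by (simp add: ZFC_def)
 then have 1: "EX p. ALL z. R z p<->Q z x" for x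
  by (auto simp: Pairing_def all_f_def ex_f_def imp_f_def mem_f_def eq_f_def iff_f_def and_f_def or_f_def not_f_def is_upair_def; metis)
 have "satq R Q e (Separation Bot 0)"
  by (rule satq_closure, rule assms(3)) (auto simp: ZFC_def)
 then have "EX b. ALL x. ~R x b"
  by (auto simp: Separation_def holds1_def all_f_def ex_f_def imp_f_def mem_f_def eq_f_def iff_f_def and_f_def or_f_def not_f_def)
 then obtain b where "!!x. ~R x b" by blast
 with assms(1,2) 1 show ?thesis by (rule infinite_quotient)
qed

theorem countable_model_ZFC:
 assumes "consistent ZFC"
 shows "EX E :: U => U => bool. ALL p:ZFC. ALL e. sat E e p"
proof -
 obtain R Q :: "nat => nat => bool" where rq: "equivp Q" "!!a b c d. Q a b==>Q c d==>R a c==>R b d"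
  "!!p e. p : ZFC==>satq R Q e p"
  using model_existence_prestructure[OF assms fv_bound_ZFC] by blast
 have inf: "infinite (range Q)" by (rule infinite_quotient_ZFC[of Q R]) (fact rq)+
 have "EX (v :: nat => U) E. surj v&(ALL a b. Q a b<->v a = v b)&(ALL a b. R a b<->E (v a) (v b))"
  by (rule quotient_structure) (fact rq(1) rq(2) inf)+
 then obtain v :: "nat => U" and E where v: "surj v" "!!a b. Q a b<->v a = v b" "!!a b. R a b<->E (v a) (v b)"
  by blast
 have "sat E e p" if "p : ZFC" for p e
 proof -
  have "(%i. v (inv v (e i))) = e" using v(1) by (simp add: surj_f_inv_f)
  then show ?thesis using satq_quotient[of v Q R E, OF v, of "%i. inv v (e i)"] rq(3)[OF that] by metis
 qed
 then show ?thesis by blast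
qed

section \<open>Evaluating formulas written with named variables\<close>

definition lv :: "(nat => 'a) => nat => nat => 'a" where
 "lv e d x = e (d - Suc x)"

lemma lv_same [simp]: "lv (case_nat a e) (Suc d) d = a"
 by (simp add: lv_def)

text \<open>A new quantifier leaves the values of the outer levels unchanged. Together with the rule
  for the new level this lets simplification evaluate all named formulas.\<close>

lemma lv_less [simp]: assumes "x < d" shows "lv (case_nat a e) (Suc d) x = lv e d x"
proof -
 have "d - x = Suc (d - Suc x)" using assms by arith
 then show ?thesis by (simp add: lv_def)
qed

lemma sat_mem_f [simp]: "sat E e ((x \<^bold>\<in> y) d)<->E (lv e d x) (lv e d y)"
 by (simp add: mem_f_def lv_def)

lemma sat_eq_f [simp]: "sat E e ((x \<^bold>= y) d)<->lv e d x = lv e d y"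
 by (simp add: eq_f_def lv_def)

lemma sat_imp_f [simp]: "sat E e ((P \<^bold>\<longrightarrow> Q) d)<->(sat E e (P d)-->sat E e (Q d))"
 by (simp add: imp_f_def)

lemma sat_not_f [simp]: "sat E e ((\<^bold>\<not> P) d)<->~sat E e (P d)"
 by (simp add: not_f_def)

lemma sat_and_f [simp]: "sat E e ((P \<^bold>\<and> Q) d)<->sat E e (P d)&sat E e (Q d)"
 by (simp add: and_f_def)

lemma sat_or_f [simp]: "sat E e ((P \<^bold>\<or> Q) d)<->sat E e (P d) | sat E e (Q d)"
 by (auto simp: or_f_def)

lemma sat_iff_f [simp]: "sat E e ((P \<^bold>\<longleftrightarrow> Q) d)<->(sat E e (P d)<->sat E e (Q d))"
 by (auto simp: iff_f_def)

lemma sat_all_f [simp]: "sat E e ((\<^bold>\<forall>x. P x) d)<->(ALL a. sat E (case_nat a e) (P d (Suc d)))"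
 by (simp add: all_f_def)

lemma sat_ex_f [simp]: "sat E e ((\<^bold>\<exists>x. P x) d)<->(EX a. sat E (case_nat a e) (P d (Suc d)))"
 by (simp add: ex_f_def)

lemma sat_ball_f [simp]: "A < d==>sat E e ((\<^bold>\<forall>x\<^bold>\<in>A. P x) d)<->(ALL a. E a (lv e d A)-->sat E (case_nat a e) (P d (Suc d)))"
 by (simp add: ball_f_def)

lemma sat_bex_f [simp]: "A < d==>sat E e ((\<^bold>\<exists>x\<^bold>\<in>A. P x) d)<->(EX a. E a (lv e d A)&sat E (case_nat a e) (P d (Suc d)))"
 by (simp add: bex_f_def)

lemma sat_holds1 [simp]: "sat E e (holds1 p x d)<->sat E (case_nat (lv e d x) (%i. e (d + i))) p"
proof -
 have "(%i. e (case i of 0 => d - Suc x | Suc i => d + i)) = case_nat (lv e d x) (%i. e (d + i))"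
  by (rule ext) (auto simp: lv_def split: nat.split)
 then show ?thesis by (simp add: holds1_def satq_subst)
qed

lemma sat_holds2 [simp]:
 "sat E e (holds2 p x y d)<->sat E (case_nat (lv e d x) (case_nat (lv e d y) (%i. e (d + i)))) p"
proof -
 have "(%i. e (case i of 0 => d - Suc x | Suc i => (case i of 0 => d - Suc y | Suc i => d + i)))
   = case_nat (lv e d x) (case_nat (lv e d y) (%i. e (d + i)))"
  by (rule ext) (auto simp: lv_def split: nat.split)
 then show ?thesis by (simp add: holds2_def satq_subst)
qed

lemma sat_is_empty [simp]: "x < d==>sat E e (is_empty x d)<->(ALL y. ~E y (lv e d x))"
 by (simp add: is_empty_def)

lemma sat_is_upair [simp]: "[|p < d; x < d; y < d|]==>sat E e (is_upair p x y d)
  <-> (ALL z. E z (lv e d p)<->z = lv e d x | z = lv e d y)"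
 by (simp add: is_upair_def)

section \<open>Set theory inside a model\<close>

named_theorems dfn

text \<open>Each index of a formula is wired by \<open>g\<close> either to an argument or to a fixed
  element, so definability allows arbitrary parameters without counting them.\<close>

definition ev :: "(nat => nat + U) => (nat => U) => nat => U" where
 "ev g e i = (case g i of Inl k => e k | Inr a => a)"

text \<open>Choice is kept apart because the set theory developed from these axioms is already used
  inside an extension while Choice is being verified there.\<close>

definition ZF :: "fm set" where
 "ZF = {Extensionality 0, Foundation 0, Pairing 0, Union_ax 0, Powerset 0, Infinity 0}
   \<union> {closure (Separation p 0) | p. True} \<union> {closure (Replacement p 0) | p. True}"

locale zf =
 fixes E :: "U => U => bool"  (infix "<:" 50)
 assumes ZF: "p : ZF==>sat E e p"
begin

subsection \<open>Definability with parameters\<close>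

definition Dfn :: "((nat => U) => bool) => bool" where
 "Dfn P<->(EX p g. ALL e. P e = sat E (ev g e) p)"

text \<open>A term is definable when its graph is: index 0 holds the value, and the arguments move
  up by one.\<close>

definition DfnT :: "((nat => U) => U) => bool" where
 "DfnT t<->Dfn (%e. e 0 = t (%i. e (Suc i)))"

lemma Dfn_imp [dfn]: assumes "Dfn P" "Dfn Q" shows "Dfn (%e. P e-->Q e)"
proof -
 obtain p g where p: "!!e. P e = sat E (ev g e) p" using assms(1) by (auto simp: Dfn_def)
 obtain q h where q: "!!e. Q e = sat E (ev h e) q" using assms(2) by (auto simp: Dfn_def)
 \<comment> \<open>Even indices keep the wiring of \<open>p\<close>, odd indices that of
   \<open>q\<close>.\<close>
 let ?k = "%i. if even i then g (i div 2) else h (i div 2)"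
 have 1: "(%i. ev ?k e (2 * i)) = ev g e" for e by (rule ext) (simp add: ev_def)
 have 2: "(%i. ev ?k e (2 * i + 1)) = ev h e" for e by (rule ext) (simp add: ev_def)
 have "(P e-->Q e)<->sat E (ev ?k e) (Imp (subst (%i. 2 * i) p) (subst (%i. 2 * i + 1) q))" for e
  by (simp only: satq.simps satq_subst 1 2 p q)
 then show ?thesis unfolding Dfn_def by blast
qed

lemma Dfn_False: "Dfn (%e. False)"
 unfolding Dfn_def by (rule exI[of _ Bot]) simp

lemma Dfn_all [dfn]: assumes "Dfn (%e. P (%i. e (Suc i)) (e 0))" shows "Dfn (%e. ALL x. P e x)"
proof -
 obtain p g where p: "!!e. P (%i. e (Suc i)) (e 0) = sat E (ev g e) p" using assms by (auto simp: Dfn_def)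
 have px: "P e x = sat E (ev g (case_nat x e)) p" for e x using p[of "case_nat x e"] by simp
 \<comment> \<open>Indices wired to argument 0 become the bound variable; the wiring of the others
   moves down by one argument.\<close>
 let ?f = "%i. if g i = Inl 0 then 0 else Suc i"
 let ?h = "%i. case g i of Inl k => Inl (k - 1) | Inr a => Inr a"
 have 1: "(%i. case_nat x (ev ?h e) (?f i)) = ev g (case_nat x e)" for e x
  by (rule ext) (auto simp: ev_def split: sum.split nat.split)
 have "(ALL x. P e x)<->sat E (ev ?h e) (Forall (subst ?f p))" for e
  by (simp only: satq.simps satq_subst 1 px)
 then show ?thesis unfolding Dfn_def by blast
qed

lemma Dfn_not [dfn]: assumes "Dfn P" shows "Dfn (%e. ~P e)"
 using Dfn_imp[OF assms Dfn_False] by simp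

lemma Dfn_bool [dfn]: "Dfn (%e. c)"
 by (cases c) (use Dfn_False Dfn_not[OF Dfn_False] in auto)

lemma Dfn_conj [dfn]: assumes "Dfn P" "Dfn Q" shows "Dfn (%e. P e&Q e)"
 using Dfn_not[OF Dfn_imp[OF assms(1) Dfn_not[OF assms(2)]]] by simp

lemma Dfn_disj [dfn]: assumes "Dfn P" "Dfn Q" shows "Dfn (%e. P e | Q e)"
 using Dfn_imp[OF Dfn_not[OF assms(1)] assms(2)] by (simp add: disj_imp)

lemma Dfn_iff [dfn]: assumes "Dfn P" "Dfn Q" shows "Dfn (%e. P e<->Q e)"
 using Dfn_conj[OF Dfn_imp[OF assms] Dfn_imp[OF assms(2,1)]] by (simp add: iff_conv_conj_imp)

lemma Dfn_ex [dfn]: assumes "Dfn (%e. P (%i. e (Suc i)) (e 0))" shows "Dfn (%e. EX x. P e x)"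
 using Dfn_not[OF Dfn_all[of "%e x. ~P e x", OF Dfn_not[OF assms]]] by simp

lemma Dfn_reidx: assumes "Dfn P" shows "Dfn (%e. P (%i. e (f i)))"
proof -
 obtain p g where p: "!!e. P e = sat E (ev g e) p" using assms by (auto simp: Dfn_def)
 have "ev g (%i. e (f i)) = ev (%i. map_sum f id (g i)) e" for e
  by (rule ext) (auto simp: ev_def split: sum.split)
 then show ?thesis unfolding Dfn_def p by metis
qed

lemma DfnT_reidx: assumes "DfnT t" shows "DfnT (%e. t (%i. e (f i)))"
 using Dfn_reidx[OF assms[unfolded DfnT_def], of "case_nat 0 (%i. Suc (f i))"] by (simp add: DfnT_def)

lemma DfnT_shift: "DfnT t==>DfnT (%e. t (%i. e (Suc i)))"
 by (rule DfnT_reidx)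

lemma DfnT_var [dfn]: "DfnT (%e. e k)"
proof -
 have "(e 0 = e (Suc k)) = sat E (ev Inl e) (Equ 0 (Suc k))" for e by (simp add: ev_def)
 then show ?thesis unfolding DfnT_def Dfn_def by blast
qed

lemma DfnT_const [dfn]: "DfnT (%e. a)"
proof -
 have "(e 0 = a) = sat E (ev (case_nat (Inl 0) (%i. Inr a)) e) (Equ 0 1)" for e by (simp add: ev_def)
 then show ?thesis unfolding DfnT_def Dfn_def by blast
qed

lemma Dfn_app: assumes "Dfn (%e. C (%i. e (Suc i)) (e 0))" "DfnT t" shows "Dfn (%e. C e (t e))"
proof -
 have "Dfn (%e. EX x. x = t e&C e x)"
  by (rule Dfn_ex, rule Dfn_conj[OF assms(2)[unfolded DfnT_def] assms(1)])
 then show ?thesis by simp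
qed

lemma Dfn1: assumes "Dfn (%e. C (e 0))" "DfnT t" shows "Dfn (%e. C (t e))"
 using Dfn_app[of "%e. C" t] assms by simp

lemma Dfn2: assumes "Dfn (%e. C (e 0) (e (Suc 0)))" "DfnT s" "DfnT t" shows "Dfn (%e. C (s e) (t e))"
 by (rule Dfn_app[of "%e y. C (s e) y"], rule Dfn_app[of "%e y. C y (e 0)"]) (use assms DfnT_shift in auto)

lemma Dfn3: assumes "Dfn (%e. C (e 0) (e (Suc 0)) (e (Suc (Suc 0))))" "DfnT s" "DfnT t" "DfnT u"
 shows "Dfn (%e. C (s e) (t e) (u e))"
proof (rule Dfn_app[of "%e y. C (s e) (t e) y"])
 show "Dfn (%e. C (s (%i. e (Suc i))) (t (%i. e (Suc i))) (e 0))"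
 proof (rule Dfn_app[of "%e y. C (s (%i. e (Suc i))) y (e 0)"])
  show "Dfn (%e. C (s (%i. e (Suc (Suc i)))) (e 0) (e (Suc 0)))"
   by (rule Dfn_app[of "%e y. C y (e 0) (e (Suc 0))"]) (use assms(1) DfnT_reidx[OF assms(2)] in auto)
 qed (use DfnT_reidx[OF assms(3)] in auto)
qed (use assms in auto)

lemma Dfn_mem [dfn]: assumes "DfnT s" "DfnT t" shows "Dfn (%e. s e<:t e)"
proof (rule Dfn2[OF _ assms])
 have "(e 0<:e (Suc 0)) = sat E (ev Inl e) (Mem 0 1)" for e by (simp add: ev_def)
 then show "Dfn (%e. e 0<:e (Suc 0))" unfolding Dfn_def by blast
qed

lemma Dfn_eq [dfn]: assumes "DfnT s" "DfnT t" shows "Dfn (%e. s e = t e)"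
proof (rule Dfn2[OF _ assms])
 have "(e 0 = e (Suc 0)) = sat E (ev Inl e) (Equ 0 1)" for e by (simp add: ev_def)
 then show "Dfn (%e. e 0 = e (Suc 0))" unfolding Dfn_def by blast
qed

lemma DfnT1: assumes "DfnT (%e. f (e 0))" "DfnT s" shows "DfnT (%e. f (s e))"
 unfolding DfnT_def
 by (rule Dfn2[of "%y x. y = f x"]) (use assms DfnT_shift DfnT_var in \<open>auto simp: DfnT_def\<close>)

lemma DfnT2: assumes "DfnT (%e. f (e 0) (e (Suc 0)))" "DfnT s" "DfnT t" shows "DfnT (%e. f (s e) (t e))"
 unfolding DfnT_def
 by (rule Dfn3[of "%y a b. y = f a b"]) (use assms(1) DfnT_shift[OF assms(2)] DfnT_shift[OF assms(3)] DfnT_var in \<open>auto simp: DfnT_def\<close>)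

lemma Dfn4: assumes "Dfn (%e. C (e 0) (e (Suc 0)) (e (Suc (Suc 0))) (e (Suc (Suc (Suc 0)))))" "DfnT s" "DfnT t" "DfnT u" "DfnT v"
 shows "Dfn (%e. C (s e) (t e) (u e) (v e))"
proof (rule Dfn_app[of "%e y. C (s e) (t e) (u e) y"])
 show "Dfn (%e. C (s (%i. e (Suc i))) (t (%i. e (Suc i))) (u (%i. e (Suc i))) (e 0))"
 proof (rule Dfn_app[of "%e y. C (s (%i. e (Suc i))) (t (%i. e (Suc i))) y (e 0)"])
  show "Dfn (%e. C (s (%i. e (Suc (Suc i)))) (t (%i. e (Suc (Suc i)))) (e 0) (e (Suc 0)))"
  proof (rule Dfn_app[of "%e y. C (s (%i. e (Suc (Suc i)))) y (e 0) (e (Suc 0))"])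
   show "Dfn (%e. C (s (%i. e (Suc (Suc (Suc i))))) (e 0) (e (Suc 0)) (e (Suc (Suc 0))))"
    by (rule Dfn_app[of "%e y. C y (e 0) (e (Suc 0)) (e (Suc (Suc 0)))"]) (use assms(1) DfnT_reidx[OF assms(2)] in auto)
  qed (use DfnT_reidx[OF assms(3)] in auto)
 qed (use DfnT_reidx[OF assms(4)] in auto)
qed (use assms in auto)

lemma DfnT3: assumes "DfnT (%e. f (e 0) (e (Suc 0)) (e (Suc (Suc 0))))" "DfnT s" "DfnT t" "DfnT u"
 shows "DfnT (%e. f (s e) (t e) (u e))"
 unfolding DfnT_def
 by (rule Dfn4[of "%y a b c. y = f a b c"]) (use assms(1) DfnT_shift[OF assms(2)] DfnT_shift[OF assms(3)] DfnT_shift[OF assms(4)] DfnT_var in \<open>auto simp: DfnT_def\<close>)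

lemma DfnT_if [dfn]: assumes "Dfn P" "DfnT s" "DfnT t" shows "DfnT (%e. if P e then s e else t e)"
proof -
 have "Dfn (%e. P (%i. e (Suc i))&e 0 = s (%i. e (Suc i)) | ~P (%i. e (Suc i))&e 0 = t (%i. e (Suc i)))"
  by (intro Dfn_disj Dfn_conj Dfn_not Dfn_reidx[OF assms(1)] assms(2,3)[unfolded DfnT_def])
 moreover have "(P f&x = s f | ~P f&x = t f)<->x = (if P f then s f else t f)" for f x by auto
 ultimately show ?thesis by (simp add: DfnT_def)
qed

subsection \<open>The axioms\<close>

lemma seteq: "(!!z. z<:x<->z<:y)==>x = y"
 using ZF[of "Extensionality 0" "%_. x"] by (simp add: ZF_def Extensionality_def)

lemma foundation: "y<:x==>EX m. m<:x&(ALL z. z<:m-->~z<:x)"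
 using ZF[of "Foundation 0" "%_. x"] by (auto simp add: ZF_def Foundation_def)

lemma ax_pair: "EX p. ALL z. z<:p<->z = x | z = y"
 using ZF[of "Pairing 0" "%_. x"] by (simp add: ZF_def Pairing_def)

lemma ax_union: "EX u. ALL z. z<:u<->(EX y. y<:F&z<:y)"
 using ZF[of "Union_ax 0" "%_. x"] by (simp add: ZF_def Union_ax_def)

lemma ax_power: "EX u. ALL y. y<:u<->(ALL z. z<:y-->z<:x)"
 using ZF[of "Powerset 0" "%_. x"] by (simp add: ZF_def Powerset_def subset_f_def)

lemma ax_infinity: "EX I. (EX z. z<:I&(ALL y. ~y<:z))&(ALL x. x<:I-->(EX s. s<:I&(ALL y. y<:s<->y<:x | y = x)))"
 using ZF[of "Infinity 0" "%_. x"] by (simp add: ZF_def Infinity_def is_succ_def)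

lemma ax_separation:
 assumes "Dfn (%e. P (e 0))" shows "EX b. ALL x. x<:b<->x<:a&P x"
proof -
 obtain p g where p: "!!e. P (e 0) = sat E (ev g e) p" using assms by (auto simp: Dfn_def)
 let ?f = "%i. if g i = Inl 0 then 0 else Suc i"
 \<comment> \<open>\<open>P\<close> looks at the first argument only, so any value may stand for the
   other arguments.\<close>
 let ?e = "ev g (%_. a)"
 have 1: "(%i. case_nat x ?e (?f i)) = ev g (case_nat x (%_. a))" for x
  by (rule ext) (auto simp: ev_def split: sum.split nat.split)
 have px: "P x = sat E (case_nat x ?e) (subst ?f p)" for x
  using p[of "case_nat x (%_. a)"] by (simp only: satq_subst 1 nat.case)
 have "sat E ?e (Separation (subst ?f p) 0)"
  by (rule satq_closure, rule ZF) (auto simp: ZF_def)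
 then show ?thesis by (simp add: Separation_def px)
qed

lemma ax_replacement:
 assumes "Dfn (%e. P (e 0) (e (Suc 0)))" "!!x y z. x<:a==>P x y==>P x z==>y = z"
 shows "EX b. ALL y. y<:b<->(EX x. x<:a&P x y)"
proof -
 obtain p g where p: "!!e. P (e 0) (e (Suc 0)) = sat E (ev g e) p" using assms(1) by (auto simp: Dfn_def)
 let ?f = "%i. if g i = Inl 0 then 0 else if g i = Inl (Suc 0) then Suc 0 else Suc (Suc i)"
 let ?e = "ev g (%_. a)"
 have 1: "(%i. case_nat x (case_nat y ?e) (?f i)) = ev g (case_nat x (case_nat y (%_. a)))" for x y
  by (rule ext) (auto simp: ev_def split: sum.split nat.split)
 have px: "P x y = sat E (case_nat x (case_nat y ?e)) (subst ?f p)" for x y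
  using p[of "case_nat x (case_nat y (%_. a))"] by (simp only: satq_subst 1 nat.case)
 have "sat E ?e (Replacement (subst ?f p) 0)"
  by (rule satq_closure, rule ZF) (auto simp: ZF_def)
 then have "(ALL x. x<:a-->(ALL y z. P x y&P x z-->y = z))-->(EX b. ALL y. (y<:b) = (EX x. x<:a&P x y))"
  by (simp add: Replacement_def px)
 then show ?thesis using assms(2) by blast
qed

subsection \<open>Set builders\<close>

definition coll :: "(U => bool) => U" where
 "coll P = (THE b. ALL x. x<:b<->P x)"

lemma coll: assumes "EX b. ALL x. x<:b<->P x" shows "x<:coll P<->P x"
proof -
 have "EX! b. ALL x. x<:b<->P x" using assms seteq by metis
 from theI'[OF this] show ?thesis by (simp add: coll_def)
qed

lemma coll_sep: assumes "Dfn (%e. P (e 0))" "!!x. P x==>x<:a" shows "x<:coll P<->P x"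
 by (rule coll) (use ax_separation[OF assms(1), of a] assms(2) in metis)

text \<open>Where no such set exists, \<open>THE\<close> has one fixed unspecified value. The graph
  is therefore definable in all cases, and definability proofs carry no existence
  conditions.\<close>

lemma DfnT_coll [dfn]: assumes "Dfn (%e. P (%i. e (Suc i)) (e 0))" shows "DfnT (%e. coll (%x. P e x))"
proof -
 have 1: "y = coll (P e)<->(ALL x. x<:y<->P e x) | ~(EX b. ALL x. x<:b<->P e x)&y = (THE b. False)" for e y
 proof (cases "EX b. ALL x. x<:b<->P e x")
  case True
  then show ?thesis using coll[OF True] seteq by metis
 next
  case False
  then have "(ALL x. x<:b<->P e x) = False" for b by blast
  then have "(%b. ALL x. x<:b<->P e x) = (%b. False)" by (rule ext)
  then have "coll (P e) = (THE b. False)" unfolding coll_def by (rule arg_cong)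
  then show ?thesis using False by auto
 qed
 have 2: "Dfn (%e. P (%i. e (Suc (Suc i))) (e 0))"
  using Dfn_reidx[OF assms, of "case_nat 0 (%i. Suc (Suc i))"] by simp
 have 3: "Dfn (%e. P (%i. e (Suc (Suc (Suc i)))) (e 0))"
  using Dfn_reidx[OF assms, of "case_nat 0 (%i. Suc (Suc (Suc i)))"] by simp
 show ?thesis unfolding DfnT_def 1 by (intro dfn 2 3)
qed

definition emp :: U where "emp = coll (%x. False)"

lemma emp [simp]: "~x<:emp"
 unfolding emp_def by (subst coll_sep[where a = x]) (intro dfn, auto)

lemma emp_eq: "(!!x. ~x<:a)==>a = emp"
 by (rule seteq) simp

lemma ex_mem: "a ~= emp==>EX x. x<:a"
 using emp_eq by blast

definition des :: "(U => bool) => U" where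
 "des P = (if EX! y. P y then THE y. P y else emp)"

lemma des_eq: assumes "P y" "!!z. P z==>z = y" shows "des P = y"
proof -
 have "EX! y. P y" using assms by blast
 moreover have "(THE y. P y) = y" using assms by (rule the_equality)
 ultimately show ?thesis by (simp add: des_def)
qed

lemma DfnT_des [dfn]: assumes "Dfn (%e. P (%i. e (Suc i)) (e 0))" shows "DfnT (%e. des (%x. P e x))"
proof -
 have 1: "y = des (P e)<->P e y&(ALL z. P e z-->z = y) | ~(EX u. P e u&(ALL z. P e z-->z = u))&y = emp" for e y
 proof (cases "EX! y. P e y")
  case True
  then show ?thesis using des_eq by metis
 next
  case False
  then show ?thesis by (auto simp: des_def)
 qed
 have 2: "Dfn (%e. P (%i. e (Suc (Suc i))) (e 0))"
  using Dfn_reidx[OF assms, of "case_nat 0 (%i. Suc (Suc i))"] by simp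
 have 3: "Dfn (%e. P (%i. e (Suc (Suc (Suc i)))) (e 0))"
  using Dfn_reidx[OF assms, of "case_nat 0 (%i. Suc (Suc (Suc i)))"] by simp
 show ?thesis unfolding DfnT_def 1 by (intro dfn 2 3 assms)
qed

definition sub :: "U => U => bool" (infix "<<=" 50) where "a<<=b<->(ALL x. x<:a-->x<:b)"

lemma Dfn_sub [dfn]: "DfnT s==>DfnT t==>Dfn (%e. s e<<=t e)"
 by (rule Dfn2[of sub], unfold sub_def, intro dfn)

lemma subI: "(!!x. x<:a==>x<:b)==>a<<=b" by (simp add: sub_def)
lemma subD: "a<<=b==>x<:a==>x<:b" by (simp add: sub_def)
lemma sub_refl [simp]: "a<<=a" by (simp add: sub_def)
lemma sub_trans: "a<<=b==>b<<=c==>a<<=c" by (simp add: sub_def)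
lemma sub_antisym: "a<<=b==>b<<=a==>a = b" by (rule seteq) (auto simp: sub_def)
lemma emp_sub [simp]: "emp<<=a" by (simp add: sub_def)

definition upair :: "U => U => U" where "upair a b = coll (%x. x = a | x = b)"
definition pair :: "U => U => U" where "pair a b = upair (upair a a) (upair a b)"
definition Uni :: "U => U" where "Uni F = coll (%x. EX y. y<:F&x<:y)"
definition un :: "U => U => U" where "un a b = coll (%x. x<:a | x<:b)"
definition df :: "U => U => U" where "df a b = coll (%x. x<:a&~x<:b)"
definition it :: "U => U => U" where "it a b = coll (%x. x<:a&x<:b)"
definition pw :: "U => U" where "pw a = coll (%x. x<<=a)"
definition sc :: "U => U" where "sc a = coll (%x. x<:a | x = a)"
definition ins :: "U => U => U" where "ins a b = coll (%x. x<:b | x = a)"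

lemma upair_dfn [dfn]: "DfnT s==>DfnT t==>DfnT (%e. upair (s e) (t e))"
 by (rule DfnT2[of upair], unfold upair_def, intro dfn)
lemma pair_dfn [dfn]: "DfnT s==>DfnT t==>DfnT (%e. pair (s e) (t e))"
 by (rule DfnT2[of pair], unfold pair_def, intro dfn)
lemma Uni_dfn [dfn]: "DfnT s==>DfnT (%e. Uni (s e))"
 by (rule DfnT1[of Uni], unfold Uni_def, intro dfn)
lemma un_dfn [dfn]: "DfnT s==>DfnT t==>DfnT (%e. un (s e) (t e))"
 by (rule DfnT2[of un], unfold un_def, intro dfn)
lemma df_dfn [dfn]: "DfnT s==>DfnT t==>DfnT (%e. df (s e) (t e))"
 by (rule DfnT2[of df], unfold df_def, intro dfn)
lemma it_dfn [dfn]: "DfnT s==>DfnT t==>DfnT (%e. it (s e) (t e))"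
 by (rule DfnT2[of it], unfold it_def, intro dfn)
lemma pw_dfn [dfn]: "DfnT s==>DfnT (%e. pw (s e))"
 by (rule DfnT1[of pw], unfold pw_def, intro dfn)
lemma sc_dfn [dfn]: "DfnT s==>DfnT (%e. sc (s e))"
 by (rule DfnT1[of sc], unfold sc_def, intro dfn)
lemma ins_dfn [dfn]: "DfnT s==>DfnT t==>DfnT (%e. ins (s e) (t e))"
 by (rule DfnT2[of ins], unfold ins_def, intro dfn)

lemma upair [simp]: "x<:upair a b<->x = a | x = b"
 unfolding upair_def by (rule coll) (rule ax_pair)

lemma Uni [simp]: "x<:Uni F<->(EX y. y<:F&x<:y)"
 unfolding Uni_def by (rule coll) (rule ax_union)

lemma un [simp]: "x<:un a b<->x<:a | x<:b"
proof -
 have "ALL x. x<:Uni (upair a b)<->x<:a | x<:b" by auto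
 then show ?thesis unfolding un_def by (intro coll) blast
qed

lemma pw [simp]: "x<:pw a<->x<<=a"
 unfolding pw_def sub_def by (rule coll) (rule ax_power)

lemma df [simp]: "x<:df a b<->x<:a&~x<:b"
 unfolding df_def by (rule coll_sep[where a = a]) (intro dfn, auto)

lemma it [simp]: "x<:it a b<->x<:a&x<:b"
 unfolding it_def by (rule coll_sep[where a = a]) (intro dfn, auto)

lemma ins [simp]: "x<:ins a b<->x<:b | x = a"
proof -
 have "ALL x. x<:un b (upair a a)<->x<:b | x = a" by auto
 then show ?thesis unfolding ins_def by (intro coll) blast
qed

lemma sc [simp]: "x<:sc a<->x<:a | x = a"
proof -
 have "ALL x. x<:un a (upair a a)<->x<:a | x = a" by auto
 then show ?thesis unfolding sc_def by (intro coll) blast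
qed

lemma pair_inj [simp]: "pair a b = pair c d<->a = c&b = d"
proof
 have u: "upair a b = upair c d<->(ALL x. x = a | x = b<->x = c | x = d)" for a b c d
  using upair seteq by metis
 assume *: "pair a b = pair c d"
 have m: "x<:pair a b<->x = upair a a | x = upair a b" for x a b by (simp add: pair_def)
 have "upair a a = upair c c | upair a a = upair c d" "upair a b = upair c c | upair a b = upair c d"
  "upair c d = upair a a | upair c d = upair a b"
  using m[of _ a b] m[of _ c d] unfolding * by blast+
 then show "a = c&b = d" unfolding u by metis
qed simp

definition img :: "(U => U) => U => U" where "img F a = coll (%y. EX x. x<:a&y = F x)"
definition sep :: "U => (U => bool) => U" where "sep a P = coll (%x. x<:a&P x)"

lemma img: "DfnT (%e. F (e 0))==>y<:img F a<->(EX x. x<:a&y = F x)"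
 unfolding img_def
 by (rule coll, rule ax_replacement) (use DfnT1[of F] in \<open>intro dfn\<close>, auto)

lemma sep: "Dfn (%e. P (e 0))==>x<:sep a P<->x<:a&P x"
 unfolding sep_def by (rule coll, rule ax_separation)

lemma DfnT_img [dfn]: assumes "DfnT (%e. F (%i. e (Suc i)) (e 0))" "DfnT t" shows "DfnT (%e. img (F e) (t e))"
proof -
 have 1: "DfnT (%e. F (%i. e (Suc (Suc i))) (e 0))"
  using DfnT_reidx[OF assms(1), of "case_nat 0 (%i. Suc (Suc i))"] by simp
 show ?thesis unfolding img_def by (intro dfn 1 DfnT_reidx[OF assms(2)])
qed

lemma DfnT_sep [dfn]: assumes "Dfn (%e. P (%i. e (Suc i)) (e 0))" "DfnT t" shows "DfnT (%e. sep (t e) (P e))"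
 unfolding sep_def by (intro dfn assms DfnT_reidx[OF assms(2)])

definition cart :: "U => U => U" where "cart a b = coll (%z. EX x y. x<:a&y<:b&z = pair x y)"

lemma cart_dfn [dfn]: "DfnT s==>DfnT t==>DfnT (%e. cart (s e) (t e))"
 by (rule DfnT2[of cart], unfold cart_def, intro dfn)

lemma cart: "z<:cart a b<->(EX x y. x<:a&y<:b&z = pair x y)"
proof -
 have d: "DfnT (%e. img (pair (e 0)) b)" "!!x. DfnT (%e. pair x (e 0))" by (intro dfn)+
 have "ALL z. z<:Uni (img (%x. img (pair x) b) a)<->(EX x y. x<:a&y<:b&z = pair x y)"
  using d by (auto simp: img)
 then show ?thesis unfolding cart_def by (intro coll) blast
qed

lemma cart_pair [simp]: "pair x y<:cart a b<->x<:a&y<:b"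
 by (auto simp: cart)

definition dm :: "U => U" where "dm f = coll (%x. EX y. pair x y<:f)"
definition rg :: "U => U" where "rg f = coll (%y. EX x. pair x y<:f)"

lemma dm_dfn [dfn]: "DfnT s==>DfnT (%e. dm (s e))"
 by (rule DfnT1[of dm], unfold dm_def, intro dfn)
lemma rg_dfn [dfn]: "DfnT s==>DfnT (%e. rg (s e))"
 by (rule DfnT1[of rg], unfold rg_def, intro dfn)

lemma pair_in_UniUni: "pair x y<:f==>x<:Uni (Uni f)&y<:Uni (Uni f)"
proof -
 assume "pair x y<:f"
 moreover have "upair x y<:pair x y" by (simp add: pair_def)
 ultimately have "upair x y<:Uni f" unfolding Uni by blast
 moreover have "x<:upair x y" "y<:upair x y" by simp_all
 ultimately show ?thesis unfolding Uni[of _ "Uni f"] by blast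
qed

lemma dm: "x<:dm f<->(EX y. pair x y<:f)"
 unfolding dm_def by (rule coll_sep[where a = "Uni (Uni f)"]) (intro dfn, use pair_in_UniUni in blast)

lemma rg: "y<:rg f<->(EX x. pair x y<:f)"
 unfolding rg_def by (rule coll_sep[where a = "Uni (Uni f)"]) (intro dfn, use pair_in_UniUni in blast)

definition app :: "U => U => U" where "app f x = des (%y. pair x y<:f)"

lemma app_dfn [dfn]: "DfnT s==>DfnT t==>DfnT (%e. app (s e) (t e))"
 by (rule DfnT2[of app], unfold app_def, intro dfn)

definition fn :: "U => U => U => bool" where
 "fn f a b<->(ALL p. p<:f-->(EX x y. x<:a&y<:b&p = pair x y)) &
   (ALL x. x<:a-->(EX y. pair x y<:f&(ALL z. pair x z<:f-->z = y)))"

lemma fn_dfn [dfn]: "DfnT s==>DfnT t==>DfnT u==>Dfn (%e. fn (s e) (t e) (u e))"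
 by (rule Dfn3[of fn], unfold fn_def, intro dfn)

lemma fn_app: assumes "fn f a b" "x<:a" shows "pair x (app f x)<:f" "app f x<:b"
proof -
 obtain y where y: "pair x y<:f" "!!z. pair x z<:f==>z = y" using assms unfolding fn_def by blast
 have "app f x = y" unfolding app_def by (rule des_eq) (fact y)+
 then show "pair x (app f x)<:f" using y(1) by simp
 then have p: "pair x (app f x)<:f" .
 have A: "ALL p. p<:f-->(EX x y. x<:a&y<:b&p = pair x y)" using assms(1) unfolding fn_def by (rule conjunct1)
 show "app f x<:b" using mp[OF spec[OF A] p] by simp
qed

lemma fn_pair: assumes "fn f a b" shows "pair x y<:f<->x<:a&y = app f x"
 using assms fn_app[OF assms] unfolding fn_def by (metis pair_inj)

lemma fn_mem: assumes "fn f a b" shows "p<:f<->(EX x. x<:a&p = pair x (app f x))"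
 using assms fn_app[OF assms] fn_pair[OF assms] unfolding fn_def by metis

lemma fn_eqI: assumes "fn f a b" "fn g a c" "!!x. x<:a==>app f x = app g x" shows "f = g"
 by (rule seteq) (use fn_mem[OF assms(1)] fn_mem[OF assms(2)] assms(3) in auto)

lemma fn_dm: "fn f a b==>dm f = a"
 by (rule seteq) (auto simp: dm fn_pair)

lemma rg_fn: "fn f a b==>y<:rg f<->(EX x. x<:a&y = app f x)"
 by (auto simp: rg fn_pair)

definition lam :: "U => (U => U) => U" where "lam a F = coll (%z. EX x. x<:a&z = pair x (F x))"

lemma DfnT_lam [dfn]: assumes "DfnT t" "DfnT (%e. F (%i. e (Suc i)) (e 0))" shows "DfnT (%e. lam (t e) (F e))"
proof -
 have 1: "DfnT (%e. F (%i. e (Suc (Suc i))) (e 0))"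
  using DfnT_reidx[OF assms(2), of "case_nat 0 (%i. Suc (Suc i))"] by simp
 show ?thesis unfolding lam_def by (intro dfn 1 DfnT_reidx[OF assms(1)])
qed

lemma lam_mem: assumes "DfnT (%e. F (e 0))" shows "z<:lam a F<->(EX x. x<:a&z = pair x (F x))"
proof -
 have "DfnT (%e. pair (e 0) (F (e 0)))" by (intro dfn assms)
 from img[OF this, of _ a] show ?thesis unfolding lam_def by (intro coll) blast
qed

lemma lam_app: assumes "DfnT (%e. F (e 0))" "x<:a" shows "app (lam a F) x = F x"
 unfolding app_def by (rule des_eq) (use assms in \<open>auto simp: lam_mem\<close>)

lemma lam_fn: assumes "DfnT (%e. F (e 0))" "!!x. x<:a==>F x<:b" shows "fn (lam a F) a b"
 unfolding fn_def using assms by (auto simp: lam_mem)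

lemma lam_cong: "(!!x. x<:a==>F x = G x)==>lam a F = lam a G"
 unfolding lam_def by (metis (no_types, lifting))

lemma fn_eta: assumes "fn f a b" shows "f = lam a (app f)"
proof (rule fn_eqI[OF assms])
 have d: "DfnT (%e. app f (e 0))" by (intro dfn)
 show "fn (lam a (app f)) a b" by (rule lam_fn[OF d]) (use fn_app assms in auto)
 show "app f x = app (lam a (app f)) x" if "x<:a" for x using lam_app[OF d that] by simp
qed

definition rs :: "U => U => U" where "rs f a = coll (%z. z<:f&(EX x y. x<:a&z = pair x y))"

lemma rs_dfn [dfn]: "DfnT s==>DfnT t==>DfnT (%e. rs (s e) (t e))"
 by (rule DfnT2[of rs], unfold rs_def, intro dfn)

lemma rs: "z<:rs f a<->z<:f&(EX x y. x<:a&z = pair x y)"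
 unfolding rs_def by (rule coll_sep[where a = f]) (intro dfn, auto)

lemma rs_pair [simp]: "pair x y<:rs f a<->pair x y<:f&x<:a"
 by (auto simp: rs)

end

context zf begin

text \<open>Substitution into a term with further arguments, for functionals such as the argument of
  \<open>Rec\<close> that are applied to definable terms.\<close>

lemma DfnT_app: assumes "DfnT (%e. F (%i. e (Suc i)) (e 0))" "DfnT t" shows "DfnT (%e. F e (t e))"
proof -
 have 1: "Dfn (%e. e 0 = F (%i. e (Suc (Suc i))) (e (Suc 0)))" using assms(1) by (simp add: DfnT_def)
 have "Dfn (%e. e (Suc 0) = F (%i. e (Suc (Suc i))) (e 0))"
  using Dfn_reidx[OF 1, of "case_nat (Suc 0) (case_nat 0 (%i. Suc (Suc i)))"] by simp
 then show ?thesis unfolding DfnT_def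
  by (intro Dfn_app[of "%e x. e 0 = F (%i. e (Suc i)) x"] DfnT_shift assms(2)) simp
qed

subsection \<open>Ordinals\<close>

lemma not_self [simp]: "~x<:x"
 using foundation[of x "upair x x"] by auto

lemma no_cycle2: "x<:y==>~y<:x"
 using foundation[of x "upair x y"] by auto

lemma no_cycle3: "x<:y==>y<:z==>~z<:x"
 using foundation[of x "ins z (upair x y)"] by auto

lemma sc_inj [simp]: "sc a = sc b<->a = b"
 using sc no_cycle2 by metis

lemma sc_neq [simp]: "sc a ~= a" "a ~= sc a" "sc a ~= emp" "emp ~= sc a"
 using sc not_self emp by metis+

definition trs :: "U => bool" where "trs a<->(ALL x. x<:a-->x<<=a)"
definition Ord :: "U => bool" where
 "Ord a<->trs a&(ALL x y. x<:a-->y<:a-->x<:y | x = y | y<:x)"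

lemma trs_dfn [dfn]: "DfnT s==>Dfn (%e. trs (s e))"
 by (rule Dfn1[of trs], unfold trs_def, intro dfn)
lemma Ord_dfn [dfn]: "DfnT s==>Dfn (%e. Ord (s e))"
 by (rule Dfn1[of Ord], unfold Ord_def, intro dfn)

lemma trsD: "trs a==>x<:a==>y<:x==>y<:a"
 by (auto simp: trs_def sub_def)

lemma Ord_trs: "Ord a==>trs a" by (simp add: Ord_def)

lemma Ord_trans: "Ord c==>a<:b==>b<:c==>a<:c"
 using Ord_trs trsD by blast

lemma Ord_mem: assumes "Ord a" "x<:a" shows "Ord x"
proof -
 have t: "y<:a" if "y<:x" for y using that assms Ord_trans by blast
 have "z<:x" if "y<:x" "z<:y" for y z
 proof -
  have "z<:a" using that t assms Ord_trans by blast
  then have "z<:x | z = x | x<:z" using assms by (auto simp: Ord_def)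
  then show ?thesis using that no_cycle2 no_cycle3 by blast
 qed
 then show ?thesis using assms t by (auto simp: Ord_def trs_def sub_def)
qed

lemma Ord_proper: assumes "Ord a" "c<<=a" "trs c" "c ~= a" shows "c<:a"
proof -
 have "df a c ~= emp" using assms(2,4) by (metis df emp sub_antisym sub_def)
 then obtain y where "y<:df a c" using ex_mem by blast
 \<comment> \<open>The membership-minimal element of the difference turns out to be \<open>c\<close>
   itself.\<close>
 from foundation[OF this] obtain m where m: "m<:a" "~m<:c" "!!z. z<:m==>~(z<:a&~z<:c)"
  unfolding df by blast
 have "m = c"
 proof (rule seteq, rule iffI)
  fix z assume "z<:m" then show "z<:c" using m assms(1) Ord_trans by blast
 next
  fix z assume z: "z<:c"
  then have "z<:a" using assms(2) by (simp add: sub_def)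
  then have "z<:m | z = m | m<:z" using assms(1) m(1) by (auto simp: Ord_def)
  then show "z<:m" using z m(2) assms(3) trsD by blast
 qed
 then show ?thesis using m by simp
qed

lemma Ord_linear: assumes "Ord a" "Ord b" shows "a<:b | a = b | b<:a"
proof -
 have t: "trs (it a b)" using assms by (auto simp: trs_def sub_def Ord_def)
 have 1: "it a b = a | it a b<:a" using Ord_proper[OF assms(1) _ t] by (auto simp: sub_def)
 have 2: "it a b = b | it a b<:b" using Ord_proper[OF assms(2) _ t] by (auto simp: sub_def)
 show ?thesis using 1 2 it[of "it a b" a b] not_self by metis
qed

lemma Ord_sub: assumes "Ord a" "Ord b" shows "a<<=b<->a<:b | a = b"
 using Ord_linear[OF assms] assms Ord_trans not_self unfolding sub_def by metis

lemma Ord_not_mem: "Ord a==>Ord b==>~a<:b<->b<<=a"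
 using Ord_linear Ord_sub no_cycle2 by blast

lemma Ord_emp [simp]: "Ord emp" by (simp add: Ord_def trs_def)

lemma Ord_sc [simp]: "Ord a==>Ord (sc a)"
 by (auto simp: Ord_def trs_def sub_def)

lemma Ord_Uni: assumes "!!x. x<:F==>Ord x" shows "Ord (Uni F)"
proof -
 have "Ord x" if "x<:Uni F" for x using that assms Ord_mem by auto
 then have "x<:y | x = y | y<:x" if "x<:Uni F" "y<:Uni F" for x y using that Ord_linear by blast
 moreover have "trs (Uni F)" using assms Ord_trans by (fastforce simp: trs_def sub_def)
 ultimately show ?thesis by (auto simp: Ord_def)
qed

text \<open>The ordinals of the model may fail to be well-ordered from outside. A least
  counterexample comes from Foundation in the model, applied to a separated set, hence the
  restriction to definable predicates.\<close>

lemma Ord_induct: assumes d: "Dfn (%e. P (e 0))" and o: "Ord a" and s: "!!a. Ord a==>(!!b. b<:a==>P b)==>P a"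
 shows "P a"
proof (rule ccontr)
 assume n: "~P a"
 have d': "Dfn (%e. ~P (e 0))" by (intro dfn d)
 have "a<:sep (sc a) (%x. ~P x)" using n by (simp add: sep[OF d'])
 then obtain m where m: "m<:sc a" "~P m" "!!z. z<:m==>z<:sc a==>P z"
  using foundation sep[OF d'] by metis
 have "Ord m" using m(1) o Ord_mem Ord_sc by blast
 moreover have "P z" if "z<:m" for z using m that o Ord_sc Ord_trans by blast
 ultimately show False using m(2) s by blast
qed

lemma Ord_least: assumes d: "Dfn (%e. P (e 0))" and o: "Ord a" "P a"
 shows "EX b. Ord b&P b&(ALL c. c<:b-->~P c)"
proof (rule ccontr)
 assume n: "~?thesis"
 have d': "Dfn (%e. ~P (e 0))" by (intro dfn d)
 have "~P a" by (rule Ord_induct[OF d' o(1)]) (use n in blast)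
 then show False using o by blast
qed

lemma Ord_emp_mem: assumes "Ord a" "a ~= emp" shows "emp<:a"
 using Ord_linear[OF assms(1) Ord_emp] assms(2) by auto

lemma Ord_sc_mem: assumes "Ord a" "x<:a" shows "sc x<:a | sc x = a"
 using Ord_linear[of "sc x" a] assms Ord_mem Ord_sc no_cycle2 by (metis not_self sc)

subsection \<open>Natural numbers\<close>

text \<open>This form does not presuppose a set of natural numbers, so \<open>om\<close> can be cut
  out of the set given by Infinity.\<close>

definition Nat :: "U => bool" where
 "Nat x<->Ord x&(ALL y. y<:sc x-->y = emp | (EX z. y = sc z))"
definition om :: U where "om = coll Nat"

lemma Nat_dfn [dfn]: "DfnT s==>Dfn (%e. Nat (s e))"
 by (rule Dfn1[of Nat], unfold Nat_def, intro dfn)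

lemma om_Nat: "x<:om<->Nat x"
proof -
 obtain I where I: "EX z. z<:I&(ALL y. ~y<:z)" "!!x. x<:I==>EX s. s<:I&(ALL y. y<:s<->y<:x | y = x)"
  using ax_infinity by blast
 have e: "emp<:I" using I(1) emp_eq by metis
 have s: "sc x<:I" if "x<:I" for x using I(2)[OF that] seteq sc by metis
 have d: "Dfn (%e. Nat (e 0)-->e 0<:I)" by (intro dfn)
 have "Nat x-->x<:I" if "Ord x" for x
 proof (rule Ord_induct[OF d that], rule impI)
  fix a assume a: "Ord a" "!!b. b<:a==>Nat b-->b<:I" "Nat a"
  then consider "a = emp" | z where "a = sc z" unfolding Nat_def by auto
  then show "a<:I"
  proof cases
   case 2
   have "Ord z" using a 2 Ord_mem by (metis sc)
   then have "Nat z" using a(3) 2 unfolding Nat_def by auto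
   then show ?thesis using a(2) 2 s by simp
  qed (simp add: e)
 qed
 then have "Nat x==>x<:I" for x unfolding Nat_def by blast
 then show ?thesis unfolding om_def by (intro coll_sep[where a = I]) (intro dfn, auto)
qed

lemma emp_om [simp]: "emp<:om" by (simp add: om_Nat Nat_def)
lemma sc_om [simp]: "x<:om==>sc x<:om" by (auto simp: om_Nat Nat_def)
lemma om_Ord_mem: "x<:om==>Ord x" by (simp add: om_Nat Nat_def)

lemma om_trans: assumes "x<:om" "y<:x" shows "y<:om"
proof -
 have o: "Ord x" "Ord y" using assms om_Ord_mem Ord_mem by blast+
 have "z<:sc x" if "z<:sc y" for z using that assms(2) o Ord_trans[of x] by auto
 then show ?thesis using assms o unfolding om_Nat Nat_def by blast
qed

lemma Ord_om [simp]: "Ord om"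
 using om_trans om_Ord_mem Ord_linear unfolding Ord_def[of om] trs_def sub_def by blast

lemma om_cases: "x<:om==>x = emp | (EX y. y<:om&x = sc y)"
 by (metis Nat_def om_Nat om_trans sc)

lemma om_induct: assumes d: "Dfn (%e. P (e 0))" and n: "n<:om" and z: "P emp" and s: "!!n. n<:om==>P n==>P (sc n)"
 shows "P n"
proof -
 have d': "Dfn (%e. e 0<:om-->P (e 0))" by (intro dfn d)
 have "n<:om-->P n"
  by (rule Ord_induct[OF d' om_Ord_mem[OF n]]) (metis om_cases s sc z)
 then show ?thesis using n by blast
qed

definition Lim :: "U => bool" where "Lim a<->Ord a&a ~= emp&(ALL x. x<:a-->(EX y. y<:a&x<:y))"

lemma not_Lim_om: assumes "x<:om" shows "~Lim x"
 using om_cases[OF assms] sc no_cycle2 unfolding Lim_def by blast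

lemma omega_unique: "Lim w&(ALL x. x<:w-->~Lim x)<->w = om"
proof -
 have l: "Lim om" unfolding Lim_def using emp_om emp sc_om sc Ord_om by metis
 show ?thesis
 proof
  assume w: "Lim w&(ALL x. x<:w-->~Lim x)"
  then have "Ord w" by (simp add: Lim_def)
  then show "w = om" using Ord_linear[of w om] w l not_Lim_om Ord_om by blast
 qed (use l not_Lim_om in auto)
qed

subsection \<open>Transitive closure and recursion on membership\<close>

text \<open>\<open>f\<close> lists the iterated unions of \<open>x\<close> up to \<open>n\<close>.
  Transitive closures come before recursion on membership, which needs transitive sets as domains of
  its approximations; for them recursion on \<open>om\<close> is enough.\<close>

definition tcs :: "U => U => U => bool" where
 "tcs x n f<->app f emp = x&(ALL m. m<:n-->app f (sc m) = Uni (app f m))"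

lemma tcs_dfn [dfn]: "DfnT s==>DfnT t==>DfnT u==>Dfn (%e. tcs (s e) (t e) (u e))"
 by (rule Dfn3[of tcs], unfold tcs_def, intro dfn)

lemma tcs_unique: assumes "tcs x n f" "tcs x n g" "n<:om" "k<:sc n" shows "app f k = app g k"
proof -
 have d: "Dfn (%e. e 0<:sc n-->app f (e 0) = app g (e 0))" by (intro dfn)
 have on: "Ord n" using assms om_Ord_mem by blast
 have k: "k<:om" using om_trans[OF sc_om[OF assms(3)] assms(4)] .
 have "k<:sc n-->app f k = app g k"
 proof (rule om_induct[OF d k])
  fix m assume m: "m<:om" "m<:sc n-->app f m = app g m"
  have "m<:n" if "sc m<:sc n" using that on Ord_trans[of n m "sc m"] by auto
  then show "sc m<:sc n-->app f (sc m) = app g (sc m)" using m assms(1,2) by (auto simp: tcs_def)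
 qed (use assms in \<open>simp add: tcs_def\<close>)
 then show ?thesis using assms by blast
qed

lemma tcs_ex: assumes "n<:om" shows "EX f. tcs x n f"
proof -
 have d: "Dfn (%e. EX f. tcs x (e 0) f)" by (intro dfn)
 show ?thesis
 proof (rule om_induct[OF d assms])
  have "DfnT (%e. x)" by (intro dfn)
  then have "tcs x emp (lam (sc emp) (%_. x))" by (simp add: tcs_def lam_app[of "%_. x"])
  then show "EX f. tcs x emp f" by blast
 next
  fix n assume n: "n<:om" "EX f. tcs x n f"
  then obtain f where f: "tcs x n f" by blast
  let ?F = "%m. if m = sc n then Uni (app f n) else app f m"
  have d: "DfnT (%e. ?F (e 0))" by (intro dfn)
  have on: "Ord n" using n om_Ord_mem by blast
  have "emp<:sc (sc n)" using Ord_emp_mem[of "sc n"] on by simp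
  then have 1: "app (lam (sc (sc n)) ?F) emp = x" using f lam_app[OF d] by (simp add: tcs_def)
  have 2: "app (lam (sc (sc n)) ?F) (sc m) = Uni (app (lam (sc (sc n)) ?F) m)" if m: "m<:sc n" for m
  proof -
   have "m ~= sc n" using m not_self by metis
   moreover have "m<:sc (sc n)" using m by simp
   moreover have "sc m<:sc (sc n)" using m on Ord_sc_mem[of "sc n" m] by auto
   ultimately show ?thesis using f m by (auto simp: lam_app[OF d] tcs_def)
  qed
  then show "EX f. tcs x (sc n) f" using 1 by (auto simp: tcs_def)
 qed
qed

definition TCn :: "U => U => U" where "TCn x n = des (%y. EX f. tcs x n f&y = app f n)"

lemma TCn_dfn [dfn]: "DfnT s==>DfnT t==>DfnT (%e. TCn (s e) (t e))"
 by (rule DfnT2[of TCn], unfold TCn_def, intro dfn)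

lemma TCn_eq: assumes "tcs x n f" "n<:om" shows "TCn x n = app f n"
proof -
 have "n<:sc n" by simp
 then show ?thesis unfolding TCn_def by (intro des_eq) (use assms tcs_unique in blast)+
qed

lemma TCn_emp: "TCn x emp = x"
 using tcs_ex[of emp x] TCn_eq by (auto simp: tcs_def)

lemma TCn_sc: assumes "n<:om" shows "TCn x (sc n) = Uni (TCn x n)"
proof -
 obtain f where f: "tcs x (sc n) f" using tcs_ex assms sc_om by blast
 then have "tcs x n f" by (simp add: tcs_def)
 then show ?thesis using TCn_eq f assms sc_om by (auto simp: tcs_def)
qed

definition tc :: "U => U" where "tc x = Uni (img (TCn x) om)"

lemma tc: "z<:tc x<->(EX n. n<:om&z<:TCn x n)"
proof -
 have "DfnT (%e. TCn x (e 0))" by (intro dfn)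
 then show ?thesis by (auto simp: tc_def img)
qed

lemma tc_base: "z<:x==>z<:tc x"
 unfolding tc by (metis TCn_emp emp_om)

lemma tc_step: "y<:z==>z<:tc x==>y<:tc x"
 using TCn_sc sc_om unfolding tc by (metis Uni)

lemma eps_induct: assumes d: "Dfn (%e. P (e 0))" and s: "!!x. (!!y. y<:x==>P y)==>P x"
 shows "P x"
proof (rule ccontr)
 assume n: "~P x"
 have d': "Dfn (%e. ~P (e 0))" by (intro dfn d)
 have "x<:sep (ins x (tc x)) (%x. ~P x)" using n by (simp add: sep[OF d'])
 then obtain m where m: "m<:ins x (tc x)" "~P m" "!!z. z<:m==>z<:ins x (tc x)==>P z"
  using foundation sep[OF d'] by metis
 then have "P z" if "z<:m" for z using that tc_step tc_base by auto
 then show False using m(2) s by blast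
qed

text \<open>An attempt: a function obeying the recursion on a transitive set. Two attempts agree
  where both are defined, so \<open>Rec\<close> may take its value from any of them.\<close>

definition att :: "(U => U => U) => U => U => bool" where
 "att H d f<->trs d&(ALL x. x<:d-->app f x = H x (lam x (app f)))"

definition Rec :: "(U => U => U) => U => U" where
 "Rec H x = des (%y. EX d f. att H d f&x<:d&y = app f x)"

lemma DfnT_Rec [dfn]:
 assumes h0: "DfnT (%e. H (%i. e (Suc (Suc i))) (e 0) (e (Suc 0)))" and t: "DfnT t"
 shows "DfnT (%e. Rec (H e) (t e))"
proof -
 have h: "DfnT (%e. H (%i. e (k i)) (s e) (u e))" if "DfnT s" "DfnT u" for k s u
 proof (rule DfnT_app[of "%e x. H (%i. e (k i)) (s e) x"])
  show "DfnT (%e. H (%i. e (Suc (k i))) (s (%i. e (Suc i))) (e 0))"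
  proof (rule DfnT_app[of "%e x. H (%i. e (Suc (k i))) x (e 0)"])
   show "DfnT (%e. H (%i. e (Suc (Suc (k i)))) (e 0) (e (Suc 0)))"
    using DfnT_reidx[OF h0, of "case_nat 0 (case_nat (Suc 0) (%i. Suc (Suc (k i))))"] by simp
  qed (use that DfnT_shift in auto)
 qed (use that in auto)
 have a: "Dfn (%e. att (H (%i. e (Suc (Suc (Suc i))))) (e (Suc 0)) (e 0))"
  unfolding att_def by (intro dfn h)
 have "DfnT (%e. Rec (H (%i. e (Suc i))) (e 0))"
 proof -
  have "Dfn (%e. att (H (%i. e (Suc (Suc (Suc (Suc i)))))) (e (Suc 0)) (e 0))"
   using Dfn_reidx[OF a, of "case_nat 0 (case_nat (Suc 0) (%i. Suc (Suc (Suc i))))"] by simp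
  then show ?thesis unfolding Rec_def by (intro dfn)
 qed
 from DfnT_app[OF this t] show ?thesis .
qed

lemma Rec_eq: assumes h0: "DfnT (%e. H (e 0) (e (Suc 0)))" shows "Rec H x = H x (lam x (Rec H))"
proof -
 note h = DfnT2[OF h0]
 have agree: "app f x = app f' x" if "att H d f" "att H d' f'" "x<:d" "x<:d'" for x d f d' f'
 proof -
  have dd: "Dfn (%e. e 0<:d-->e 0<:d'-->app f (e 0) = app f' (e 0))" by (intro dfn)
  have "x<:d-->x<:d'-->app f x = app f' x"
  proof (rule eps_induct[OF dd], intro impI)
   fix x assume ih: "!!y. y<:x==>y<:d-->y<:d'-->app f y = app f' y" and x: "x<:d" "x<:d'"
   have "lam x (app f) = lam x (app f')" by (rule lam_cong) (use ih x that(1,2) trsD in \<open>auto simp: att_def\<close>)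
   then show "app f x = app f' x" using x that(1,2) by (simp add: att_def)
  qed
  then show ?thesis using that by blast
 qed
 have ra: "Rec H x = app f x" if "att H d f" "x<:d" for x d f
  unfolding Rec_def
 proof (rule des_eq)
  show "EX d' f'. att H d' f'&x<:d'&app f x = app f' x" using that by blast
  fix z assume "EX d f. att H d f&x<:d&z = app f x"
  then show "z = app f x" using agree that by blast
 qed
 have rq: "Rec H x = H x (lam x (Rec H))" if "att H d f" "x<:d" for x d f
 proof -
  have "lam x (app f) = lam x (Rec H)" by (rule lam_cong) (use that ra trsD in \<open>auto simp: att_def\<close>)
  then show ?thesis using that ra by (simp add: att_def)
 qed
 have da: "Dfn (%e. EX d f. att H d f&e 0<:d)" unfolding att_def by (intro dfn h)
 have "EX d f. att H d f&x<:d"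
 proof (rule eps_induct[OF da])
  fix x assume ih: "!!y. y<:x==>EX d f. att H d f&y<:d"
  let ?Q = "%z. z = x | (EX d f. att H d f&z<:d)"
  let ?F = "%z. H z (lam z (Rec H))"
  have dq: "Dfn (%e. ?Q (e 0))" unfolding att_def by (intro dfn h)
  have dF: "DfnT (%e. ?F (e 0))" by (intro dfn h)
  \<comment> \<open>The point \<open>x\<close> together with the part of its closure covered by
    attempts; this is transitive by the induction hypothesis.\<close>
  define d where "d = sep (ins x (tc x)) ?Q"
  have d: "z<:d<->z<:ins x (tc x)&?Q z" for z unfolding d_def by (rule sep[OF dq])
  have down: "y<:d&(EX d f. att H d f&y<:d)" if "z<:d" "y<:z" for y z
  proof -
   have "EX d f. att H d f&y<:d"
    using that ih unfolding d by (metis att_def trsD)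
   moreover have "y<:tc x" using that tc_base tc_step unfolding d by auto
   ultimately show ?thesis unfolding d by simp
  qed
  have "app (lam d ?F) z = H z (lam z (app (lam d ?F)))" if "z<:d" for z
  proof -
   have "lam z (Rec H) = lam z (app (lam d ?F))"
    by (rule lam_cong) (use down[OF that] rq lam_app[OF dF] in metis)
   then show ?thesis using lam_app[OF dF that] by simp
  qed
  moreover have "trs d" using down by (auto simp: trs_def sub_def)
  ultimately have "att H d (lam d ?F)" by (simp add: att_def)
  moreover have "x<:d" by (simp add: d)
  ultimately show "EX d f. att H d f&x<:d" by blast
 qed
 then show ?thesis using rq by blast
qed

subsection \<open>Rank and collection\<close>

definition rk :: "U => U" where "rk = Rec (%x f. Uni (img (%y. sc (app f y)) x))"
text \<open>On an ordinal this is the level of the cumulative hierarchy with that index.\<close>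

definition Wh :: "U => U" where "Wh = Rec (%x f. Uni (img (%y. pw (app f y)) x))"

lemma rk_dfn [dfn]: "DfnT s==>DfnT (%e. rk (s e))"
 unfolding rk_def by (rule DfnT1[of "Rec _"], intro dfn)
lemma Wh_dfn [dfn]: "DfnT s==>DfnT (%e. Wh (s e))"
 unfolding Wh_def by (rule DfnT1[of "Rec _"], intro dfn)

lemma rk: "z<:rk x<->(EX y. y<:x&z<:sc (rk y))"
proof -
 let ?H = "%x f. Uni (img (%y. sc (app f y)) x)"
 have h: "DfnT (%e. ?H (e 0) (e (Suc 0)))" by (intro dfn)
 have "DfnT (%e. rk (e 0))" by (intro dfn)
 then have l: "app (lam x rk) y = rk y" if "y<:x" for y using lam_app that by simp
 have "DfnT (%e. sc (app (lam x rk) (e 0)))" by (intro dfn)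
 then have "z<:?H x (lam x rk)<->(EX y. y<:x&z<:sc (rk y))"
  using l by (auto simp: img)
 then show ?thesis using Rec_eq[OF h, of x] by (simp add: rk_def)
qed

lemma Wh: "z<:Wh x<->(EX y. y<:x&z<<=Wh y)"
proof -
 let ?H = "%x f. Uni (img (%y. pw (app f y)) x)"
 have h: "DfnT (%e. ?H (e 0) (e (Suc 0)))" by (intro dfn)
 have "DfnT (%e. Wh (e 0))" by (intro dfn)
 then have l: "app (lam x Wh) y = Wh y" if "y<:x" for y using lam_app that by simp
 have "DfnT (%e. pw (app (lam x Wh) (e 0)))" by (intro dfn)
 then have "z<:?H x (lam x Wh)<->(EX y. y<:x&z<<=Wh y)"
  using l by (auto simp: img)
 then show ?thesis using Rec_eq[OF h, of x] by (simp add: Wh_def)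
qed

lemma Ord_rk: "Ord (rk x)"
proof -
 have d: "Dfn (%e. Ord (rk (e 0)))" by (intro dfn)
 show ?thesis
 proof (rule eps_induct[OF d])
  fix x assume ih: "!!y. y<:x==>Ord (rk y)"
  have di: "DfnT (%e. sc (rk (e 0)))" by (intro dfn)
  have "rk x = Uni (img (%y. sc (rk y)) x)" by (rule seteq) (auto simp: rk[of _ x] img[OF di] simp del: sc)
  then show "Ord (rk x)" using ih by (auto intro!: Ord_Uni simp: img[OF di])
 qed
qed

lemma rk_mem: "y<:x==>rk y<:rk x"
 using rk[of "rk y" x] by auto

lemma sub_Wh: "x<<=Wh (rk x)"
proof -
 have d: "Dfn (%e. e 0<<=Wh (rk (e 0)))" by (intro dfn)
 show ?thesis
 proof (rule eps_induct[OF d], rule subI)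
  fix x z assume "!!y. y<:x==>y<<=Wh (rk y)" "z<:x"
  then show "z<:Wh (rk x)" using rk_mem unfolding Wh[of z] by blast
 qed
qed

text \<open>Scott's trick: replacement is applied to the least rank of a witness, and the levels of
  the hierarchy at these ranks catch witnesses themselves.\<close>

lemma collection:
 assumes d: "Dfn (%e. P (e 0) (e (Suc 0)))"
 shows "EX B. ALL x. x<:a-->(EX y. P x y)-->(EX y. y<:B&P x y)"
proof -
 let ?R = "%x b. Ord b&(EX y. P x y&rk y = b)&(ALL c. c<:b-->~(EX y. P x y&rk y = c))"
 note D = Dfn2[OF d]
 have "Dfn (%e. ?R (e 0) (e (Suc 0)))" by (intro dfn D)
 then have "EX b. ALL y. y<:b<->(EX x. x<:a&?R x y)"
  by (rule ax_replacement) (use Ord_linear in blast)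
 then obtain B where B: "!!y. y<:B<->(EX x. x<:a&?R x y)" by blast
 have di: "DfnT (%e. pw (Wh (e 0)))" by (intro dfn)
 have "EX y. y<:Uni (img (%b. pw (Wh b)) B)&P x y" if "x<:a" "P x y" for x y
 proof -
  have "Dfn (%e. EX y. P x y&rk y = e 0)" by (intro dfn D)
  then have "EX b. ?R x b" using Ord_least[of "%b. EX y. P x y&rk y = b" "rk y"] that Ord_rk by blast
  then obtain b where b: "?R x b" by blast
  then obtain y where y: "P x y" "rk y = b" by blast
  have "b<:B" using B b that by blast
  then have "pw (Wh b)<:img (%b. pw (Wh b)) B" unfolding img[OF di] by blast
  moreover have "y<:pw (Wh b)" using y sub_Wh[of y] by simp
  ultimately show ?thesis using y unfolding Uni by blast
 qed
 then show ?thesis by blast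
qed

subsection \<open>Choice and well-orderings\<close>

lemma sat_is_pair [simp]: assumes "p < d" "x < d" "y < d"
 shows "sat E e (is_pair p x y d)<->lv e d p = pair (lv e d x) (lv e d y)"
proof -
 have u: "(ALL z. z<:s<->z = a | z = b)<->s = upair a b" for s a b using upair seteq by metis
 have u': "(ALL z. z<:s<->z = a)<->s = upair a a" for s a using u[of s a a] by simp
 show ?thesis using assms by (simp add: is_pair_def u u' pair_def less_SucI)
qed

lemma sat_rel [simp]: "r < d==>x < d==>y < d==>sat E e (rel r x y d)<->pair (lv e d x) (lv e d y)<:lv e d r"
 by (simp add: rel_def less_SucI)

lemma sat_is_fun [simp]: "f < d==>x < d==>y < d==>sat E e (is_fun f x y d)<->fn (lv e d f) (lv e d x) (lv e d y)"
 by (simp add: is_fun_def fn_def less_SucI)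

end

locale zfc = zf +
 assumes choice: "sat E e (Choice 0)"
begin

lemma ax_choice: assumes "!!x. x<:F==>x ~= emp" shows "EX f. ALL x. x<:F-->app f x<:x"
proof -
 have "ALL F. (ALL x. x<:F-->(EX y. y<:x))-->(EX u f. fn f F u&(ALL x. x<:F-->(ALL y. pair x y<:f-->y<:x)))"
  using choice by (simp add: Choice_def)
 then obtain u f where "fn f F u" "!!x y. x<:F==>pair x y<:f==>y<:x" using assms ex_mem by metis
 then show ?thesis using fn_app by metis
qed

definition inj :: "U => U => bool" where
 "inj f a<->(ALL x y. x<:a-->y<:a-->app f x = app f y-->x = y)"
definition bij :: "U => U => U => bool" where
 "bij f a b<->fn f a b&inj f a&(ALL y. y<:b-->(EX x. x<:a&app f x = y))"

lemma inj_dfn [dfn]: "DfnT s==>DfnT t==>Dfn (%e. inj (s e) (t e))"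
 by (rule Dfn2[of inj], unfold inj_def, intro dfn)
lemma bij_dfn [dfn]: "DfnT s==>DfnT t==>DfnT u==>Dfn (%e. bij (s e) (t e) (u e))"
 by (rule Dfn3[of bij], unfold bij_def, intro dfn)

lemma bij_inverse: assumes "bij f a b" shows "EX g. bij g b a&(ALL x. x<:a-->app g (app f x) = x)&(ALL y. y<:b-->app f (app g y) = y)"
proof -
 let ?G = "%y. des (%x. x<:a&app f x = y)"
 have d: "DfnT (%e. ?G (e 0))" by (intro dfn)
 have 1: "?G (app f x) = x" if "x<:a" for x
  by (rule des_eq) (use that assms in \<open>auto simp: bij_def inj_def\<close>)
 have 2: "?G y<:a&app f (?G y) = y" if "y<:b" for y
 proof -
  obtain x where "x<:a" "app f x = y" using assms \<open>y<:b\<close> unfolding bij_def by blast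
  then show ?thesis using 1[of x] by simp
 qed
 have "fn (lam b ?G) b a" by (rule lam_fn[OF d]) (use 2 in blast)
 moreover have a: "app (lam b ?G) y = ?G y" if "y<:b" for y using lam_app[OF d that] .
 moreover have fb: "app f x<:b" if "x<:a" for x using assms that fn_app unfolding bij_def by blast
 moreover have "inj (lam b ?G) b" unfolding inj_def using a 2 by (metis (no_types, lifting))
 ultimately have "bij (lam b ?G) b a" unfolding bij_def using 1 by force
 moreover have "app (lam b ?G) (app f x) = x" if "x<:a" for x using a[OF fb[OF that]] 1[OF that] by simp
 moreover have "app f (app (lam b ?G) y) = y" if "y<:b" for y using a[OF that] 2[OF that] by simp
 ultimately show ?thesis by blast
qed

lemma no_Ord_set: "~(ALL a. Ord a-->a<:B)"
proof
 assume B: "ALL a. Ord a-->a<:B"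
 have d: "Dfn (%e. Ord (e 0))" by (intro dfn)
 have s: "x<:sep B Ord<->Ord x" for x using B sep[OF d] by blast
 then have "Ord (sep B Ord)" using Ord_linear Ord_mem unfolding Ord_def[of "sep B Ord"] trs_def sub_def by blast
 then show False using s not_self by blast
qed

text \<open>Transfinite recursion picks \<open>c\<close> of what is left over; if it never ended,
  all ordinals would form a set by replacement. With a choice function for \<open>c\<close> this
  well-orders \<open>a\<close>, with minima it computes order types.\<close>

lemma enumeration:
 assumes d: "DfnT (%e. c (e 0))" and c: "!!X. X<<=a==>X ~= emp==>c X<:X"
 shows "EX \<theta> g. Ord \<theta> & bij g \<theta> a&(ALL \<alpha>. \<alpha><:\<theta> --> app g \<alpha> = c (df a (img (app g) \<alpha>)))"
proof -
 note c_dfn = DfnT1[OF d]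
 \<comment> \<open>Once \<open>a\<close> is exhausted the value is \<open>a\<close>, which is no
   element of \<open>a\<close>.\<close>
 let ?H = "%x f. if df a (img (app f) x) = emp then a else c (df a (img (app f) x))"
 have h: "DfnT (%e. ?H (e 0) (e (Suc 0)))" by (intro dfn c_dfn)
 define G where "G = Rec ?H"
 have dG: "DfnT (%e. G (e 0))" unfolding G_def by (intro dfn c_dfn)
 have im: "img (app (lam x F)) x = img F x" if "DfnT (%e. F (e 0))" for x F
 proof (rule seteq)
  have "DfnT (%e. app (lam x F) (e 0))" by (intro dfn DfnT1[OF that])
  then show "z<:img (app (lam x F)) x<->z<:img F x" for z
   unfolding img[OF that] img[OF \<open>DfnT (%e. app (lam x F) (e 0))\<close>] using lam_app[OF that] by metis
 qed
 have G: "G x = (if df a (img G x) = emp then a else c (df a (img G x)))" for x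
  using Rec_eq[OF h, of x] im[OF dG, of x] unfolding G_def by simp
 have sub: "df a X<<=a" for X by (simp add: sub_def)
 have Gin: "G x<:df a (img G x)" if "df a (img G x) ~= emp" for x
  using that c[OF sub] G[of x] by simp
 have ne: "G x ~= G y" if "y<:x" "df a (img G x) ~= emp" for x y
  using Gin[OF that(2)] that(1) by (auto simp: img[OF dG])
 have "EX x. Ord x&df a (img G x) = emp"
 proof (rule ccontr)
  assume n: "~?thesis"
  have "Dfn (%e. Ord (e (Suc 0))&G (e (Suc 0)) = e 0)" by (intro dfn DfnT1[OF dG])
  then have "EX b. ALL y. y<:b<->(EX x. x<:a&Ord y&G y = x)"
   by (rule ax_replacement[of "%x y. Ord y&G y = x"]) (use ne n Ord_linear in metis)
  then obtain B where B: "!!y. y<:B<->(EX x. x<:a&Ord y&G y = x)" by blast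
  have "y<:B" if "Ord y" for y using B n Gin that df by metis
  then show False using no_Ord_set by blast
 qed
 moreover have "Dfn (%e. df a (img G (e 0)) = emp)" by (intro dfn DfnT1[OF dG])
 ultimately obtain \<theta> where t: "Ord \<theta>" "df a (img G \<theta>) = emp" "!!x. x<:\<theta> ==> df a (img G x) ~= emp"
  using Ord_least[of "%x. df a (img G x) = emp"] by blast
 have Ga: "G x<:a" if "x<:\<theta>" for x using Gin[OF t(3)[OF that]] by simp
 have g: "app (lam \<theta> G) x = G x" if "x<:\<theta>" for x using lam_app[OF dG that] .
 have "fn (lam \<theta> G) \<theta> a" by (rule lam_fn[OF dG Ga])
 moreover have "inj (lam \<theta> G) \<theta>"
  unfolding inj_def using g ne t(1,3) Ord_mem Ord_linear by metis
 moreover have "EX x. x<:\<theta> & app (lam \<theta> G) x = y" if "y<:a" for y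
  using t(2) that g img[OF dG] by (metis df emp)
 ultimately have b: "bij (lam \<theta> G) \<theta> a" by (simp add: bij_def)
 have "app (lam \<theta> G) x = c (df a (img (app (lam \<theta> G)) x))" if "x<:\<theta>" for x
 proof -
  have dl: "DfnT (%e. app (lam \<theta> G) (e 0))" by (intro dfn DfnT1[OF dG])
  have "img (app (lam \<theta> G)) x = img G x"
   by (rule seteq) (use g that t(1) Ord_trans in \<open>auto simp: img[OF dl] img[OF dG]\<close>)
  then show ?thesis using g[OF that] G[of x] t(3)[OF that] by simp
 qed
 then show ?thesis using t(1) b by blast
qed

lemma wellordering: "EX \<theta> g. Ord \<theta> & bij g \<theta> a"
proof -
 have "EX f. ALL x. x<:df (pw a) (upair emp emp)-->app f x<:x"
  by (rule ax_choice) auto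
 then obtain f where f: "!!x. x<<=a==>x ~= emp==>app f x<:x" by auto
 have "DfnT (%e. app f (e 0))" by (intro dfn)
 from enumeration[OF this f] show ?thesis by blast
qed

lemma order_type:
 assumes d: "Dfn (%e. L (e 0) (e (Suc 0)))"
  and lin: "!!x y. x<:a==>y<:a==>L x y | x = y | L y x"
  and irr: "!!x. x<:a==>~L x x"
  and tr: "!!x y z. x<:a==>y<:a==>z<:a==>L x y==>L y z==>L x z"
  and wf: "!!X. X<<=a==>X ~= emp==>EX m. m<:X&(ALL y. y<:X-->~L y m)"
 shows "EX \<theta> f. Ord \<theta> & bij f a \<theta> & (ALL x y. x<:a-->y<:a-->(L x y<->app f x<:app f y))"
proof -
 let ?c = "%X. des (%m. m<:X&(ALL y. y<:X-->~L y m))"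
 have cd: "DfnT (%e. ?c (e 0))" by (intro dfn Dfn2[OF d])
 have c: "?c X<:X&(ALL y. y<:X-->~L y (?c X))" if X: "X<<=a" "X ~= emp" for X
 proof -
  obtain m where m: "m<:X" "ALL y. y<:X-->~L y m" using wf[OF X] by blast
  have "?c X = m"
  proof (rule des_eq)
   fix z assume "z<:X&(ALL y. y<:X-->~L y z)"
   then show "z = m" using m lin[of z m] subD[OF X(1)] by blast
  qed (use m in blast)
  then show ?thesis using m by simp
 qed
 obtain \<theta> g where g: "Ord \<theta>" "bij g \<theta> a" "!!\<alpha>. \<alpha><:\<theta> ==> app g \<alpha> = ?c (df a (img (app g) \<alpha>))"
  using enumeration[OF cd] c by blast
 have ga: "app g x<:a" if "x<:\<theta>" for x using g(2) that fn_app unfolding bij_def by blast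
 have dg: "DfnT (%e. app g (e 0))" by (intro dfn)
 have lt: "L (app g x) (app g y)" if "x<:y" "y<:\<theta>" for x y
 proof -
  have x: "x<:\<theta>" using that g(1) Ord_trans by blast
  have nm: "app g z<:df a (img (app g) x)" if "z<:\<theta>" "~z<:x" for z
   using ga[OF that(1)] that g(1,2) x Ord_trans unfolding df img[OF dg] bij_def inj_def by metis
  have "~L (app g y) (app g x)"
   using c[of "df a (img (app g) x)"] nm[OF that(2)] no_cycle2[OF that(1)] g(3)[OF x] by (metis df emp sub_def)
  moreover have "app g x ~= app g y" using x that g(2) unfolding bij_def inj_def by (metis not_self)
  ultimately show ?thesis using lin ga x that by blast
 qed
 have le: "L (app g x) (app g y)<->x<:y" if "x<:\<theta>" "y<:\<theta>" for x y
  using lt that g(1) Ord_linear[of x y] Ord_mem irr tr ga by metis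
 obtain f where f: "bij f a \<theta>" "!!y. y<:a==>app g (app f y) = y" using bij_inverse[OF g(2)] by blast
 have "L x y<->app f x<:app f y" if "x<:a" "y<:a" for x y
  using le[of "app f x" "app f y"] f that fn_app unfolding bij_def by metis
 then show ?thesis using g(1) f(1) by blast
qed

text \<open>Choice for a class relation: collection first confines the witnesses to a set.\<close>

lemma choice_fun:
 assumes d: "Dfn (%e. P (e 0) (e (Suc 0)))" and ex: "!!x. x<:a==>EX y. P x y"
 shows "EX f b. fn f a b&(ALL x. x<:a-->P x (app f x))"
proof -
 obtain B where B: "!!x. x<:a==>EX y. y<:B&P x y" using collection[OF d, of a] ex by blast
 obtain c where c: "!!x. x<:df (pw B) (upair emp emp)==>app c x<:x" using ax_choice[of "df (pw B) (upair emp emp)"] by auto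
 let ?F = "%x. app c (sep B (P x))"
 have dF: "DfnT (%e. ?F (e 0))" by (intro dfn Dfn2[OF d])
 have F: "?F x<:B&P x (?F x)" if "x<:a" for x
 proof -
  have ds: "Dfn (%e. P x (e 0))" by (intro Dfn2[OF d] dfn)
  have "sep B (P x)<:df (pw B) (upair emp emp)" using B[OF that] by (metis df emp pw sep[OF ds] sub_def upair)
  from c[OF this] show ?thesis by (simp add: sep[OF ds])
 qed
 have "fn (lam a ?F) a B" by (rule lam_fn[OF dF]) (use F in blast)
 moreover have "P x (app (lam a ?F) x)" if "x<:a" for x using lam_app[OF dF that] F[OF that] by simp
 ultimately show ?thesis by blast
qed

end

context zfc begin

subsection \<open>Comparing sizes\<close>

definition lep :: "U => U => bool" where "lep a b<->(EX f. fn f a b&inj f a)"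
definition ctbl :: "U => bool" where "ctbl a<->lep a om"
definition fin :: "U => bool" where "fin a<->(EX n. n<:om&lep a n)"

lemma lep_dfn [dfn]: "DfnT s==>DfnT t==>Dfn (%e. lep (s e) (t e))"
 by (rule Dfn2[of lep], unfold lep_def, intro dfn)
lemma ctbl_dfn [dfn]: "DfnT s==>Dfn (%e. ctbl (s e))"
 by (rule Dfn1[of ctbl], unfold ctbl_def, intro dfn)
lemma fin_dfn [dfn]: "DfnT s==>Dfn (%e. fin (s e))"
 by (rule Dfn1[of fin], unfold fin_def, intro dfn)

lemma lepI: assumes "DfnT (%e. F (e 0))" "!!x. x<:a==>F x<:b" "!!x y. x<:a==>y<:a==>F x = F y==>x = y"
 shows "lep a b"
proof -
 have "fn (lam a F) a b" using assms(1,2) by (rule lam_fn)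
 moreover have "inj (lam a F) a" using assms(3) lam_app[OF assms(1)] by (simp add: inj_def)
 ultimately show ?thesis unfolding lep_def by blast
qed

lemma lep_sub: "a<<=b==>lep a b"
 by (rule lepI[of "%x. x"]) (auto simp: sub_def intro: dfn)

lemma lep_refl [simp]: "lep a a"
 by (rule lep_sub) simp

lemma lep_trans: assumes "lep a b" "lep b c" shows "lep a c"
proof -
 obtain f g where f: "fn f a b" "inj f a" and g: "fn g b c" "inj g b" using assms unfolding lep_def by blast
 have d: "DfnT (%e. app g (app f (e 0)))" by (intro dfn)
 show ?thesis
  by (rule lepI[OF d]) (use f g fn_app(2) in \<open>auto simp: inj_def\<close>)
qed

lemma bij_lep: assumes "bij f a b" shows "lep a b" "lep b a"
 using assms bij_inverse[OF assms] unfolding bij_def lep_def by blast+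

lemma lep_surj: assumes "DfnT (%e. F (e 0))" "!!y. y<:b==>EX x. x<:a&y = F x" shows "lep b a"
proof -
 have "Dfn (%e. e (Suc 0)<:a&e 0 = F (e (Suc 0)))" by (intro dfn DfnT1[OF assms(1)])
 then have "EX f c. fn f b c&(ALL x. x<:b-->app f x<:a&x = F (app f x))"
  by (rule choice_fun[of "%y x. x<:a&y = F x"]) (use assms(2) in blast)
 then obtain f where f: "!!x. x<:b==>app f x<:a&x = F (app f x)" by blast
 have d: "DfnT (%e. app f (e 0))" by (intro dfn)
 show ?thesis by (rule lepI[OF d]) (use f in metis)+
qed

lemma lep_img: "DfnT (%e. F (e 0))==>lep (img F a) a"
 by (rule lep_surj) (auto simp: img)

definition p1 :: "U => U" where "p1 z = des (%x. EX y. z = pair x y)"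
definition p2 :: "U => U" where "p2 z = des (%y. EX x. z = pair x y)"

lemma p1_dfn [dfn]: "DfnT s==>DfnT (%e. p1 (s e))"
 by (rule DfnT1[of p1], unfold p1_def, intro dfn)
lemma p2_dfn [dfn]: "DfnT s==>DfnT (%e. p2 (s e))"
 by (rule DfnT1[of p2], unfold p2_def, intro dfn)

lemma p1 [simp]: "p1 (pair x y) = x" unfolding p1_def by (rule des_eq) auto
lemma p2 [simp]: "p2 (pair x y) = y" unfolding p2_def by (rule des_eq) auto

lemma lep_cart: assumes "lep a c" "lep b d" shows "lep (cart a b) (cart c d)"
proof -
 obtain f g where f: "fn f a c" "inj f a" and g: "fn g b d" "inj g b" using assms unfolding lep_def by blast
 have d: "DfnT (%e. pair (app f (p1 (e 0))) (app g (p2 (e 0))))" by (intro dfn)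
 show ?thesis
  by (rule lepI[OF d]) (use f g fn_app(2) in \<open>auto simp: cart inj_def\<close>)
qed

lemma ctbl_sub: "ctbl b==>a<<=b==>ctbl a"
 unfolding ctbl_def using lep_sub lep_trans by blast

lemma ctbl_lep: "ctbl b==>lep a b==>ctbl a"
 unfolding ctbl_def using lep_trans by blast

lemma cantor: "~lep (pw a) a"
proof
 assume "lep (pw a) a"
 then obtain f where f: "fn f (pw a) a" "inj f (pw a)" unfolding lep_def by blast
 let ?P = "%x. EX X. X<<=a&app f X = x&~x<:X"
 have d: "Dfn (%e. ?P (e 0))" by (intro dfn)
 define D where "D = sep a ?P"
 have D: "x<:D<->x<:a&?P x" for x unfolding D_def by (rule sep[OF d])
 have s: "D<<=a" using D by (simp add: sub_def)
 then have "app f D<:a" using f fn_app(2) by simp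
 then show False using s D[of "app f D"] f(2) unfolding inj_def pw by blast
qed

subsection \<open>Finite sets\<close>

text \<open>If the value \<open>n\<close> is taken elsewhere, the point having it receives the value
  of the removed point instead.\<close>

lemma lep_remove: assumes "lep b (sc n)" "a<:b" shows "lep (df b (upair a a)) n"
proof -
 obtain f where f: "fn f b (sc n)" "inj f b" using assms unfolding lep_def by blast
 let ?F = "%x. if app f x = n then app f a else app f x"
 have d: "DfnT (%e. ?F (e 0))" by (intro dfn)
 have m: "app f x<:n | app f x = n" if "x<:b" for x using fn_app(2)[OF f(1) that] by simp
 have i: "x = y" if "x<:b" "y<:b" "app f x = app f y" for x y using that f(2) by (simp add: inj_def)
 show ?thesis
 proof (rule lepI[OF d])
  fix x assume "x<:df b (upair a a)"
  then show "?F x<:n" using m[of x] m[of a] i[of x a] assms(2) by auto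
 next
  fix x y assume "x<:df b (upair a a)" "y<:df b (upair a a)" "?F x = ?F y"
  then show "x = y" using i[of x y] i[of x a] i[of y a] assms(2) by (auto split: if_splits)
 qed
qed

lemma not_lep_sc: assumes "n<:om" shows "~lep (sc n) n"
proof (rule om_induct[OF _ assms])
 show "Dfn (%e. ~lep (sc (e 0)) (e 0))" by (intro dfn)
 show "~lep (sc emp) emp" unfolding lep_def using fn_app(2)[of _ "sc emp" emp emp] by auto
 fix n assume n: "n<:om" "~lep (sc n) n"
 have "df (sc (sc n)) (upair (sc n) (sc n)) = sc n"
  by (rule seteq) (use not_self[of "sc n"] sc in \<open>auto simp del: not_self\<close>)
 then show "~lep (sc (sc n)) (sc n)" using lep_remove[of "sc (sc n)" n "sc n"] n by auto
qed

lemma not_fin_om: "~fin om"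
proof
 assume "fin om"
 then obtain n where n: "n<:om" "lep om n" by (auto simp: fin_def)
 have "sc n<<=om" using n om_trans[OF sc_om[OF n(1)]] by (auto simp: sub_def)
 then show False using not_lep_sc[OF n(1)] n lep_sub lep_trans by blast
qed

lemma fin_lep: "lep a b==>fin b==>fin a"
 unfolding fin_def using lep_trans by blast

lemma fin_sub: "fin b==>a<<=b==>fin a"
 using fin_lep lep_sub by blast

lemma fin_om: "n<:om==>fin n"
 unfolding fin_def using lep_refl by blast

lemma fin_emp [simp]: "fin emp" by (rule fin_om) simp

lemma fin_ins [simp]: assumes "fin a" shows "fin (ins x a)"
proof -
 obtain n where n: "n<:om" "lep a n" using assms by (auto simp: fin_def)
 then obtain f where f: "fn f a n" "inj f a" unfolding lep_def by blast
 let ?F = "%y. if y<:a then app f y else n"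
 have d: "DfnT (%e. ?F (e 0))" by (intro dfn)
 have m: "app f y<:n" if "y<:a" for y using f that fn_app(2) by blast
 have "lep (ins x a) (sc n)"
 proof (rule lepI[OF d])
  fix y z assume "y<:ins x a" "z<:ins x a" "?F y = ?F z"
  then show "y = z" using m[of y] m[of z] f(2) not_self unfolding inj_def ins by metis
 qed (use m in auto)
 then show ?thesis using n(1) sc_om unfolding fin_def by blast
qed

lemma fin_induct: assumes d: "Dfn (%e. P (e 0))" and a: "fin a" and z: "P emp"
  and s: "!!x a. fin a==>~x<:a==>P a==>P (ins x a)"
 shows "P a"
proof -
 obtain n where n: "n<:om" "lep a n" using a by (auto simp: fin_def)
 have d': "Dfn (%e. ALL a. lep a (e 0)-->P a)" by (intro dfn Dfn1[OF d])
 have "ALL a. lep a n-->P a"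
 proof (rule om_induct[OF d' n(1)])
  show "ALL a. lep a emp-->P a"
  proof (intro allI impI)
   fix a assume "lep a emp"
   then have "a = emp" unfolding lep_def using fn_app(2) emp emp_eq by metis
   then show "P a" using z by simp
  qed
  fix n assume n: "n<:om" and ih: "ALL a. lep a n-->P a"
  show "ALL a. lep a (sc n)-->P a"
  proof (intro allI impI)
   fix a assume a: "lep a (sc n)"
   show "P a"
   proof (cases "a = emp")
    case False
    then obtain x where x: "x<:a" using ex_mem by blast
    have l: "lep (df a (upair x x)) n" using lep_remove[OF a x] .
    have "ins x (df a (upair x x)) = a" by (rule seteq) (use x in auto)
    moreover have "fin (df a (upair x x))" using l n by (auto simp: fin_def)
    ultimately show ?thesis using s[of "df a (upair x x)" x] ih l by simp
   qed (simp add: z)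
  qed
 qed
 then show ?thesis using n by blast
qed

lemma fin_un: assumes "fin a" "fin b" shows "fin (un a b)"
proof (rule fin_induct[OF _ assms(1)])
 show "Dfn (%e. fin (un (e 0) b))" by (intro dfn)
 have "un emp b = b" by (rule seteq) simp
 then show "fin (un emp b)" using assms by simp
 fix x a assume "fin (un a b)"
 moreover have "un (ins x a) b = ins x (un a b)" by (rule seteq) auto
 ultimately show "fin (un (ins x a) b)" by simp
qed

lemma fin_img: "DfnT (%e. F (e 0))==>fin a==>fin (img F a)"
 using lep_img fin_lep by blast

lemma fin_Uni: assumes "fin F" "!!x. x<:F==>fin x" shows "fin (Uni F)"
proof -
 have "(ALL x. x<:F-->fin x)-->fin (Uni F)"
 proof (rule fin_induct[OF _ assms(1)])
  show "Dfn (%e. (ALL x. x<:e 0-->fin x)-->fin (Uni (e 0)))" by (intro dfn)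
  have "Uni emp = emp" by (rule seteq) simp
  then show "(ALL x. x<:emp-->fin x)-->fin (Uni emp)" by simp
  fix x a assume "(ALL x. x<:a-->fin x)-->fin (Uni a)"
  moreover have "Uni (ins x a) = un x (Uni a)" by (rule seteq) auto
  ultimately show "(ALL y. y<:ins x a-->fin y)-->fin (Uni (ins x a))" using fin_un by auto
 qed
 then show ?thesis using assms by blast
qed

lemma fin_cart: assumes "fin a" "fin b" shows "fin (cart a b)"
proof -
 have d: "DfnT (%e. img (pair (e 0)) b)" "!!x. DfnT (%e. pair x (e 0))" by (intro dfn)+
 have "cart a b = Uni (img (%x. img (pair x) b) a)"
  by (rule seteq) (auto simp: cart img[OF d(1)] img[OF d(2)])
 moreover have "fin (Uni (img (%x. img (pair x) b) a))"
  by (rule fin_Uni, rule fin_img[OF d(1) assms(1)]) (use fin_img[OF d(2) assms(2)] in \<open>auto simp: img[OF d(1)]\<close>)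
 ultimately show ?thesis by simp
qed

lemma fin_ctbl: "fin a==>ctbl a"
 unfolding fin_def ctbl_def using lep_sub lep_trans om_trans unfolding sub_def by blast

lemma fin_Ord_max: assumes "fin a" "a ~= emp" "!!x. x<:a==>Ord x"
 shows "EX m. m<:a&(ALL x. x<:a-->x<<=m)"
proof -
 have "a ~= emp-->(ALL x. x<:a-->Ord x)-->(EX m. m<:a&(ALL x. x<:a-->x<<=m))"
 proof (rule fin_induct[OF _ assms(1)])
  show "Dfn (%e. e 0 ~= emp-->(ALL x. x<:e 0-->Ord x)-->(EX m. m<:e 0&(ALL x. x<:e 0-->x<<=m)))"
   by (intro dfn)
  fix x a assume ih: "a ~= emp-->(ALL x. x<:a-->Ord x)-->(EX m. m<:a&(ALL x. x<:a-->x<<=m))"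
  show "ins x a ~= emp-->(ALL y. y<:ins x a-->Ord y)-->(EX m. m<:ins x a&(ALL y. y<:ins x a-->y<<=m))"
  proof (intro impI)
   assume o: "ALL y. y<:ins x a-->Ord y"
   show "EX m. m<:ins x a&(ALL y. y<:ins x a-->y<<=m)"
   proof (cases "a = emp")
    case True
    then show ?thesis by auto
   next
    case False
    then obtain m where m: "m<:a" "!!y. y<:a==>y<<=m" using ih o by auto
    have "x<<=m | m<<=x" using o m(1) Ord_linear[of x m] Ord_sub by auto
    then show ?thesis using m sub_trans by (metis ins sub_refl)
   qed
  qed
 qed simp
 then show ?thesis using assms by blast
qed

subsection \<open>Products and unions\<close>

lemma least_by: assumes "DfnT (%e. F (e 0))" "x<:X" shows "EX m. m<:X&(ALL y. y<:X-->~F y<:F m)"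
proof -
 have "F x<:img F X" using assms by (auto simp: img)
 from foundation[OF this] show ?thesis unfolding img[OF assms(1)] by blast
qed

text \<open>If the order type exceeded \<open>k\<close>, the point at position \<open>k\<close>
  would have a copy of \<open>k\<close> among its predecessors.\<close>

lemma lep_segments:
 assumes d: "Dfn (%e. L (e 0) (e (Suc 0)))"
  and lin: "!!x y. x<:a==>y<:a==>L x y | x = y | L y x"
  and irr: "!!x. x<:a==>~L x x"
  and tr: "!!x y z. x<:a==>y<:a==>z<:a==>L x y==>L y z==>L x z"
  and wf: "!!X. X<<=a==>X ~= emp==>EX m. m<:X&(ALL y. y<:X-->~L y m)"
  and k: "Ord k" and seg: "!!x. x<:a==>~lep k (sep a (%y. L y x))"
 shows "lep a k"
proof -
 have "EX \<theta> f. Ord \<theta> & bij f a \<theta> & (ALL x y. x<:a-->y<:a-->(L x y<->app f x<:app f y))"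
  by (rule order_type[OF d]) (fact lin irr tr wf)+
 then obtain \<theta> f where t: "Ord \<theta>" "bij f a \<theta>" "!!x y. x<:a==>y<:a==>L x y<->app f x<:app f y"
  by blast
 show ?thesis
 proof (cases "k<:\<theta>")
  case False
  then have "\<theta><<=k" using Ord_not_mem[OF k t(1)] by simp
  then show ?thesis using bij_lep(1)[OF t(2)] lep_sub lep_trans by blast
 next
  case True
  obtain x where x: "x<:a" "app f x = k" using t(2) True unfolding bij_def by blast
  obtain g where g: "bij g \<theta> a" "!!y. y<:\<theta> ==> app f (app g y) = y" using bij_inverse[OF t(2)] by blast
  have dL: "Dfn (%e. L (e 0) x)" by (intro Dfn2[OF d] dfn)
  have dg: "DfnT (%e. app g (e 0))" by (intro dfn)
  have kt: "y<:\<theta>" if "y<:k" for y using that True t(1) Ord_trans by blast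
  have ga: "app g y<:a" if "y<:\<theta>" for y using g(1) fn_app(2) that unfolding bij_def by blast
  have "lep k (sep a (%y. L y x))"
  proof (rule lepI[OF dg])
   fix y assume "y<:k"
   then show "app g y<:sep a (%y. L y x)"
    using kt ga g(2) t(3) x by (simp add: sep[OF dL])
  next
   fix y z assume "y<:k" "z<:k" "app g y = app g z"
   then show "y = z" using kt g(2) by metis
  qed
  then show ?thesis using seg x by blast
 qed
qed

text \<open>Goedel's ordering of pairs, by maximum and then lexicographically: the predecessors of a
  pair lie in the square of the successor of its maximum.\<close>

lemma lep_square: assumes k: "Ord k" and m: "!!m. m<:k==>~lep k (cart (sc m) (sc m))"
 shows "lep (cart k k) k"
proof -
 \<comment> \<open>The union of two ordinals is their maximum.\<close>
 let ?M = "%p. un (p1 p) (p2 p)"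
 let ?L = "%p q. ?M p<:?M q | ?M p = ?M q&(p1 p<:p1 q | p1 p = p1 q&p2 p<:p2 q)"
 have d: "Dfn (%e. ?L (e 0) (e (Suc 0)))" by (intro dfn)
 have o: "Ord x" if "x<:k" for x using that k Ord_mem by blast
 have pk: "p1 p<:k&p2 p<:k" if "p<:cart k k" for p using that by (auto simp: cart)
 have peq: "p = q" if "p<:cart k k" "q<:cart k k" "p1 p = p1 q" "p2 p = p2 q" for p q using that by (auto simp: cart)
 have un2: "un x y = x | un x y = y" if "Ord x" "Ord y" for x y
 proof -
  have "un x y = y" if "x<<=y" by (rule seteq) (use that in \<open>auto simp: sub_def\<close>)
  moreover have "un x y = x" if "y<<=x" by (rule seteq) (use that in \<open>auto simp: sub_def\<close>)
  ultimately show ?thesis using Ord_linear[OF that] Ord_sub that by blast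
 qed
 have Mk: "?M p<:k" if "p<:cart k k" for p using un2[of "p1 p" "p2 p"] pk[OF that] o by metis
 show ?thesis
 proof (rule lep_segments[OF d _ _ _ _ k])
  fix p q assume p: "p<:cart k k" and q: "q<:cart k k"
  show "?L p q | p = q | ?L q p"
   using Ord_linear[of "?M p" "?M q"] Ord_linear[of "p1 p" "p1 q"] Ord_linear[of "p2 p" "p2 q"] Mk[OF p] Mk[OF q] pk[OF p] pk[OF q] peq[OF p q] o by metis
 next
  fix p assume p: "p<:cart k k"
  show "~?L p p" by simp
 next
  fix p q r assume p: "p<:cart k k" and q: "q<:cart k k" and r: "r<:cart k k" and l: "?L p q" "?L q r"
  have t: "x<:z" if "x<:y" "y<:z" "z<:k" for x y z using that o Ord_trans by blast
  show "?L p r" using l t[OF _ _ Mk[OF r], of "?M p" "?M q"] t[of "p1 p" "p1 q" "p1 r"] t[of "p2 p" "p2 q" "p2 r"] pk[OF r] by metis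
 next
  fix X assume X: "X<<=cart k k" "X ~= emp"
  have dM: "DfnT (%e. ?M (e 0))" by (intro dfn)
  obtain x where "x<:X" using X ex_mem by blast
  then obtain a where a: "a<:X" "!!y. y<:X==>~?M y<:?M a" using least_by[OF dM] by metis
  have dX: "Dfn (%e. ?M (e 0) = ?M a)" by (intro dfn)
  let ?X = "sep X (%y. ?M y = ?M a)"
  have d1: "DfnT (%e. p1 (e 0))" and d2: "DfnT (%e. p2 (e 0))" by (intro dfn)+
  obtain b where b: "b<:X" "?M b = ?M a" "!!y. y<:X==>?M y = ?M a==>~p1 y<:p1 b"
   using least_by[OF d1, of a ?X] a(1) by (auto simp: sep[OF dX])
  have dY: "Dfn (%e. ?M (e 0) = ?M a&p1 (e 0) = p1 b)" by (intro dfn)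
  let ?Y = "sep X (%y. ?M y = ?M a&p1 y = p1 b)"
  obtain c where c: "c<:X" "?M c = ?M a" "p1 c = p1 b" "!!y. y<:X==>?M y = ?M a==>p1 y = p1 b==>~p2 y<:p2 c"
   using least_by[OF d2, of b ?Y] b(1,2) by (auto simp: sep[OF dY])
  show "EX m. m<:X&(ALL y. y<:X-->~?L y m)"
   using a b c by metis
 next
  fix q assume q: "q<:cart k k"
  have dq: "Dfn (%e. ?L (e 0) q)" by (intro dfn)
  have "sep (cart k k) (%p. ?L p q)<<=cart (sc (?M q)) (sc (?M q))"
  proof (rule subI)
   fix p assume "p<:sep (cart k k) (%p. ?L p q)"
   then have p: "p<:cart k k" "?L p q" unfolding sep[OF dq] by blast+
   have oM: "Ord (?M p)" "Ord (?M q)" using Mk p(1) q o by blast+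
   have "?M p<<=?M q" using p(2) Ord_sub[OF oM] by blast
   then have "p1 p<<=?M q" "p2 p<<=?M q" by (auto simp: sub_def)
   then have "p1 p<:sc (?M q)" "p2 p<:sc (?M q)" using Ord_sub[OF _ oM(2)] pk[OF p(1)] o by auto
   then show "p<:cart (sc (?M q)) (sc (?M q))" using p(1) by (auto simp: cart)
  qed
  then show "~lep k (sep (cart k k) (%p. ?L p q))" using m[OF Mk[OF q]] lep_sub lep_trans by blast
 qed
qed

lemma lep_om_square: "lep (cart om om) om"
proof (rule lep_square)
 fix m assume "m<:om"
 then have "fin (cart (sc m) (sc m))" using fin_cart fin_om sc_om by blast
 then show "~lep om (cart (sc m) (sc m))" using fin_lep not_fin_om by blast
qed simp

lemma lep_Uni: assumes d: "DfnT (%e. B (e 0))" and a: "lep a k" and b: "!!x. x<:a==>lep (B x) k" and k: "lep (cart k k) k"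
 shows "lep (Uni (img B a)) k"
proof -
 note dB = DfnT1[OF d]
 have "Dfn (%e. fn (e (Suc 0)) (B (e 0)) k&inj (e (Suc 0)) (B (e 0)))" by (intro dfn dB)
 then have "EX f c. fn f a c&(ALL x. x<:a-->fn (app f x) (B x) k&inj (app f x) (B x))"
  by (rule choice_fun[of "%x f. fn f (B x) k&inj f (B x)"]) (use b in \<open>auto simp: lep_def\<close>)
 then obtain f where f: "!!x. x<:a==>fn (app f x) (B x) k&inj (app f x) (B x)" by blast
 have "Dfn (%e. e (Suc 0)<:a&e 0<:B (e (Suc 0)))" by (intro dfn dB)
 then have "EX h c. fn h (Uni (img B a)) c&(ALL z. z<:Uni (img B a)-->app h z<:a&z<:B (app h z))"
  by (rule choice_fun[of "%z x. x<:a&z<:B x"]) (auto simp: img[OF d])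
 then obtain h where h: "!!z. z<:Uni (img B a)==>app h z<:a&z<:B (app h z)" by blast
 let ?F = "%z. pair (app h z) (app (app f (app h z)) z)"
 have dF: "DfnT (%e. ?F (e 0))" by (intro dfn)
 have "lep (Uni (img B a)) (cart a k)"
 proof (rule lepI[OF dF])
  fix z assume "z<:Uni (img B a)"
  then have "app h z<:a" "z<:B (app h z)" using h by blast+
  moreover have "fn (app f (app h z)) (B (app h z)) k" using f \<open>app h z<:a\<close> by blast
  ultimately show "?F z<:cart a k" using fn_app(2) by simp
 next
  fix z w assume zw: "z<:Uni (img B a)" "w<:Uni (img B a)" and e: "?F z = ?F w"
  have "app h z = app h w" "app (app f (app h z)) z = app (app f (app h w)) w" using e unfolding pair_inj by blast+
  moreover have "inj (app f (app h z)) (B (app h z))" "z<:B (app h z)" "w<:B (app h w)" using h zw f by blast+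
  ultimately show "z = w" unfolding inj_def by metis
 qed
 then show ?thesis using lep_cart[OF a lep_refl] k lep_trans by blast
qed

lemma ctbl_Uni: assumes d: "DfnT (%e. B (e 0))" and a: "ctbl a" and b: "!!x. x<:a==>ctbl (B x)"
 shows "ctbl (Uni (img B a))"
 using lep_Uni[OF d] a b lep_om_square unfolding ctbl_def by blast

lemma ctbl_cart: "ctbl a==>ctbl b==>ctbl (cart a b)"
 unfolding ctbl_def using lep_cart lep_om_square lep_trans by blast

lemma ctbl_un: assumes "ctbl a" "ctbl b" shows "ctbl (un a b)"
proof -
 let ?B = "%x. if x = emp then a else b"
 have d: "DfnT (%e. ?B (e 0))" by (intro dfn)
 have "?B emp = a" "?B (sc emp) = b" by simp_all
 then have "a<:img ?B (upair emp (sc emp))" "b<:img ?B (upair emp (sc emp))"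
  unfolding img[OF d] upair by metis+
 moreover have "x = a | x = b" if "x<:img ?B (upair emp (sc emp))" for x
  using that unfolding img[OF d] by auto
 ultimately have "un a b = Uni (img ?B (upair emp (sc emp)))" by (intro seteq) (unfold Uni un, blast)
 moreover have "ctbl (Uni (img ?B (upair emp (sc emp))))"
 proof (rule ctbl_Uni[OF d])
  have "upair emp (sc emp) = sc (sc emp)" by (rule seteq) auto
  then show "ctbl (upair emp (sc emp))" using fin_ctbl fin_om by simp
 qed (use assms in auto)
 ultimately show ?thesis by simp
qed

text \<open>Otherwise the set would be a countable union of countable fibres.\<close>

lemma unc_fiber: assumes d: "DfnT (%e. F (e 0))" and a: "~ctbl a" and c: "ctbl c" and F: "!!x. x<:a==>F x<:c"
 shows "EX y. y<:c&~ctbl (sep a (%x. F x = y))"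
proof (rule ccontr)
 assume n: "~?thesis"
 have dB: "DfnT (%e. sep a (%x. F x = e 0))" by (intro dfn DfnT1[OF d])
 have "ctbl (Uni (img (%y. sep a (%x. F x = y)) c))" by (rule ctbl_Uni[OF dB c]) (use n in blast)
 moreover have "a<<=Uni (img (%y. sep a (%x. F x = y)) c)"
 proof (rule subI)
  fix x assume x: "x<:a"
  have ds: "Dfn (%e. F (e 0) = F x)" by (intro dfn DfnT1[OF d])
  have "x<:sep a (%x'. F x' = F x)" using x by (simp add: sep[OF ds])
  moreover have "sep a (%x'. F x' = F x)<:img (%y. sep a (%x. F x = y)) c"
   unfolding img[OF dB] using F[OF x] by blast
  ultimately show "x<:Uni (img (%y. sep a (%x. F x = y)) c)" unfolding Uni by blast
 qed
 ultimately show False using a ctbl_sub by blast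
qed

text \<open>With countable fibres the image is uncountable, and one representative is chosen for
  each value.\<close>

lemma unc_injective: assumes d: "DfnT (%e. F (e 0))" and a: "~ctbl a" and c: "!!y. ctbl (sep a (%x. F x = y))"
 shows "EX b. b<<=a&~ctbl b&(ALL x y. x<:b-->y<:b-->F x = F y-->x = y)"
proof -
 have i: "~ctbl (img F a)" using unc_fiber[OF d a, of "img F a"] c img[OF d] by blast
 have "Dfn (%e. e (Suc 0)<:a&e 0 = F (e (Suc 0)))" by (intro dfn DfnT1[OF d])
 then have "EX g c. fn g (img F a) c&(ALL y. y<:img F a-->app g y<:a&y = F (app g y))"
  by (rule choice_fun[of "%y x. x<:a&y = F x"]) (auto simp: img[OF d])
 then obtain g where g: "!!y. y<:img F a==>app g y<:a&y = F (app g y)" by blast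
 have dg: "DfnT (%e. app g (e 0))" by (intro dfn)
 let ?b = "img (app g) (img F a)"
 have "lep (img F a) ?b" by (rule lepI[OF dg]) (use g in \<open>auto simp: img[OF dg]\<close>, metis)
 then have "~ctbl ?b" using i ctbl_lep by blast
 moreover have "?b<<=a" using g by (auto simp: sub_def img[OF dg])
 moreover have "x = y" if "x<:?b" "y<:?b" "F x = F y" for x y
  using that g unfolding img[OF dg] by metis
 ultimately show ?thesis by blast
qed

definition Fnc :: "U => U => U" where "Fnc r c = sep (pw (cart r c)) (%f. fn f r c)"

lemma Fnc_dfn [dfn]: "DfnT s==>DfnT t==>DfnT (%e. Fnc (s e) (t e))"
 by (rule DfnT2[of Fnc], unfold Fnc_def, intro dfn)

lemma Fnc: "f<:Fnc r c<->fn f r c"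
proof -
 have d: "Dfn (%e. fn (e 0) r c)" by (intro dfn)
 have "fn f r c==>f<<=cart r c" by (auto simp: sub_def fn_mem fn_app cart)
 then show ?thesis unfolding Fnc_def sep[OF d] by auto
qed

lemma rs_fn: assumes "fn f a b" "c<<=a" shows "fn (rs f c) c b" "x<:c==>app (rs f c) x = app f x"
proof -
 have p: "pair x y<:rs f c<->x<:c&y = app f x" for x y using assms by (auto simp: fn_pair sub_def)
 have "EX x y. x<:c&y<:b&p = pair x y" if q: "p<:rs f c" for p
 proof -
  obtain x y where "p = pair x y" "x<:c" using q rs by blast
  then show ?thesis using p q assms fn_app(2) subD by metis
 qed
 then show f: "fn (rs f c) c b" unfolding fn_def using p by blast
 show "x<:c==>app (rs f c) x = app f x" using p fn_pair[OF f] by metis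
qed

lemma ctbl_Fnc: assumes "fin r" "ctbl c" shows "ctbl (Fnc r c)"
proof (rule fin_induct[OF _ assms(1)])
 show "Dfn (%e. ctbl (Fnc (e 0) c))" by (intro dfn)
 have "Fnc emp c<<=sc emp" by (auto simp: sub_def Fnc fn_def intro: emp_eq)
 then show "ctbl (Fnc emp c)" using fin_ctbl fin_om fin_sub sc_om emp_om by blast
 fix x a assume ih: "ctbl (Fnc a c)"
 let ?F = "%f. pair (rs f a) (app f x)"
 have d: "DfnT (%e. ?F (e 0))" by (intro dfn)
 have s: "a<<=ins x a" by (simp add: sub_def)
 have "lep (Fnc (ins x a) c) (cart (Fnc a c) c)"
 proof (rule lepI[OF d])
  fix f assume "f<:Fnc (ins x a) c"
  then show "?F f<:cart (Fnc a c) c" using rs_fn(1)[OF _ s] fn_app(2)[of f "ins x a"] by (simp add: Fnc)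
 next
  fix f g assume f: "f<:Fnc (ins x a) c" and g: "g<:Fnc (ins x a) c" and e: "?F f = ?F g"
  have "app f y = app g y" if "y<:ins x a" for y
   using that e rs_fn(2)[OF f[unfolded Fnc] s, of y] rs_fn(2)[OF g[unfolded Fnc] s, of y] by auto
  then show "f = g" using fn_eqI f g unfolding Fnc by blast
 qed
 then show "ctbl (Fnc (ins x a) c)" using ctbl_lep ctbl_cart ih assms(2) by blast
qed

definition two :: U where "two = sc (sc emp)"
definition Sq :: U where "Sq = Uni (img (%n. Fnc n two) om)"

lemma Sq: "s<:Sq<->(EX n. n<:om&fn s n two)"
proof -
 have d: "DfnT (%e. Fnc (e 0) two)" by (intro dfn)
 show ?thesis by (auto simp: Sq_def img[OF d] Fnc)
qed

lemma ctbl_Sq: "ctbl Sq"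
proof -
 have d: "DfnT (%e. Fnc (e 0) two)" by (intro dfn)
 have t: "ctbl two" unfolding two_def by (intro fin_ctbl fin_om sc_om emp_om)
 show ?thesis unfolding Sq_def
  by (rule ctbl_Uni[OF d]) (use ctbl_Fnc fin_om t in \<open>auto simp: ctbl_def\<close>)
qed

subsection \<open>The first uncountable ordinal\<close>

definition om1 :: U where "om1 = des (%u. Ord u&~ctbl u&(ALL x. x<:u-->ctbl x))"

lemma om1_unique: "Ord u&~ctbl u&(ALL x. x<:u-->ctbl x)<->u = om1"
proof -
 let ?P = "%u. Ord u&~ctbl u&(ALL x. x<:u-->ctbl x)"
 obtain \<theta> g where t: "Ord \<theta>" "bij g \<theta> (pw om)" using wellordering by blast
 have "~ctbl \<theta>" using bij_lep(2)[OF t(2)] cantor[of om] lep_trans unfolding ctbl_def by blast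
 moreover have "Dfn (%e. ~ctbl (e 0))" by (intro dfn)
 ultimately obtain u where u: "?P u" using Ord_least[of "%x. ~ctbl x" \<theta>] t(1) by blast
 have un: "v = u" if "?P v" for v using that u Ord_linear by blast
 have "om1 = u" unfolding om1_def by (rule des_eq[where y = u]) (use u un in blast)+
 then show ?thesis using u un by blast
qed

lemma Ord_om1 [simp]: "Ord om1" and unc_om1: "~ctbl om1" and om1_ctbl: "x<:om1==>ctbl x"
 using om1_unique[of om1] by blast+

lemma om1_Ord: "x<:om1==>Ord x" using Ord_om1 Ord_mem by blast

lemma om_om1: "om<:om1"
proof -
 have "ctbl om" by (simp add: ctbl_def)
 then show ?thesis using Ord_linear[of om om1] unc_om1 Ord_sub[of om1 om] ctbl_sub by auto
qed

lemma om1_sc: "x<:om1==>sc x<:om1"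
proof -
 assume x: "x<:om1"
 have "un x (upair x x) = sc x" by (rule seteq) auto
 moreover have "upair x x = ins x emp" by (rule seteq) auto
 ultimately have "ctbl (sc x)" using ctbl_un[OF om1_ctbl[OF x], of "upair x x"] fin_ctbl by simp
 then show ?thesis using Ord_sc_mem[OF Ord_om1 x] unc_om1 by auto
qed

lemma unc_lep: assumes "~ctbl a" shows "lep om1 a"
proof -
 obtain \<theta> g where t: "Ord \<theta>" "bij g \<theta> a" using wellordering by blast
 have "~ctbl \<theta>" using bij_lep(2)[OF t(2)] assms ctbl_lep by blast
 then have "~\<theta><:om1" using om1_ctbl by blast
 then have "om1<<=\<theta>" using Ord_not_mem[OF t(1) Ord_om1] by simp
 then show ?thesis using bij_lep(1)[OF t(2)] lep_sub lep_trans by blast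
qed

lemma lep_om1_square: "lep (cart om1 om1) om1"
proof (rule lep_square)
 fix m assume "m<:om1"
 then have "ctbl (cart (sc m) (sc m))" using ctbl_cart om1_sc om1_ctbl by blast
 then show "~lep om1 (cart (sc m) (sc m))" using unc_om1 ctbl_lep by blast
qed simp

text \<open>The order of \<open>om1\<close> is pulled back along an injection. Its order type is
  uncountable, while every proper initial segment embeds in a countable ordinal.\<close>

lemma unc_bij_om1: assumes "lep a om1" "~ctbl a" shows "EX f. bij f a om1"
proof -
 obtain f where f: "fn f a om1" "inj f a" using assms(1) unfolding lep_def by blast
 let ?L = "%x y. app f x<:app f y"
 have d: "Dfn (%e. ?L (e 0) (e (Suc 0)))" by (intro dfn)
 have df: "DfnT (%e. app f (e 0))" by (intro dfn)
 have m: "app f x<:om1" "Ord (app f x)" if "x<:a" for x using fn_app(2)[OF f(1) that] om1_Ord by blast+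
 have "EX \<theta> g. Ord \<theta> & bij g a \<theta> & (ALL x y. x<:a-->y<:a-->(?L x y<->app g x<:app g y))"
 proof (rule order_type[OF d])
  show "?L x y | x = y | ?L y x" if "x<:a" "y<:a" for x y
   using Ord_linear[OF m(2) m(2), OF that] f(2) that unfolding inj_def by blast
  show "?L x z" if "x<:a" "y<:a" "z<:a" "?L x y" "?L y z" for x y z using that m(2) Ord_trans by blast
  show "EX m. m<:X&(ALL y. y<:X-->~?L y m)" if "X<<=a" "X ~= emp" for X
   using ex_mem[OF that(2)] least_by[OF df] by blast
 qed simp
 then obtain \<theta> g where t: "Ord \<theta>" "bij g a \<theta>" "!!x y. x<:a==>y<:a==>(?L x y<->app g x<:app g y)" by blast
 obtain h where h: "bij h \<theta> a" "!!y. y<:\<theta> ==> app g (app h y) = y" using bij_inverse[OF t(2)] by blast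
 have "~ctbl \<theta>" using bij_lep(1)[OF t(2)] assms(2) ctbl_lep by blast
 moreover have "ctbl z" if z: "z<:\<theta>" for z
 proof -
  have hz: "app h y<:a" if "y<:\<theta>" for y using h(1) that fn_app(2) unfolding bij_def by blast
  have dF: "DfnT (%e. app f (app h (e 0)))" by (intro dfn)
  have "lep z (app f (app h z))"
  proof (rule lepI[OF dF])
   fix y assume y: "y<:z"
   then have "y<:\<theta>" using z t(1) Ord_trans by blast
   then show "app f (app h y)<:app f (app h z)" using t(3)[OF hz hz] h(2) z y by simp
  next
   fix x y assume "x<:z" "y<:z" and e: "app f (app h x) = app f (app h y)"
   then have "x<:\<theta>" "y<:\<theta>" using z t(1) Ord_trans by blast+
   then show "x = y" using e hz h(2) f(2) unfolding inj_def by metis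
  qed
  then show ?thesis using m(1)[OF hz[OF z]] om1_ctbl ctbl_lep by blast
 qed
 ultimately have "\<theta> = om1" using t(1) om1_unique by blast
 then show ?thesis using t(2) by blast
qed

subsection \<open>Maximal sets and Delta-systems\<close>

text \<open>A greedy run through an enumeration of \<open>S\<close> adds each element whose addition
  keeps the property. By heredity, an element that could be added at the end could have been added
  at its turn.\<close>

lemma tukey: assumes d: "Dfn (%e. P (e 0))" and z: "P emp" and her: "!!X Y. P Y==>X<<=Y==>P X"
  and chain: "!!C. [|C ~= emp; !!X. X<:C==>P X; !!X Y. X<:C==>Y<:C==>X<<=Y | Y<<=X|]==>P (Uni C)"
 shows "EX X. X<<=S&P X&(ALL a. a<:S-->~a<:X-->~P (ins a X))"
proof -
 obtain \<theta> g where t: "Ord \<theta>" "bij g \<theta> S" using wellordering by blast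
 note dP = Dfn1[OF d]
 let ?Y = "%x f. Uni (img (app f) x)"
 let ?H = "%x f. if P (ins (app g x) (?Y x f)) then ins (app g x) (?Y x f) else ?Y x f"
 have h: "DfnT (%e. ?H (e 0) (e (Suc 0)))" by (intro dfn dP)
 define K where "K = Rec ?H"
 have dK: "DfnT (%e. K (e 0))" unfolding K_def by (intro dfn dP)
 define Y where "Y x = Uni (img K x)" for x
 have im: "?Y x (lam x K) = Y x" for x
 proof (rule seteq)
  have dl: "DfnT (%e. app (lam x K) (e 0))" by (intro dfn DfnT1[OF dK])
  show "z<:?Y x (lam x K)<->z<:Y x" for z
   unfolding Y_def Uni img[OF dl] img[OF dK] using lam_app[OF dK] by metis
 qed
 have K: "K x = (if P (ins (app g x) (Y x)) then ins (app g x) (Y x) else Y x)" for x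
  using Rec_eq[OF h, of x] im[of x] unfolding K_def by simp
 have Y: "z<:Y x<->(EX b. b<:x&z<:K b)" for z x unfolding Y_def Uni img[OF dK] by blast
 have YK: "Y x<<=K x" for x using K[of x] by (auto simp: sub_def)
 have mono: "K b<<=K a" if "b<:a" for a b using that YK[of a] Y by (auto simp: sub_def)
 have PY: "P (Y a)" if a: "Ord a" and k: "!!b. b<:a==>P (K b)" for a
 proof (cases "a = emp")
  case True
  then have "Y a = emp" using Y by (auto intro: emp_eq)
  then show ?thesis using z by simp
 next
  case False
  show ?thesis unfolding Y_def
  proof (rule chain)
   obtain b where "b<:a" using False ex_mem by blast
   then have "K b<:img K a" unfolding img[OF dK] by blast
   then show "img K a ~= emp" by auto
   show "P X" if "X<:img K a" for X using that k unfolding img[OF dK] by blast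
   show "X<<=Z | Z<<=X" if XZ: "X<:img K a" "Z<:img K a" for X Z
   proof -
    obtain b c where bc: "b<:a" "c<:a" "X = K b" "Z = K c" using XZ unfolding img[OF dK] by blast
    then show ?thesis using Ord_linear[of b c] a Ord_mem mono sub_refl by metis
   qed
  qed
 qed
 have dPK: "Dfn (%e. P (K (e 0)))" by (intro dP DfnT1[OF dK] dfn)
 have PK: "P (K a)" if "Ord a" for a
 proof (rule Ord_induct[OF dPK that])
  fix a assume "Ord a" "!!b. b<:a==>P (K b)"
  then have "P (Y a)" by (rule PY)
  then show "P (K a)" using K[of a] by simp
 qed
 have PT: "P (Y \<theta>)" using PY[OF t(1)] PK t(1) Ord_mem by blast
 have gS: "app g x<:S" if "x<:\<theta>" for x using t(2) that fn_app(2) unfolding bij_def by blast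
 have dS: "Dfn (%e. e 0<:\<theta> --> K (e 0)<<=S)" by (intro dfn DfnT1[OF dK])
 have KS: "a<:\<theta> --> K a<<=S" if "Ord a" for a
 proof (rule Ord_induct[OF dS that], intro impI subI)
  fix a z assume ih: "!!b. b<:a==>b<:\<theta> --> K b<<=S" and a: "a<:\<theta>" and z: "z<:K a"
  have "z = app g a | z<:Y a" using z K[of a] by (auto split: if_splits)
  then show "z<:S" using gS[OF a] ih Y a t(1) Ord_trans subD by metis
 qed
 have YS: "Y \<theta><<=S" using KS t(1) Ord_mem unfolding sub_def Y by blast
 have "~P (ins a (Y \<theta>))" if a: "a<:S" "~a<:Y \<theta>" for a
 proof
  assume p: "P (ins a (Y \<theta>))"
  obtain x where x: "x<:\<theta>" "app g x = a" using t(2) a(1) unfolding bij_def by blast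
  have "ins a (Y x)<<=ins a (Y \<theta>)" using x(1) t(1) Ord_trans unfolding sub_def ins Y by blast
  then have "P (ins a (Y x))" using her p by blast
  then have "a<:K x" using K[of x] x(2) by simp
  then show False using a(2) x(1) Y by blast
 qed
 then show ?thesis using PT YS by blast
qed

lemma max_pairwise: assumes d: "Dfn (%e. R (e 0) (e (Suc 0)))"
 shows "EX X. X<<=S&(ALL x y. x<:X-->y<:X-->x ~= y-->R x y) &
  (ALL a. a<:S-->~a<:X-->(EX x. x<:X&(~R a x | ~R x a)))"
proof -
 let ?P = "%X. ALL x y. x<:X-->y<:X-->x ~= y-->R x y"
 have dP: "Dfn (%e. ?P (e 0))" by (intro dfn Dfn2[OF d])
 have "EX X. X<<=S&?P X&(ALL a. a<:S-->~a<:X-->~?P (ins a X))"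
 proof (rule tukey[OF dP])
  show "?P X" if "?P Y" "X<<=Y" for X Y using that subD by metis
  show "?P (Uni C)" if C: "!!X. X<:C==>?P X" "!!X Y. X<:C==>Y<:C==>X<<=Y | Y<<=X" for C
   using C subD unfolding Uni by metis
 qed simp
 then obtain X where X: "X<<=S" "?P X" "!!a. a<:S==>~a<:X==>~?P (ins a X)" by blast
 have "EX x. x<:X&(~R a x | ~R x a)" if "a<:S" "~a<:X" for a
  using X(2) X(3)[OF that] unfolding ins by metis
 then show ?thesis using X by blast
qed

text \<open>Induction on a bound for the size outside a common part \<open>e\<close>. If a point
  outside \<open>e\<close> lies in uncountably many sets, it joins \<open>e\<close>. Otherwise a
  maximal family disjoint outside \<open>e\<close> is uncountable, since a countable one would meet
  only countably many sets.\<close>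

lemma delta_system:
 assumes d: "DfnT (%e. D (e 0))" and F: "~ctbl F" "!!p. p<:F==>fin (D p)"
 shows "EX G r. G<<=F&~ctbl G&fin r&(ALL p q. p<:G-->q<:G-->p ~= q-->it (D p) (D q) = r)"
proof -
 note dD = DfnT1[OF d]
 let ?C = "%F r. EX G. G<<=F&~ctbl G&(ALL p q. p<:G-->q<:G-->p ~= q-->it (D p) (D q) = r)"
 let ?P = "%n. ALL F e. ~ctbl F-->fin e-->(ALL p. p<:F-->e<<=D p)-->(ALL p. p<:F-->lep (df (D p) e) n) -->
   (EX r. fin r&?C F r)"
 have dP: "Dfn (%e. ?P (e 0))" by (intro dfn dD)
 have P: "?P n" if "n<:om" for n
 proof (rule om_induct[OF dP that])
  have "it (D p) (D q) = e" if "e<<=D p" "e<<=D q" "lep (df (D p) e) emp" "lep (df (D q) e) emp" for p q e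
  proof -
   have "~x<:df (D p) e" for x using that(3) fn_app(2) unfolding lep_def by (metis emp)
   then show ?thesis using that(1,2) by (auto intro!: seteq simp: sub_def)
  qed
  then show "?P emp" by (meson sub_refl)
 next
  fix n assume n: "n<:om" and ih: "?P n"
  show "?P (sc n)"
  proof (intro allI impI)
   fix F e assume F: "~ctbl F" and e: "fin e" and eD: "ALL p. p<:F-->e<<=D p" and l: "ALL p. p<:F-->lep (df (D p) e) (sc n)"
   show "EX r. fin r&?C F r"
   proof (cases "EX a. ~a<:e&~ctbl (sep F (%p. a<:D p))")
    case True
    then obtain a where a: "~a<:e" "~ctbl (sep F (%p. a<:D p))" by blast
    have ds: "Dfn (%e. a<:D (e 0))" by (intro dfn dD)
    let ?F = "sep F (%p. a<:D p)"
    have F': "p<:?F<->p<:F&a<:D p" for p by (rule sep[OF ds])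
    have "lep (df (D p) (ins a e)) n" if "p<:?F" for p
    proof -
     have "df (D p) (ins a e) = df (df (D p) e) (upair a a)" by (rule seteq) auto
     then show ?thesis using lep_remove[of "df (D p) e" n a] that F' l a(1) by simp
    qed
    moreover have "ins a e<<=D p" if "p<:?F" for p using that F' eD by (auto simp: sub_def)
    ultimately obtain r where r: "fin r" "?C ?F r" using ih a(2) fin_ins[OF e] by blast
    have "?F<<=F" using F' by (simp add: sub_def)
    then show ?thesis using r sub_trans by meson
   next
    case False
    have ds: "Dfn (%x. a<:D (x 0))" for a by (intro dfn dD)
    let ?R = "%p q. it (df (D p) e) (df (D q) e) = emp"
    have dR: "Dfn (%x. ?R (x 0) (x (Suc 0)))" by (intro dfn dD)
    obtain X where X: "X<<=F" "!!p q. p<:X==>q<:X==>p ~= q==>?R p q"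
     "!!p. p<:F==>~p<:X==>EX q. q<:X&(~?R p q | ~?R q p)"
     using max_pairwise[OF dR, of F] by blast
    have "~ctbl X"
    proof
     assume cX: "ctbl X"
     have dB: "DfnT (%x. df (D (x 0)) e)" by (intro dfn dD)
     let ?U = "Uni (img (%p. df (D p) e) X)"
     have "fin (df (D p) e)" if "p<:X" for p
      unfolding fin_def using l X(1) that n sc_om subD by blast
     then have cU: "ctbl ?U" by (intro ctbl_Uni[OF dB cX] fin_ctbl)
     have dE: "DfnT (%x. sep F (%p. x 0<:D p))" by (intro dfn dD)
     let ?V = "Uni (img (%a. sep F (%p. a<:D p)) ?U)"
     have "ctbl ?V"
     proof (rule ctbl_Uni[OF dE cU])
      fix a assume "a<:?U"
      then have "~a<:e" unfolding Uni img[OF dB] by auto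
      then show "ctbl (sep F (%p. a<:D p))" using False by blast
     qed
     then have "ctbl (un X ?V)" using cX ctbl_un by blast
     moreover have "F<<=un X ?V"
     proof (rule subI)
      fix p assume p: "p<:F"
      show "p<:un X ?V"
      proof (cases "p<:X")
       case False
       then obtain q a where q: "q<:X" "a<:D p" "a<:df (D q) e"
        using X(3)[OF p] ex_mem it df by metis
       have "a<:?U" unfolding Uni img[OF dB] using q by blast
       moreover have "p<:sep F (%p. a<:D p)" using p q by (simp add: sep[OF ds])
       ultimately have "p<:?V" unfolding Uni[of _ "img _ ?U"] img[OF dE] by blast
       then show ?thesis by simp
      qed simp
     qed
     ultimately show False using F ctbl_sub by blast
    qed
    moreover have "it (D p) (D q) = e" if "p<:X" "q<:X" "p ~= q" for p q
    proof (rule seteq)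
     fix a
     show "a<:it (D p) (D q)<->a<:e"
      using X(2)[OF that] eD X(1) that(1,2) emp[of a] it df unfolding sub_def by metis
    qed
    ultimately show ?thesis using X(1) e by blast
   qed
  qed
 qed
 \<comment> \<open>The least number bounding the size of \<open>D p\<close>; uncountably many
   \<open>p\<close> share it.\<close>
 let ?N = "%p. des (%n. n<:om&lep (D p) n&(ALL m. m<:n-->~lep (D p) m))"
 have dN: "DfnT (%e. ?N (e 0))" by (intro dfn dD)
 have N: "?N p<:om&lep (D p) (?N p)" if p: "p<:F" for p
 proof -
  obtain k where k: "k<:om" "lep (D p) k" using F(2)[OF p] by (auto simp: fin_def)
  have "Dfn (%e. lep (D p) (e 0))" by (intro dfn dD)
  then obtain n where n: "Ord n" "lep (D p) n" "ALL m. m<:n-->~lep (D p) m"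
   using Ord_least[of "lep (D p)" k] k om_Ord_mem by blast
  have "n<:om" using n k Ord_linear[OF n(1) om_Ord_mem[OF k(1)]] om_trans by blast
  moreover have "?N p = n"
   by (rule des_eq) (use n \<open>n<:om\<close> Ord_linear om_Ord_mem in blast)+
  ultimately show ?thesis using n by simp
 qed
 have "ctbl om" by (simp add: ctbl_def)
 then have "EX n. n<:om&~ctbl (sep F (%p. ?N p = n))" by (rule unc_fiber[OF dN F(1)]) (use N in blast)
 then obtain n where n: "n<:om" "~ctbl (sep F (%p. ?N p = n))" by blast
 have ds: "Dfn (%e. ?N (e 0) = n)" by (intro dfn dD)
 have "df (D p) emp = D p" for p by (rule seteq) simp
 moreover have "lep (D p) n" if "p<:sep F (%p. ?N p = n)" for p
 proof -
  have "p<:F" "?N p = n" using that unfolding sep[OF ds] by blast+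
  then show ?thesis using N[of p] by simp
 qed
 ultimately have "lep (df (D p) emp) n" if "p<:sep F (%p. ?N p = n)" for p using that by simp
 then obtain r where "fin r" "?C (sep F (%p. ?N p = n)) r" using P[OF n(1)] n(2) fin_emp emp_sub by blast
 moreover have "sep F (%p. ?N p = n)<<=F" using sep[OF ds] by (simp add: sub_def)
 ultimately show ?thesis using sub_trans by meson
qed

end

subsection \<open>Forcing\<close>

locale forcing = zfc +
 fixes P R :: U
 assumes le_refl0: "p<:P==>pair p p<:R"
  and le_trans0: "[|p<:P; q<:P; r<:P; pair p q<:R; pair q r<:R|]==>pair p r<:R"
begin

definition le :: "U => U => bool" where "le p q<->p<:P&q<:P&pair p q<:R"

lemma le_dfn [dfn]: "DfnT s==>DfnT t==>Dfn (%e. le (s e) (t e))"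
 by (rule Dfn2[of le], unfold le_def, intro dfn)

lemma le_refl: "p<:P==>le p p" using le_refl0 by (simp add: le_def)
lemma le_trans: "le p q==>le q r==>le p r" using le_trans0 unfolding le_def by blast
lemma leP: "le p q==>p<:P" "le p q==>q<:P" by (simp_all add: le_def)

text \<open>One back-and-forth step: wherever a member of one name is present, an extension relates
  it by \<open>B\<close> to a present member of the other name.\<close>

definition cov :: "U => U => U => U => bool" where
 "cov B p a b <->
  (ALL c s q. pair c s<:a-->le q p-->le q s -->
   (EX r d u. le r q&pair d u<:b&le r u&pair r (pair c d)<:B)) &
  (ALL d u q. pair d u<:b-->le q p-->le q u -->
   (EX r c s. le r q&pair c s<:a&le r s&pair r (pair c d)<:B))"
definition bis :: "U => bool" where "bis B<->(ALL p a b. pair p (pair a b)<:B-->cov B p a b)"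

text \<open>Equality of names is forced when some set is a bisimulation witnessing it; this avoids a
 recursion on names.\<close>

definition EQ :: "U => U => U => bool" where "EQ p a b<->(EX B. bis B&cov B p a b)"
definition ME :: "U => U => U => bool" where
 "ME p a b<->(ALL q. le q p-->(EX r d u. le r q&pair d u<:b&le r u&EQ r a d))"

lemma cov_dfn [dfn]: "DfnT s==>DfnT t==>DfnT u==>DfnT v==>Dfn (%e. cov (s e) (t e) (u e) (v e))"
 by (rule Dfn4[of cov], unfold cov_def, intro dfn)
lemma bis_dfn [dfn]: "DfnT s==>Dfn (%e. bis (s e))"
 by (rule Dfn1[of bis], unfold bis_def, intro dfn)
lemma EQ_dfn [dfn]: "DfnT s==>DfnT t==>DfnT u==>Dfn (%e. EQ (s e) (t e) (u e))"
 by (rule Dfn3[of EQ], unfold EQ_def, intro dfn)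
lemma ME_dfn [dfn]: "DfnT s==>DfnT t==>DfnT u==>Dfn (%e. ME (s e) (t e) (u e))"
 by (rule Dfn3[of ME], unfold ME_def, intro dfn)

lemma cov_mono: assumes "cov B p a b" "B<<=B'" "le q p" shows "cov B' q a b"
 using assms unfolding cov_def sub_def by (meson le_trans)

lemma EQ_iff: assumes p: "p<:P" shows "EQ p a b <->
  (ALL c s q. pair c s<:a-->le q p-->le q s -->
   (EX r d u. le r q&pair d u<:b&le r u&EQ r c d)) &
  (ALL d u q. pair d u<:b-->le q p-->le q u -->
   (EX r c s. le r q&pair c s<:a&le r s&EQ r c d))" (is "_<->?R")
proof
 assume "EQ p a b"
 then obtain B where B: "bis B" "cov B p a b" by (auto simp: EQ_def)
 have "EQ r c d" if "pair r (pair c d)<:B" for r c d using that B unfolding EQ_def bis_def by blast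
 then show ?R using B(2) unfolding cov_def by meson
next
 assume R: ?R
 let ?T = "cart P (cart (dm a) (dm b))"
 let ?Q = "%x B. bis B&x<:B"
 have dQ: "Dfn (%e. ?Q (e 0) (e (Suc 0)))" by (intro dfn)
 \<comment> \<open>Adding to \<open>B\<close> the very triple that it covers leaves it a
   bisimulation.\<close>
 have ex: "EX B. ?Q (pair r (pair c d)) B" if "EQ r c d" "r<:P" for r c d
 proof -
  obtain B where B: "bis B" "cov B r c d" using \<open>EQ r c d\<close> by (auto simp: EQ_def)
  have s: "B<<=ins (pair r (pair c d)) B" by (simp add: sub_def)
  have "cov (ins (pair r (pair c d)) B) p' a' b'" if "pair p' (pair a' b')<:ins (pair r (pair c d)) B" for p' a' b'
  proof (cases "pair p' (pair a' b')<:B")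
   case True
   then have "cov B p' a' b'" using B(1) by (simp add: bis_def)
   then show ?thesis unfolding cov_def using s unfolding sub_def by meson
  next
   case False
   then have "p' = r" "a' = c" "b' = d" using that by auto
   then show ?thesis using cov_mono[OF B(2) s le_refl[OF \<open>r<:P\<close>]] by simp
  qed
  then have "bis (ins (pair r (pair c d)) B)" by (simp add: bis_def)
  then show ?thesis by (intro exI[of _ "ins (pair r (pair c d)) B"]) simp
 qed
 obtain C where C: "!!x. x<:?T==>EX B. ?Q x B==>EX B. B<:C&?Q x B" using collection[OF dQ, of ?T] by blast
 have db: "Dfn (%e. bis (e 0))" by (intro dfn)
 define BB where "BB = Uni (sep C bis)"
 have sub: "B<<=BB" if "B<:C" "bis B" for B using that sep[OF db] by (auto simp: sub_def BB_def)
 have m: "cov BB p' a' b'" if "cov B p' a' b'" "B<:C" "bis B" for B p' a' b'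
  using that(1) sub[OF that(2,3)] unfolding cov_def sub_def by meson
 have "bis BB" unfolding bis_def
 proof (intro allI impI)
  fix p' a' b' assume "pair p' (pair a' b')<:BB"
  then obtain B where B: "B<:C" "bis B" "pair p' (pair a' b')<:B" using sep[OF db] unfolding BB_def by auto
  have "cov B p' a' b'" using B(2,3) unfolding bis_def by blast
  then show "cov BB p' a' b'" using m B(1,2) by blast
 qed
 moreover have in_B: "pair r (pair c d)<:BB" if h: "EQ r c d" "r<:P" "c<:dm a" "d<:dm b" for r c d
 proof -
  have "EX B. B<:C&bis B&pair r (pair c d)<:B" using C[OF _ ex[OF h(1,2)]] h by simp
  then show ?thesis using sub subD by blast
 qed
 have "cov BB p a b" unfolding cov_def
 proof (intro conjI allI impI)
  fix c s q assume a: "pair c s<:a" "le q p" "le q s"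
  then obtain r d u where "le r q" "pair d u<:b" "le r u" "EQ r c d" using R by blast
  then show "EX r d u. le r q&pair d u<:b&le r u&pair r (pair c d)<:BB"
   using in_B leP(1) a(1) dm by meson
 next
  fix d u q assume a: "pair d u<:b" "le q p" "le q u"
  then obtain r c s where "le r q" "pair c s<:a" "le r s" "EQ r c d" using R by blast
  then show "EX r c s. le r q&pair c s<:a&le r s&pair r (pair c d)<:BB"
   using in_B leP(1) a(1) dm by meson
 qed
 ultimately show "EQ p a b" unfolding EQ_def by blast
qed

lemma rk_pair: "pair c s<:a==>rk c<:rk a"
proof -
 assume a: "pair c s<:a"
 have "rk c<:rk (upair c c)" "rk (upair c c)<:rk (pair c s)"
  by (rule rk_mem, simp add: pair_def)+
 moreover have "rk (pair c s)<:rk a" by (rule rk_mem) (rule a)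
 ultimately have "rk c<:rk (upair c c)" "rk (upair c c)<:rk (pair c s)" "rk (pair c s)<:rk a" by blast+
 then show ?thesis using Ord_rk Ord_trans by blast
qed

lemma name_induct: assumes d: "Dfn (%e. Q (e 0))" and s: "!!a. (!!c s. pair c s<:a==>Q c)==>Q a" shows "Q a"
proof -
 have d': "Dfn (%e. ALL a. rk a = e 0-->Q a)" by (intro dfn Dfn1[OF d])
 have "ALL b. rk b = rk a-->Q b"
  by (rule Ord_induct[OF d' Ord_rk]) (use s rk_pair in metis)
 then show ?thesis by blast
qed

lemma EQ_mono: "EQ p a b==>le q p==>EQ q a b"
 unfolding EQ_def using cov_mono sub_refl by blast

lemma EQ_fwd: "EQ p a b==>pair c s<:a==>le q p==>le q s==>EX r d u. le r q&pair d u<:b&le r u&EQ r c d"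
 using EQ_iff leP(2) by meson

lemma EQ_bwd: "EQ p a b==>pair d u<:b==>le q p==>le q u==>EX r c s. le r q&pair c s<:a&le r s&EQ r c d"
 using EQ_iff leP(2) by meson

lemma EQ_refl: assumes "p<:P" shows "EQ p a a"
proof -
 have d: "Dfn (%e. ALL p. p<:P-->EQ p (e 0) (e 0))" by (intro dfn)
 have "ALL p. p<:P-->EQ p a a"
 proof (rule name_induct[OF d], intro allI impI)
  fix a p assume ih: "!!c s. pair c s<:a==>ALL p. p<:P-->EQ p c c" and p: "p<:P"
  show "EQ p a a" unfolding EQ_iff[OF p] using ih le_refl leP(1) by meson
 qed
 then show ?thesis using assms by blast
qed

lemma EQ_sym: assumes "EQ p a b" "p<:P" shows "EQ p b a"
proof -
 have d: "Dfn (%e. ALL p b. p<:P-->EQ p (e 0) b-->EQ p b (e 0))" by (intro dfn)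
 have "ALL p b. p<:P-->EQ p a b-->EQ p b a"
 proof (rule name_induct[OF d], intro allI impI)
  fix a p b assume ih: "!!c s. pair c s<:a==>ALL p b. p<:P-->EQ p c b-->EQ p b c" and p: "p<:P" and e: "EQ p a b"
  show "EQ p b a" unfolding EQ_iff[OF p]
  proof (intro conjI allI impI)
   fix c s q assume c: "pair c s<:b" "le q p" "le q s"
   obtain r d u where "le r q" "pair d u<:a" "le r u" "EQ r d c" using EQ_bwd[OF e c] by blast
   then show "EX r d u. le r q&pair d u<:a&le r u&EQ r c d" using ih leP(1) by blast
  next
   fix d u q assume c: "pair d u<:a" "le q p" "le q u"
   obtain r c s where "le r q" "pair c s<:b" "le r s" "EQ r d c" using EQ_fwd[OF e c] by blast
   then show "EX r c s. le r q&pair c s<:b&le r s&EQ r c d" using ih leP(1) c(1) by blast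
  qed
 qed
 then show ?thesis using assms by blast
qed

lemma EQ_trans: assumes "EQ p a b" "EQ p b c" "p<:P" shows "EQ p a c"
proof -
 have d: "Dfn (%e. ALL p b c. p<:P-->EQ p (e 0) b-->EQ p b c-->EQ p (e 0) c)" by (intro dfn)
 have "ALL p b c. p<:P-->EQ p a b-->EQ p b c-->EQ p a c"
 proof (rule name_induct[OF d], intro allI impI)
  fix a p b c assume ih: "!!c s. pair c s<:a==>ALL p b d. p<:P-->EQ p c b-->EQ p b d-->EQ p c d"
   and p: "p<:P" and e: "EQ p a b" "EQ p b c"
  show "EQ p a c" unfolding EQ_iff[OF p]
  proof (intro conjI allI impI)
   fix x s q assume x: "pair x s<:a" "le q p" "le q s"
   obtain r y u where r: "le r q" "pair y u<:b" "le r u" "EQ r x y" using EQ_fwd[OF e(1) x] by blast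
   obtain r' z v where r': "le r' r" "pair z v<:c" "le r' v" "EQ r' y z"
    using EQ_fwd[OF e(2) r(2) le_trans[OF r(1) x(2)] r(3)] by blast
   have "EQ r' x z" using ih[OF x(1)] leP(1)[OF r'(1)] EQ_mono[OF r(4) r'(1)] r'(4) by blast
   then show "EX r d u. le r q&pair d u<:c&le r u&EQ r x d" using r' r(1) le_trans by blast
  next
   fix z v q assume z: "pair z v<:c" "le q p" "le q v"
   obtain r y u where r: "le r q" "pair y u<:b" "le r u" "EQ r y z" using EQ_bwd[OF e(2) z] by blast
   obtain r' x s where r': "le r' r" "pair x s<:a" "le r' s" "EQ r' x y"
    using EQ_bwd[OF e(1) r(2) le_trans[OF r(1) z(2)] r(3)] by blast
   have "EQ r' x z" using ih[OF r'(2)] leP(1)[OF r'(1)] EQ_mono[OF r(4) r'(1)] r'(4) by blast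
   then show "EX r c s. le r q&pair c s<:a&le r s&EQ r c z" using r' r(1) le_trans by blast
  qed
 qed
 then show ?thesis using assms by blast
qed

lemma EQ_dense: assumes p: "p<:P" and d: "!!q. le q p==>EX r. le r q&EQ r a b" shows "EQ p a b"
 unfolding EQ_iff[OF p]
proof (intro conjI allI impI)
 fix c s q assume a: "pair c s<:a" "le q p" "le q s"
 obtain r where r: "le r q" "EQ r a b" using d a by blast
 have "le r s" "le r r" using r a le_trans le_refl leP by blast+
 then show "EX r d u. le r q&pair d u<:b&le r u&EQ r c d" using EQ_fwd[OF r(2) a(1)] r(1) le_trans by blast
next
 fix d u q assume a: "pair d u<:b" "le q p" "le q u"
 obtain r where r: "le r q" "EQ r a b" using d a by blast
 have "le r u" "le r r" using r a le_trans le_refl leP by blast+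
 then show "EX r c s. le r q&pair c s<:a&le r s&EQ r c d" using EQ_bwd[OF r(2) a(1)] r(1) le_trans by blast
qed

lemma ME_mono: "ME p a b==>le q p==>ME q a b"
 unfolding ME_def using le_trans by blast

lemma ME_dense: assumes d: "!!q. le q p==>EX r. le r q&ME r a b" shows "ME p a b"
 unfolding ME_def
proof (intro allI impI)
 fix q assume "le q p"
 then obtain r where "le r q" "ME r a b" using d by blast
 then show "EX r d u. le r q&pair d u<:b&le r u&EQ r a d" unfolding ME_def using le_refl leP le_trans by meson
qed

lemma ME_cong1: assumes "ME p a b" "EQ p a a'" shows "ME p a' b"
 unfolding ME_def
proof (intro allI impI)
 fix q assume q: "le q p"
 then obtain r d u where r: "le r q" "pair d u<:b" "le r u" "EQ r a d" using assms(1) unfolding ME_def by blast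
 have "EQ r a a'" using EQ_mono assms(2) le_trans[OF r(1) q] by blast
 then have "EQ r a' d" using EQ_trans[OF EQ_sym r(4)] leP(1)[OF r(1)] by blast
 then show "EX r d u. le r q&pair d u<:b&le r u&EQ r a' d" using r by blast
qed

lemma ME_cong2: assumes "ME p a b" "EQ p b b'" shows "ME p a b'"
 unfolding ME_def
proof (intro allI impI)
 fix q assume q: "le q p"
 then obtain r d u where r: "le r q" "pair d u<:b" "le r u" "EQ r a d" using assms(1) unfolding ME_def by blast
 obtain r' d' u' where r': "le r' r" "pair d' u'<:b'" "le r' u'" "EQ r' d d'"
  using EQ_fwd[OF assms(2) r(2) le_trans[OF r(1) q] r(3)] by blast
 have "EQ r' a d'" using EQ_trans[OF EQ_mono[OF r(4) r'(1)] r'(4)] leP(1)[OF r'(1)] by blast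
 then show "EX r d u. le r q&pair d u<:b'&le r u&EQ r a d" using r' r(1) le_trans by blast
qed

lemma ME_member: assumes "pair d u<:b" "u<:P" shows "ME u d b"
 unfolding ME_def using assms le_refl leP EQ_refl by meson

text \<open>Every set of the model serves as a name, so the quantifier ranges over the whole
  universe. The atomic clauses are closed under density, and the other clauses pass this on, which
  is the content of \<open>fo_dense\<close>.\<close>

primrec fo :: "fm => U => (nat => U) => bool" where
 "fo (Mem i j) p e = ME p (e i) (e j)"
| "fo (Equ i j) p e = EQ p (e i) (e j)"
| "fo Bot p e = False"
| "fo (Imp A B) p e = (ALL q. le q p-->fo A q e-->fo B q e)"
| "fo (Forall A) p e = (ALL x. fo A p (case_nat x e))"

lemma fo_mono: "fo A p e==>le q p==>fo A q e"
proof (induction A arbitrary: p q e)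
 case (Mem i j)
 then show ?case unfolding fo.simps by (rule ME_mono)
next
 case (Equ i j)
 then show ?case unfolding fo.simps by (rule EQ_mono)
next
 case (Imp A B)
 then show ?case unfolding fo.simps using le_trans by blast
next
 case (Forall A)
 then show ?case unfolding fo.simps by blast
qed simp

lemma fo_dense: assumes "p<:P" "!!q. le q p==>EX r. le r q&fo A r e" shows "fo A p e"
 using assms
proof (induction A arbitrary: p e)
 case (Mem i j)
 show ?case unfolding fo.simps by (rule ME_dense) (use Mem.prems(2) in simp)
next
 case (Equ i j)
 show ?case unfolding fo.simps by (rule EQ_dense[OF Equ.prems(1)]) (use Equ.prems(2) in simp)
next
 case Bot
 then show ?case using le_refl by auto
next
 case (Imp A B)
 show ?case unfolding fo.simps
 proof (intro allI impI)
  fix q assume q: "le q p" "fo A q e"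
  show "fo B q e"
  proof (rule Imp.IH(2))
   show "q<:P" using q leP by blast
   fix q' assume q': "le q' q"
   then obtain r where r: "le r q'" "fo (Imp A B) r e" using Imp.prems(2) q(1) le_trans by blast
   have "fo A r e" using fo_mono q(2) q' r(1) le_trans by blast
   then show "EX r. le r q'&fo B r e" using r le_refl leP(1) by auto
  qed
 qed
next
 case (Forall A)
 show ?case unfolding fo.simps
 proof
  fix x
  show "fo A p (case_nat x e)" by (rule Forall.IH) (use Forall.prems in auto)
 qed
qed

lemma ev_dfn: "DfnT (%e. ev h e i)"
 by (cases "h i") (auto simp: ev_def intro: dfn)

text \<open>Definability of forcing, by an induction on formulas outside the model. The wiring
  \<open>h\<close> absorbs the environments that grow under quantifiers.\<close>

lemma fo_Dfn_ev: "Dfn (%e. fo A (e k) (ev h e))"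
proof (induction A arbitrary: k h)
 case (Mem i j)
 show ?case by (simp, intro dfn ev_dfn)
next
 case (Equ i j)
 show ?case by (simp, intro dfn ev_dfn)
next
 case Bot
 show ?case by (simp, intro dfn)
next
 case (Imp A B)
 have 1: "ev h (%i. e (Suc i)) = ev (%i. map_sum Suc id (h i)) e" for e
  by (rule ext) (auto simp: ev_def split: sum.split)
 show ?case unfolding fo.simps
  by (rule Dfn_all, intro dfn, unfold 1) (rule Imp.IH)+
next
 case (Forall A)
 have 1: "case_nat (e 0) (ev h (%i. e (Suc i))) = ev (case_nat (Inl 0) (%i. map_sum Suc id (h i))) e" for e
  by (rule ext) (auto simp: ev_def split: sum.split nat.split)
 show ?case unfolding fo.simps
  by (rule Dfn_all) (unfold 1, rule Forall.IH)
qed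

lemma fo_Dfn1: "Dfn (%e. fo A (e 0) \<rho>)"
 using fo_Dfn_ev[of A 0 "%i. Inr (\<rho> i)"] by (simp add: ev_def[abs_def])

lemma fo_Dfn2: "Dfn (%e. fo A (e 0) (case_nat (e (Suc 0)) \<rho>))"
proof -
 have "ev (case_nat (Inl (Suc 0)) (%i. Inr (\<rho> i))) e = case_nat (e (Suc 0)) \<rho>" for e
  by (rule ext) (auto simp: ev_def split: nat.split)
 then show ?thesis using fo_Dfn_ev[of A 0 "case_nat (Inl (Suc 0)) (%i. Inr (\<rho> i))"] by simp
qed

lemma fo_Dfn3: "Dfn (%e. fo A (e 0) (case_nat (e (Suc 0)) (case_nat (e (Suc (Suc 0))) \<rho>)))"
proof -
 have "ev (case_nat (Inl (Suc 0)) (case_nat (Inl (Suc (Suc 0))) (%i. Inr (\<rho> i)))) e = case_nat (e (Suc 0)) (case_nat (e (Suc (Suc 0))) \<rho>)" for e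
  by (rule ext) (auto simp: ev_def split: nat.split)
 then show ?thesis using fo_Dfn_ev[of A 0 "case_nat (Inl (Suc 0)) (case_nat (Inl (Suc (Suc 0))) (%i. Inr (\<rho> i)))"] by simp
qed

text \<open>Check names. Every condition is attached to every member, since no greatest condition is
  assumed.\<close>

definition chk :: "U => U" where "chk = Rec (%x f. cart (img (app f) x) P)"

lemma chk_dfn [dfn]: "DfnT s==>DfnT (%e. chk (s e))"
 unfolding chk_def by (rule DfnT1[of "Rec _"], intro dfn)

lemma chk: "z<:chk x<->(EX y p. y<:x&p<:P&z = pair (chk y) p)"
proof -
 let ?H = "%x f. cart (img (app f) x) P"
 have h: "DfnT (%e. ?H (e 0) (e (Suc 0)))" by (intro dfn)
 have d: "DfnT (%e. chk (e 0))" by (intro dfn)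
 have d': "DfnT (%e. app (lam x chk) (e 0))" by (intro dfn)
 have "img (app (lam x chk)) x = img chk x"
  by (rule seteq) (unfold img[OF d] img[OF d'], use lam_app[OF d] in metis)
 then have "chk x = cart (img chk x) P" using Rec_eq[OF h, of x] unfolding chk_def[symmetric] by simp
 then show ?thesis unfolding cart img[OF d] by (simp add: cart img[OF d]) blast
qed

text \<open>The countable type enumerates all sets of the model, so a descending sequence of
  conditions enters every dense one. A set that cannot be entered at its turn is passed
  over.\<close>

lemma generic_exists: assumes "p0<:P"
 shows "EX G. p0 : G&(ALL p:G. p<:P)&(ALL p:G. ALL q. le p q-->q : G) &
  (ALL p:G. ALL q:G. EX r:G. le r p&le r q) &
  (ALL D. (ALL p. p<:P-->(EX q. q<:D&le q p))-->(EX q:G. q<:D))"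
proof -
 define D :: "nat => U" where "D n = from_nat n" for n
 define nx where "nx n q = (if EX r. le r q&r<:D n then SOME r. le r q&r<:D n else q)" for n q
 define s where "s = rec_nat p0 nx"
 have s0: "s 0 = p0" and sS: "s (Suc n) = nx n (s n)" for n by (simp_all add: s_def)
 have nx: "le (nx n q) q&((EX r. le r q&r<:D n)-->nx n q<:D n)" if "q<:P" for n q
 proof (cases "EX r. le r q&r<:D n")
  case True
  from someI_ex[OF this] show ?thesis using True by (simp add: nx_def)
 qed (use that le_refl in \<open>auto simp: nx_def\<close>)
 have sP: "s n<:P" for n
 proof (induction n)
  case (Suc n)
  then show ?case unfolding sS using nx leP(1) by blast
 qed (use assms s0 in simp)
 have dec: "le (s n) (s m)" if "m \<le> n" for m n
  using that
 proof (induction rule: dec_induct)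
  case base
  then show ?case using sP le_refl by blast
 next
  case (step n)
  then show ?case using nx[OF sP[of n], of n] sS le_trans by metis
 qed
 define G where "G = {p. EX n. le (s n) p}"
 have "p0 : G" using le_refl[OF assms] s0 unfolding G_def by (metis mem_Collect_eq)
 moreover have "ALL p:G. p<:P" using leP by (auto simp: G_def)
 moreover have "ALL p:G. ALL q. le p q-->q : G" using le_trans by (auto simp: G_def)
 moreover have "ALL p:G. ALL q:G. EX r:G. le r p&le r q"
 proof (intro ballI)
  fix p q assume "p : G" "q : G"
  then obtain m n where mn: "le (s m) p" "le (s n) q" by (auto simp: G_def)
  let ?k = "max m n"
  have "le (s ?k) (s m)" "le (s ?k) (s n)" using dec by simp_all
  then have "le (s ?k) p" "le (s ?k) q" using mn le_trans by blast+
  moreover have "s ?k : G" using le_refl[OF sP] by (auto simp: G_def)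
  ultimately show "EX r:G. le r p&le r q" by blast
 qed
 moreover have "EX q:G. q<:C" if C: "ALL p. p<:P-->(EX q. q<:C&le q p)" for C
 proof -
  have "D (to_nat C) = C" by (simp add: D_def)
  then have "s (Suc (to_nat C))<:C" using nx[OF sP[of "to_nat C"], of "to_nat C"] C sP sS by metis
  moreover have "s (Suc (to_nat C)) : G" using le_refl[OF sP] unfolding G_def by blast
  ultimately show ?thesis by blast
 qed
 ultimately show ?thesis by blast
qed

end

section \<open>Generic filters and the truth lemma\<close>

locale generic = forcing +
 fixes G :: "U set"
 assumes GP: "p : G==>p<:P" and Gne: "G ~= {}" and Gup: "p : G==>le p q==>q : G"
  and Gdir: "p : G==>q : G==>EX r:G. le r p&le r q"
  and Gdense: "(!!p. p<:P==>EX q. q<:D&le q p)==>EX q:G. q<:D"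
begin

text \<open>Adding the conditions incompatible with \<open>p0\<close> makes the class dense
  everywhere, and the filter, containing \<open>p0\<close>, has no member incompatible with
  it.\<close>

lemma generic_below: assumes d: "Dfn (%e. C (e 0))" and p0: "p0 : G" and C: "!!p. le p p0==>EX q. le q p&C q"
 shows "EX q:G. C q&le q p0"
proof -
 let ?C = "%q. C q&le q p0 | ~(EX r. le r q&le r p0)"
 have d': "Dfn (%e. ?C (e 0))" by (intro dfn Dfn1[OF d])
 have "EX q:G. q<:sep P ?C"
 proof (rule Gdense)
  fix p assume p: "p<:P"
  show "EX q. q<:sep P ?C&le q p"
  proof (cases "EX r. le r p&le r p0")
   case True
   then obtain r where r: "le r p" "le r p0" by blast
   then obtain q where "le q r" "C q" using C by blast
   then show ?thesis using r le_trans leP unfolding sep[OF d'] by blast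
  next
   case False
   then show ?thesis using p le_refl unfolding sep[OF d'] by blast
  qed
 qed
 then obtain q where "q : G" "?C q" unfolding sep[OF d'] by blast
 then show ?thesis using Gdir p0 by blast
qed

lemma generic_dense: assumes d: "Dfn (%e. C (e 0))" and C: "!!p. p<:P==>EX q. le q p&C q"
 shows "EX q:G. C q"
proof -
 obtain p0 where "p0 : G" using Gne by blast
 from generic_below[OF d this] show ?thesis using C leP by blast
qed

text \<open>For implications and quantifiers, the conditions that force the formula or force a
  definite reason against it are dense and definable, so the filter contains one.\<close>

lemma truth: "satq (%a b. EX p:G. ME p a b) (%a b. EX p:G. EQ p a b) e A<->(EX p:G. fo A p e)"
proof (induction A arbitrary: e)
 case (Imp A B)
 show ?case
 proof
  assume "EX p:G. fo (Imp A B) p e"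
  then obtain p where p: "p : G" "fo (Imp A B) p e" by blast
  have "EX q:G. fo B q e" if q: "q : G" "fo A q e" for q
  proof -
   obtain r where r: "r : G" "le r p" "le r q" using Gdir p q by blast
   have "fo A r e" using fo_mono[OF q(2) r(3)] .
   then show ?thesis using p(2) r by auto
  qed
  then show "satq (%a b. EX p:G. ME p a b) (%a b. EX p:G. EQ p a b) e (Imp A B)" using Imp by auto
 next
  assume s: "satq (%a b. EX p:G. ME p a b) (%a b. EX p:G. EQ p a b) e (Imp A B)"
  let ?C = "%p. fo (Imp A B) p e | (fo A p e&(ALL q. le q p-->~fo B q e))"
  have d: "Dfn (%e'. ?C (e' 0))" by (intro dfn fo_Dfn1 Dfn1[OF fo_Dfn1])
  have "EX q:G. ?C q"
  proof (rule generic_dense[OF d])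
   fix p assume p: "p<:P"
   show "EX q. le q p&?C q"
   proof (cases "fo (Imp A B) p e")
    case True
    then show ?thesis using le_refl[OF p] by blast
   next
    case False
    then obtain q where q: "le q p" "fo A q e" "~fo B q e" by auto
    then obtain r where r: "le r q" "!!r'. le r' r==>~fo B r' e" using fo_dense[of q B e] leP by blast
    then have "fo A r e" using fo_mono q by blast
    then show ?thesis using r q le_trans by blast
   qed
  qed
  then obtain q where q: "q : G" "?C q" by blast
  have "~(fo A q e&(ALL r. le r q-->~fo B r e))"
  proof
   assume a: "fo A q e&(ALL r. le r q-->~fo B r e)"
   then obtain r where "r : G" "fo B r e" using s Imp q(1) by auto
   then obtain r' where "r' : G" "le r' r" "le r' q" using Gdir q by blast
   then show False using a fo_mono \<open>fo B r e\<close> by blast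
  qed
  then show "EX p:G. fo (Imp A B) p e" using q by blast
 qed
next
 case (Forall A)
 show ?case
 proof
  assume "EX p:G. fo (Forall A) p e"
  then show "satq (%a b. EX p:G. ME p a b) (%a b. EX p:G. EQ p a b) e (Forall A)" using Forall by auto
 next
  assume s: "satq (%a b. EX p:G. ME p a b) (%a b. EX p:G. EQ p a b) e (Forall A)"
  let ?C = "%p. fo (Forall A) p e | (EX x. ALL q. le q p-->~fo A q (case_nat x e))"
  have d0: "Dfn (%e'. fo A (e' 0) (case_nat (e' (Suc 0)) e))" by (rule fo_Dfn2)
  have d: "Dfn (%e'. ?C (e' 0))"
   by (intro dfn Dfn1[OF fo_Dfn1] Dfn2[OF d0, of "%e. e 0" "%e. e (Suc 0)"])
  have "EX q:G. ?C q"
  proof (rule generic_dense[OF d])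
   fix p assume p: "p<:P"
   show "EX q. le q p&?C q"
   proof (cases "fo (Forall A) p e")
    case True
    then show ?thesis using le_refl[OF p] by blast
   next
    case False
    then obtain x where "~fo A p (case_nat x e)" by auto
    then obtain q where "le q p" "!!r. le r q==>~fo A r (case_nat x e)" using fo_dense[OF p] by blast
    then show ?thesis by blast
   qed
  qed
  then obtain q where q: "q : G" "?C q" by blast
  have "~(ALL r. le r q-->~fo A r (case_nat x e))" for x
  proof
   assume a: "ALL r. le r q-->~fo A r (case_nat x e)"
   obtain r where "r : G" "fo A r (case_nat x e)" using s Forall by auto
   then obtain r' where "r' : G" "le r' r" "le r' q" using Gdir q by blast
   then show False using a fo_mono \<open>fo A r (case_nat x e)\<close> by blast
  qed
  then show "EX p:G. fo (Forall A) p e" using q by blast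
 qed
qed simp_all

text \<open>Singletons and the empty set have names, so forced equality has infinitely many classes
  and the extension lives on \<open>U\<close> again.\<close>

lemma extension_quotient:
 "EX (v :: U => U) E'. surj v&(ALL a b. v a = v b<->(EX p:G. EQ p a b))&(ALL a b. E' (v a) (v b)<->(EX p:G. ME p a b))"
proof -
 let ?Q = "%a b. EX p:G. EQ p a b" and ?R = "%a b. EX p:G. ME p a b"
 have Q: "equivp ?Q"
 proof (rule equivpI)
  show "reflp ?Q" using Gne GP EQ_refl by (intro reflpI) blast
  show "symp ?Q" using EQ_sym GP by (intro sympI) blast
  show "transp ?Q"
  proof (rule transpI)
   fix a b c assume "?Q a b" "?Q b c"
   then obtain p q where "p : G" "EQ p a b" "q : G" "EQ q b c" by blast
   then obtain r where "r : G" "EQ r a b" "EQ r b c" using Gdir EQ_mono by metis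
   then show "?Q a c" using EQ_trans GP by blast
  qed
 qed
 have R: "?R b d" if h: "?Q a b" "?Q c d" "?R a c" for a b c d
 proof -
  obtain p q s where p: "p : G" "EQ p a b" "q : G" "EQ q c d" "s : G" "ME s a c" using h by blast
  then obtain r where r: "r : G" "le r p" "le r q" using Gdir by blast
  then obtain r' where r': "r' : G" "le r' r" "le r' s" using Gdir p by blast
  have "EQ r' a b" "EQ r' c d" "ME r' a c" using p r r' EQ_mono ME_mono le_trans by blast+
  then show ?thesis using r'(1) ME_cong1 ME_cong2 by blast
 qed
 have s: "EX p. ALL z. ?R z p<->?Q z x" for x
 proof (intro exI allI)
  fix z
  show "?R z (cart (upair x x) P)<->?Q z x"
  proof
   assume "?R z (cart (upair x x) P)"
   then obtain p where p: "p : G" "ME p z (cart (upair x x) P)" by blast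
   have d: "Dfn (%e. EQ (e 0) z x)" by (intro dfn)
   have "EX q:G. EQ q z x&le q p"
    by (rule generic_below[OF d p(1)]) (use p(2) in \<open>auto simp: ME_def\<close>)
   then show "?Q z x" by blast
  next
   assume "?Q z x"
   then obtain p where p: "p : G" "EQ p z x" by blast
   have "ME p x (cart (upair x x) P)" using GP p by (intro ME_member) auto
   then show "?R z (cart (upair x x) P)" using p ME_cong1 EQ_sym GP by blast
  qed
 qed
 have e: "~?R z emp" for z
  using le_refl GP by (auto simp: ME_def)
 have inf: "infinite (range ?Q)" by (rule infinite_quotient[of ?Q ?R]) (use Q R s e in blast)+
 have "EX (v :: U => U) E'. surj v&(ALL a b. ?Q a b<->v a = v b)&(ALL a b. ?R a b<->E' (v a) (v b))"
  by (rule quotient_structure[OF Q _ inf]) (use R in blast)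
 then show ?thesis by metis
qed

end

lemma sat_closure: "(!!e. sat E e p)==>sat E e (closure p)"
proof -
 assume "!!e. sat E e p"
 then have "sat E e ((Forall ^^ n) p)" for n e by (induction n arbitrary: e) auto
 then show ?thesis by (simp add: closure_def)
qed

section \<open>The axioms of set theory in a generic extension\<close>

locale ext = generic +
 fixes v :: "U => U" and E' :: "U => U => bool"
 assumes v_surj: "surj v" and v_eq: "v a = v b<->(EX p:G. EQ p a b)" and v_mem: "E' (v a) (v b)<->(EX p:G. ME p a b)"
begin

lemma sat_ext: "sat E' (%i. v (e i)) A<->(EX p:G. fo A p e)"
 using truth[of e A] satq_quotient[of v "%a b. EX p:G. EQ p a b" "%a b. EX p:G. ME p a b" E' e A] v_surj v_eq v_mem by simp

lemma v_ex: "EX a. x = v a" using v_surj by (metis surjD)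

lemma env_ex: "EX \<rho>. e = (%i. v (\<rho> i))"
 using v_ex by (intro exI[of _ "%i. SOME a. e i = v a"] ext) (metis (mono_tags, lifting) someI_ex)

lemma v_case: "(%i. v (case_nat d \<rho> i)) = case_nat (v d) (%i. v (\<rho> i))"
 by (rule ext) (auto split: nat.split)

lemma v_elems: "E' y (v b)<->(EX d u. pair d u<:b&u : G&y = v d)"
proof
 assume y: "E' y (v b)"
 obtain a where a: "y = v a" using v_ex by blast
 obtain p where p: "p : G" "ME p a b" using y v_mem a by blast
 have d: "Dfn (%e. EX d u. pair d u<:b&le (e 0) u&EQ (e 0) a d)" by (intro dfn)
 have "EX r:G. (EX d u. pair d u<:b&le r u&EQ r a d)&le r p"
  by (rule generic_below[OF d p(1)]) (use p(2) in \<open>unfold ME_def, blast\<close>)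
 then show "EX d u. pair d u<:b&u : G&y = v d" using a v_eq Gup by blast
next
 assume "EX d u. pair d u<:b&u : G&y = v d"
 then show "E' y (v b)" using ME_member GP v_mem by blast
qed

text \<open>Densely often a condition forces equality, or it puts a member into one name and keeps
  it out of the other. The second kind is impossible in the filter when the elements are the
  same.\<close>

lemma N_ext: assumes "!!z. E' z x<->E' z y" shows "x = y"
proof -
 obtain a b where ab: "x = v a" "y = v b" using v_ex by blast
 let ?D = "%p a b. EX c s. pair c s<:a&le p s&(ALL q. le q p-->~ME q c b)"
 have d: "Dfn (%e. EQ (e 0) a b | ?D (e 0) a b | ?D (e 0) b a)" by (intro dfn)
 have nME: "EX q'. le q' q&(ALL r. le r q'-->~ME r c b)" if h: "le q q" "~(EX r d u. le r q&pair d u<:b&le r u&EQ r c d)" for q c b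
 proof (rule ccontr)
  assume "~?thesis"
  then obtain r where r: "le r q" "ME r c b" using h(1) by blast
  then obtain r' d u where "le r' r" "pair d u<:b" "le r' u" "EQ r' c d" using le_refl leP(1) unfolding ME_def by blast
  then show False using h(2) r(1) le_trans by blast
 qed
 have "EX q:G. EQ q a b | ?D q a b | ?D q b a"
 proof (rule generic_dense[OF d])
  fix p assume p: "p<:P"
  show "EX q. le q p&(EQ q a b | ?D q a b | ?D q b a)"
  proof (cases "EQ p a b")
   case True
   then show ?thesis using le_refl[OF p] by blast
  next
   case False
   then consider c s q where "pair c s<:a" "le q p" "le q s" "~(EX r d u. le r q&pair d u<:b&le r u&EQ r c d)"
    | c s q where "pair c s<:b" "le q p" "le q s" "~(EX r d u. le r q&pair d u<:a&le r u&EQ r d c)"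
    unfolding EQ_iff[OF p] by blast
   then show ?thesis
   proof cases
    case (1 c s q)
    obtain q' where "le q' q" "ALL r. le r q'-->~ME r c b" using nME[OF _ 1(4)] le_refl leP 1(2) by blast
    then show ?thesis using 1 le_trans by blast
   next
    case (2 c s q)
    have "~(EX r d u. le r q&pair d u<:a&le r u&EQ r c d)" using 2(4) EQ_sym leP by blast
    then obtain q' where "le q' q" "ALL r. le r q'-->~ME r c a" using nME[of q a c] le_refl leP 2(2) by blast
    then show ?thesis using 2 le_trans by blast
   qed
  qed
 qed
 then obtain q where q: "q : G" "EQ q a b | ?D q a b | ?D q b a" by blast
 have nD: "~?D q a b" if h: "!!z. E' z (v a)==>E' z (v b)" for a b
 proof
  assume "?D q a b"
  then obtain c s where c: "pair c s<:a" "le q s" "!!r. le r q==>~ME r c b" by blast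
  then have "E' (v c) (v a)" using v_elems Gup q(1) by blast
  then obtain p where "p : G" "ME p c b" using h v_mem by blast
  then show False using c(3) Gdir[OF q(1)] ME_mono by blast
 qed
 have "EQ q a b" using q(2) nD[of a b] nD[of b a] assms ab by blast
 then show ?thesis using q(1) v_eq ab by blast
qed

text \<open>The minimal element is the value of a name of least rank. Ranks of names in the
  extension may have no least one from outside, so the minimum is taken in the ground model, over
  all names forced in by extensions of a condition.\<close>

lemma N_foundation: assumes "E' y x" shows "EX m. E' m x&(ALL z. E' z m-->~E' z x)"
proof -
 obtain a where a: "x = v a" using v_ex by blast
 obtain c0 where c0: "y = v c0" using v_ex by blast
 obtain p0 where p0: "p0 : G" "ME p0 c0 a" using assms a c0 v_mem by blast
 let ?C = "%q. EX c. ME q c a&(ALL d r. rk d<:rk c-->le r q-->~ME r d a)"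
 have d: "Dfn (%e. ?C (e 0))" by (intro dfn)
 have "EX q:G. ?C q&le q p0"
 proof (rule generic_below[OF d p0(1)])
  fix p assume p: "le p p0"
  have dr: "Dfn (%e. EX c q. rk c = e 0&le q p&ME q c a)" by (intro dfn)
  have "EX c q. rk c = rk c0&le q p&ME q c a" using p ME_mono[OF p0(2)] le_refl leP by blast
  then obtain b where b: "Ord b" "EX c q. rk c = b&le q p&ME q c a" "!!b'. b'<:b==>~(EX c q. rk c = b'&le q p&ME q c a)"
   using Ord_least[OF dr Ord_rk] by blast
  then obtain c q where "rk c = b" "le q p" "ME q c a" by blast
  then show "EX q. le q p&?C q" using b(3) le_trans by blast
 qed
 then obtain q c where q: "q : G" "ME q c a" "!!d r. rk d<:rk c==>le r q==>~ME r d a" by blast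
 have "~E' z x" if z: "E' z (v c)" for z
 proof
  assume zx: "E' z x"
  obtain d u where du: "pair d u<:c" "z = v d" using z v_elems by blast
  then obtain p where p: "p : G" "ME p d a" using zx a v_mem by blast
  obtain r where "le r q" "le r p" using Gdir q(1) p(1) by blast
  then show False using q(3)[OF rk_pair[OF du(1)]] ME_mono p(2) by blast
 qed
 moreover have "E' (v c) x" using q a v_mem by blast
 ultimately show ?thesis by blast
qed

lemma N_upair: "E' z (v (cart (upair a b) P))<->z = v a | z = v b"
 using Gne GP by (auto simp: v_elems)

lemma N_union: "EX u. ALL z. E' z u<->(EX y. E' y F&E' z y)"
proof -
 obtain a where a: "F = v a" using v_ex by blast
 let ?Q = "%z. EX c p b s t. z = pair c p&pair b s<:a&pair c t<:b&le p s&le p t"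
 have d: "Dfn (%e. ?Q (e 0))" by (intro dfn)
 \<comment> \<open>Components lie two levels below the pair, so a name of a member of a member of
   \<open>F\<close> is found in the fifth union of \<open>a\<close>.\<close>
 let ?n = "sep (cart (Uni (Uni (Uni (Uni (Uni a))))) P) ?Q"
 have n: "pair c p<:?n<->(EX b s t. pair b s<:a&pair c t<:b&le p s&le p t)" for c p
 proof -
  have "c<:Uni (Uni (Uni (Uni (Uni a))))" if "pair b s<:a" "pair c t<:b" for b s t
  proof -
   have b: "b<:Uni (Uni a)" using pair_in_UniUni that(1) by blast
   have "c<:Uni (Uni b)" using pair_in_UniUni that(2) by blast
   then obtain y where y: "y<:Uni b" "c<:y" unfolding Uni[of c] by blast
   then obtain z where z: "z<:b" "y<:z" unfolding Uni[of y] by blast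
   have "z<:Uni (Uni (Uni a))" unfolding Uni[of z] using b z by blast
   then have "y<:Uni (Uni (Uni (Uni a)))" unfolding Uni[of y] using z by blast
   then show ?thesis unfolding Uni[of c] using y by blast
  qed
  then show ?thesis unfolding sep[OF d] using leP(1) by auto
 qed
 have "E' z (v ?n)<->(EX y. E' y F&E' z y)" for z
 proof
  assume "E' z (v ?n)"
  then obtain c p b s t where c: "z = v c" "p : G" "pair b s<:a" "pair c t<:b" "le p s" "le p t"
   unfolding v_elems[of z] n by blast
  have "s : G" "t : G" using c Gup by blast+
  then have "E' (v b) (v a)" "E' z (v b)" unfolding v_elems using c by blast+
  then show "EX y. E' y F&E' z y" unfolding a by blast
 next
  assume "EX y. E' y F&E' z y"
  then obtain b s c t where b: "pair b s<:a" "s : G" "pair c t<:b" "t : G" "z = v c"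
   unfolding a using v_elems by metis
  obtain p where "p : G" "le p s" "le p t" using Gdir b by blast
  then show "E' z (v ?n)" unfolding v_elems[of z] n using b by blast
 qed
 then show ?thesis by blast
qed

lemma N_separation: "EX b. ALL x. E' x b<->E' x a&sat E' (case_nat x e) A"
proof -
 obtain a0 \<rho> where a: "a = v a0" "e = (%i. v (\<rho> i))" using v_ex env_ex by blast
 let ?Q = "%z. EX c q s. z = pair c q&pair c s<:a0&le q s&fo A q (case_nat c \<rho>)"
 have d: "Dfn (%e. ?Q (e 0))" by (intro dfn Dfn2[OF fo_Dfn2])
 let ?n = "sep (cart (dm a0) P) ?Q"
 have n: "pair c q<:?n<->(EX s. pair c s<:a0&le q s&fo A q (case_nat c \<rho>))" for c q
  unfolding sep[OF d] using leP(1) by (auto simp: dm)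
 have s: "sat E' (case_nat (v c) e) A<->(EX p:G. fo A p (case_nat c \<rho>))" for c
  using sat_ext[of "case_nat c \<rho>" A] by (simp add: v_case a)
 have "E' x (v ?n)<->E' x a&sat E' (case_nat x e) A" for x
 proof
  assume "E' x (v ?n)"
  then obtain c q s' where "pair c s'<:a0" "le q s'" "fo A q (case_nat c \<rho>)" "q : G" "x = v c" unfolding v_elems n by blast
  then show "E' x a&sat E' (case_nat x e) A" using s a v_elems Gup by blast
 next
  assume h: "E' x a&sat E' (case_nat x e) A"
  then obtain c s' where c: "pair c s'<:a0" "s' : G" "x = v c" unfolding a v_elems by blast
  then obtain p where "p : G" "fo A p (case_nat c \<rho>)" using h s by blast
  then obtain q where "q : G" "le q s'" "fo A q (case_nat c \<rho>)" using c Gdir fo_mono by metis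
  then show "E' x (v ?n)" unfolding v_elems n using c by blast
 qed
 then show ?thesis by blast
qed

text \<open>Every subset of \<open>x\<close> is the value of a name inside the product of
  \<open>dm a\<close> and \<open>P\<close>, attaching to each \<open>d\<close> the conditions that
  force it into the subset. So the power set of that product in the ground model has enough
  names.\<close>

lemma N_power: "EX u. ALL y. E' y u<->(ALL z. E' z y-->E' z x)"
proof -
 obtain a where a: "x = v a" using v_ex by blast
 let ?A = "Forall (Imp (Mem 0 1) (Mem 0 2))"
 have s: "(ALL z. E' z (v c)-->E' z x)<->(EX p:G. fo ?A p (case_nat c (%_. a)))" for c
  unfolding sat_ext[symmetric] v_case a by (simp add: numeral_2_eq_2)
 let ?Q = "%z. EX c q. z = pair c q&fo ?A q (case_nat c (%_. a))"
 have d: "Dfn (%e. ?Q (e 0))" by (intro dfn Dfn2[OF fo_Dfn2])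
 let ?n = "sep (cart (pw (cart (dm a) P)) P) ?Q"
 have n: "pair c q<:?n<->c<<=cart (dm a) P&q<:P&fo ?A q (case_nat c (%_. a))" for c q
  unfolding sep[OF d] by auto
 have "E' y (v ?n)<->(ALL z. E' z y-->E' z x)" for y
 proof
  assume "E' y (v ?n)"
  then obtain c q where "fo ?A q (case_nat c (%_. a))" "q : G" "y = v c" unfolding v_elems n by blast
  then show "ALL z. E' z y-->E' z x" using s by blast
 next
  assume y: "ALL z. E' z y-->E' z x"
  obtain c where c: "y = v c" using v_ex by blast
  let ?T = "%z. EX d q. z = pair d q&ME q d c"
  have dT: "Dfn (%e. ?T (e 0))" by (intro dfn)
  let ?c = "sep (cart (dm a) P) ?T"
  have c': "pair d q<:?c<->d<:dm a&q<:P&ME q d c" for d q unfolding sep[OF dT] by auto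
  have "v ?c = y"
  proof (rule N_ext)
   fix z show "E' z (v ?c)<->E' z y"
   proof
    assume "E' z (v ?c)"
    then show "E' z y" unfolding v_elems c' c using v_mem[of _ c] v_elems by metis
   next
    assume z: "E' z y"
    then obtain d u where d: "pair d u<:a" "z = v d" using y a v_elems by blast
    then obtain p where "p : G" "ME p d c" using z c v_mem by blast
    then show "E' z (v ?c)" unfolding v_elems c' using d dm GP by blast
   qed
  qed
  then have "ALL z. E' z (v ?c)-->E' z x" using y by simp
  then obtain p where "p : G" "fo ?A p (case_nat ?c (%_. a))" using s[of ?c] by blast
  moreover have "?c<<=cart (dm a) P" unfolding sub_def sep[OF dT] by blast
  ultimately show "E' y (v ?n)" unfolding v_elems n using GP \<open>v ?c = y\<close> by blast
 qed
 then show ?thesis by blast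
qed

text \<open>Collection in the ground model confines names of values, over all pairs of a member name
  and a condition. Functionality identifies the actual value with that of a collected name.\<close>

lemma N_replacement: assumes f: "!!x y z. E' x a==>sat E' (case_nat x (case_nat y e)) A==>sat E' (case_nat x (case_nat z e)) A==>y = z"
 shows "EX b. ALL y. E' y b<->(EX x. E' x a&sat E' (case_nat x (case_nat y e)) A)"
proof -
 obtain a0 \<rho> where a: "a = v a0" "e = (%i. v (\<rho> i))" using v_ex env_ex by blast
 let ?F = "%q c y. fo A q (case_nat c (case_nat y \<rho>))"
 have s: "sat E' (case_nat (v c) (case_nat (v y) e)) A<->(EX p:G. ?F p c y)" for c y
  using sat_ext[of "case_nat c (case_nat y \<rho>)" A] by (simp add: v_case a)
 have dC: "Dfn (%e. ?F (p2 (e 0)) (p1 (e 0)) (e (Suc 0)))" by (intro Dfn3[OF fo_Dfn3] dfn)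
 obtain B where B: "!!z. z<:cart (dm a0) P==>EX y. ?F (p2 z) (p1 z) y==>EX y. y<:B&?F (p2 z) (p1 z) y"
  using collection[OF dC, of "cart (dm a0) P"] by blast
 let ?Q = "%z. EX y q c s. z = pair y q&pair c s<:a0&le q s&?F q c y"
 have d: "Dfn (%e. ?Q (e 0))" by (intro dfn Dfn3[OF fo_Dfn3])
 let ?n = "sep (cart B P) ?Q"
 have n: "pair y q<:?n<->y<:B&(EX c s. pair c s<:a0&le q s&?F q c y)" for y q
  unfolding sep[OF d] using leP(1) by auto
 have "E' y (v ?n)<->(EX x. E' x a&sat E' (case_nat x (case_nat y e)) A)" for y
 proof
  assume "E' y (v ?n)"
  then obtain y0 q c t where "pair c t<:a0" "le q t" "?F q c y0" "q : G" "y = v y0" unfolding v_elems n by blast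
  then show "EX x. E' x a&sat E' (case_nat x (case_nat y e)) A" using s a v_elems Gup by blast
 next
  assume "EX x. E' x a&sat E' (case_nat x (case_nat y e)) A"
  then obtain x where x: "E' x a" "sat E' (case_nat x (case_nat y e)) A" by blast
  obtain c t where c: "pair c t<:a0" "t : G" "x = v c" using x(1) unfolding a v_elems by blast
  obtain y0 where y0: "y = v y0" using v_ex by blast
  obtain p where p: "p : G" "?F p c y0" using x(2) s c(3) y0 by blast
  obtain q where q: "q : G" "le q t" "le q p" using Gdir c(2) p(1) by blast
  have "?F q c y0" using p(2) q(3) fo_mono by blast
  then have "EX y. y<:B&?F q c y" using B[of "pair c q"] c(1) GP[OF q(1)] unfolding p1 p2 cart_pair dm by blast
  then obtain y1 where y1: "y1<:B" "?F q c y1" by blast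
  then have "sat E' (case_nat x (case_nat (v y1) e)) A" using s c(3) q(1) by blast
  then have "y = v y1" using f[OF x(1) x(2)] by blast
  then show "E' y (v ?n)" unfolding v_elems n using y1 c q by blast
 qed
 then show ?thesis by blast
qed

lemma v_chk: "E' y (v (chk x))<->(EX z. z<:x&y = v (chk z))"
 unfolding v_elems chk using Gne GP by auto

lemma N_infinity: "EX I. (EX z. E' z I&(ALL y. ~E' y z))&(ALL x. E' x I-->(EX s. E' s I&(ALL y. E' y s<->E' y x | y = x)))"
proof (rule exI[of _ "v (chk om)"], intro conjI allI impI)
 show "EX z. E' z (v (chk om))&(ALL y. ~E' y z)"
  by (rule exI[of _ "v (chk emp)"]) (unfold v_chk, use emp_om emp in blast)
 fix x assume "E' x (v (chk om))"
 then obtain n where n: "n<:om" "x = v (chk n)" unfolding v_chk by blast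
 show "EX s. E' s (v (chk om))&(ALL y. E' y s<->E' y x | y = x)"
  by (rule exI[of _ "v (chk (sc n))"]) (unfold v_chk n(2), use n(1) sc_om sc in blast)
qed

lemma zf_N: "zf E'"
proof
 fix p e assume "p : ZF"
 then consider "p = Extensionality 0" | "p = Foundation 0" | "p = Pairing 0" | "p = Union_ax 0" | "p = Powerset 0" | "p = Infinity 0"
  | A where "p = closure (Separation A 0)" | A where "p = closure (Replacement A 0)"
  unfolding ZF_def by blast
 then show "sat E' e p"
 proof cases
  case 1
  then show ?thesis using N_ext by (auto simp: Extensionality_def)
 next
  case 2
  then show ?thesis using N_foundation by (simp add: Foundation_def) meson
 next
  case 3
  have "EX p. ALL z. E' z p<->z = x | z = y" for x y using v_ex[of x] v_ex[of y] N_upair by blast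
  then show ?thesis using 3 by (simp add: Pairing_def)
 next
  case 4
  then show ?thesis using N_union by (simp add: Union_ax_def)
 next
  case 5
  then show ?thesis using N_power by (simp add: Powerset_def subset_f_def)
 next
  case 6
  then show ?thesis using N_infinity by (simp add: Infinity_def is_succ_def)
 next
  case 7
  have "sat E' e (Separation A 0)" for e using N_separation by (simp add: Separation_def)
  then show ?thesis using 7 sat_closure by blast
 next
  case 8
  have "sat E' e (Replacement A 0)" for e
   using N_replacement[of _ e A] by (simp add: Replacement_def)
  then show ?thesis using 8 sat_closure by blast
 qed
qed

sublocale N: zf E' by (rule zf_N)

lemma chk_inj0: assumes "p<:P" "EQ p (chk a) (chk b)" shows "a = b"
proof -
 have d: "Dfn (%e. ALL p b. p<:P-->EQ p (chk (e 0)) (chk b)-->e 0 = b)" by (intro dfn)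
 have "ALL p b. p<:P-->EQ p (chk a) (chk b)-->a = b"
 proof (rule eps_induct[OF d], intro allI impI, rule seteq, rule iffI)
  fix a p b z assume ih: "!!y. y<:a==>ALL p b. p<:P-->EQ p (chk y) (chk b)-->y = b" and p: "p<:P" and e: "EQ p (chk a) (chk b)"
  {
   assume z: "z<:a"
   then have "pair (chk z) p<:chk a" using p chk by blast
   from EQ_fwd[OF e this le_refl[OF p] le_refl[OF p]]
   obtain r d u where "le r p" "pair d u<:chk b" "EQ r (chk z) d" by blast
   then show "z<:b" using ih[OF z] leP(1) unfolding chk by auto
  next
   assume z: "z<:b"
   then have "pair (chk z) p<:chk b" using p chk by blast
   from EQ_bwd[OF e this le_refl[OF p] le_refl[OF p]]
   obtain r d u where r: "le r p" "pair d u<:chk a" "EQ r d (chk z)" by blast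
   then obtain y where "y<:a" "d = chk y" unfolding chk by auto
   then show "z<:a" using ih[of y] leP(1)[OF r(1)] r(3) by auto
  }
 qed
 then show ?thesis using assms by blast
qed

lemma chk_inj: "v (chk a) = v (chk b)<->a = b"
 using v_eq chk_inj0 GP by blast

text \<open>The ground model well-orders a set of names for all elements of elements of
  \<open>F\<close>. The evaluated enumeration \<open>h\<close> is a set of the extension, and each
  member of \<open>F\<close> is sent to its element of least index.\<close>

lemma N_choice: "sat E' e (Choice 0)"
proof -
 have "EX u f. N.fn f F u&(ALL x. E' x F-->(ALL y. E' (N.pair x y) f-->E' y x))" if ne: "!!x. E' x F==>EX y. E' y x" for F
 proof -
  obtain a0 where a: "F = v a0" using v_ex by blast
  have ddm: "DfnT (%e. dm (e 0))" by (intro dfn)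
  let ?D = "Uni (img dm (dm a0))"
  obtain \<theta> g where t: "Ord \<theta>" "bij g \<theta> ?D" using wellordering by blast
  define upn where "upn a b = cart (upair a b) P" for a b
  define opn where "opn a b = upn (upn a a) (upn a b)" for a b
  have upn: "v (upn a b) = N.upair (v a) (v b)" for a b unfolding upn_def by (rule N_ext) (simp add: N_upair)
  have opn: "v (opn a b) = N.pair (v a) (v b)" for a b unfolding opn_def upn N.pair_def ..
  have dop: "DfnT (%e. opn (chk (e 0)) (app g (e 0)))" unfolding opn_def upn_def by (intro dfn)
  define h where "h = v (cart (img (%\<alpha>. opn (chk \<alpha>) (app g \<alpha>)) \<theta>) P)"
  have h: "E' z h<->(EX \<alpha>. \<alpha><:\<theta> & z = N.pair (v (chk \<alpha>)) (v (app g \<alpha>)))" for z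
   unfolding h_def v_elems cart_pair img[OF dop] opn[symmetric] using Gne GP by blast
  have happ: "N.app h (v (chk \<alpha>)) = v (app g \<alpha>)" if "\<alpha><:\<theta>" for \<alpha>
   unfolding N.app_def by (rule N.des_eq) (use that h chk_inj in auto)
  let ?T = "v (chk \<theta>)"
  let ?R = "%x y. EX \<beta>. E' \<beta> ?T&y = N.app h \<beta> & E' y x&(ALL \<gamma>. E' \<gamma> \<beta> --> ~(E' \<gamma> ?T&E' (N.app h \<gamma>) x))"
  have dR: "N.Dfn (%e. ?R (e 0) (e (Suc 0)))" by (intro dfn)
  let ?c = "%x. N.des (?R x)"
  have dc: "N.DfnT (%e. ?c (e 0))" by (intro dfn)
  have c: "E' (?c x) x" if x: "E' x F" for x
  proof -
   obtain b s where b: "pair b s<:a0" "x = v b" using x unfolding a v_elems by blast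
   obtain y where "E' y x" using ne x by blast
   then obtain d u where d: "pair d u<:b" "y = v d" "E' (v d) x" unfolding b v_elems by blast
   have "d<:?D" unfolding Uni img[OF ddm] using b d dm by blast
   then obtain \<alpha> where al: "\<alpha><:\<theta>" "app g \<alpha> = d" using t(2) unfolding bij_def by blast
   have dS: "N.Dfn (%e. E' (N.app h (e 0)) x)" by (intro dfn)
   let ?S = "N.sep ?T (%\<beta>. E' (N.app h \<beta>) x)"
   have S: "E' (v (chk \<alpha>)) ?S" unfolding N.sep[OF dS] v_chk using al happ d by auto
   from N.foundation[OF S] obtain m where m: "E' m ?T" "E' (N.app h m) x" "!!z. E' z m==>~(E' z ?T&E' (N.app h z) x)"
    unfolding N.sep[OF dS] by blast
   have "?c x = N.app h m"
   proof (rule N.des_eq)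
    show "?R x (N.app h m)" using m by blast
    fix y assume "?R x y"
    then obtain \<beta> where be: "E' \<beta> ?T" "y = N.app h \<beta>" "E' y x" "!!\<gamma>. E' \<gamma> \<beta> ==> ~(E' \<gamma> ?T&E' (N.app h \<gamma>) x)" by blast
    obtain i k where ik: "i<:\<theta>" "m = v (chk i)" "k<:\<theta>" "\<beta> = v (chk k)" using m(1) be(1) unfolding v_chk by blast
    have "~i<:k" using be(4)[of m] m ik v_chk by blast
    moreover have "~k<:i" using m(3)[of \<beta>] be ik v_chk by blast
    ultimately have "i = k" using ik t(1) Ord_linear Ord_mem by blast
    then show "y = N.app h m" using be ik by simp
   qed
   then show ?thesis using m by simp
  qed
  have f: "N.fn (N.lam F ?c) F (N.img ?c F)" by (rule N.lam_fn[OF dc]) (unfold N.img[OF dc], blast)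
  moreover have "E' y x" if "E' x F" "E' (N.pair x y) (N.lam F ?c)" for x y
   using that c unfolding N.lam_mem[OF dc] by auto
  ultimately show ?thesis by blast
 qed
 then show ?thesis by (simp add: Choice_def)
qed

lemma zfc_N: "zfc E'"
 by (intro zfc.intro zf_N zfc_axioms.intro) (rule N_choice)

end

text \<open>From here on the extension is reached only through the embedding \<open>j\<close>, the
  evaluation of names for sets of ground model elements, and the relation \<open>T\<close> between
  elements and conditions that describes a subset of \<open>j a\<close>, closed under strengthening
  and under density.\<close>

locale gext = generic + N: zfc E' for E' :: "U => U => bool" +
 fixes j :: "U => U"
 assumes j_mem: "E' y (j x)<->(EX z. z<:x&y = j z)"
  and j_eq [simp]: "j x = j y<->x = y"
  and j_real: "EX S. ALL y. E' y S<->(EX x p. p : G&pair x p<:T&y = j x)"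
  and j_name: "(!!y. E' y S==>E' y (j a))==>EX T. (ALL x p. pair x p<:T-->x<:a&p<:P) &
   (ALL x p q. pair x p<:T-->le q p-->pair x q<:T) &
   (ALL x p. x<:a-->p<:P-->(ALL q. le q p-->(EX r. le r q&pair x r<:T))-->pair x p<:T) &
   (ALL x. x<:a-->(E' (j x) S<->(EX p:G. pair x p<:T)))"

text \<open>The relation \<open>T\<close> collects the pairs for which \<open>p\<close> forces the
  check name of \<open>x\<close> into a name of the subset.\<close>

lemma (in ext) gext_chk: "gext E P R G E' (%x. v (chk x))"
proof (intro gext.intro generic_axioms zfc_N gext_axioms.intro)
 show "EX S. ALL y. E' y S<->(EX x p. p : G&pair x p<:T&y = v (chk x))" for T
 proof -
  have d: "DfnT (%e. pair (chk (p1 (e 0))) (p2 (e 0)))" by (intro dfn)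
  let ?Q = "%z. EX x p. z = pair x p"
  have dQ: "Dfn (%e. ?Q (e 0))" by (intro dfn)
  let ?n = "img (%z. pair (chk (p1 z)) (p2 z)) (sep T ?Q)"
  have n: "pair c p<:?n<->(EX x. c = chk x&pair x p<:T)" for c p
   unfolding img[OF d] sep[OF dQ] by auto
  have "ALL y. E' y (v ?n)<->(EX x p. p : G&pair x p<:T&y = v (chk x))"
   unfolding v_elems n by blast
  then show ?thesis by blast
 qed
 show "EX T. (ALL x p. pair x p<:T-->x<:a&p<:P) &
   (ALL x p q. pair x p<:T-->le q p-->pair x q<:T) &
   (ALL x p. x<:a-->p<:P-->(ALL q. le q p-->(EX r. le r q&pair x r<:T))-->pair x p<:T) &
   (ALL x. x<:a-->(E' (v (chk x)) S<->(EX p:G. pair x p<:T)))" for S a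
 proof -
  obtain s where s: "S = v s" using v_ex by blast
  let ?Q = "%z. EX x p. z = pair x p&ME p (chk x) s"
  have d: "Dfn (%e. ?Q (e 0))" by (intro dfn)
  have T: "pair x p<:sep (cart a P) ?Q<->x<:a&p<:P&ME p (chk x) s" for x p
   unfolding sep[OF d] by auto
  show ?thesis
  proof (intro exI[of _ "sep (cart a P) ?Q"] conjI allI impI; (unfold T)?)
   fix x p q assume "x<:a&p<:P&ME p (chk x) s" "le q p"
   then show "x<:a&q<:P&ME q (chk x) s" using ME_mono leP by blast
  next
   fix x p assume "x<:a" "p<:P" "ALL q. le q p-->(EX r. le r q&x<:a&r<:P&ME r (chk x) s)"
   then show "x<:a&p<:P&ME p (chk x) s" using ME_dense by blast
  next
   fix x assume "x<:a"
   then show "E' (v (chk x)) S<->(EX p:G. x<:a&p<:P&ME p (chk x) s)" using s v_mem GP by blast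
  qed blast+
 qed
qed (use v_chk chk_inj in blast)+

theorem (in forcing) generic_extension: assumes "p0<:P" shows "EX G E' j. gext E P R G E' j&p0 : G"
proof -
 obtain G where G: "p0 : G" "ALL p:G. p<:P" "ALL p:G. ALL q. le p q-->q : G" "ALL p:G. ALL q:G. EX r:G. le r p&le r q"
  "ALL D. (ALL p. p<:P-->(EX q. q<:D&le q p))-->(EX q:G. q<:D)"
  using generic_exists[OF assms] by blast
 interpret generic E P R G by unfold_locales (use G in blast)+
 obtain v :: "U => U" and E' where v: "surj v" "!!a b. v a = v b<->(EX p:G. EQ p a b)" "!!a b. E' (v a) (v b)<->(EX p:G. ME p a b)"
  using extension_quotient by blast
 interpret ext E P R G v E' by unfold_locales (use v in blast)+
 show ?thesis using gext_chk G(1) by blast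
qed

subsection \<open>Finite-support iterations with coordinates in the first uncountable ordinal\<close>

context zfc begin

lemma fn_un: assumes "fn p a c" "fn q b c" "ALL x. x<:a-->~x<:b"
 shows "fn (un p q) (un a b) c" "x<:a==>app (un p q) x = app p x" "x<:b==>app (un p q) x = app q x"
proof -
 have pr: "pair x y<:un p q<->x<:a&y = app p x | x<:b&y = app q x" for x y
  by (simp add: fn_pair[OF assms(1)] fn_pair[OF assms(2)])
 show f: "fn (un p q) (un a b) c"
  unfolding fn_def
 proof (intro conjI allI impI)
  fix z assume "z<:un p q"
  then show "EX x y. x<:un a b&y<:c&z = pair x y"
   using assms(1,2) unfolding fn_def un by meson
 next
  fix x assume "x<:un a b"
  then have "x<:a | x<:b" by simp
  then show "EX y. pair x y<:un p q&(ALL z. pair x z<:un p q-->z = y)"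
   using pr assms(3) by metis
 qed
 show "x<:a==>app (un p q) x = app p x" using pr[of x "app p x"] fn_pair[OF f, of x "app p x"] by simp
 show "x<:b==>app (un p q) x = app q x" using pr[of x "app q x"] fn_pair[OF f, of x "app q x"] by simp
qed

text \<open>The iterands are orders on \<open>om1\<close>: a triple \<open>tri p a b\<close> in \<open>app t x\<close> means that \<open>p\<close> forces \<open>a\<close> to be
 below \<open>b\<close> in the \<open>x\<close>-th one.\<close>

definition cond :: "U => U => bool" where "cond a p<->fin (dm p)&fn p (dm p) om1&dm p<<=a"
definition Cnd :: "U => U" where "Cnd a = sep (pw (cart a om1)) (cond a)"
definition tri :: "U => U => U => U" where "tri p a b = pair p (pair a b)"
text \<open>At each coordinate in the support of \<open>p\<close>, the part of \<open>q\<close>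
  before it must force the new entry to be equal to or below the old one.\<close>

definition LE :: "U => U => U => bool" where
 "LE t q p<->(ALL x. x<:dm p-->x<:dm q&(app q x = app p x | tri (rs q x) (app q x) (app p x)<:app t x))"
definition cle :: "U => U => U => U => bool" where "cle \<tau> r c a<->c = a | tri r c a<:\<tau>"

lemma cond_dfn [dfn]: "DfnT s==>DfnT t==>Dfn (%e. cond (s e) (t e))"
 by (rule Dfn2[of cond], unfold cond_def, intro dfn)
lemma Cnd_dfn [dfn]: "DfnT s==>DfnT (%e. Cnd (s e))"
 by (rule DfnT1[of Cnd], unfold Cnd_def, intro dfn)
lemma tri_dfn [dfn]: "DfnT s==>DfnT t==>DfnT u==>DfnT (%e. tri (s e) (t e) (u e))"
 by (rule DfnT3[of tri], unfold tri_def, intro dfn)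
lemma LE_dfn [dfn]: "DfnT s==>DfnT t==>DfnT u==>Dfn (%e. LE (s e) (t e) (u e))"
 by (rule Dfn3[of LE], unfold LE_def, intro dfn)
lemma cle_dfn [dfn]: "DfnT s==>DfnT t==>DfnT u==>DfnT v==>Dfn (%e. cle (s e) (t e) (u e) (v e))"
 by (rule Dfn4[of cle], unfold cle_def, intro dfn)

lemma Cnd: "p<:Cnd a<->cond a p"
proof -
 have d: "Dfn (%e. cond a (e 0))" by (intro dfn)
 have "p<<=cart a om1" if "cond a p"
  using that fn_mem[of p "dm p" om1] fn_app(2)[of p "dm p" om1] unfolding cond_def sub_def cart by metis
 then show ?thesis unfolding Cnd_def sep[OF d] by auto
qed

lemma cond_fn: "cond a p==>fn p (dm p) om1" and cond_fin: "cond a p==>fin (dm p)"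
 and cond_dm: "cond a p==>x<:dm p==>x<:a" and cond_app: "cond a p==>x<:dm p==>app p x<:om1"
 using fn_app(2) by (auto simp: cond_def sub_def)

lemma condI: "fin d==>fn p d om1==>d<<=a==>cond a p"
 using fn_dm[of p d om1] by (simp add: cond_def)

lemma cond_mono: "cond a p==>a<<=b==>cond b p"
 unfolding cond_def using sub_trans by blast

lemma cond_eqI: "cond a p==>cond b q==>dm p = dm q==>(!!x. x<:dm p==>app p x = app q x)==>p = q"
 using fn_eqI[of p "dm p" om1 q om1] by (simp add: cond_def)

lemma cond_emp: "cond a emp"
 by (rule condI[of emp]) (auto simp: fn_def)

lemma dm_emp [simp]: "dm emp = emp" by (rule seteq) (simp add: dm)

lemma dm_rs: "dm (rs p b) = it (dm p) b"
 by (rule seteq) (auto simp: dm)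

lemma rs_rs: "c<<=b==>rs (rs p b) c = rs p c"
 by (rule seteq) (auto simp: rs sub_def)

lemma cond_rs: assumes "cond a p" shows "cond b (rs p b)" "x<:dm p==>x<:b==>app (rs p b) x = app p x"
proof -
 have e: "rs p b = rs p (it (dm p) b)"
  by (rule seteq) (use fn_mem[OF cond_fn[OF assms]] in \<open>auto simp: rs\<close>)
 have s: "it (dm p) b<<=dm p" by (simp add: sub_def)
 have f: "fn (rs p b) (it (dm p) b) om1" unfolding e by (rule rs_fn(1)[OF cond_fn[OF assms] s])
 show "cond b (rs p b)" by (rule condI[OF _ f]) (use fin_sub[OF cond_fin[OF assms] s] in \<open>auto simp: sub_def\<close>)
 show "x<:dm p==>x<:b==>app (rs p b) x = app p x"
  unfolding e using rs_fn(2)[OF cond_fn[OF assms] s] by simp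
qed

lemma cond_rs_a: "cond a p==>cond a (rs p b)"
 using cond_rs(1)[of a p b] unfolding cond_def dm_rs by (auto simp: sub_def)

lemma rs_id: assumes "cond a p" "a<<=b" shows "rs p b = p"
proof (rule cond_eqI[OF cond_rs(1)[OF assms(1)] assms(1)])
 show "dm (rs p b) = dm p" unfolding dm_rs by (rule seteq) (use cond_dm[OF assms(1)] subD[OF assms(2)] in auto)
 show "app (rs p b) x = app p x" if "x<:dm (rs p b)" for x using cond_rs(2)[OF assms(1)] that by (simp add: dm_rs)
qed

lemma LE_refl: "LE t p p" by (simp add: LE_def)

lemma LE_dm: "LE t q p==>x<:dm p==>x<:dm q" by (simp add: LE_def)

lemma LE_rs: assumes "LE t q p" "cond a q" "cond b p" "Ord c" shows "LE t (rs q c) (rs p c)"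
 unfolding LE_def
proof (intro allI impI)
 fix x assume "x<:dm (rs p c)"
 then have x: "x<:dm p" "x<:c" by (simp_all add: dm_rs)
 then have xq: "x<:dm q" using assms(1) LE_dm by blast
 have "x<<=c" using assms(4) x(2) Ord_trans by (auto simp: sub_def)
 then have "rs (rs q c) x = rs q x" by (rule rs_rs)
 then show "x<:dm (rs q c)&(app (rs q c) x = app (rs p c) x | tri (rs (rs q c) x) (app (rs q c) x) (app (rs p c) x)<:app t x)"
  using assms(1) x xq cond_rs(2)[OF assms(2) xq x(2)] cond_rs(2)[OF assms(3) x] by (simp add: LE_def dm_rs)
qed

lemma LE_join: assumes "LE t (rs q b) (rs p b)" "cond a q" "cond a p" "Ord b"
  "!!x. x<:dm p==>~x<:b==>x<:dm q&cle (app t x) (rs q x) (app q x) (app p x)"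
 shows "LE t q p"
 unfolding LE_def
proof (intro allI impI)
 fix x assume x: "x<:dm p"
 show "x<:dm q&(app q x = app p x | tri (rs q x) (app q x) (app p x)<:app t x)"
 proof (cases "x<:b")
  case True
  have "x<<=b" using assms(4) True Ord_trans by (auto simp: sub_def)
  then have r: "rs (rs q b) x = rs q x" by (rule rs_rs)
  have xp: "x<:dm (rs p b)" using x True by (simp add: dm_rs)
  then have xq: "x<:dm q" using LE_dm[OF assms(1)] by (simp add: dm_rs)
  show ?thesis using assms(1) xp xq r cond_rs(2)[OF assms(2) xq True] cond_rs(2)[OF assms(3) x True] unfolding LE_def by auto
 next
  case False
  then show ?thesis using assms(5)[OF x] by (simp add: cle_def)
 qed
qed

text \<open>The order below a stage sees only earlier iterands, which is what makes the recursion
  defining the iteration meaningful.\<close>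

lemma LE_cong: assumes "!!x. x<:a==>app t x = app t' x" "cond a p" shows "LE t q p<->LE t' q p"
 unfolding LE_def using assms cond_dm by metis

text \<open>The two facts about iterands behind transitivity of \<open>LE\<close>: what they relate
  persists under stronger conditions, and each is transitive.\<close>

definition valid :: "U => U => bool" where
 "valid d t<->(ALL x. x<:d -->
  (ALL p q a b. cond x p-->cond x q-->LE t q p-->tri p a b<:app t x-->tri q a b<:app t x) &
  (ALL p a b c. tri p a b<:app t x-->tri p b c<:app t x-->tri p a c<:app t x))"

lemma LE_trans: assumes v: "valid d t" and d: "Ord d" and p: "cond d p" and q: "cond d q" and r: "cond d r"
  and rq: "LE t r q" and qp: "LE t q p"
 shows "LE t r p"
 unfolding LE_def
proof (intro allI impI)
 fix x assume x: "x<:dm p"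
 have xd: "x<:d" using cond_dm[OF p x] .
 have xq: "x<:dm q" and xr: "x<:dm r" using x LE_dm qp rq by blast+
 have "LE t (rs r x) (rs q x)" using LE_rs[OF rq r q] d xd Ord_mem by blast
 then have A: "tri (rs q x) a b<:app t x==>tri (rs r x) a b<:app t x" for a b
  using v xd cond_rs(1)[OF q] cond_rs(1)[OF r] unfolding valid_def by blast
 have B: "tri s a b<:app t x==>tri s b c<:app t x==>tri s a c<:app t x" for s a b c
  using v xd unfolding valid_def by blast
 have 1: "app q x = app p x | tri (rs q x) (app q x) (app p x)<:app t x" using qp x unfolding LE_def by blast
 have 2: "app r x = app q x | tri (rs r x) (app r x) (app q x)<:app t x" using rq xq unfolding LE_def by blast
 show "x<:dm r&(app r x = app p x | tri (rs r x) (app r x) (app p x)<:app t x)"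
  using xr 1 2 A B by metis
qed

text \<open>Amalgam of a condition \<open>r\<close> living before stage \<open>b\<close>, usually
  stronger than the restriction of \<open>p\<close>, with the rest of \<open>p\<close>.\<close>

definition am :: "U => U => U => U" where "am r p b = un r (rs p (df (dm p) b))"

lemma am: assumes r: "cond b r" and p: "cond d p" and bd: "b<<=d"
 shows "cond d (am r p b)" "dm (am r p b) = un (dm r) (df (dm p) b)" "rs (am r p b) b = r"
  "x<:dm r==>app (am r p b) x = app r x" "x<:dm p==>~x<:b==>app (am r p b) x = app p x"
proof -
 have s: "df (dm p) b<<=dm p" by (simp add: sub_def)
 note f = rs_fn[OF cond_fn[OF p] s]
 have dj: "ALL x. x<:dm r-->~x<:df (dm p) b" using cond_dm[OF r] by simp
 note u = fn_un[OF cond_fn[OF r] f(1) dj]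
 show dmu: "dm (am r p b) = un (dm r) (df (dm p) b)" unfolding am_def by (rule fn_dm[OF u(1)])
 show c: "cond d (am r p b)" unfolding am_def
  by (rule condI[OF _ u(1)]) (use fin_un[OF cond_fin[OF r] fin_sub[OF cond_fin[OF p] s]] cond_dm[OF r] cond_dm[OF p] subD[OF bd] in \<open>auto simp: sub_def\<close>)
 show 1: "app (am r p b) x = app r x" if "x<:dm r" for x unfolding am_def by (rule u(2)[OF that])
 show "x<:dm p==>~x<:b==>app (am r p b) x = app p x" unfolding am_def using u(3)[of x] f(2)[of x] by simp
 show "rs (am r p b) b = r"
 proof (rule cond_eqI[OF cond_rs(1)[OF c] r])
  show e: "dm (rs (am r p b) b) = dm r" unfolding dm_rs dmu by (rule seteq) (use cond_dm[OF r] in auto)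
  fix x assume "x<:dm (rs (am r p b) b)"
  then have x: "x<:dm r" using e by simp
  then show "app (rs (am r p b) b) x = app r x" using cond_rs(2)[OF c, of x b] 1[OF x] cond_dm[OF r x] dmu by simp
 qed
qed

lemma am_LE: assumes r: "cond b r" and p: "cond d p" and bd: "b<<=d" "Ord b" and l: "LE t r (rs p b)"
 shows "LE t (am r p b) p" "LE t (am r p b) r"
proof -
 note a = am[OF r p bd(1)]
 show "LE t (am r p b) p"
  by (rule LE_join[OF _ a(1) p bd(2)]) (use a l in \<open>auto simp: cle_def\<close>)
 have rr: "rs r b = r" using rs_id[OF r] by simp
 show "LE t (am r p b) r"
  by (rule LE_join[OF _ a(1) cond_mono[OF r bd(1)] bd(2)]) (use a rr LE_refl cond_dm[OF r] in auto)
qed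

lemma ins_cond: assumes p: "cond d p" and x: "x<:d" "~x<:dm p" and a: "a<:om1"
 shows "cond d (ins (pair x a) p)" "dm (ins (pair x a) p) = ins x (dm p)" "app (ins (pair x a) p) x = a"
  "y<:dm p==>app (ins (pair x a) p) y = app p y"
proof -
 have f1: "fn (upair (pair x a) (pair x a)) (upair x x) om1" using a by (auto simp: fn_def)
 have a1: "app (upair (pair x a) (pair x a)) x = a" unfolding app_def by (rule des_eq) auto
 have e: "ins (pair x a) p = un p (upair (pair x a) (pair x a))" "un (dm p) (upair x x) = ins x (dm p)"
  by (rule seteq, simp)+
 have dj: "ALL y. y<:dm p-->~y<:upair x x" using x(2) by auto
 note u = fn_un[OF cond_fn[OF p] f1 dj, folded e(1), unfolded e(2)]
 show "cond d (ins (pair x a) p)"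
  by (rule condI[OF _ u(1)]) (use cond_fin[OF p] cond_dm[OF p] x in \<open>auto simp: sub_def\<close>)
 show "dm (ins (pair x a) p) = ins x (dm p)" by (rule fn_dm[OF u(1)])
 show "app (ins (pair x a) p) x = a" using u(3)[of x] a1 by simp
 show "y<:dm p==>app (ins (pair x a) p) y = app p y" by (rule u(2))
qed

end

text \<open>Finite binary sequences are coded by countable ordinals through \<open>sv\<close>; the coordinates in
 \<open>IA\<close> and \<open>IB\<close> will carry the Cohen reals forming the two dense sets.\<close>

locale coh = zfc +
 fixes sv IA IB :: U
 assumes sv: "fn sv om1 Sq" "!!s. s<:Sq==>EX a. a<:om1&app sv a = s"
  and IA: "IA<<=om1" "~ctbl IA" and IB: "IB<<=om1" "~ctbl IB" and dj: "x<:IA==>~x<:IB"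
begin

text \<open>A decided violation of the Lipschitz condition: the left reals agree up to
  \<open>m\<close>, the right ones differ before \<open>m\<close>, and the finite sequences in
  \<open>r\<close> are long enough to show both.\<close>

definition K :: "U => U => U => bool" where
 "K r y z<->p1 y<:dm r&p2 y<:dm r&p1 z<:dm r&p2 z<:dm r &
  (EX m l. m<:om&l<:m&m<<=dm (app sv (app r (p1 y)))&m<<=dm (app sv (app r (p1 z))) &
   rs (app sv (app r (p1 y))) m = rs (app sv (app r (p1 z))) m &
   l<:dm (app sv (app r (p2 y)))&l<:dm (app sv (app r (p2 z))) &
   app (app sv (app r (p2 y))) l ~= app (app sv (app r (p2 z))) l)"

lemma K_dfn [dfn]: "DfnT s==>DfnT t==>DfnT u==>Dfn (%e. K (s e) (t e) (u e))"
 by (rule Dfn3[of K], unfold K_def, intro dfn)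

definition qa :: "U => U" where "qa z = p1 (p2 z)"
definition qy :: "U => U" where "qy z = p2 (p2 z)"

lemma qa_dfn [dfn]: "DfnT s==>DfnT (%e. qa (s e))"
 by (rule DfnT1[of qa], unfold qa_def, intro dfn)
lemma qy_dfn [dfn]: "DfnT s==>DfnT (%e. qy (s e))"
 by (rule DfnT1[of qy], unfold qy_def, intro dfn)

definition quad :: "U => U => U => U" where "quad p a y = pair p (pair a y)"

lemma quad_dfn [dfn]: "DfnT s==>DfnT t==>DfnT u==>DfnT (%e. quad (s e) (t e) (u e))"
 by (rule DfnT3[of quad], unfold quad_def, intro dfn)

lemma quad [simp]: "p1 (quad p a y) = p" "qa (quad p a y) = a" "qy (quad p a y) = y"
 by (simp_all add: quad_def qa_def qy_def)

text \<open>Members carry a condition, an element of a further iterand and a pair of indices. The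
  entry \<open>qa\<close> is what \<open>good2\<close> bounds in the successor step.\<close>

definition fam :: "U => U => bool" where
 "fam d F<->~ctbl F&(ALL z. z<:F-->cond d (p1 z)&qa z<:om1&p1 (qy z)<:IA&p2 (qy z)<:IB) &
  (ALL z w. z<:F-->w<:F-->z ~= w-->p1 (qy z) ~= p1 (qy w)&p2 (qy z) ~= p2 (qy w))"

definition good :: "U => U => bool" where
 "good d t<->(ALL F. fam d F-->(EX z w r. z<:F&w<:F&cond d r&LE t r (p1 z)&LE t r (p1 w)&K r (qy z) (qy w)))"

text \<open>The requirement on the order \<open>\<tau>\<close> at one more coordinate under which
  goodness passes to the successor stage.\<close>

definition good2 :: "U => U => U => bool" where
 "good2 d t \<tau> <-> (ALL F. fam d F-->(EX z w r c. z<:F&w<:F&cond d r&LE t r (p1 z)&LE t r (p1 w)&K r (qy z) (qy w) &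
   c<:om1&cle \<tau> r c (qa z)&cle \<tau> r c (qa w)))"

lemma fam_dfn [dfn]: "DfnT s==>DfnT t==>Dfn (%e. fam (s e) (t e))"
 by (rule Dfn2[of fam], unfold fam_def, intro dfn)
lemma good_dfn [dfn]: "DfnT s==>DfnT t==>Dfn (%e. good (s e) (t e))"
 by (rule Dfn2[of good], unfold good_def, intro dfn)
lemma good2_dfn [dfn]: "DfnT s==>DfnT t==>DfnT u==>Dfn (%e. good2 (s e) (t e) (u e))"
 by (rule Dfn3[of good2], unfold good2_def, intro dfn)

lemma K_irrefl: "~K r y y" by (simp add: K_def)

section \<open>Families of labelled conditions and the preservation of goodness\<close>

lemma fam_sub: "fam d F==>F'<<=F==>~ctbl F'==>fam d F'"
 unfolding fam_def sub_def by blast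

lemma fam_img:
 assumes F: "fam d F" and d: "DfnT (%e. f (e 0))" and f: "!!z. z<:F==>cond d' (f z)"
 shows "fam d' (img (%z. quad (f z) (qa z) (qy z)) F)"
proof -
 have dq: "DfnT (%e. quad (f (e 0)) (qa (e 0)) (qy (e 0)))" by (intro dfn DfnT1[OF d])
 let ?F = "img (%z. quad (f z) (qa z) (qy z)) F"
 have "lep F ?F"
 proof (rule lepI[OF dq])
  fix x y assume "x<:F" "y<:F" "quad (f x) (qa x) (qy x) = quad (f y) (qa y) (qy y)"
  then show "x = y" using F unfolding fam_def by (metis quad(3))
 qed (auto simp: img[OF dq])
 then have "~ctbl ?F" using F ctbl_lep unfolding fam_def by blast
 moreover have "p1 (qy z) ~= p1 (qy w)&p2 (qy z) ~= p2 (qy w)" if zw: "z<:?F" "w<:?F" "z ~= w" for z w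
 proof -
  obtain z' w' where z': "z'<:F" "z = quad (f z') (qa z') (qy z')" "w'<:F" "w = quad (f w') (qa w') (qy w')"
   using zw(1,2) unfolding img[OF dq] by blast
  then have "z' ~= w'" using zw(3) by blast
  then show ?thesis using F z' unfolding fam_def by simp
 qed
 moreover have "cond d' (p1 z)&qa z<:om1&p1 (qy z)<:IA&p2 (qy z)<:IB" if h: "z<:?F" for z
 proof -
  obtain z' where "z'<:F" "z = quad (f z') (qa z') (qy z')" using h unfolding img[OF dq] by blast
  then show ?thesis using F f unfolding fam_def by simp
 qed
 ultimately show ?thesis unfolding fam_def by blast
qed

lemma fam_mono: "fam d F==>d<<=d'==>fam d' F"
 unfolding fam_def using cond_mono by blast

text \<open>The Cohen order as an iterand: reverse inclusion of the coded sequences, the same for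
  every condition.\<close>

definition cot :: "U => U" where
 "cot x = sep (cart (Cnd x) (cart om1 om1)) (%z. app sv (p2 (p2 z))<<=app sv (p1 (p2 z)))"

lemma cot_dfn [dfn]: "DfnT s==>DfnT (%e. cot (s e))"
 by (rule DfnT1[of cot], unfold cot_def, intro dfn)

lemma cot: "tri p a b<:cot x<->cond x p&a<:om1&b<:om1&app sv b<<=app sv a"
proof -
 have d: "Dfn (%e. app sv (p2 (p2 (e 0)))<<=app sv (p1 (p2 (e 0))))" by (intro dfn)
 show ?thesis unfolding cot_def tri_def sep[OF d] by (simp add: Cnd)
qed

definition coht :: "U => bool" where "coht t<->(ALL x. x<:om1-->app t x = cot x)"

lemma Sq_fn: assumes "s<:Sq" "s'<:Sq" "s<<=s'" shows "dm s<<=dm s'" "x<:dm s==>app s' x = app s x" "m<<=dm s==>rs s' m = rs s m"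
proof -
 obtain n n' where n: "fn s n two" "fn s' n' two" using assms Sq by blast
 note pr = fn_pair[OF n(1)] fn_pair[OF n(2)]
 have d: "dm s = n" "dm s' = n'" using fn_dm n by blast+
 have sub: "pair x y<:s==>pair x y<:s'" for x y using assms(3) subD by blast
 show "dm s<<=dm s'" unfolding d sub_def using pr sub by blast
 show a: "app s' x = app s x" if "x<:dm s" for x using that pr sub unfolding d by metis
 show "rs s' m = rs s m" if "m<<=dm s"
 proof (rule seteq)
  fix z
  have "pair x y<:s'<->pair x y<:s" if "x<:m" for x y
   using that \<open>m<<=dm s\<close> a[of x] pr sub subD unfolding d by metis
  then show "z<:rs s' m<->z<:rs s m" unfolding rs by blast
 qed
qed

lemma sv_Sq: "a<:om1==>app sv a<:Sq" using sv(1) fn_app(2) by blast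

lemma coht_LE: assumes "coht t" "LE t q p" "cond d p" "cond d q" "x<:dm p" "x<:om1"
 shows "app sv (app p x)<<=app sv (app q x)"
proof -
 have "app q x = app p x | tri (rs q x) (app q x) (app p x)<:app t x" using assms(2,5) unfolding LE_def by blast
 then show ?thesis using assms(1,6) cot unfolding coht_def by auto
qed

text \<open>A stronger condition only prolongs the Cohen sequences, so agreements and differences
  already decided persist.\<close>

lemma K_mono: assumes c: "coht t" and l: "LE t q r" and q: "cond d q" and r: "cond d r"
  and y: "p1 y<:om1" "p2 y<:om1" "p1 z<:om1" "p2 z<:om1" and k: "K r y z"
 shows "K q y z"
proof -
 have dd: "p1 y<:dm r" "p2 y<:dm r" "p1 z<:dm r" "p2 z<:dm r" using k by (auto simp: K_def)
 have dq: "p1 y<:dm q" "p2 y<:dm q" "p1 z<:dm q" "p2 z<:dm q" using dd LE_dm[OF l] by blast+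
 let ?s = "%r x. app sv (app r x)"
 have S: "?s r x<:Sq" "?s q x<:Sq" "?s r x<<=?s q x" if "x<:dm r" "x<:om1" for x
  using that sv_Sq cond_app q r LE_dm[OF l] coht_LE[OF c l r q] by blast+
 note F = Sq_fn[OF S]
 obtain m l' where m: "m<:om" "l'<:m" "m<<=dm (?s r (p1 y))" "m<<=dm (?s r (p1 z))" "rs (?s r (p1 y)) m = rs (?s r (p1 z)) m"
  "l'<:dm (?s r (p2 y))" "l'<:dm (?s r (p2 z))" "app (?s r (p2 y)) l' ~= app (?s r (p2 z)) l'" using k unfolding K_def by blast
 have "m<<=dm (?s q (p1 y))" "m<<=dm (?s q (p1 z))" using m F(1)[OF dd(1) y(1) dd(1) y(1) dd(1) y(1)] F(1)[OF dd(3) y(3) dd(3) y(3) dd(3) y(3)] sub_trans by blast+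
 moreover have "rs (?s q (p1 y)) m = rs (?s q (p1 z)) m" using m(3-5) F(3)[OF dd(1) y(1) dd(1) y(1) dd(1) y(1)] F(3)[OF dd(3) y(3) dd(3) y(3) dd(3) y(3)] by simp
 moreover have "l'<:dm (?s q (p2 y))" "l'<:dm (?s q (p2 z))" using m(6,7) F(1)[OF dd(2) y(2) dd(2) y(2) dd(2) y(2)] F(1)[OF dd(4) y(4) dd(4) y(4) dd(4) y(4)] subD by blast+
 moreover have "app (?s q (p2 y)) l' ~= app (?s q (p2 z)) l'" using m(6-8) F(2)[OF dd(2) y(2) dd(2) y(2) dd(2) y(2)] F(2)[OF dd(4) y(4) dd(4) y(4) dd(4) y(4)] by simp
 ultimately show ?thesis unfolding K_def using m(1,2) dq by blast
qed

lemma K_rs: assumes "cond d r" "om1<<=b" "p1 y<:om1" "p2 y<:om1" "p1 z<:om1" "p2 z<:om1"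
 shows "K (rs r b) y z<->K r y z"
proof -
 have i: "x<:dm (rs r b)<->x<:dm r" if "x<:om1" for x using that assms(2) subD by (auto simp: dm_rs)
 have a: "app (rs r b) x = app r x" if "x<:om1" "x<:dm r" for x using that assms(1,2) cond_rs(2) subD by blast
 show ?thesis
 proof (cases "p1 y<:dm r&p2 y<:dm r&p1 z<:dm r&p2 z<:dm r")
  case True
  then have e: "app (rs r b) (p1 y) = app r (p1 y)" "app (rs r b) (p2 y) = app r (p2 y)"
   "app (rs r b) (p1 z) = app r (p1 z)" "app (rs r b) (p2 z) = app r (p2 z)" using a assms(3-6) by blast+
  show ?thesis unfolding K_def e i[OF assms(3)] i[OF assms(4)] i[OF assms(5)] i[OF assms(6)] ..
 next
  case False
  then show ?thesis unfolding K_def i[OF assms(3)] i[OF assms(4)] i[OF assms(5)] i[OF assms(6)] by blast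
 qed
qed

lemma fam_om1: "fam d F==>z<:F==>p1 (qy z)<:om1&p2 (qy z)<:om1"
 using IA(1) IB(1) unfolding fam_def sub_def by blast

text \<open>The root of a Delta-system is finite, hence bounded by some \<open>b\<close> below the
  limit, whatever the cofinality. Goodness at \<open>b\<close> handles the restrictions; from
  \<open>b\<close> on the two supports are disjoint, so the rests of both conditions can be put on
  top.\<close>

lemma good_limit:
 assumes d: "Ord d" "om1<:d" and lim: "!!x. x<:d==>sc x<:d"
  and g: "!!b. b<:d==>om1<<=b==>good b t"
 shows "good d t"
 unfolding good_def
proof (intro allI impI)
 fix F assume F: "fam d F"
 have dD: "DfnT (%e. dm (p1 (e 0)))" by (intro dfn)
 have "EX G r. G<<=F&~ctbl G&fin r&(ALL p q. p<:G-->q<:G-->p ~= q-->it (dm (p1 p)) (dm (p1 q)) = r)"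
  by (rule delta_system[OF dD]) (use F cond_fin in \<open>unfold fam_def, blast+\<close>)
 then obtain G r where G: "G<<=F" "~ctbl G" "fin r" "!!p q. p<:G==>q<:G==>p ~= q==>it (dm (p1 p)) (dm (p1 q)) = r" by blast
 have fG: "fam d G" using fam_sub[OF F G(1,2)] .
 have cd: "cond d (p1 z)" if "z<:G" for z using that fG unfolding fam_def by blast
 \<comment> \<open>The bound also has to leave all Cohen coordinates below it, so that
   \<open>K\<close> is not affected by the restriction.\<close>
 have "EX b. b<:d&om1<<=b&it r d<<=b"
 proof (cases "it r d = emp")
  case True
  then show ?thesis using d(2) by (intro exI[of _ om1]) simp
 next
  case False
  have "fin (it r d)" by (rule fin_sub[OF G(3)]) (simp add: sub_def)
  then obtain m where m: "m<:it r d" "!!x. x<:it r d==>x<<=m" using fin_Ord_max[of "it r d"] False d(1) Ord_mem by (metis it)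
  have om: "Ord m" using m(1) d(1) Ord_mem by auto
  have mm: "x<:sc m" if "x<:it r d" for x
  proof -
   have "Ord x" using that d(1) Ord_mem by auto
   then show ?thesis using m(2)[OF that] Ord_sub[OF _ om] by auto
  qed
  have scm: "sc m<:d" using lim m(1) by simp
  show ?thesis
  proof (cases "om1<<=sc m")
   case True
   then show ?thesis using mm scm by (auto simp: sub_def)
  next
   case False
   then have "sc m<:om1" using Ord_not_mem[of "sc m" om1] om by auto
   then have "sc m<<=om1" using Ord_sub om by auto
   then show ?thesis using mm d(2) by (intro exI[of _ om1]) (auto simp: sub_def)
  qed
 qed
 then obtain b where b: "b<:d" "om1<<=b" "it r d<<=b" by blast
 have ob: "Ord b" using b(1) d(1) Ord_mem by blast
 have bd: "b<<=d" using b(1) d(1) Ord_trans by (auto simp: sub_def)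
 have df: "DfnT (%e. rs (p1 (e 0)) b)" by (intro dfn)
 let ?f = "%z. quad (rs (p1 z) b) (qa z) (qy z)"
 have dq: "DfnT (%e. ?f (e 0))" by (intro dfn)
 have "fam b (img ?f G)" by (rule fam_img[OF fG df]) (use cd cond_rs(1) in blast)
 then obtain z' w' r0 where h: "z'<:img ?f G" "w'<:img ?f G" "cond b r0" "LE t r0 (p1 z')" "LE t r0 (p1 w')" "K r0 (qy z') (qy w')"
  using g[OF b(1,2)] unfolding good_def by blast
 obtain z w where zw: "z<:G" "w<:G" "z' = ?f z" "w' = ?f w" using h(1,2) unfolding img[OF dq] by blast
 let ?p = "p1 z" and ?q = "p1 w"
 have l: "LE t r0 (rs ?p b)" "LE t r0 (rs ?q b)" and k: "K r0 (qy z) (qy w)" using h(4-6) zw by simp_all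
 have "z ~= w" using k K_irrefl by blast
 then have root: "it (dm ?p) (dm ?q) = r" using G(4) zw by blast
 note cp = cd[OF zw(1)] and cq = cd[OF zw(2)]
 note a1 = am[OF h(3) cp bd]
 let ?q1 = "am r0 ?p b"
 let ?D = "df (dm ?q) b"
 have s: "?D<<=dm ?q" by (simp add: sub_def)
 note f2 = rs_fn[OF cond_fn[OF cq] s]
 have dj: "ALL x. x<:dm ?q1-->~x<:?D"
 proof (intro allI impI notI)
  fix x assume xq: "x<:dm ?q1" and "x<:?D"
  then have x: "x<:dm ?q" "~x<:b" by simp_all
  have "x<:dm ?p" using xq x(2) cond_dm[OF h(3)] unfolding a1(2) by auto
  then have "x<:r" using x(1) root it by metis
  then show False using x cond_dm[OF cq] b(3) by (auto simp: sub_def)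
 qed
 note u = fn_un[OF cond_fn[OF a1(1)] f2(1) dj]
 let ?r = "un ?q1 (rs ?q ?D)"
 have dr: "dm ?r = un (dm ?q1) ?D" by (rule fn_dm[OF u(1)])
 have cr: "cond d ?r"
  by (rule condI[OF _ u(1)]) (use fin_un[OF cond_fin[OF a1(1)] fin_sub[OF cond_fin[OF cq] s]] cond_dm[OF a1(1)] cond_dm[OF cq] in \<open>auto simp: sub_def\<close>)
 have rb: "rs ?r b = r0"
 proof -
  have "rs ?r b = rs ?q1 b"
  proof (rule cond_eqI[OF cond_rs(1)[OF cr] cond_rs(1)[OF a1(1)]])
   show e: "dm (rs ?r b) = dm (rs ?q1 b)" unfolding dm_rs dr by (rule seteq) auto
   fix x assume "x<:dm (rs ?r b)"
   then have "x<:dm (rs ?q1 b)" using e by simp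
   then have x: "x<:dm ?q1" "x<:b" by (simp_all add: dm_rs)
   then show "app (rs ?r b) x = app (rs ?q1 b) x" using cond_rs(2)[OF cr _ x(2)] cond_rs(2)[OF a1(1) x] u(2)[OF x(1)] dr by simp
  qed
  then show ?thesis using a1(3) by simp
 qed
 have "LE t ?r ?p"
 proof (rule LE_join[OF _ cr cp ob])
  show "LE t (rs ?r b) (rs ?p b)" using rb l by simp
  fix x assume x: "x<:dm ?p" "~x<:b"
  then have "x<:dm ?q1" unfolding a1(2) by simp
  then show "x<:dm ?r&cle (app t x) (rs ?r x) (app ?r x) (app ?p x)" using dr u(2)[of x] a1(5)[OF x] by (simp add: cle_def)
 qed
 moreover have "LE t ?r ?q"
 proof (rule LE_join[OF _ cr cq ob])
  show "LE t (rs ?r b) (rs ?q b)" using rb l by simp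
  fix x assume x: "x<:dm ?q" "~x<:b"
  then have "x<:?D" by simp
  then show "x<:dm ?r&cle (app t x) (rs ?r x) (app ?r x) (app ?q x)" using dr u(3)[of x] f2(2)[of x] by (simp add: cle_def)
 qed
 moreover have "K ?r (qy z) (qy w)"
  using K_rs[OF cr b(2), of "qy z" "qy w"] fam_om1[OF fG] zw(1,2) k rb by simp
 ultimately show "EX z w r. z<:F&w<:F&cond d r&LE t r (p1 z)&LE t r (p1 w)&K r (qy z) (qy w)"
  using zw(1,2) G(1) subD cr by blast
qed

text \<open>If uncountably many members use coordinate \<open>b\<close>, their entries there become
  the labels for \<open>good2\<close>, and the bound \<open>c\<close> becomes the entry of the
  common extension. Otherwise uncountably many members already live before \<open>b\<close>.\<close>

lemma good_succ:
 assumes o: "Ord b" "om1<<=b" and g: "good b t" "good2 b t (app t b)"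
 shows "good (sc b) t"
 unfolding good_def
proof (intro allI impI)
 fix F assume F: "fam (sc b) F"
 have bs: "b<<=sc b" by (simp add: sub_def)
 have ds: "Dfn (%e. b<:dm (p1 (e 0)))" "Dfn (%e. ~b<:dm (p1 (e 0)))" by (intro dfn)+
 let ?F1 = "sep F (%z. b<:dm (p1 z))" and ?F0 = "sep F (%z. ~b<:dm (p1 z))"
 have s: "?F1<<=F" "?F0<<=F" by (simp_all add: sub_def sep[OF ds(1)] sep[OF ds(2)])
 have cF: "cond (sc b) (p1 z)" if "z<:F" for z using that F unfolding fam_def by blast
 show "EX z w r. z<:F&w<:F&cond (sc b) r&LE t r (p1 z)&LE t r (p1 w)&K r (qy z) (qy w)"
 proof (cases "ctbl ?F1")
  case True
  have "F = un ?F0 ?F1" by (rule seteq) (auto simp: sep[OF ds(1)] sep[OF ds(2)])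
  then have "~ctbl ?F0" using True ctbl_un F unfolding fam_def by metis
  then have f0: "fam (sc b) ?F0" using fam_sub[OF F s(2)] by blast
  have "cond b (p1 z)" if "z<:?F0" for z
   using that cF[of z] unfolding sep[OF ds(2)] cond_def by (auto simp: sub_def)
  then have "fam b ?F0" using f0 unfolding fam_def by blast
  then show ?thesis using g(1) s(2) cond_mono[OF _ bs] subD unfolding good_def by meson
 next
  case False
  then have f1: "fam (sc b) ?F1" using fam_sub[OF F s(1)] by blast
  let ?f = "%z. quad (rs (p1 z) b) (app (p1 z) b) (qy z)"
  have dq: "DfnT (%e. ?f (e 0))" by (intro dfn)
  have bd: "b<:dm (p1 z)" "z<:F" if "z<:?F1" for z using that unfolding sep[OF ds(1)] by blast+
  have "fam b (img ?f ?F1)"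
  proof -
   have "lep ?F1 (img ?f ?F1)"
   proof (rule lepI[OF dq])
    fix x y assume "x<:?F1" "y<:?F1" "?f x = ?f y"
    then show "x = y" using f1 unfolding fam_def by (metis quad(3))
   qed (auto simp: img[OF dq])
   then have "~ctbl (img ?f ?F1)" using False ctbl_lep by blast
   moreover have "cond b (p1 z)&qa z<:om1&p1 (qy z)<:IA&p2 (qy z)<:IB" if hz: "z<:img ?f ?F1" for z
   proof -
    obtain z' where z': "z'<:?F1" "z = ?f z'" using hz unfolding img[OF dq] by blast
    then show ?thesis using f1 cond_rs(1)[OF cF] cond_app[OF cF] bd[OF z'(1)] unfolding fam_def by simp
   qed
   moreover have "p1 (qy z) ~= p1 (qy w)&p2 (qy z) ~= p2 (qy w)" if zw: "z<:img ?f ?F1" "w<:img ?f ?F1" "z ~= w" for z w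
   proof -
    obtain z' w' where z': "z'<:?F1" "z = ?f z'" "w'<:?F1" "w = ?f w'" using zw(1,2) unfolding img[OF dq] by blast
    then have "z' ~= w'" using zw(3) by blast
    then show ?thesis using f1 z' unfolding fam_def by simp
   qed
   ultimately show ?thesis unfolding fam_def by blast
  qed
  then obtain z' w' r c where h: "z'<:img ?f ?F1" "w'<:img ?f ?F1" "cond b r" "LE t r (p1 z')" "LE t r (p1 w')" "K r (qy z') (qy w')"
   "c<:om1" "cle (app t b) r c (qa z')" "cle (app t b) r c (qa w')" using g(2) unfolding good2_def by blast
  obtain z w where zw: "z<:?F1" "w<:?F1" "z' = ?f z" "w' = ?f w" using h(1,2) unfolding img[OF dq] by blast
  let ?r = "ins (pair b c) r"
  have nb: "~b<:dm r" using cond_dm[OF h(3)] not_self by blast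
  note i = ins_cond[OF cond_mono[OF h(3) bs] _ nb h(7)]
  have i': "cond (sc b) ?r" "dm ?r = ins b (dm r)" "app ?r b = c" "!!y. y<:dm r==>app ?r y = app r y" using i by auto
  have rb: "rs ?r b = r"
  proof (rule cond_eqI[OF cond_rs(1)[OF i'(1)] h(3)])
   show e: "dm (rs ?r b) = dm r" unfolding dm_rs i'(2) by (rule seteq) (use cond_dm[OF h(3)] in auto)
   fix x assume "x<:dm (rs ?r b)"
   then have "x<:dm r" using e by simp
   then show "app (rs ?r b) x = app r x" using cond_rs(2)[OF i'(1)] i'(2,4) cond_dm[OF h(3)] by simp
  qed
  have LEz: "LE t ?r (p1 z)" if "z<:?F1" "LE t r (rs (p1 z) b)" "cle (app t b) r c (app (p1 z) b)" for z
  proof (rule LE_join[OF _ i'(1) cF[OF bd(2)[OF that(1)]] o(1)])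
   show "LE t (rs ?r b) (rs (p1 z) b)" using rb that by simp
   fix x assume x: "x<:dm (p1 z)" "~x<:b"
   then have "x = b" using cond_dm[OF cF[OF bd(2)[OF that(1)]]] by auto
   then show "x<:dm ?r&cle (app t x) (rs ?r x) (app ?r x) (app (p1 z) x)" using i' rb that(3) by simp
  qed
  have "LE t ?r (p1 z)" "LE t ?r (p1 w)" using LEz zw h by auto
  moreover have "K ?r (qy z) (qy w)"
   using K_rs[OF i'(1) o(2), of "qy z" "qy w"] fam_om1[OF f1] zw h(6) rb by simp
  ultimately show ?thesis using bd(2)[OF zw(1)] bd(2)[OF zw(2)] i'(1) by blast
 qed
qed

end

context zfc begin

lemma fn_ins: assumes "fn f n c" "a<:c" "~x<:n"
 shows "fn (ins (pair x a) f) (ins x n) c" "app (ins (pair x a) f) x = a" "y<:n==>app (ins (pair x a) f) y = app f y"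
proof -
 have f1: "fn (upair (pair x a) (pair x a)) (upair x x) c" using assms(2) by (auto simp: fn_def)
 have a1: "app (upair (pair x a) (pair x a)) x = a" unfolding app_def by (rule des_eq) auto
 have e: "ins (pair x a) f = un f (upair (pair x a) (pair x a))" "un n (upair x x) = ins x n"
  by (rule seteq, simp)+
 have dj: "ALL y. y<:n-->~y<:upair x x" using assms(3) by auto
 note u = fn_un[OF assms(1) f1 dj, folded e(1), unfolded e(2)]
 show "fn (ins (pair x a) f) (ins x n) c" by (rule u(1))
 show "app (ins (pair x a) f) x = a" using u(3)[of x] a1 by simp
 show "y<:n==>app (ins (pair x a) f) y = app f y" by (rule u(2))
qed

lemma two_elements: assumes "~ctbl a" shows "EX x y. x<:a&y<:a&x ~= y"
proof (rule ccontr)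
 assume n: "~?thesis"
 have "a ~= emp" using assms fin_ctbl[OF fin_emp] by blast
 then obtain x where "x<:a" using ex_mem by blast
 then have "a<<=ins x emp" using n by (auto simp: sub_def)
 then show False using assms fin_ctbl[OF fin_ins[OF fin_emp]] ctbl_sub by blast
qed

lemma fn_codomain: assumes "fn f a b" "!!x. x<:a==>app f x<:c" shows "fn f a c"
proof -
 have d: "DfnT (%e. app f (e 0))" by (intro dfn)
 have "fn (lam a (app f)) a c" by (rule lam_fn[OF d assms(2)])
 then show ?thesis using fn_eta[OF assms(1)] by metis
qed

subsection \<open>Bookkeeping\<close>

lemma lep_sc: assumes "om<<=g" shows "lep (sc g) g"
proof -
 let ?F = "%x. if x = g then emp else if x<:om then sc x else x"
 have d: "DfnT (%e. ?F (e 0))" by (intro dfn)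
 have go: "~g<:om" using assms subD not_self by blast
 have so: "sc x<:g" if "x<:om" for x using that assms sc_om subD by blast
 show ?thesis
 proof (rule lepI[OF d])
  fix x assume "x<:sc g"
  then show "?F x<:g" using so subD[OF assms emp_om] by auto
 next
  fix x y assume "x<:sc g" "y<:sc g" "?F x = ?F y"
  then show "x = y" using sc_om emp_om by (auto split: if_splits)
 qed
qed

lemma lep_pw: assumes "lep a b" shows "lep (pw a) (pw b)"
proof -
 obtain f where f: "fn f a b" "inj f a" using assms unfolding lep_def by blast
 have df: "DfnT (%e. app f (e 0))" by (intro dfn)
 have d: "DfnT (%e. img (app f) (e 0))" by (intro dfn)
 show ?thesis
 proof (rule lepI[OF d])
  fix x assume "x<:pw a"
  then show "img (app f) x<:pw b" using f(1) fn_app(2) by (auto simp: sub_def img[OF df])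
 next
  fix x y assume xy: "x<:pw a" "y<:pw a" and e: "img (app f) x = img (app f) y"
  have "z<:img (app f) w<->(EX u. u<:w&z = app f u)" for z w by (rule img[OF df])
  then have "u<:y" if "u<:x" for u using that e xy f(2) unfolding inj_def pw sub_def by metis
  moreover have "u<:x" if "u<:y" for u using that e xy f(2) img[OF df] unfolding inj_def pw sub_def by metis
  ultimately show "x = y" by (intro seteq) blast
 qed
qed

lemma lep_Fnc: assumes "lep a b" shows "lep (Fnc c a) (Fnc c b)"
proof -
 obtain f where f: "fn f a b" "inj f a" using assms unfolding lep_def by blast
 have dg: "DfnT (%e. app f (app g (e 0)))" for g by (intro dfn)
 have d: "DfnT (%e. lam c (%x. app f (app (e 0) x)))" by (intro dfn)
 show ?thesis
 proof (rule lepI[OF d])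
  fix g assume "g<:Fnc c a"
  then show "lam c (%x. app f (app g x))<:Fnc c b" unfolding Fnc using lam_fn[OF dg] f(1) fn_app(2) by blast
 next
  fix g h assume g: "g<:Fnc c a" and h: "h<:Fnc c a" and e: "lam c (%x. app f (app g x)) = lam c (%x. app f (app h x))"
  have "app g x = app h x" if "x<:c" for x
   using lam_app[OF dg that, of g] lam_app[OF dg that, of h] e f(2) g h that fn_app(2) unfolding inj_def Fnc by metis
  then show "g = h" using fn_eqI g h unfolding Fnc by blast
 qed
qed

text \<open>The iteration will have as length the least ordinal of this size. The size is unchanged
  by forming functions from \<open>om1\<close>, which gives both the cofinality and the count of
  names.\<close>

definition Pi1 :: U where "Pi1 = pw om1"

text \<open>A function from \<open>om1\<close> to subsets of \<open>om1\<close> is coded by a subset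
  of the square of \<open>om1\<close>.\<close>

lemma Pi1_Fnc: "lep (Fnc om1 Pi1) Pi1"
proof -
 let ?G = "%f. sep (cart om1 om1) (%z. p2 z<:app f (p1 z))"
 have d: "DfnT (%e. ?G (e 0))" by (intro dfn)
 have ds: "Dfn (%e. p2 (e 0)<:app f (p1 (e 0)))" for f by (intro dfn)
 have G: "pair x y<:?G f<->x<:om1&y<:om1&y<:app f x" for x y f by (simp add: sep[OF ds])
 have "lep (Fnc om1 Pi1) (pw (cart om1 om1))"
 proof (rule lepI[OF d])
  show "?G f<:pw (cart om1 om1)" for f by (simp add: sub_def sep[OF ds])
  fix f g assume f: "f<:Fnc om1 Pi1" and g: "g<:Fnc om1 Pi1" and e: "?G f = ?G g"
  have "app f x = app g x" if x: "x<:om1" for x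
  proof (rule seteq)
   fix y
   have s: "app f x<<=om1" "app g x<<=om1" using f g x fn_app(2) unfolding Fnc Pi1_def pw[symmetric] by blast+
   have "pair x y<:?G f<->pair x y<:?G g" using e by simp
   then show "y<:app f x<->y<:app g x" unfolding G using x s subD by blast
  qed
  then show "f = g" using fn_eqI f g unfolding Fnc by blast
 qed
 then show ?thesis using lep_pw[OF lep_om1_square] lep_trans unfolding Pi1_def by blast
qed

lemma emp_om1: "emp<:om1" "sc emp<:om1"
 using om_om1 Ord_trans[OF Ord_om1 _ om_om1] by simp_all

lemma Pi1_cart: assumes "lep a Pi1" "lep b Pi1" shows "lep (cart a b) Pi1"
proof -
 let ?F = "%z. lam om1 (%x. if x = emp then p1 z else p2 z)"
 have d: "DfnT (%e. ?F (e 0))" by (intro dfn)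
 have di: "DfnT (%e. if e 0 = emp then p1 z else p2 z)" for z by (intro dfn)
 have "lep (cart Pi1 Pi1) (Fnc om1 Pi1)"
 proof (rule lepI[OF d])
  fix z assume "z<:cart Pi1 Pi1"
  then show "?F z<:Fnc om1 Pi1" unfolding Fnc by (intro lam_fn[OF di]) (auto simp: cart)
 next
  fix z w assume zw: "z<:cart Pi1 Pi1" "w<:cart Pi1 Pi1" and e: "?F z = ?F w"
  have "p1 z = p1 w" "p2 z = p2 w"
   using lam_app[OF di emp_om1(1), of z] lam_app[OF di emp_om1(1), of w] lam_app[OF di emp_om1(2), of z] lam_app[OF di emp_om1(2), of w] e by simp_all
  then show "z = w" using zw by (auto simp: cart)
 qed
 then show ?thesis using Pi1_Fnc lep_cart[OF assms] lep_trans by blast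
qed

lemma Pi1_om1: "lep om1 Pi1"
 unfolding Pi1_def by (rule lep_sub) (use Ord_om1 Ord_trans in \<open>auto simp: sub_def\<close>)

lemma Pi1_sc: assumes "lep a Pi1" shows "lep (sc a) Pi1"
proof -
 let ?b = "ins emp (ins (sc emp) emp)"
 have b: "lep ?b Pi1"
  by (rule lep_trans[OF lep_sub Pi1_om1]) (use emp_om1 in \<open>auto simp: sub_def\<close>)
 obtain f where f: "fn f a Pi1" "inj f a" using assms unfolding lep_def by blast
 let ?H = "%y. if y = a then pair emp emp else pair (app f y) (sc emp)"
 have dH: "DfnT (%e. ?H (e 0))" by (intro dfn)
 have "emp<:Pi1" by (simp add: Pi1_def)
 then have "lep (sc a) (cart Pi1 ?b)"
  by (intro lepI[OF dH]) (use f fn_app(2)[OF f(1)] in \<open>auto split: if_splits simp: inj_def\<close>)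
 then show ?thesis using Pi1_cart[OF lep_refl b] lep_trans by blast
qed

definition Sub1 :: "U => U" where "Sub1 a = sep (pw a) (%p. lep p om1)"

lemma Sub1: "p<:Sub1 a<->p<<=a&lep p om1"
proof -
 have "Dfn (%e. lep (e 0) om1)" by (intro dfn)
 then show ?thesis unfolding Sub1_def by (simp add: sep)
qed

lemma Pi1_Sub1: assumes "lep a Pi1" shows "lep (Sub1 a) Pi1"
proof -
 let ?F = "%g. df (rg g) (upair a a)"
 have d: "DfnT (%e. ?F (e 0))" by (intro dfn)
 have "lep (Sub1 a) (Fnc om1 (sc a))"
 proof (rule lep_surj[OF d])
  fix p assume "p<:Sub1 a"
  then have p: "p<<=a" "lep p om1" unfolding Sub1 by blast+
  obtain f where f: "fn f p om1" "inj f p" using p(2) unfolding lep_def by blast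
  let ?G = "%x. des (%y. y<:p&app f y = x | y = a&~(EX u. u<:p&app f u = x))"
  have dG: "DfnT (%e. ?G (e 0))" by (intro dfn)
  have G1: "?G (app f y) = y" if "y<:p" for y
   by (rule des_eq) (use that f(2) in \<open>unfold inj_def, blast+\<close>)
  have G2: "?G x = a" if "~(EX u. u<:p&app f u = x)" for x
   by (rule des_eq) (use that in blast)+
  have G: "?G x = a | ?G x<:p" for x
  proof (cases "EX u. u<:p&app f u = x")
   case True
   then obtain u where u: "u<:p" "app f u = x" by blast
   have e: "?G x = u" using G1[OF u(1)] unfolding u(2) .
   show ?thesis unfolding e using u(1) by (rule disjI2)
  next
   case False
   show ?thesis by (rule disjI1) (rule G2[OF False])
  qed
  have fg: "fn (lam om1 ?G) om1 (sc a)" by (rule lam_fn[OF dG]) (use G p(1) subD in \<open>unfold sc, blast\<close>)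
  moreover have "p = ?F (lam om1 ?G)"
  proof (rule seteq)
   fix y
   have la: "app (lam om1 ?G) x = ?G x" if "x<:om1" for x by (rule lam_app[OF dG that])
   have r: "y<:rg (lam om1 ?G)<->(EX x. x<:om1&y = ?G x)"
    unfolding rg_fn[OF fg] by (intro ex_cong1 conj_cong refl) (simp only: la)
   have na: "y ~= a" if "y<:p" using that p(1) subD not_self by blast
   have "y<:p==>app f y<:om1" using f(1) fn_app(2) by blast
   moreover have "y = a | y<:p" if h: "EX x. x<:om1&y = ?G x"
   proof -
    obtain x where "y = ?G x" using h by blast
    then show ?thesis using G[of x] by simp
   qed
   moreover have "y<:p==>y = ?G (app f y)" using G1 by simp
   ultimately show "y<:p<->y<:?F (lam om1 ?G)" unfolding df upair r using na by blast
  qed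
  ultimately show "EX g. g<:Fnc om1 (sc a)&p = ?F g" unfolding Fnc by blast
 qed
 then show ?thesis using lep_Fnc[OF Pi1_sc[OF assms]] Pi1_Fnc lep_trans by blast
qed

text \<open>A condition together with a name of at most \<open>om1\<close> many entries for a
  relation on \<open>om1\<close>; the orders offered after the Cohen coordinates come from such
  codes.\<close>

definition Codes :: "U => U" where "Codes l = cart (Cnd l) (Sub1 (cart (Cnd l) (cart om1 om1)))"

lemma Pi1_Cnd: assumes "lep a Pi1" shows "lep (Cnd a) Pi1"
proof -
 have "Cnd a<<=Sub1 (cart a om1)"
 proof (rule subI)
  fix p assume "p<:Cnd a"
  then have c: "cond a p" by (simp add: Cnd)
  note m = fn_mem[OF cond_fn[OF c]]
  have "p<<=cart a om1" using m cond_dm[OF c] cond_app[OF c] by (auto simp: sub_def cart)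
  have dp: "DfnT (%e. p1 (e 0))" by (intro dfn)
  have "lep p (dm p)" by (rule lepI[OF dp]) (use m in auto)
  moreover have "lep (dm p) om1" using fin_ctbl[OF cond_fin[OF c]] om_om1 Ord_om1 Ord_sub[OF Ord_om Ord_om1] lep_sub lep_trans unfolding ctbl_def by blast
  ultimately show "p<:Sub1 (cart a om1)" unfolding Sub1 using \<open>p<<=cart a om1\<close> lep_trans by blast
 qed
 then show ?thesis using Pi1_Sub1[OF Pi1_cart[OF assms Pi1_om1]] lep_sub lep_trans by blast
qed

lemma Pi1_Codes: "lep a Pi1==>lep (Codes a) Pi1"
 unfolding Codes_def by (intro Pi1_cart Pi1_Cnd Pi1_Sub1 Pi1_om1)

text \<open>The length is the least ordinal of the size of \<open>Pi1\<close>. A Koenig argument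
  bounds the maps from \<open>om1\<close> into it, and as pairs of an ordinal below it and a code
  can be numbered by it, each code recurs cofinally.\<close>

lemma bookkeeping:
 "EX l h. Ord l&om1<:l&(ALL x. x<:l-->sc x<:l) &
  (ALL f. fn f om1 l-->(EX b. b<:l&(ALL x. x<:om1-->app f x<<=b))) &
  (ALL c. c<:Codes l-->(ALL b. b<:l-->(EX x. x<:l&~x<:b&app h x = c)))"
proof -
 obtain \<theta> g where t: "Ord \<theta>" "bij g \<theta> Pi1" using wellordering by blast
 have "Dfn (%e. lep Pi1 (e 0))" by (intro dfn)
 then obtain l where l: "Ord l" "lep Pi1 l" "!!c. c<:l==>~lep Pi1 c"
  using Ord_least[of "lep Pi1" \<theta>] t(1) bij_lep(2)[OF t(2)] by blast
 have "~\<theta><:l" using l(3) bij_lep(2)[OF t(2)] by blast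
 then have lP: "lep l Pi1" using Ord_not_mem[OF t(1) l(1)] bij_lep(1)[OF t(2)] lep_sub lep_trans by blast
 have nl: "~lep l c" if "c<:l" for c using l(2) l(3)[OF that] lep_trans by blast
 have om1l: "om1<:l"
 proof (rule ccontr)
  assume "~om1<:l"
  then have "l<<=om1" using Ord_not_mem[OF Ord_om1 l(1)] by blast
  then show False using l(2) cantor[of om1] lep_sub lep_trans unfolding Pi1_def by blast
 qed
 have lim: "sc x<:l" if x: "x<:l" for x
 proof (rule ccontr)
  assume "~sc x<:l"
  then have e: "sc x = l" using Ord_sc_mem[OF l(1) x] by blast
  then have "om1<:x | om1 = x" using om1l by (metis sc)
  then have "om1<<=x" using Ord_sub[OF Ord_om1] x l(1) Ord_mem by blast
  then have "om<<=x" using Ord_sub[OF Ord_om Ord_om1] om_om1 sub_trans by blast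
  then show False using lep_sc e nl[OF x] by metis
 qed
 have koenig: "EX b. b<:l&(ALL x. x<:om1-->app f x<<=b)" if f: "fn f om1 l" for f
 proof (rule ccontr)
  assume n: "~?thesis"
  have ub: "EX x. x<:om1&b<:app f x" if b: "b<:l" for b
  proof -
   obtain x where x: "x<:om1" "~app f x<<=b" using n b by blast
   have "Ord (app f x)" "Ord b" using fn_app(2)[OF f x(1)] b l(1) Ord_mem by blast+
   then show ?thesis using x Ord_not_mem[of b "app f x"] by blast
  qed
  have "lep (Fnc om1 l) l" using lep_Fnc[OF lP] Pi1_Fnc l(2) lep_trans by blast
  then obtain e where e: "fn e (Fnc om1 l) l" "inj e (Fnc om1 l)" unfolding lep_def by blast
  \<comment> \<open>Diagonalisation: at \<open>x\<close> the values of all functions with number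
    below \<open>f x\<close> are avoided. If \<open>f\<close> were unbounded, the resulting function
    could have no number.\<close>
  let ?P = "%x y. y<:l&(ALL k. k<:Fnc om1 l-->app e k<:app f x-->app k x ~= y)"
  have dP: "Dfn (%e. ?P (e 0) (e (Suc 0)))" by (intro dfn)
  have "EX y. ?P x y" if x: "x<:om1" for x
  proof (rule ccontr)
   assume n: "~(EX y. ?P x y)"
   let ?F = "%u. app (des (%k. k<:Fnc om1 l&app e k = u)) x"
   have dF: "DfnT (%e. ?F (e 0))" by (intro dfn)
   have "lep l (app f x)"
   proof (rule lep_surj[OF dF])
    fix y assume "y<:l"
    then obtain k where k: "k<:Fnc om1 l" "app e k<:app f x" "app k x = y" using n by blast
    have "des (%k'. k'<:Fnc om1 l&app e k' = app e k) = k"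
     by (rule des_eq) (use k e(2) in \<open>unfold inj_def, blast+\<close>)
    then show "EX u. u<:app f x&y = ?F u" using k by metis
   qed
   then show False using nl fn_app(2)[OF f x] by blast
  qed
  then have "EX k c. fn k om1 c&(ALL x. x<:om1-->?P x (app k x))" by (rule choice_fun[OF dP])
  then obtain k c where k: "fn k om1 c" "!!x. x<:om1==>?P x (app k x)" by blast
  have "k<:Fnc om1 l" unfolding Fnc using fn_codomain[OF k(1)] k(2) by blast
  then show False using ub[of "app e k"] fn_app(2)[OF e(1)] k(2) by blast
 qed
 have "lep (cart l (Codes l)) l" using Pi1_cart[OF lP Pi1_Codes[OF lP]] l(2) lep_trans by blast
 then obtain e where e: "fn e (cart l (Codes l)) l" "inj e (cart l (Codes l))" unfolding lep_def by blast
 let ?H = "%x. p2 (des (%z. z<:cart l (Codes l)&app e z = x))"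
 have dH: "DfnT (%e. ?H (e 0))" by (intro dfn)
 have H: "?H (app e (pair b c)) = c" if "b<:l" "c<:Codes l" for b c
 proof -
  have "des (%z. z<:cart l (Codes l)&app e z = app e (pair b c)) = pair b c"
   by (rule des_eq) (use that e(2) in \<open>unfold inj_def, auto\<close>)
  then show ?thesis by simp
 qed
 have el: "app e (pair b c)<:l" if "b<:l" "c<:Codes l" for b c using fn_app(2)[OF e(1)] that by simp
 have "EX x. x<:l&~x<:b&app (lam l ?H) x = c" if c: "c<:Codes l" and b: "b<:l" for c b
 proof (rule ccontr)
  assume n: "~?thesis"
  have de: "DfnT (%x. app e (pair (x 0) c))" by (intro dfn)
  \<comment> \<open>The occurrences of the code, one for each ordinal below \<open>l\<close>, would
    all fall below \<open>b\<close>.\<close>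
  have "lep l b"
  proof (rule lepI[OF de])
   fix x assume x: "x<:l"
   note l1 = el[OF x c]
   have "app (lam l ?H) (app e (pair x c)) = c" using lam_app[OF dH l1] unfolding H[OF x c] .
   then show "app e (pair x c)<:b" using n l1 by blast
  next
   fix x y assume "x<:l" "y<:l" "app e (pair x c) = app e (pair y c)"
   then have "pair x c = pair y c" using e(2) c unfolding inj_def by (metis cart_pair)
   then show "x = y" by simp
  qed
  then show False using nl b by blast
 qed
 then have "ALL c. c<:Codes l-->(ALL b. b<:l-->(EX x. x<:l&~x<:b&app (lam l ?H) x = c))" by simp
 moreover have "ALL x. x<:l-->sc x<:l" "ALL f. fn f om1 l-->(EX b. b<:l&(ALL x. x<:om1-->app f x<<=b))" using lim koenig by simp_all
 ultimately show ?thesis using l(1) om1l by (intro exI[of _ l] exI[of _ "lam l ?H"] conjI)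
qed

end

context coh begin

subsection \<open>Cohen coordinates\<close>

lemma LE_coh: assumes "coht t" "cond om1 p" "cond om1 q" "!!x. x<:dm p==>x<:dm q&app sv (app p x)<<=app sv (app q x)"
 shows "LE t q p"
 unfolding LE_def
proof (intro allI impI)
 fix x assume x: "x<:dm p"
 then have "x<:om1" using cond_dm[OF assms(2)] by blast
 then have "app t x = cot x" using assms(1) by (simp add: coht_def)
 then show "x<:dm q&(app q x = app p x | tri (rs q x) (app q x) (app p x)<:app t x)"
  using assms(4)[OF x] cond_rs(1)[OF assms(3)] cond_app[OF assms(2) x] cond_app[OF assms(3)] by (simp add: cot)
qed

text \<open>After thinning, two members carry the same sequences on the root of their supports and
  at their own indices, which lie off the root. The left sequences are prolonged to a common one,
  the right ones by different last values.\<close>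

lemma good_cohen: assumes t: "coht t" shows "good om1 t"
 unfolding good_def
proof (intro allI impI)
 fix F assume F: "fam om1 F"
 have cF: "cond om1 (p1 z)" if "z<:F" for z using that F unfolding fam_def by blast
 define S where "S z x = (if x<:dm (p1 z) then app sv (app (p1 z) x) else emp)" for z x
 \<comment> \<open>The supports are enlarged by the indices, so that the Delta-system controls the
   indices as well.\<close>
 define D where "D z = ins (p1 (qy z)) (ins (p2 (qy z)) (dm (p1 z)))" for z
 have dS: "DfnT s==>DfnT u==>DfnT (%e. S (s e) (u e))" for s u
  by (rule DfnT2[of S], unfold S_def, intro dfn)
 have dD: "DfnT (%e. D (e 0))" unfolding D_def by (intro dfn)
 have fD: "fin (D z)" if "z<:F" for z unfolding D_def using cond_fin[OF cF[OF that]] by simp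
 obtain G r where G: "G<<=F" "~ctbl G" "fin r" "!!p q. p<:G==>q<:G==>p ~= q==>it (D p) (D q) = r"
  using delta_system[OF dD _ fD] F unfolding fam_def by blast
 have di: "DfnT (%e. p1 (qy (e 0)))" and dk: "DfnT (%e. p2 (qy (e 0)))" by (intro dfn)+
 have dsi: "Dfn (%e. p1 (qy (e 0))<:r)" and dsk: "Dfn (%e. p2 (qy (e 0))<:r)" by (intro dfn)+
 \<comment> \<open>Indices determine the member, so only finitely many members have an index in the
   finite root.\<close>
 let ?Bi = "sep G (%z. p1 (qy z)<:r)" and ?Bk = "sep G (%z. p2 (qy z)<:r)"
 have inj: "z = w" if "z<:G" "w<:G" "p1 (qy z) = p1 (qy w) | p2 (qy z) = p2 (qy w)" for z w
  using that F subD[OF G(1)] unfolding fam_def by blast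
 have "lep ?Bi r" by (rule lepI[OF di]) (use inj in \<open>auto simp: sep[OF dsi]\<close>)
 moreover have "lep ?Bk r" by (rule lepI[OF dk]) (use inj in \<open>auto simp: sep[OF dsk]\<close>)
 ultimately have cB: "ctbl (un ?Bi ?Bk)" using ctbl_un fin_ctbl fin_lep G(3) by blast
 let ?G = "df G (un ?Bi ?Bk)"
 have "G<<=un ?G (un ?Bi ?Bk)" by (auto simp: sub_def)
 then have uG: "~ctbl ?G" using cB ctbl_un ctbl_sub G(2) by blast
 have empSq: "emp<:Sq" unfolding Sq by (rule exI[of _ emp]) (simp add: fn_def)
 have SS: "S z x<:Sq" if "z<:F" for z x unfolding S_def using empSq sv_Sq cond_app[OF cF[OF that]] by simp
 let ?Ph = "%z. pair (lam r (S z)) (pair (S z (p1 (qy z))) (S z (p2 (qy z))))"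
 have dPh: "DfnT (%e. ?Ph (e 0))" by (intro dfn dS)
 have dSz: "DfnT (%e. S z (e 0))" for z by (intro dS dfn)
 have "?Ph z<:cart (Fnc r Sq) (cart Sq Sq)" if "z<:?G" for z
 proof -
  have z: "z<:F" using that subD[OF G(1)] by simp
  have "fn (lam r (S z)) r Sq" by (rule lam_fn[OF dSz]) (rule SS[OF z])
  then show ?thesis using SS[OF z] by (simp add: Fnc)
 qed
 moreover have "ctbl (cart (Fnc r Sq) (cart Sq Sq))" using ctbl_cart ctbl_Fnc[OF G(3) ctbl_Sq] ctbl_Sq by blast
 ultimately obtain y where "~ctbl (sep ?G (%z. ?Ph z = y))" using unc_fiber[OF dPh uG] by blast
 then obtain z w where zw0: "z<:sep ?G (%z. ?Ph z = y)" "w<:sep ?G (%z. ?Ph z = y)" "z ~= w" using two_elements by blast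
 have dy: "Dfn (%e. ?Ph (e 0) = y)" by (intro dfn dS)
 have zG: "z<:?G" "w<:?G" "?Ph z = ?Ph w" using zw0(1,2) unfolding sep[OF dy] by simp_all
 define i k i' k' where ik: "i = p1 (qy z)" "k = p2 (qy z)" "i' = p1 (qy w)" "k' = p2 (qy w)"
 have z: "z<:G" "z<:F" "w<:G" "w<:F" using zG subD[OF G(1)] by auto
 have nr: "~i<:r" "~k<:r" "~i'<:r" "~k'<:r" using zG z unfolding df un sep[OF dsi] sep[OF dsk] ik by blast+
 have Sr: "S z x = S w x" if "x<:r" for x
 proof -
  have "lam r (S z) = lam r (S w)" using zG(3) by simp
  then show ?thesis using lam_app[OF dSz that] by metis
 qed
 have Si: "S z i = S w i'" and Sk: "S z k = S w k'" using zG(3) unfolding ik by simp_all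
 have root: "it (D z) (D w) = r" using G(4)[OF z(1,3) zw0(3)] .
 have AB: "i<:IA" "i'<:IA" "k<:IB" "k'<:IB" using F z unfolding fam_def ik by blast+
 have o1: "i<:om1" "i'<:om1" "k<:om1" "k'<:om1" using AB IA(1) IB(1) subD by blast+
 have ne1: "i ~= i'" "k ~= k'" using inj[OF z(1,3)] zw0(3) unfolding ik by blast+
 have "i ~= k" "i ~= k'" "i' ~= k" "i' ~= k'" using dj[OF AB(1)] dj[OF AB(2)] AB(3,4) by blast+
 note ne = ne1 this
 obtain n where n: "n<:om" "fn (S z i) n two" using SS[OF z(2)] Sq by blast
 obtain n' where n': "n'<:om" "fn (S z k) n' two" using SS[OF z(2)] Sq by blast
 \<comment> \<open>The common left length \<open>m\<close> must not cut the old left sequence and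
   must exceed \<open>n'\<close>, the position at which the right sequences are going to
   differ.\<close>
 have "EX m. m<:om&n<<=m&n'<:m"
 proof (cases "n'<:n")
  case True
  then show ?thesis using n(1) by (intro exI[of _ n]) simp
 next
  case False
  then have "n<<=n'" using Ord_not_mem[of n' n] n(1) n'(1) om_Ord_mem by blast
  then show ?thesis using n'(1) by (intro exI[of _ "sc n'"]) (auto simp: sub_def)
 qed
 then obtain m where m: "m<:om" "n<<=m" "n'<:m" by blast
 have tw: "emp<:two" "sc emp<:two" by (simp_all add: two_def)
 let ?pf = "%x. if x<:n then app (S z i) x else emp"
 have dpf: "DfnT (%e. ?pf (e 0))" by (intro dfn)
 let ?pad = "lam m ?pf"
 have pad: "fn ?pad m two" by (rule lam_fn[OF dpf]) (use fn_app(2)[OF n(2)] tw in auto)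
 have padS: "?pad<:Sq" using pad m(1) Sq by blast
 have spad: "S z i<<=?pad"
 proof (rule subI)
  fix u assume "u<:S z i"
  then obtain x where "x<:n" "u = pair x (app (S z i) x)" using fn_mem[OF n(2)] by blast
  then show "u<:?pad" unfolding lam_mem[OF dpf] using m(2) subD by (intro exI[of _ x]) auto
 qed
 have insn: "ins n' n' = sc n'" by (rule seteq) auto
 have e: "fn (ins (pair n' a) (S z k)) (sc n') two" "app (ins (pair n' a) (S z k)) n' = a" "ins (pair n' a) (S z k)<:Sq"
  "S z k<<=ins (pair n' a) (S z k)" if "a<:two" for a
 proof -
  note fi = fn_ins[OF n'(2) that not_self]
  show "fn (ins (pair n' a) (S z k)) (sc n') two" using fi(1) insn by simp
  then show "ins (pair n' a) (S z k)<:Sq" using Sq sc_om n'(1) by blast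
  show "app (ins (pair n' a) (S z k)) n' = a" by (rule fi(2))
  show "S z k<<=ins (pair n' a) (S z k)" by (simp add: sub_def)
 qed
 obtain \<alpha> where al: "\<alpha><:om1" "app sv \<alpha> = ?pad" using sv(2)[OF padS] by blast
 obtain \<beta>0 where b0: "\<beta>0<:om1" "app sv \<beta>0 = ins (pair n' emp) (S z k)" using sv(2)[OF e(3)[OF tw(1)]] by blast
 obtain \<beta>1 where b1: "\<beta>1<:om1" "app sv \<beta>1 = ins (pair n' (sc emp)) (S z k)" using sv(2)[OF e(3)[OF tw(2)]] by blast
 \<comment> \<open>Away from the four indices the entry of the first condition wins; on the root it
   codes the same sequence as the entry of the second.\<close>
 let ?Q = "%x. if x = i | x = i' then \<alpha> else if x = k then \<beta>0 else if x = k' then \<beta>1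
   else if x<:dm (p1 z) then app (p1 z) x else app (p1 w) x"
 have dQ: "DfnT (%e. ?Q (e 0))" by (intro dfn)
 let ?d = "un (D z) (D w)"
 have Dd: "x<:D z<->x = i | x = k | x<:dm (p1 z)" "x<:D w<->x = i' | x = k' | x<:dm (p1 w)" for x
  unfolding D_def ik by auto
 have fq: "fn (lam ?d ?Q) ?d om1"
  by (rule lam_fn[OF dQ]) (use al b0 b1 cond_app[OF cF[OF z(2)]] cond_app[OF cF[OF z(4)]] Dd in auto)
 define q where "q = lam ?d ?Q"
 have q: "app q x = ?Q x" if "x<:?d" for x unfolding q_def by (rule lam_app[OF dQ that])
 have dmq: "dm q = ?d" unfolding q_def by (rule fn_dm[OF fq])
 have cq: "cond om1 q" unfolding q_def
 proof (rule condI[OF _ fq])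
  show "fin ?d" using fin_un fD z by blast
  show "?d<<=om1" using o1 cond_dm[OF cF[OF z(2)]] cond_dm[OF cF[OF z(4)]] Dd by (auto simp: sub_def)
 qed
 have Sin: "S z x = app sv (app (p1 z) x)" if "x<:dm (p1 z)" for x using that by (simp add: S_def)
 have Sin': "S w x = app sv (app (p1 w) x)" if "x<:dm (p1 w)" for x using that by (simp add: S_def)
 have inr: "x<:r" if "x<:D z" "x<:D w" for x using root that by (metis it)
 have "LE t q (p1 z)"
 proof (rule LE_coh[OF t cF[OF z(2)] cq])
  fix x assume x: "x<:dm (p1 z)"
  have xd: "x<:D z" using x Dd by blast
  have "x ~= i'" "x ~= k'" using inr[OF xd] nr Dd by blast+
  then have "app q x = (if x = i then \<alpha> else if x = k then \<beta>0 else app (p1 z) x)" using q[of x] xd x by simp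
  then show "x<:dm q&app sv (app (p1 z) x)<<=app sv (app q x)"
   using xd al(2) b0(2) spad e(4)[OF tw(1)] Sin[OF x] unfolding dmq by auto
 qed
 moreover have "LE t q (p1 w)"
 proof (rule LE_coh[OF t cF[OF z(4)] cq])
  fix x assume x: "x<:dm (p1 w)"
  have xd: "x<:D w" using x Dd by blast
  have nn: "x ~= i" "x ~= k" using inr[OF _ xd] nr Dd by blast+
  have Qx: "app q x = (if x = i' then \<alpha> else if x = k' then \<beta>1 else if x<:dm (p1 z) then app (p1 z) x else app (p1 w) x)"
   using q[of x] xd nn by simp
  have "app sv (app (p1 w) x)<<=app sv (app q x)"
  proof (cases "x = i' | x = k'")
   case True
   then show ?thesis using Qx al(2) b1(2) spad e(4)[OF tw(2)] Sin'[OF x] Si Sk ne(6) by auto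
  next
   case False
   show ?thesis
   proof (cases "x<:dm (p1 z)")
    case True
    then have "S z x = S w x" using Sr inr Dd xd by blast
    then show ?thesis using Qx False True Sin Sin' x by simp
   qed (use Qx False in simp)
  qed
  then show "x<:dm q&app sv (app (p1 w) x)<<=app sv (app q x)" using xd unfolding dmq by simp
 qed
 moreover have "K q (qy z) (qy w)"
 proof -
  have qi: "app q i = \<alpha>" "app q i' = \<alpha>" "app q k = \<beta>0" "app q k' = \<beta>1" using q Dd ne by auto
  have dms: "dm ?pad = m" "dm (app sv \<beta>0) = sc n'" "dm (app sv \<beta>1) = sc n'"
   using fn_dm[OF pad] fn_dm[OF e(1)[OF tw(1)]] fn_dm[OF e(1)[OF tw(2)]] b0 b1 by simp_all
  have "app (app sv \<beta>0) n' ~= app (app sv \<beta>1) n'" using e(2)[OF tw(1)] e(2)[OF tw(2)] b0(2) b1(2) by simp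
  moreover have "i<:dm q" "i'<:dm q" "k<:dm q" "k'<:dm q" unfolding dmq using Dd by auto
  moreover have "n'<:sc n'" by simp
  ultimately show ?thesis unfolding K_def ik[symmetric] qi al(2) dms using m dms by (intro conjI exI[of _ m] exI[of _ n']) simp_all
 qed
 ultimately show "EX z w r. z<:F&w<:F&cond om1 r&LE t r (p1 z)&LE t r (p1 w)&K r (qy z) (qy w)"
  using z cq by blast
qed

subsection \<open>The iteration\<close>

text \<open>The order with nice name \<open>R\<close>, whose elements are pairs of a condition and a pair of elements of
 \<open>om1\<close>, as it is forced below the condition \<open>c\<close>.\<close>

definition ftau :: "U => U => U => U => U" where
 "ftau t c R x = sep (cart (Cnd x) (cart om1 om1)) (%z. ALL q. cond x q-->LE t q (p1 z)-->LE t q c -->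
   (EX r s. cond x r&LE t r q&LE t r s&pair s (p2 z)<:R))"

lemma ftau: "tri p a b<:ftau t c R x<->cond x p&a<:om1&b<:om1&(ALL q. cond x q-->LE t q p-->LE t q c -->
   (EX r s. cond x r&LE t r q&LE t r s&pair s (pair a b)<:R))"
proof -
 have d: "Dfn (%e. ALL q. cond x q-->LE t q (p1 (e 0))-->LE t q c -->
   (EX r s. cond x r&LE t r q&LE t r s&pair s (p2 (e 0))<:R))" by (intro dfn)
 show ?thesis unfolding ftau_def tri_def sep[OF d] by (simp add: Cnd)
qed

lemma ftau_dfn [dfn]: assumes "DfnT s" "DfnT t" "DfnT u" "DfnT v" shows "DfnT (%e. ftau (s e) (t e) (u e) (v e))"
proof -
 have s: "DfnT (%e. ftau (s (%i. e (f i))) (e 0) (e (Suc 0)) (e (Suc (Suc 0))))" for f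
  unfolding ftau_def by (intro dfn DfnT_reidx[OF assms(1)])
 have "DfnT (%e. ftau (s e) (t e) (u e) (v e))"
 proof (rule DfnT_app[of "%e x. ftau (s e) (t e) (u e) x", OF _ assms(4)], rule DfnT_app[of "%e x. ftau (s (%i. e (Suc i))) (t (%i. e (Suc i))) x (e 0)", OF _ DfnT_shift[OF assms(3)]],
   rule DfnT_app[of "%e x. ftau (s (%i. e (Suc (Suc i)))) x (e 0) (e (Suc 0))", OF _ DfnT_reidx[OF assms(2)]])
  show "DfnT (%e. ftau (s (%i. e (Suc (Suc (Suc i))))) (e 0) (e (Suc 0)) (e (Suc (Suc 0))))" by (rule s)
 qed
 then show ?thesis .
qed

text \<open>The order relating everything, used at stages whose code is rejected.\<close>

definition triv :: "U => U" where "triv x = cart (Cnd x) (cart om1 om1)"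

lemma triv_dfn [dfn]: "DfnT s==>DfnT (%e. triv (s e))"
 by (rule DfnT1[of triv], unfold triv_def, intro dfn)

lemma triv: "tri p a b<:triv x<->cond x p&a<:om1&b<:om1"
 by (simp add: triv_def tri_def Cnd)

text \<open>Transitivity and goodness are computed from the iteration before \<open>x\<close>, so
  they are statements of the ground model on which the recursion can branch.\<close>

definition okc :: "U => U => U => U => bool" where
 "okc x t c R<->cond x c&R<<=cart (Cnd x) (cart om1 om1) &
  (ALL p a b d. tri p a b<:ftau t c R x-->tri p b d<:ftau t c R x-->tri p a d<:ftau t c R x) &
  good2 x t (ftau t c R x)"

lemma okc_dfn [dfn]: "DfnT s==>DfnT t==>DfnT u==>DfnT v==>Dfn (%e. okc (s e) (t e) (u e) (v e))"
 by (rule Dfn4[of okc], unfold okc_def, intro dfn)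

lemma good2_cong: assumes "!!y. y<:x==>app t y = app t' y" shows "good2 x t \<tau> <-> good2 x t' \<tau>"
proof -
 have "LE t r (p1 z)<->LE t' r (p1 z)" if "fam x F" "z<:F" for r z F
  using LE_cong[OF assms] that unfolding fam_def by blast
 then show ?thesis unfolding good2_def by meson
qed

lemma ftau_cong: assumes "!!y. y<:x==>app t y = app t' y" "cond x c" "R<<=cart (Cnd x) (cart om1 om1)"
 shows "ftau t c R x = ftau t' c R x"
proof -
 have l: "LE t q p<->LE t' q p" if "cond x p" for p q using LE_cong[OF assms(1) that] by blast
 have R: "cond x s" if "pair s z<:R" for s z using subD[OF assms(3) that] by (simp add: Cnd)
 have "z<:ftau t c R x<->z<:ftau t' c R x" for z
 proof (cases "EX p a b. z = tri p a b&cond x p")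
  case True
  then obtain p a b where "z = tri p a b" "cond x p" by blast
  then show ?thesis using l R assms(2) by (simp add: ftau) meson
 next
  case False
  have "EX p a b. z = tri p a b&cond x p" if "z<:cart (Cnd x) (cart om1 om1)" using that unfolding cart tri_def Cnd by blast
  moreover have "z<:cart (Cnd x) (cart om1 om1)" if "z<:ftau t c R x" for t
  proof -
   have d: "Dfn (%e. ALL q. cond x q-->LE t q (p1 (e 0))-->LE t q c -->
    (EX r s. cond x r&LE t r q&LE t r s&pair s (p2 (e 0))<:R))" by (intro dfn)
   show ?thesis using that unfolding ftau_def sep[OF d] by blast
  qed
  ultimately show ?thesis using False by blast
 qed
 then show ?thesis by (rule seteq)
qed

lemma okc_cong: assumes "!!y. y<:x==>app t y = app t' y" shows "okc x t c R<->okc x t' c R"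
proof (cases "cond x c&R<<=cart (Cnd x) (cart om1 om1)")
 case True
 then have e: "ftau t c R x = ftau t' c R x" using ftau_cong[OF assms] by blast
 have "good2 x t \<tau> <-> good2 x t' \<tau>" for \<tau> by (rule good2_cong[OF assms])
 then show ?thesis unfolding okc_def e by blast
qed (auto simp: okc_def)

lemma good2_triv: assumes "good x t" shows "good2 x t (triv x)"
 unfolding good2_def
proof (intro allI impI)
 fix F assume F: "fam x F"
 then obtain z w r where h: "z<:F" "w<:F" "cond x r" "LE t r (p1 z)" "LE t r (p1 w)" "K r (qy z) (qy w)" using assms unfolding good_def by blast
 have "qa z<:om1" "qa w<:om1" using F h unfolding fam_def by blast+
 then show "EX z w r c. z<:F&w<:F&cond x r&LE t r (p1 z)&LE t r (p1 w)&K r (qy z) (qy w) &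
   c<:om1&cle (triv x) r c (qa z)&cle (triv x) r c (qa w)"
  using h emp_om1(1) unfolding cle_def triv by blast
qed

theorem iteration:
 "EX l t. Ord l&om1<:l&(ALL x. x<:l-->sc x<:l) &
  (ALL f. fn f om1 l-->(EX b. b<:l&(ALL x. x<:om1-->app f x<<=b))) &
  coht t&valid l t&good l t &
  (ALL c R b. cond l c-->R<<=cart (Cnd l) (cart om1 om1)-->lep R om1-->b<:l -->
   (EX x. x<:l&b<<=x&om1<<=x&(okc x t c R-->app t x = ftau t c R x)))"
proof -
 obtain l h where l: "Ord l" "om1<:l" "!!x. x<:l==>sc x<:l"
  "!!f. fn f om1 l==>EX b. b<:l&(ALL x. x<:om1-->app f x<<=b)"
  "!!c b. c<:Codes l==>b<:l==>EX x. x<:l&~x<:b&app h x = c"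
  using bookkeeping by blast
 let ?H = "%x f. if x<:om1 then cot x else if okc x f (p1 (app h x)) (p2 (app h x)) then ftau f (p1 (app h x)) (p2 (app h x)) x else triv x"
 have dH: "DfnT (%e. ?H (e 0) (e (Suc 0)))" by (intro dfn)
 define T where "T = Rec ?H"
 have dT: "DfnT (%e. T (e 0))" unfolding T_def by (intro dfn)
 define t where "t = lam l T"
 have tT: "app t x = T x" if "x<:l" for x unfolding t_def by (rule lam_app[OF dT that])
 have t: "app t x = ?H x t" if x: "x<:l" for x
 proof -
  have e: "app (lam x T) y = app t y" if "y<:x" for y
   using lam_app[OF dT that] tT[of y] that x l(1) Ord_trans by simp
  have "okc x (lam x T) c R<->okc x t c R" for c R by (rule okc_cong) (rule e)
  moreover have "ftau (lam x T) c R x = ftau t c R x" if "okc x t c R" for c R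
   by (rule ftau_cong) (use e that okc_def in auto)
  moreover have "T x = ?H x (lam x T)" using Rec_eq[OF dH, of x] unfolding T_def .
  ultimately show ?thesis using tT[OF x] by simp
 qed
 have co: "coht t" unfolding coht_def
 proof (intro allI impI)
  fix x assume x: "x<:om1"
  then have "x<:l" using l(1,2) Ord_trans by blast
  then show "app t x = cot x" using t[of x] x by simp
 qed
 let ?V = "%x. (ALL p q a b. cond x p-->cond x q-->LE t q p-->tri p a b<:app t x-->tri q a b<:app t x) &
  (ALL p a b c. tri p a b<:app t x-->tri p b c<:app t x-->tri p a c<:app t x)"
 have dV: "Dfn (%e. e 0<:l-->?V (e 0))" by (intro dfn)
 have V: "x<:l-->?V x" if "Ord x" for x
 proof (rule Ord_induct[where P="%x. x<:l-->?V x", OF dV that], rule impI)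
  fix x assume ox: "Ord x" and ih: "!!y. y<:x==>y<:l-->?V y" and x: "x<:l"
  have vx: "valid x t" unfolding valid_def using ih x l(1) Ord_trans by blast
  consider "app t x = cot x" | "app t x = triv x" | c R where "okc x t c R" "app t x = ftau t c R x"
   using t[OF x] by metis
  then show "?V x"
  proof cases
   case 1
   show ?thesis unfolding 1 cot using sub_trans by blast
  next
   case 2
   show ?thesis unfolding 2 triv by blast
  next
   case (3 c R)
   have "?V x<->(ALL p q a b. cond x p-->cond x q-->LE t q p-->tri p a b<:ftau t c R x-->tri q a b<:ftau t c R x)"
    using 3 unfolding okc_def by auto
   moreover have "tri q a b<:ftau t c R x" if "cond x p" "cond x q" "LE t q p" "tri p a b<:ftau t c R x" for p q a b
    using that LE_trans[OF vx ox] unfolding ftau by blast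
   ultimately show ?thesis by blast
  qed
 qed
 then have v: "valid l t" unfolding valid_def using l(1) Ord_mem by blast
 have dg: "Dfn (%e. om1<<=e 0-->e 0<<=l-->good (e 0) t)" by (intro dfn)
 have "om1<<=l-->l<<=l-->good l t"
 proof (rule Ord_induct[where P="%x. om1<<=x-->x<<=l-->good x t", OF dg l(1)], intro impI)
  fix d assume od: "Ord d" and ih: "!!b. b<:d==>om1<<=b-->b<<=l-->good b t" and d: "om1<<=d" "d<<=l"
  have bl: "b<<=l" "b<:l" if "b<:d" for b using that d(2) subD l(1) Ord_trans unfolding sub_def by blast+
  consider "d = om1" | b where "om1<:d" "d = sc b" | "om1<:d" "!!x. x<:d==>sc x<:d"
   using Ord_sub[OF Ord_om1 od] d(1) Ord_sc_mem[OF od] by metis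
  then show "good d t"
  proof cases
   case 1
   then show ?thesis using good_cohen[OF co] by simp
  next
   case (2 b)
   have ob: "Ord b" using od 2(2) Ord_mem by (metis sc)
   have ob1: "om1<<=b" using 2 Ord_sub[OF Ord_om1 ob] by simp
   have bd: "b<:d" using 2 by simp
   have gb: "good b t" using ih[OF bd] ob1 bl[OF bd] by blast
   have "~b<:om1" using ob1 subD not_self by blast
   then have "good2 b t (app t b)" using t[OF bl(2)[OF bd]] good2_triv[OF gb] unfolding okc_def by auto
   then show ?thesis using good_succ[OF ob ob1 gb] 2 by simp
  next
   case 3
   show ?thesis
   proof (rule good_limit[OF od 3(1)])
    show "sc x<:d" if "x<:d" for x using 3(2) that by blast
    show "good b t" if "b<:d" "om1<<=b" for b using ih[OF that(1)] that(2) bl(1)[OF that(1)] by blast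
   qed
  qed
 qed
 then have g: "good l t" using l(1,2) Ord_sub[OF Ord_om1] by simp
 have "EX x. x<:l&b<<=x&om1<<=x&(okc x t c R-->app t x = ftau t c R x)"
  if c: "cond l c" "R<<=cart (Cnd l) (cart om1 om1)" "lep R om1" "b<:l" for c R b
 proof -
  have cd: "pair c R<:Codes l" using c unfolding Codes_def by (simp add: Cnd Sub1)
  have ob: "Ord b" using c(4) l(1) Ord_mem by blast
  obtain b' where b': "b'<:l" "b<<=b'" "om1<<=b'"
   using Ord_linear[OF ob Ord_om1] Ord_sub[OF ob Ord_om1] Ord_sub[OF Ord_om1 ob] c(4) l(2) sub_refl by metis
  obtain x where x: "x<:l" "~x<:b'" "app h x = pair c R" using l(5)[OF cd b'(1)] by blast
  have "b'<<=x" using Ord_not_mem[of x b'] x(1,2) b'(1) l(1) Ord_mem by blast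
  then have s: "b<<=x" "om1<<=x" using b' sub_trans by blast+
  have "~x<:om1" using s(2) subD not_self by blast
  then have "okc x t c R-->app t x = ftau t c R x" using t[OF x(1)] x(3) by simp
  then show ?thesis using x(1) s by blast
 qed
 then have "ALL c R b. cond l c-->R<<=cart (Cnd l) (cart om1 om1)-->lep R om1-->b<:l -->
   (EX x. x<:l&b<<=x&om1<<=x&(okc x t c R-->app t x = ftau t c R x))" by simp
 moreover have "ALL x. x<:l-->sc x<:l" "ALL f. fn f om1 l-->(EX b. b<:l&(ALL x. x<:om1-->app f x<<=b))" using l(3,4) by simp_all
 ultimately show ?thesis using l(1,2) co v g by (intro exI[of _ l] exI[of _ t] conjI)
qed

end

subsection \<open>Absoluteness\<close>

text \<open>The conditions that belong to the class or have no extension in it are dense.\<close>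

lemma (in generic) avoid: assumes d: "Dfn (%e. C (e 0))" and n: "!!q. q : G==>~C q"
 shows "EX c:G. ALL q. le q c-->~C q"
proof -
 have d': "Dfn (%e. C (e 0) | (ALL r. le r (e 0)-->~C r))" by (intro dfn Dfn1[OF d])
 have "EX q:G. C q | (ALL r. le r q-->~C r)"
 proof (rule generic_dense[OF d'])
  fix p assume p: "p<:P"
  show "EX q. le q p&(C q | (ALL r. le r q-->~C r))"
  proof (cases "EX r. le r p&C r")
   case False
   then show ?thesis using le_refl[OF p] by blast
  qed blast
 qed
 then show ?thesis using n by blast
qed

context gext begin

lemma jE: "E' y (j x)==>(!!z. z<:x==>y = j z==>thesis)==>thesis"
 unfolding j_mem by blast

lemma j_in [simp]: "E' (j x) (j y)<->x<:y"
 unfolding j_mem by simp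

lemma j_upair: "j (upair a b) = N.upair (j a) (j b)"
 by (rule N.seteq) (auto simp: j_mem)

lemma j_pair: "j (pair a b) = N.pair (j a) (j b)"
 by (simp add: pair_def N.pair_def j_upair)

lemma j_emp: "j emp = N.emp"
 by (rule N.seteq) (simp add: j_mem)

lemma j_sc: "j (sc x) = N.sc (j x)"
 by (rule N.seteq) (auto simp: j_mem)

lemma j_ins: "j (ins x y) = N.ins (j x) (j y)"
 by (rule N.seteq) (auto simp: j_mem)

lemma j_sub [simp]: "N.sub (j a) (j b)<->a<<=b"
 unfolding N.sub_def sub_def j_mem by auto

lemma j_cart: "j (cart a b) = N.cart (j a) (j b)"
proof (rule N.seteq)
 fix z show "E' z (j (cart a b))<->E' z (N.cart (j a) (j b))"
  unfolding N.cart j_mem cart using j_pair by metis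
qed

lemma j_Ord: "N.Ord (j a)<->Ord a"
proof -
 have "N.trs (j a)<->trs a" unfolding N.trs_def trs_def j_mem using j_sub by blast
 moreover have "(ALL x y. E' x (j a)-->E' y (j a)-->E' x y | x = y | E' y x) <->
  (ALL x y. x<:a-->y<:a-->x<:y | x = y | y<:x)" (is "?A<->?B")
 proof
  assume A: ?A
  show ?B
  proof (intro allI impI)
   fix x y assume "x<:a" "y<:a"
   then show "x<:y | x = y | y<:x" using A[rule_format, of "j x" "j y"] by simp
  qed
 next
  assume B: ?B
  show ?A
  proof (intro allI impI)
   fix x y assume "E' x (j a)" "E' y (j a)"
   then obtain u w where "u<:a" "x = j u" "w<:a" "y = j w" by (elim jE)
   then show "E' x y | x = y | E' y x" using B by simp
  qed
 qed
 ultimately show ?thesis unfolding N.Ord_def Ord_def by blast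
qed

lemma j_Lim: "N.Lim (j a)<->Lim a"
proof -
 have "(ALL x. E' x (j a)-->(EX y. E' y (j a)&E' x y))<->(ALL x. x<:a-->(EX y. y<:a&x<:y))" (is "?A<->?B")
 proof
  assume A: ?A
  show ?B
  proof (intro allI impI)
   fix x assume "x<:a"
   then obtain y where "E' y (j a)" "E' (j x) y" using A[rule_format, of "j x"] by auto
   moreover from this(1) obtain w where "w<:a" "y = j w" by (elim jE)
   ultimately show "EX y. y<:a&x<:y" by auto
  qed
 next
  assume B: ?B
  show ?A
  proof (intro allI impI)
   fix x assume "E' x (j a)"
   then obtain u where u: "u<:a" "x = j u" by (elim jE)
   then obtain y where "y<:a" "u<:y" using B by blast
   then show "EX y. E' y (j a)&E' x y" using u by (intro exI[of _ "j y"]) simp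
  qed
 qed
 moreover have "j a = N.emp<->a = emp" using j_eq[of a emp] unfolding j_emp .
 ultimately show ?thesis unfolding N.Lim_def Lim_def j_Ord by blast
qed

lemma j_om: "j om = N.om"
proof -
 have L: "Lim om" "!!x. x<:om==>~Lim x" using omega_unique[of om] by blast+
 have "~N.Lim x" if "E' x (j om)" for x using that L(2) j_Lim by (auto elim: jE)
 then have "N.Lim (j om)&(ALL x. E' x (j om)-->~N.Lim x)" using L(1) j_Lim by blast
 then show ?thesis unfolding N.omega_unique .
qed

lemma j_two: "j two = N.two" by (simp add: two_def N.two_def j_sc j_emp)

lemma j_fn: assumes f: "fn f a b" shows "N.fn (j f) (j a) (j b)" "x<:a==>N.app (j f) (j x) = j (app f x)"
proof -
 show 1: "N.fn (j f) (j a) (j b)" unfolding N.fn_def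
 proof (intro conjI allI impI)
  fix p assume "E' p (j f)"
  then obtain q where q: "q<:f" "p = j q" by (elim jE)
  then obtain x where "x<:a" "q = pair x (app f x)" using fn_mem[OF f] by blast
  then show "EX x y. E' x (j a)&E' y (j b)&p = N.pair x y"
   using q fn_app(2)[OF f] by (intro exI[of _ "j x"] exI[of _ "j (app f x)"]) (simp add: j_pair)
 next
  fix x assume "E' x (j a)"
  then obtain u where u: "u<:a" "x = j u" by (elim jE)
  have "z = j (app f u)" if "E' (N.pair x z) (j f)" for z
  proof -
   obtain q where q: "q<:f" "N.pair x z = j q" using \<open>E' (N.pair x z) (j f)\<close> by (elim jE)
   then obtain w where w: "w<:a" "q = pair w (app f w)" using fn_mem[OF f] by blast
   then have "x = j w" "z = j (app f w)" using q(2) by (simp_all add: j_pair)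
   then show ?thesis using u by simp
  qed
  moreover have "E' (N.pair x (j (app f u))) (j f)" using fn_app(1)[OF f u(1)] u(2) by (simp add: j_pair[symmetric])
  ultimately show "EX y. E' (N.pair x y) (j f)&(ALL z. E' (N.pair x z) (j f)-->z = y)" by blast
 qed
 assume x: "x<:a"
 have "E' (N.pair (j x) (j (app f x))) (j f)" using fn_app(1)[OF f x] by (simp add: j_pair[symmetric])
 then show "N.app (j f) (j x) = j (app f x)" using N.fn_pair[OF 1] by simp
qed

lemma j_ctbl: assumes "ctbl a" shows "N.ctbl (j a)"
proof -
 obtain f where f: "fn f a om" "inj f a" using assms unfolding ctbl_def lep_def by blast
 have "N.inj (j f) (j a)" unfolding N.inj_def
 proof (intro allI impI)
  fix x y assume "E' x (j a)" "E' y (j a)" and e: "N.app (j f) x = N.app (j f) y"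
  then obtain u w where u: "u<:a" "x = j u" "w<:a" "y = j w" by (elim jE)
  then have "app f u = app f w" using e j_fn(2)[OF f(1)] by simp
  then show "x = y" using u f(2) unfolding inj_def by blast
 qed
 then show ?thesis unfolding N.ctbl_def N.lep_def using j_fn(1)[OF f(1)] j_om by metis
qed

end

subsection \<open>The generic extension by the iteration\<close>

locale iter = coh +
 fixes l t :: U
 assumes l: "Ord l" "om1<:l" and scl: "x<:l==>sc x<:l"
  and koenig: "fn f om1 l==>EX b. b<:l&(ALL x. x<:om1-->app f x<<=b)"
  and t: "coht t" "valid l t" "good l t"
  and stages: "[|cond l c; S<<=cart (Cnd l) (cart om1 om1); lep S om1; b<:l|] ==>
   EX x. x<:l&b<<=x&om1<<=x&(okc x t c S-->app t x = ftau t c S x)"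
begin

lemma om1l: "om1<<=l" using l Ord_sub[OF Ord_om1 l(1)] by blast

text \<open>The inverse of an injection into \<open>om1\<close> extends to a function on
  \<open>om1\<close> with values in \<open>l\<close>, to which the cofinality statement
  applies.\<close>

lemma bounded: assumes X: "X<<=l" "lep X om1" shows "EX b. b<:l&X<<=b"
proof -
 obtain f where f: "fn f X om1" "inj f X" using X(2) unfolding lep_def by blast
 let ?D = "%a. des (%x. x<:X&app f x = a)"
 let ?g = "%a. if ?D a<:l then ?D a else emp"
 have dg: "DfnT (%e. ?g (e 0))" by (intro dfn)
 have D: "?D (app f x) = x" if "x<:X" for x
  by (rule des_eq) (use that f(2) in \<open>unfold inj_def, blast+\<close>)
 have "emp<:l" using l Ord_trans[OF l(1) emp_om1(1)] by blast
 then have "fn (lam om1 ?g) om1 l" by (intro lam_fn[OF dg]) simp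
 from koenig[OF this] obtain b where b: "b<:l" "!!x. x<:om1==>app (lam om1 ?g) x<<=b" by blast
 have "x<:sc b" if x: "x<:X" for x
 proof -
  have fx: "app f x<:om1" using fn_app(2)[OF f(1) x] .
  have xl: "x<:l" using subD[OF X(1) x] .
  have "app (lam om1 ?g) (app f x) = x" unfolding lam_app[OF dg fx] D[OF x] using xl by simp
  then have "x<<=b" using b(2)[OF fx] by simp
  moreover have "Ord x" "Ord b" using xl b(1) l(1) Ord_mem by blast+
  ultimately show ?thesis using Ord_sub[of x b] by simp
 qed
 then show ?thesis using scl[OF b(1)] unfolding sub_def by blast
qed

end

locale iext = iter + gext +
 assumes PC: "P = Cnd l" and RC: "R = sep (cart (Cnd l) (Cnd l)) (%z. LE t (p1 z) (p2 z))"
begin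

lemma le: "le q p<->cond l q&cond l p&LE t q p"
proof -
 have d: "Dfn (%e. LE t (p1 (e 0)) (p2 (e 0)))" by (intro dfn)
 show ?thesis unfolding le_def unfolding PC RC sep[OF d] by (auto simp: Cnd)
qed

lemma Pcond: "p<:P<->cond l p" unfolding PC Cnd ..

lemma Gcond: "p : G==>cond l p" using GP Pcond by blast

text \<open>Labelling the conditions with distinct indices from both sides turns them into a family
  to which goodness applies. Irreflexivity of \<open>K\<close> makes the two compatible members
  distinct.\<close>

lemma ccc: assumes d: "DfnT (%e. f (e 0))" and a: "~ctbl a" and f: "!!x. x<:a==>f x<:P"
 shows "EX x y r. x<:a&y<:a&x ~= y&le r (f x)&le r (f y)"
proof -
 obtain h where h: "fn h om1 a" "inj h om1" using unc_lep[OF a] unfolding lep_def by blast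
 obtain u where u: "fn u om1 IA" "inj u om1" using unc_lep[OF IA(2)] unfolding lep_def by blast
 obtain w where w: "fn w om1 IB" "inj w om1" using unc_lep[OF IB(2)] unfolding lep_def by blast
 let ?q = "%x. quad (f (app h x)) emp (pair (app u x) (app w x))"
 have dq: "DfnT (%e. ?q (e 0))" by (intro dfn DfnT1[OF d])
 let ?F = "img ?q om1"
 have "lep om1 ?F"
 proof (rule lepI[OF dq])
  fix x y assume "x<:om1" "y<:om1" "?q x = ?q y"
  then have "qy (?q x) = qy (?q y)" by simp
  then show "x = y" using u(2) \<open>x<:om1\<close> \<open>y<:om1\<close> unfolding inj_def quad by simp
 qed (auto simp: img[OF dq])
 then have "~ctbl ?F" using unc_om1 ctbl_lep by blast
 moreover have "cond l (p1 z)&qa z<:om1&p1 (qy z)<:IA&p2 (qy z)<:IB" if z: "z<:?F" for z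
 proof -
  obtain x where x: "x<:om1" "z = ?q x" using z unfolding img[OF dq] by blast
  show ?thesis unfolding x(2) using f[OF fn_app(2)[OF h(1) x(1)]] Pcond emp_om1 fn_app(2)[OF u(1) x(1)] fn_app(2)[OF w(1) x(1)] by simp
 qed
 moreover have "p1 (qy z) ~= p1 (qy v)&p2 (qy z) ~= p2 (qy v)" if z: "z<:?F" "v<:?F" "z ~= v" for z v
 proof -
  obtain x y where x: "x<:om1" "z = ?q x" "y<:om1" "v = ?q y" using z(1,2) unfolding img[OF dq] by blast
  then have "x ~= y" using z(3) by blast
  then show ?thesis unfolding x(2,4) using u(2) w(2) x(1,3) unfolding inj_def by simp blast
 qed
 ultimately have "fam l ?F" unfolding fam_def by blast
 then obtain z v r where z: "z<:?F" "v<:?F" "cond l r" "LE t r (p1 z)" "LE t r (p1 v)" "K r (qy z) (qy v)"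
  using t(3) unfolding good_def by blast
 obtain x y where x: "x<:om1" "z = ?q x" "y<:om1" "v = ?q y" using z(1,2) unfolding img[OF dq] by blast
 have "x ~= y" using z(6) K_irrefl unfolding x(2,4) by auto
 then have "app h x ~= app h y" using h(2) x unfolding inj_def by blast
 moreover have "le r (f (app h x))" "le r (f (app h y))"
  using z(3-5) f[OF fn_app(2)[OF h(1) x(1)]] f[OF fn_app(2)[OF h(1) x(3)]] unfolding le Pcond x(2,4) by simp_all
 ultimately show ?thesis using fn_app(2)[OF h(1)] x(1,3) by blast
qed

text \<open>Fix a condition securing that the numbering is injective. Below it, different candidates
  for the element with number \<open>n\<close> need incompatible conditions, so each
  \<open>n\<close> has only countably many candidates.\<close>

lemma cover: assumes X: "N.ctbl X" "!!y. E' y X==>E' y (j a)"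
 shows "EX C. ctbl C&C<<=a&(ALL y. E' y X-->E' y (j C))"
proof -
 obtain f where f: "N.fn f X N.om" "N.inj f X" using X(1) unfolding N.ctbl_def N.lep_def by blast
 have "E' y (j (cart a om))" if y: "E' y f" for y
 proof -
  obtain x where "E' x X" "y = N.pair x (N.app f x)" using y N.fn_mem[OF f(1)] by blast
  then show ?thesis unfolding j_cart N.cart using X(2) N.fn_app(2)[OF f(1)] j_om by metis
 qed
 from j_name[of f "cart a om", OF this] obtain T where
  T: "!!x p q. pair x p<:T==>le q p==>pair x q<:T" "!!x. x<:cart a om==>E' (j x) f<->(EX p:G. pair x p<:T)"
   "!!x p. pair x p<:T==>x<:cart a om&p<:P" by blast
 let ?V = "%q. EX x x' n. x ~= x'&pair (pair x n) q<:T&pair (pair x' n) q<:T"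
 have dV: "Dfn (%e. ?V (e 0))" by (intro dfn)
 have "EX p0:G. ALL q. le q p0-->~?V q"
 proof (rule avoid[OF dV], rule notI)
  fix q assume q: "q : G" "?V q"
  then obtain x x' n where x: "x ~= x'" "pair (pair x n) q<:T" "pair (pair x' n) q<:T" by blast
  have "E' (N.pair (j x) (j n)) f" "E' (N.pair (j x') (j n)) f"
   using T(2)[of "pair x n"] T(2)[of "pair x' n"] T(3)[OF x(2)] T(3)[OF x(3)] x q(1) unfolding j_pair by blast+
  then show False using x(1) f(2) unfolding N.fn_pair[OF f(1)] N.inj_def by (metis j_eq)
 qed
 then obtain p0 where p0: "p0 : G" "!!q. le q p0==>~?V q" by blast
 let ?Q = "%n x p. le p p0&pair (pair x n) p<:T"
 let ?B = "%n. sep a (%x. EX p. ?Q n x p)"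
 have dB: "DfnT (%e. ?B (e 0))" by (intro dfn)
 have dQ: "Dfn (%e. ?Q n (e 0) (e (Suc 0)))" for n by (intro dfn)
 have dQ': "Dfn (%e. EX p. ?Q n (e 0) p)" for n by (intro dfn)
 have cB: "ctbl (?B n)" for n
 proof (rule ccontr)
  assume u: "~ctbl (?B n)"
  have "EX p. ?Q n x p" if "x<:?B n" for x using that unfolding sep[OF dQ'] by blast
  from choice_fun[OF dQ[of n] this] obtain h b where h: "fn h (?B n) b" "!!x. x<:?B n==>?Q n x (app h x)" by blast
  have dh: "DfnT (%e. app h (e 0))" by (intro dfn)
  have "app h x<:P" if "x<:?B n" for x using h(2)[OF that] leP by blast
  from ccc[OF dh u this] obtain x y r where r: "x<:?B n" "y<:?B n" "x ~= y" "le r (app h x)" "le r (app h y)" by blast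
  have "le r p0" using h(2)[OF r(1)] r(4) le_trans by blast
  moreover have "pair (pair x n) r<:T" "pair (pair y n) r<:T" using T(1) h(2)[OF r(1)] h(2)[OF r(2)] r(4,5) by blast+
  ultimately show False using p0(2) r(3) by blast
 qed
 let ?C = "Uni (img ?B om)"
 have "ctbl om" by (simp add: ctbl_def)
 from ctbl_Uni[OF dB this cB] have "ctbl ?C" .
 moreover have "?C<<=a" unfolding sub_def Uni img[OF dB] sep[OF dQ'] by (auto simp: sep[OF dQ'])
 moreover have "E' y (j ?C)" if y: "E' y X" for y
 proof -
  obtain x where x: "x<:a" "y = j x" using X(2)[OF y] by (elim jE)
  have "E' (N.app f y) (j om)" using N.fn_app(2)[OF f(1) y] j_om by simp
  then obtain n where n: "n<:om" "N.app f y = j n" by (elim jE)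
  have "E' (j (pair x n)) f" using N.fn_app(1)[OF f(1) y] n x by (simp add: j_pair)
  then obtain p where p: "p : G" "pair (pair x n) p<:T" using T(2)[of "pair x n"] x n by auto
  obtain r where "r : G" "le r p" "le r p0" using Gdir p(1) p0(1) by blast
  then have "x<:?B n" unfolding sep[OF dQ'] using x(1) T(1)[OF p(2)] by blast
  then have "x<:?C" unfolding Uni img[OF dB] using n(1) by blast
  then show ?thesis using x(2) by simp
 qed
 ultimately show ?thesis by blast
qed

lemma j_unc: assumes "N.ctbl (j a)" shows "ctbl a"
proof -
 obtain C where C: "ctbl C" "!!y. E' y (j a)==>E' y (j C)" using cover[OF assms] by blast
 have "a<<=C" using C(2) by (metis j_in sub_def)
 then show ?thesis using C(1) ctbl_sub by blast
qed

lemma j_om1: "j om1 = N.om1"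
proof -
 have "N.ctbl x" if "E' x (j om1)" for x using that om1_ctbl j_ctbl by (auto elim: jE)
 then show ?thesis using N.om1_unique[of "j om1"] j_Ord Ord_om1 j_unc unc_om1 by blast
qed

lemma K_le: "le q r==>p1 y<:om1==>p2 y<:om1==>p1 z<:om1==>p2 z<:om1==>K r y z==>K q y z"
 using K_mono[OF t(1)] unfolding le by blast

text \<open>Otherwise, below each member densely many conditions are compatible with only countably
  many members. A maximal antichain of such conditions is countable, so some member is compatible
  with none of them, against maximality.\<close>

lemma fam_unc: assumes F: "fam l F" and n: "~ctbl F"
 shows "EX z q. z<:F&le q (p1 z)&(ALL q'. le q' q-->~ctbl (sep F (%w. EX r. le r q'&le r (p1 w))))"
proof (rule ccontr)
 assume n: "~?thesis"
 let ?A = "%q. sep F (%w. EX r. le r q&le r (p1 w))"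
 have dA: "DfnT (%e. ?A (e 0))" by (intro dfn)
 have A: "w<:?A q<->w<:F&(EX r. le r q&le r (p1 w))" for w q
 proof -
  have "Dfn (%e. EX r. le r q&le r (p1 (e 0)))" by (intro dfn)
  from sep[OF this] show ?thesis .
 qed
 have dc: "Dfn (%e. ctbl (?A (e 0)))" by (intro dfn)
 have dI: "Dfn (%e. ~(EX r. le r (e 0)&le r (e (Suc 0))))" by (intro dfn)
 let ?S = "sep P (%q. ctbl (?A q))"
 from max_pairwise[OF dI, of ?S] obtain W where W: "W<<=?S" "!!x y. x<:W==>y<:W==>x ~= y==>~(EX r. le r x&le r y)"
  "!!a. a<:?S==>~a<:W==>EX x r. x<:W&le r a&le r x" by blast
 have WS: "x<:P&ctbl (?A x)" if "x<:W" for x using subD[OF W(1) that] unfolding sep[OF dc] .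
 have di: "DfnT (%e. e 0)" by (intro dfn)
 have "ctbl W"
 proof (rule ccontr)
  assume "~ctbl W"
  from ccc[OF di this] WS W(2) show False by blast
 qed
 from ctbl_Uni[OF dA this] WS have U: "ctbl (Uni (img ?A W))" by blast
 obtain z where z: "z<:F" "~z<:Uni (img ?A W)" using U ctbl_sub assms(2) unfolding sub_def by blast
 have zW: "~z<:?A x" if "x<:W" for x using z(2) that unfolding Uni img[OF dA] by blast
 have zP: "p1 z<:P" using F z(1) Pcond unfolding fam_def by blast
 obtain q' where q': "le q' (p1 z)" "ctbl (?A q')" using n z(1) le_refl[OF zP] by blast
 then have "q'<:?S" unfolding sep[OF dc] using leP by blast
 then consider "q'<:W" | x r where "x<:W" "le r q'" "le r x" using W(3) by blast
 then show False
 proof cases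
  case 1
  then show False using zW[of q'] z(1) q' le_refl leP unfolding A by blast
 next
  case 2
  then show False using zW[of x] z(1) q' le_trans unfolding A by blast
 qed
qed

text \<open>If the selected members were countable, a countable ground model set \<open>C\<close>
  would cover them, but below \<open>q\<close> it is always possible to select a member outside
  \<open>C\<close>.\<close>

lemma unc_generic: assumes q: "q : G" "!!q'. le q' q==>~ctbl (sep F (%w. EX r. le r q'&le r (p1 w)))"
 shows "EX X. (ALL y. E' y X<->(EX z. z<:F&p1 z : G&y = j z))&~N.ctbl X"
proof -
 have d: "DfnT (%e. pair (e 0) (p1 (e 0)))" by (intro dfn)
 obtain X where X0: "!!y. E' y X<->(EX x p. p : G&pair x p<:img (%z. pair z (p1 z)) F&y = j x)" using j_real by blast
 have X: "E' y X<->(EX z. z<:F&p1 z : G&y = j z)" for y unfolding X0 img[OF d] by auto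
 have "~N.ctbl X"
 proof
  assume "N.ctbl X"
  moreover have "E' y (j F)" if "E' y X" for y using that unfolding X by auto
  ultimately obtain C where C: "ctbl C" "!!y. E' y X==>E' y (j C)" using cover by blast
  have dr: "Dfn (%e. EX z. z<:F&~z<:C&le (e 0) (p1 z))" by (intro dfn)
  have "EX r:G. (EX z. z<:F&~z<:C&le r (p1 z))&le r q"
  proof (rule generic_below[OF dr q(1)])
   fix p assume p: "le p q"
   have ds: "Dfn (%e. EX r. le r p&le r (p1 (e 0)))" by (intro dfn)
   have "~sep F (%w. EX r. le r p&le r (p1 w))<<=C" using q(2)[OF p] C(1) ctbl_sub by blast
   then show "EX r. le r p&(EX z. z<:F&~z<:C&le r (p1 z))" unfolding sub_def sep[OF ds] by blast
  qed
  then obtain r z where z: "r : G" "z<:F" "~z<:C" "le r (p1 z)" by blast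
  then have "E' (j z) X" unfolding X using Gup by blast
  then show False using C(2)[of "j z"] z(3) by simp
 qed
 then show ?thesis using X by blast
qed

text \<open>Goodness carried over to the extension. Possible elements of \<open>X\<close> are
  labelled with conditions forcing them in, below a condition that excludes counterexamples; after
  thinning to a set injective in both coordinates, goodness produces the excluded situation.\<close>

theorem generic_pair:
 assumes X: "!!y. E' y X==>E' y (j (cart IA IB))" "~N.ctbl X"
  and inj: "!!y z. E' y X==>E' z X==>N.p1 y = N.p1 z | N.p2 y = N.p2 z==>y = z"
 shows "EX y z. EX p:G. E' (j y) X&E' (j z) X&K p y z"
proof (rule ccontr)
 assume no: "~?thesis"
 let ?Y = "cart IA IB"
 from j_name[of X ?Y, OF X(1)] obtain T where
  T: "!!x p q. pair x p<:T==>le q p==>pair x q<:T" "!!x. x<:?Y==>E' (j x) X<->(EX p:G. pair x p<:T)"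
   "!!x p. pair x p<:T==>x<:?Y&p<:P" by blast
 let ?V = "%q. EX y z. pair y q<:T&pair z q<:T&(K q y z | y ~= z&(p1 y = p1 z | p2 y = p2 z))"
 have dV: "Dfn (%e. ?V (e 0))" by (intro dfn)
 have "EX p0:G. ALL q. le q p0-->~?V q"
 proof (rule avoid[OF dV], rule notI)
  fix q assume q: "q : G" "?V q"
  then obtain y z where y: "pair y q<:T" "pair z q<:T" "K q y z | y ~= z&(p1 y = p1 z | p2 y = p2 z)" by blast
  have yY: "y<:?Y" "z<:?Y" using T(3) y(1,2) by blast+
  have jX: "E' (j y) X" "E' (j z) X" using T(2) yY y(1,2) q(1) by blast+
  then have "y ~= z" "p1 y = p1 z | p2 y = p2 z" using no q(1) y(3) by blast+
  moreover obtain a b c d where "y = pair a b" "z = pair c d" using yY unfolding cart by blast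
  ultimately show False using inj[OF jX] by (simp add: j_pair)
 qed
 then obtain p0 where p0: "p0 : G" "!!q. le q p0==>~?V q" by blast
 let ?Q = "%y p. le p p0&pair y p<:T"
 have dQ: "Dfn (%e. ?Q (e 0) (e (Suc 0)))" and dQ': "Dfn (%e. EX p. ?Q (e 0) p)" by (intro dfn)+
 define Z where "Z = sep ?Y (%y. EX p. ?Q y p)"
 have Z: "y<:Z<->y<:?Y&(EX p. ?Q y p)" for y unfolding Z_def sep[OF dQ'] ..
 have "E' y (j Z)" if y: "E' y X" for y
 proof -
  obtain x where x: "x<:?Y" "y = j x" using X(1)[OF y] by (elim jE)
  then obtain p where p: "p : G" "pair x p<:T" using T(2) y by blast
  obtain r where "r : G" "le r p" "le r p0" using Gdir p(1) p0(1) by blast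
  then have "x<:Z" unfolding Z using x(1) T(1)[OF p(2)] by blast
  then show ?thesis using x(2) by simp
 qed
 then have "N.sub X (j Z)" unfolding N.sub_def by blast
 then have uZ: "~ctbl Z" using j_ctbl X(2) N.ctbl_sub by blast
 have "EX p. ?Q y p" if "y<:Z" for y using that unfolding Z by blast
 from choice_fun[OF dQ this] obtain h b where h: "fn h Z b" "!!y. y<:Z==>?Q y (app h y)" by blast
 have dh: "DfnT (%e. app h (e 0))" by (intro dfn)
 have hP: "app h y<:P" if "y<:Z" for y using h(2)[OF that] leP by blast
 have comp: "~?V r" "pair x r<:T" "pair y r<:T" if r: "x<:Z" "y<:Z" "le r (app h x)" "le r (app h y)" for x y r
 proof -
  have "le r p0" using h(2)[OF r(1)] r(3) le_trans by blast
  then show "~?V r" by (rule p0(2))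
  show "pair x r<:T" "pair y r<:T" using T(1) h(2)[OF r(1)] h(2)[OF r(2)] r(3,4) by blast+
 qed
 \<comment> \<open>Elements sharing a coordinate have incompatible labels, because injectivity is
   forced below \<open>p0\<close>.\<close>
 have fib: "ctbl B" if B: "B<<=Z" "!!x y. x<:B==>y<:B==>p1 x = p1 y | p2 x = p2 y" for B
 proof (rule ccontr)
  assume u: "~ctbl B"
  have "app h x<:P" if "x<:B" for x using hP subD[OF B(1) that] by blast
  from ccc[OF dh u this] obtain x y r where r: "x<:B" "y<:B" "x ~= y" "le r (app h x)" "le r (app h y)" by blast
  show False using comp[OF subD[OF B(1) r(1)] subD[OF B(1) r(2)] r(4,5)] r(3) B(2)[OF r(1,2)] by blast
 qed
 have d1: "DfnT (%e. p1 (e 0))" and d2: "DfnT (%e. p2 (e 0))" by (intro dfn)+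
 have s1: "x<:sep B (%x. p1 x = c)<->x<:B&p1 x = c" and s2: "x<:sep B (%x. p2 x = c)<->x<:B&p2 x = c" for x B c
 proof -
  have d: "Dfn (%e. p1 (e 0) = c)" "Dfn (%e. p2 (e 0) = c)" by (intro dfn)+
  show "x<:sep B (%x. p1 x = c)<->x<:B&p1 x = c" "x<:sep B (%x. p2 x = c)<->x<:B&p2 x = c"
   unfolding sep[OF d(1)] sep[OF d(2)] by blast+
 qed
 have "ctbl (sep Z (%x. p1 x = c))" for c by (rule fib) (auto simp: sub_def s1)
 from unc_injective[OF d1 uZ this] obtain Z1 where Z1: "Z1<<=Z" "~ctbl Z1" "!!x y. x<:Z1==>y<:Z1==>p1 x = p1 y==>x = y" by blast
 have "ctbl (sep Z1 (%x. p2 x = c))" for c by (rule fib) (use subD[OF Z1(1)] in \<open>auto simp: sub_def s2\<close>)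
 from unc_injective[OF d2 Z1(2) this] obtain Z2 where Z2: "Z2<<=Z1" "~ctbl Z2" "!!x y. x<:Z2==>y<:Z2==>p2 x = p2 y==>x = y" by blast
 have ZZ: "x<:Z" if "x<:Z2" for x using that Z1(1) Z2(1) subD by blast
 have dq: "DfnT (%e. quad (app h (e 0)) emp (e 0))" by (intro dfn)
 let ?F = "img (%y. quad (app h y) emp y) Z2"
 have "lep Z2 ?F" by (rule lepI[OF dq]) (unfold img[OF dq], blast, metis quad(3))
 then have "~ctbl ?F" using Z2(2) ctbl_lep by blast
 moreover have "cond l (p1 z)&qa z<:om1&p1 (qy z)<:IA&p2 (qy z)<:IB" if z: "z<:?F" for z
 proof -
  obtain x where x: "x<:Z2" "z = quad (app h x) emp x" using z unfolding img[OF dq] by blast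
  have "x<:?Y" using ZZ[OF x(1)] unfolding Z by blast
  then have "p1 x<:IA" "p2 x<:IB" by (auto simp: cart)
  then show ?thesis unfolding x(2) quad using hP[OF ZZ[OF x(1)]] Pcond emp_om1 by blast
 qed
 moreover have "p1 (qy z) ~= p1 (qy v)&p2 (qy z) ~= p2 (qy v)" if z: "z<:?F" "v<:?F" "z ~= v" for z v
 proof -
  obtain x y where x: "x<:Z2" "z = quad (app h x) emp x" "y<:Z2" "v = quad (app h y) emp y" using z(1,2) unfolding img[OF dq] by blast
  then have "x ~= y" using z(3) by blast
  then show ?thesis unfolding x(2,4) quad using Z1(3) Z2(3) subD[OF Z2(1)] x(1,3) by blast
 qed
 ultimately have "fam l ?F" unfolding fam_def by blast
 then obtain z v r where z: "z<:?F" "v<:?F" "cond l r" "LE t r (p1 z)" "LE t r (p1 v)" "K r (qy z) (qy v)"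
  using t(3) unfolding good_def by blast
 obtain x y where x: "x<:Z2" "z = quad (app h x) emp x" "y<:Z2" "v = quad (app h y) emp y" using z(1,2) unfolding img[OF dq] by blast
 have "le r (app h x)" "le r (app h y)" using z(3-5) hP ZZ x(1,3) unfolding x(2,4) quad le Pcond by blast+
 from comp[OF ZZ[OF x(1)] ZZ[OF x(3)] this] z(6) show False unfolding x(2,4) quad by blast
qed

subsection \<open>Names for small sets\<close>

text \<open>Forcing for names with few entries. The condition is the first component of an entry,
  matching the triples \<open>tri\<close> of the iterands.\<close>

definition frc :: "U => U => U => bool" where
 "frc S p z<->cond l p&(ALL q. le q p-->(EX r s. le r q&le r s&pair s z<:S))"

lemma frc_dfn [dfn]: "DfnT s==>DfnT u==>DfnT w==>Dfn (%e. frc (s e) (u e) (w e))"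
 by (rule Dfn3[of frc], unfold frc_def, intro dfn)

lemma frc_mono: "frc S p z==>le q p==>frc S q z"
 unfolding frc_def using le_trans le by blast

lemma frc_dense: assumes "cond l p" "!!q. le q p==>EX r. le r q&frc S r z" shows "frc S p z"
 unfolding frc_def
proof (intro conjI allI impI assms(1))
 fix q assume "le q p"
 then obtain r where r: "le r q" "frc S r z" using assms(2) by blast
 then obtain r' s where "le r' r" "le r' s" "pair s z<:S" using le_refl leP unfolding frc_def by blast
 then show "EX r s. le r q&le r s&pair s z<:S" using r le_trans by blast
qed

text \<open>For each element a maximal antichain of conditions forcing it in is enough. The chain
  condition keeps the entries down to \<open>om1\<close> many, and the cofinality of
  \<open>l\<close> bounds their supports.\<close>

lemma small_name: assumes a: "lep a om1" and S: "!!y. E' y S==>E' y (j a)"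
 shows "EX Q b. Q<<=cart (Cnd l) a&lep Q om1&b<:l&(ALL p z. pair p z<:Q-->cond b p) &
  (ALL z. z<:a-->(E' (j z) S<->(EX p:G. frc Q p z)))"
proof -
 from j_name[of S a, OF S] obtain T where
  T: "!!x p q. pair x p<:T==>le q p==>pair x q<:T" "!!x. x<:a==>E' (j x) S<->(EX p:G. pair x p<:T)"
   "!!x p. pair x p<:T==>x<:a&p<:P"
   "!!x p. x<:a==>p<:P==>(ALL q. le q p-->(EX r. le r q&pair x r<:T))==>pair x p<:T" by blast
 have dI: "Dfn (%e. ~(EX r. le r (e 0)&le r (e (Suc 0))))" by (intro dfn)
 let ?W = "%z W. (ALL x. x<:W-->pair z x<:T)&(ALL x y. x<:W-->y<:W-->x ~= y-->~(EX r. le r x&le r y)) &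
  (ALL p. pair z p<:T-->(EX r s. le r p&le r s&s<:W))"
 have dW: "Dfn (%e. ?W (e 0) (e (Suc 0)))" by (intro dfn)
 have "EX W. ?W z W" for z
 proof -
  have dT: "Dfn (%e. pair z (e 0)<:T)" by (intro dfn)
  from max_pairwise[OF dI, of "sep P (%p. pair z p<:T)"] obtain W where W: "W<<=sep P (%p. pair z p<:T)"
   "!!x y. x<:W==>y<:W==>x ~= y==>~(EX r. le r x&le r y)"
   "!!a. a<:sep P (%p. pair z p<:T)==>~a<:W==>EX x r. x<:W&le r a&le r x" by blast
  have 1: "pair z x<:T" if "x<:W" for x using subD[OF W(1) that] unfolding sep[OF dT] by blast
  have "EX r s. le r p&le r s&s<:W" if p: "pair z p<:T" for p
  proof (cases "p<:W")
   case True
   then show ?thesis using le_refl T(3)[OF p] by blast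
  next
   case False
   have "p<:sep P (%p. pair z p<:T)" unfolding sep[OF dT] using T(3)[OF p] p by blast
   then show ?thesis using W(3) False by blast
  qed
  then show ?thesis using 1 W(2) by blast
 qed
 from choice_fun[OF dW this, of a] obtain w c where w0: "fn w a c&(ALL z. z<:a-->?W z (app w z))" by (elim exE) (rule that)
 have w: "?W z (app w z)" if "z<:a" for z by (rule mp[OF spec[OF conjunct2[OF w0]] that])
 have di: "DfnT (%e. e 0)" by (intro dfn)
 have cw: "ctbl (app w z)" if z: "z<:a" for z
 proof (rule ccontr)
  assume u: "~ctbl (app w z)"
  have "x<:P" if "x<:app w z" for x using w[OF z] that T(3) by blast
  from ccc[OF di u this] show False using w[OF z] by blast
 qed
 have dp: "DfnT (%e. pair (e 0) z)" for z by (intro dfn)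
 let ?B = "%z. img (%p. pair p z) (app w z)"
 have dB: "DfnT (%e. ?B (e 0))" by (intro dfn)
 define Q where "Q = Uni (img ?B a)"
 have Q: "u<:Q<->(EX z p. z<:a&p<:app w z&u = pair p z)" for u
  unfolding Q_def Uni img[OF dB] using img[OF dp] by blast
 have co: "lep x om1" if "ctbl x" for x
  using that lep_sub Ord_sub[OF Ord_om Ord_om1] om_om1 lep_trans unfolding ctbl_def by blast
 have "lep (?B z) om1" if "z<:a" for z using lep_img[OF dp] co[OF cw[OF that]] lep_trans by blast
 then have lQ: "lep Q om1" unfolding Q_def by (intro lep_Uni[OF dB a _ lep_om1_square])
 have QT: "pair z p<:T&z<:a" if "pair p z<:Q" for p z using that w unfolding Q by auto
 have QP: "cond l p" if "pair p z<:Q" for p z using QT[OF that] T(3) Pcond by blast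
 have dd: "DfnT (%e. dm (p1 (e 0)))" by (intro dfn)
 let ?X = "Uni (img (%u. dm (p1 u)) Q)"
 have X: "x<:?X<->(EX p z. pair p z<:Q&x<:dm p)" for x
  unfolding Uni img[OF dd] using Q by (metis p1)
 have "?X<<=l" unfolding sub_def X using QP cond_dm by blast
 moreover have "lep (dm (p1 u)) om1" if "u<:Q" for u
  using that QP cond_fin fin_ctbl co unfolding Q by (metis Q p1)
 then have "lep ?X om1" by (intro lep_Uni[OF dd lQ _ lep_om1_square])
 ultimately obtain b where b: "b<:l" "?X<<=b" using bounded by blast
 have bp: "cond b p" if p: "pair p z<:Q" for p z
 proof -
  have "dm p<<=b" using X b(2) p unfolding sub_def by blast
  then show ?thesis using QP[OF p] unfolding cond_def by blast
 qed
 have "pair z p<:T<->frc Q p z" if z: "z<:a" for z p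
 proof
  assume p: "pair z p<:T"
  have "EX r s. le r q&le r s&pair s z<:Q" if q: "le q p" for q
  proof -
   have "pair z q<:T" using T(1)[OF p q] .
   then obtain r s where "le r q" "le r s" "s<:app w z" using w[OF z] by blast
   then show ?thesis unfolding Q using z by blast
  qed
  then show "frc Q p z" unfolding frc_def using T(3)[OF p] Pcond by blast
 next
  assume p: "frc Q p z"
  show "pair z p<:T"
  proof (rule T(4)[OF z])
   show "p<:P" using p Pcond unfolding frc_def by blast
   show "ALL q. le q p-->(EX r. le r q&pair z r<:T)" using p QT T(1) unfolding frc_def by blast
  qed
 qed
 then have "E' (j z) S<->(EX p:G. frc Q p z)" if "z<:a" for z using T(2)[OF that] that by blast
 moreover have "Q<<=cart (Cnd l) a" unfolding sub_def
 proof (intro allI impI)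
  fix u assume "u<:Q"
  then obtain z p where "z<:a" "u = pair p z" "pair p z<:Q" unfolding Q by blast
  then show "u<:cart (Cnd l) a" using QP by (simp add: Cnd)
 qed
 ultimately show ?thesis using lQ b(1) bp by (intro exI[of _ Q] exI[of _ b]) blast
qed

subsection \<open>Martin's axiom in the extension\<close>

lemma le_rs: assumes "le r q" "Ord x" "x<<=l" shows "le (rs r x) (rs q x)"
 using LE_rs[of t r q l l x] cond_rs_a assms(1,2) unfolding le by blast

lemma le_rs_self: assumes "cond l r" "Ord x" shows "le r (rs r x)"
proof -
 have "LE t r (rs r x)" unfolding LE_def
 proof (intro allI impI)
  fix y assume y: "y<:dm (rs r x)"
  then have "y<:dm r" "y<:x" by (simp_all add: dm_rs)
  then show "y<:dm r&(app r y = app (rs r x) y | tri (rs r y) (app r y) (app (rs r x) y)<:app t y)"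
   using cond_rs(2)[OF assms(1)] by simp
 qed
 then show ?thesis unfolding le using assms(1) cond_rs_a by blast
qed

lemma amal: assumes r: "cond x r" and q: "cond l q" and x: "Ord x" "x<<=l" and rq: "le r (rs q x)"
 shows "EX u. le u q&le u r&rs u x = r"
proof -
 have "LE t r (rs q x)" using rq unfolding le by blast
 then have "LE t (am r q x) q" "LE t (am r q x) r" by (rule am_LE[OF r q x(2,1)])+
 then show ?thesis unfolding le using am(1,3)[OF r q x(2)] cond_mono[OF r x(2)] q by blast
qed

context
 fixes S :: U and x :: U
 assumes S: "S<<=cart (Cnd l) (cart om1 om1)" and x: "Ord x" "x<<=l" "om1<<=x" and supp: "!!p z. pair p z<:S==>cond x p"
begin

text \<open>The name is supported before \<open>x\<close>, so the coordinates from \<open>x\<close>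
  on can be exchanged by amalgamation without affecting what is forced.\<close>

lemma frc_rs: assumes f: "frc S r z" shows "frc S (rs r x) z"
 unfolding frc_def
proof (intro conjI allI impI)
 have r: "cond l r" using f unfolding frc_def by blast
 then show "cond l (rs r x)" by (rule cond_rs_a)
 fix q assume q: "le q (rs r x)"
 have qc: "cond l q" using q le by blast
 have "le (rs q x) (rs (rs r x) x)" using le_rs[OF q x(1,2)] .
 then have "le (rs q x) (rs r x)" using rs_rs[of x x r] by simp
 then obtain u where u: "le u r" "rs u x = rs q x" using amal[OF cond_rs(1)[OF qc] r x(1,2)] by blast
 then obtain r2 s where r2: "le r2 u" "le r2 s" "pair s z<:S" using f unfolding frc_def by blast
 have ss: "rs s x = s" using rs_id[OF supp[OF r2(3)]] by simp
 have "le (rs r2 x) (rs q x)" using le_rs[OF r2(1) x(1,2)] u(2) by simp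
 moreover have "cond l r2" using r2(1) le by blast
 ultimately obtain r3 where r3: "le r3 q" "le r3 (rs r2 x)" using amal[OF cond_rs(1) qc x(1,2)] by blast
 have "le (rs r2 x) s" using le_rs[OF r2(2) x(1,2)] ss by simp
 then show "EX r s. le r q&le r s&pair s z<:S" using r3 r2(3) le_trans by blast
qed

text \<open>Below \<open>c\<close>, forcing computed at stage \<open>x\<close> and forcing in the
  whole iteration agree: restrict in the one direction, amalgamate in the other.\<close>

lemma ftau_frc: assumes c: "cond x c" and p: "cond x p" "le p c" and ab: "a<:om1" "b<:om1"
 shows "tri p a b<:ftau t c S x<->frc S p (pair a b)"
proof
 have L: "cond x q==>cond l q" for q using cond_mono x(2) by blast
 assume f: "tri p a b<:ftau t c S x"
 show "frc S p (pair a b)" unfolding frc_def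
 proof (intro conjI allI impI)
  show "cond l p" using L p(1) .
  fix q assume q: "le q p"
  have qc: "cond l q" using q le by blast
  have pp: "rs p x = p" using rs_id[OF p(1)] by simp
  have "le (rs q x) p" using le_rs[OF q x(1,2)] pp by simp
  then have "LE t (rs q x) p" "LE t (rs q x) c" using p(2) le_trans unfolding le by blast+
  then obtain r s where r: "cond x r" "LE t r (rs q x)" "LE t r s" "pair s (pair a b)<:S"
   using f cond_rs(1)[OF qc] unfolding ftau by blast
  have "le r (rs q x)" "le r s" using r L[OF r(1)] L[OF supp[OF r(4)]] cond_rs_a[OF qc] unfolding le by blast+
  then show "EX r s. le r q&le r s&pair s (pair a b)<:S" using amal[OF r(1) qc x(1,2)] r(4) le_trans by blast
 qed
next
 assume f: "frc S p (pair a b)"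
 have "EX r s. cond x r&LE t r q&LE t r s&pair s (pair a b)<:S" if q: "cond x q" "LE t q p" for q
 proof -
  have "le q p" using q p(1) cond_mono x(2) unfolding le by blast
  then obtain r s where r: "le r q" "le r s" "pair s (pair a b)<:S" using f unfolding frc_def by blast
  have e: "rs q x = q" "rs s x = s" using rs_id[OF q(1)] rs_id[OF supp[OF r(3)]] by simp_all
  have "LE t (rs r x) q" "LE t (rs r x) s" using le_rs[OF r(1) x(1,2)] le_rs[OF r(2) x(1,2)] unfolding e le by blast+
  then show ?thesis using r(3) cond_rs(1) r(1) unfolding le by blast
 qed
 then show "tri p a b<:ftau t c S x" unfolding ftau using p(1) ab by blast
qed

lemma ftau_mono: "tri p a b<:ftau t c S x==>cond x q==>LE t q p==>tri q a b<:ftau t c S x"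
proof -
 assume h: "tri p a b<:ftau t c S x" "cond x q" "LE t q p"
 have v: "valid x t" using t(2) subD[OF x(2)] unfolding valid_def by blast
 have "cond x p" using h(1) unfolding ftau by blast
 from LE_trans[OF v x(1) this h(2) _ _ h(3)] show "tri q a b<:ftau t c S x" using h(1,2) unfolding ftau by blast
qed

text \<open>In \<open>ftau\<close> only extensions below both \<open>p\<close> and \<open>c\<close>
  count. In particular, a condition incompatible with \<open>c\<close> puts all elements of
  \<open>om1\<close> in relation.\<close>

lemma ftau_local: assumes c: "cond x c" and p: "cond x p" and ab: "a<:om1" "b<:om1"
  and h: "!!q. cond x q==>le q p==>le q c==>frc S q (pair a b)"
 shows "tri p a b<:ftau t c S x"
proof -
 have L: "cond x q==>cond l q" for q using cond_mono x(2) by blast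
 have "EX r s. cond x r&LE t r q&LE t r s&pair s (pair a b)<:S" if q: "cond x q" "LE t q p" "LE t q c" for q
 proof -
  have "le q p" "le q c" using q L c p unfolding le by blast+
  then have "tri q a b<:ftau t c S x" using ftau_frc[OF c q(1) _ ab] h q(1) by blast
  then show ?thesis unfolding ftau using q LE_refl by blast
 qed
 then show ?thesis unfolding ftau using p ab by blast
qed

text \<open>Goodness of the order named by \<open>S\<close>, for the whole iteration and below
  \<open>c\<close>; \<open>good2_stage\<close> transfers it to stage \<open>x\<close>.\<close>

definition nobad :: "U => bool" where
 "nobad c<->(ALL F. fam l F-->(ALL z. z<:F-->le (p1 z) c)-->(EX z w r e. z<:F&w<:F&le r (p1 z)&le r (p1 w) &
   K r (qy z) (qy w)&e<:om1&frc S r (pair e (qa z))&frc S r (pair e (qa w))))"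

text \<open>If only countably many members are compatible with \<open>c\<close>, the others are put
  in relation to everything by \<open>ftau\<close>, and goodness of the iteration yields the pair.
  Otherwise the members are first strengthened below \<open>c\<close>. In both cases the extension
  found is restricted to \<open>x\<close>.\<close>

lemma good2_stage: assumes c: "cond x c" and nb: "nobad c" shows "good2 x t (ftau t c S x)"
 unfolding good2_def
proof (intro allI impI)
 fix F assume F: "fam x F"
 have Fl: "fam l F" using fam_mono[OF F x(2)] .
 have L: "cond x q==>cond l q" for q using cond_mono x(2) by blast
 have px: "cond x (p1 z)" "qa z<:om1" if "z<:F" for z using F that unfolding fam_def by blast+
 have rx: "cond x (rs r x)&LE t (rs r x) (p1 z)" if "cond l r" "LE t r (p1 z)" "z<:F" for r z
 proof -
  have "le r (p1 z)" using that L px(1) unfolding le by blast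
  then have "le (rs r x) (rs (p1 z) x)" using le_rs x by blast
  then show ?thesis using rs_id[OF px(1)[OF that(3)]] cond_rs(1)[OF that(1)] unfolding le by simp
 qed
 have kx: "K (rs r x) (qy z) (qy w)" if "cond l r" "z<:F" "w<:F" "K r (qy z) (qy w)" for r z w
  using K_rs[OF that(1) x(3)] fam_om1[OF F that(2)] fam_om1[OF F that(3)] that(4) by blast
 have dF: "Dfn (%e. EX r. le r (p1 (e 0))&le r c)" by (intro dfn)
 define F1 where "F1 = sep F (%z. EX r. le r (p1 z)&le r c)"
 have F1: "z<:F1<->z<:F&(EX r. le r (p1 z)&le r c)" for z unfolding F1_def sep[OF dF] ..
 show "EX z w r e. z<:F&w<:F&cond x r&LE t r (p1 z)&LE t r (p1 w)&K r (qy z) (qy w) &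
   e<:om1&cle (ftau t c S x) r e (qa z)&cle (ftau t c S x) r e (qa w)"
 proof (cases "ctbl F1")
  case True
  have "F<<=un (df F F1) F1" by (auto simp: sub_def)
  then have "~ctbl (df F F1)" using True ctbl_un ctbl_sub F unfolding fam_def by blast
  moreover have "df F F1<<=F" by (simp add: sub_def)
  ultimately have "fam l (df F F1)" using fam_sub[OF Fl] by blast
  then obtain z w r where z: "z<:df F F1" "w<:df F F1" "cond l r" "LE t r (p1 z)" "LE t r (p1 w)" "K r (qy z) (qy w)"
   using t(3) unfolding good_def by blast
  have zF: "z<:F" "w<:F" "~z<:F1" using z(1,2) by auto
  note r1 = rx[OF z(3,4) zF(1)] rx[OF z(3,5) zF(2)]
  have le1: "le (rs r x) (p1 z)" using r1(1) L px(1)[OF zF(1)] unfolding le by blast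
  have "tri (rs r x) emp a<:ftau t c S x" if "a<:om1" for a
  proof (rule ftau_local[OF c _ emp_om1(1) that])
   show "cond x (rs r x)" using r1 by blast
   fix q assume "le q (rs r x)" "le q c"
   then show "frc S q (pair emp a)" using zF F1 le1 le_trans by blast
  qed
  then show ?thesis using zF(1,2) r1 kx[OF z(3) zF(1,2) z(6)] emp_om1(1) px(2) unfolding cle_def by blast
 next
  case False
  have dQ: "Dfn (%e. le (e (Suc 0)) (p1 (e 0))&le (e (Suc 0)) c)" by (intro dfn)
  have "EX r. le r (p1 z)&le r c" if "z<:F1" for z using that unfolding F1 by blast
  from choice_fun[OF dQ this] obtain h b where h: "!!z. z<:F1==>le (app h z) (p1 z)&le (app h z) c" by blast
  have dh: "DfnT (%e. app h (e 0))" by (intro dfn)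
  have dq: "DfnT (%e. quad (app h (e 0)) (qa (e 0)) (qy (e 0)))" by (intro dfn)
  have F1F: "F1<<=F" unfolding sub_def F1 by blast
  let ?F = "img (%z. quad (app h z) (qa z) (qy z)) F1"
  have "fam l ?F" by (rule fam_img[OF fam_sub[OF Fl F1F False] dh]) (use h le in blast)
  moreover have "le (p1 z) c" if "z<:?F" for z using that h unfolding img[OF dq] by auto
  ultimately obtain z' w' r e where zw: "z'<:?F" "w'<:?F" "le r (p1 z')" "le r (p1 w')" "K r (qy z') (qy w')"
   "e<:om1" "frc S r (pair e (qa z'))" "frc S r (pair e (qa w'))" using nb unfolding nobad_def by blast
  obtain z w where z: "z<:F1" "z' = quad (app h z) (qa z) (qy z)" "w<:F1" "w' = quad (app h w) (qa w) (qy w)"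
   using zw(1,2) unfolding img[OF dq] by blast
  have zF: "z<:F" "w<:F" using z F1 by blast+
  have lr: "le r (p1 z)" "le r (p1 w)" "le r c" using zw(3,4) h[OF z(1)] h[OF z(3)] le_trans unfolding z(2,4) quad by blast+
  have rl: "cond l r" "LE t r (p1 z)" "LE t r (p1 w)" using lr unfolding le by blast+
  note r1 = rx[OF rl(1,2) zF(1)] rx[OF rl(1,3) zF(2)]
  have "rs c x = c" using rs_id[OF c] by simp
  then have rc: "le (rs r x) c" using le_rs[OF lr(3) x(1,2)] by simp
  have "tri (rs r x) e (qa z)<:ftau t c S x" "tri (rs r x) e (qa w)<:ftau t c S x"
   using ftau_frc[OF c _ rc zw(6) px(2)[OF zF(1)]] ftau_frc[OF c _ rc zw(6) px(2)[OF zF(2)]] r1 frc_rs zw(7,8) unfolding z(2,4) quad by blast+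
  then show ?thesis using zF r1 kx[OF rl(1) zF] zw(5,6) unfolding z(2,4) quad cle_def by blast
 qed
qed

lemma nobad_dfn: "Dfn (%e. nobad (e 0))"
 unfolding nobad_def by (intro dfn)

text \<open>Otherwise bad families exist densely below some condition of the filter. By
  \<open>fam_unc\<close> such a family can be made to keep uncountably many members in the filter,
  and the assumption about the extension then yields the pair the family must not have.\<close>

lemma nobad_ex:
 assumes c1: "c1 : G"
  and gq: "!!X F. fam l F==>ALL y. E' y X-->E' y (j F)==>~N.ctbl X ==>
   EX z w e p. E' (j z) X&E' (j w) X&e<:om1&p : G&K p (qy z) (qy w)&frc S p (pair e (qa z))&frc S p (pair e (qa w))"
 shows "EX c:G. le c c1&nobad c"
proof (rule ccontr)
 assume no: "~?thesis"
 have dC: "Dfn (%e. le (e 0) c1&nobad (e 0))" by (intro dfn nobad_dfn)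
 have "EX c:G. ALL q. le q c-->~(le q c1&nobad q)" by (rule avoid[OF dC]) (use no in blast)
 then obtain c2 where c2: "c2 : G" "!!q. le q c2==>~(le q c1&nobad q)" by blast
 obtain c3 where c3: "c3 : G" "le c3 c1" "le c3 c2" using Gdir c1 c2(1) by blast
 let ?B = "%F. fam l F&~(EX z w r e. z<:F&w<:F&le r (p1 z)&le r (p1 w) &
   K r (qy z) (qy w)&e<:om1&frc S r (pair e (qa z))&frc S r (pair e (qa w)))"
 let ?U = "%F q. ALL q'. le q' q-->~ctbl (sep F (%w. EX r. le r q'&le r (p1 w)))"
 have dU: "Dfn (%e. EX F. ?B F&?U F (e 0))" by (intro dfn)
 have "EX q:G. (EX F. ?B F&?U F q)&le q c3"
 proof (rule generic_below[OF dU c3(1)])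
  fix p assume p: "le p c3"
  then have "~nobad p" using c2(2) c3(2,3) le_trans by blast
  then obtain F where F: "?B F" "!!z. z<:F==>le (p1 z) p" unfolding nobad_def by blast
  have fF: "fam l F" using F(1) by blast
  then have "~ctbl F" unfolding fam_def by blast
  from fam_unc[OF fF this] obtain z q where z: "z<:F" "le q (p1 z)" "?U F q" by blast
  then have "le q p" using F(2) le_trans by blast
  then show "EX q. le q p&(EX F. ?B F&?U F q)" using F(1) z(3) by blast
 qed
 then obtain q F where q: "q : G" "?B F" "?U F q" by blast
 have fF: "fam l F" using q(2) by blast
 obtain X where X: "!!y. E' y X<->(EX z. z<:F&p1 z : G&y = j z)" "~N.ctbl X"
  using unc_generic[OF q(1), of F] q(3) by blast
 have "ALL y. E' y X-->E' y (j F)" unfolding X(1) by auto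
 from gq[OF fF this X(2)] obtain z w e p where h: "E' (j z) X" "E' (j w) X" "e<:om1" "p : G" "K p (qy z) (qy w)"
  "frc S p (pair e (qa z))" "frc S p (pair e (qa w))" by blast
 have zw: "z<:F" "p1 z : G" "w<:F" "p1 w : G" using h(1,2) unfolding X(1) by auto
 obtain r0 where r0: "r0 : G" "le r0 (p1 z)" "le r0 (p1 w)" using Gdir zw by blast
 obtain r where r: "r : G" "le r r0" "le r p" using Gdir r0(1) h(4) by blast
 have "K r (qy z) (qy w)" using K_le[OF r(3)] h(5) fam_om1[OF fF zw(1)] fam_om1[OF fF zw(3)] by blast
 moreover have "le r (p1 z)" "le r (p1 w)" using r0 r(2) le_trans by blast+
 ultimately show False using q(2) zw h(3) frc_mono[OF h(6) r(3)] frc_mono[OF h(7) r(3)] by blast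
qed

end

end

subsection \<open>What is needed of the extension\<close>

context zfc begin

text \<open>The relation between pairs of reals that \<open>K\<close> decides: a violation of the
  Lipschitz condition.\<close>

definition gp :: "U => U => bool" where
 "gp y z<->(EX m. m<:om&(ALL k. k<:m-->app (p1 y) k = app (p1 z) k)&(EX k. k<:m&app (p2 y) k ~= app (p2 z) k))"
definition ic :: "U => bool" where
 "ic X<->(ALL y z. y<:X-->z<:X-->p1 y = p1 z | p2 y = p2 z-->y = z)"
definition ic2 :: "U => bool" where
 "ic2 X<->(ALL y z. y<:X-->z<:X-->p1 (p2 y) = p1 (p2 z) | p2 (p2 y) = p2 (p2 z)-->y = z)"
text \<open>If this failed for \<open>X\<close>, the points whose labels lie in a generic filter of
  \<open>Q\<close> would be pairwise unrelated, so the property to be preserved could be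
  lost.\<close>

definition thin :: "U => U => U => U => bool" where
 "thin Q S A B<->(ALL X. X<<=cart Q (cart A B)-->~ctbl X-->ic2 X -->
  (EX y z e. y<:X&z<:X&e<:Q&pair e (p1 y)<:S&pair e (p1 z)<:S&gp (p2 y) (p2 z)))"

end

text \<open>The interface to the extension: two dense sets of reals, the exclusion property for
  their product, and Martin's axiom for thin preorders on \<open>om1\<close>, with the
  \<open>om1\<close> many dense sets given as the sections of one relation \<open>D\<close>.\<close>

locale lip = zfc +
 fixes A B :: U
 assumes A: "A<<=Fnc om two" "lep A om1" "[|fn x om two; n<:om|]==>~ctbl (sep A (%a. ALL k. k<:n-->app a k = app x k))"
  and B: "B<<=Fnc om two" "lep B om1" "[|fn x om two; n<:om|]==>~ctbl (sep B (%a. ALL k. k<:n-->app a k = app x k))"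
  and AB: "[|X<<=cart A B; ~ctbl X; ic X|]==>EX y z. y<:X&z<:X&gp y z"
  and MA1: "[|S<<=cart om1 om1; ALL a. a<:om1-->pair a a<:S; ALL a b c. pair a b<:S-->pair b c<:S-->pair a c<:S;
   thin om1 S A B; D<<=cart om1 om1; ALL x a. x<:om1-->a<:om1-->(EX b. pair b a<:S&pair x b<:D)|] ==>
   EX H. H<<=om1&(ALL a b. a<:H-->b<:H-->(EX e. e<:H&pair e a<:S&pair e b<:S))&(ALL x. x<:om1-->(EX b. b<:H&pair x b<:D))"

context iext begin

lemma max2: assumes "b<:l" "b'<:l" shows "EX d. d<:l&b<<=d&b'<<=d"
proof -
 have "Ord b" "Ord b'" using assms l(1) Ord_mem by blast+
 then have "b<<=b' | b'<<=b" using Ord_linear[of b b'] Ord_sub[of b b'] Ord_sub[of b' b] by auto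
 then show ?thesis using assms sub_refl by blast
qed

theorem MA_ext:
 assumes S: "!!y. E' y S==>E' y (j (cart om1 om1))" and D: "!!y. E' y D==>E' y (j (cart om1 om1))"
  and refl: "!!a. a<:om1==>E' (j (pair a a)) S"
  and trans: "!!a b d. E' (j (pair a b)) S==>E' (j (pair b d)) S==>E' (j (pair a d)) S"
  and dense: "!!x a. x<:om1==>a<:om1==>EX b. b<:om1&E' (j (pair b a)) S&E' (j (pair x b)) D"
  and gq: "!!X F. fam l F==>ALL y. E' y X-->E' y (j F)==>~N.ctbl X ==>
   EX z w e p. E' (j z) X&E' (j w) X&e<:om1&p : G&K p (qy z) (qy w)&E' (j (pair e (qa z))) S&E' (j (pair e (qa w))) S"
 shows "EX H. (ALL y. E' y H-->E' y (j om1)) &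
  (ALL a b. E' (j a) H-->E' (j b) H-->(EX e. E' (j e) H&E' (j (pair e a)) S&E' (j (pair e b)) S)) &
  (ALL x. x<:om1-->(EX b. E' (j b) H&E' (j (pair x b)) D))"
proof -
 let ?oo = "cart om1 om1"
 obtain Q bS where Q: "Q<<=cart (Cnd l) ?oo" "lep Q om1" "bS<:l" "!!p z. pair p z<:Q==>cond bS p"
  "!!z. z<:?oo==>E' (j z) S<->(EX p:G. frc Q p z)" using small_name[OF lep_om1_square S] by blast
 obtain V bD where V: "V<<=cart (Cnd l) ?oo" "bD<:l" "!!p z. pair p z<:V==>cond bD p"
  "!!z. z<:?oo==>E' (j z) D<->(EX p:G. frc V p z)" using small_name[OF lep_om1_square D] by blast
 have SQ: "E' (j (pair a b)) S<->(EX p:G. frc Q p (pair a b))" and DV: "E' (j (pair a b)) D<->(EX p:G. frc V p (pair a b))"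
  if "a<:om1" "b<:om1" for a b using Q(5)[of "pair a b"] V(4)[of "pair a b"] that by simp_all
 have Soo: "a<:om1" "b<:om1" if "E' (j (pair a b)) S" for a b using S[OF that] by simp_all
 have Qoo: "a<:om1" "b<:om1" if "frc Q p (pair a b)" for p a b
 proof -
  have "cond l p" and f: "!!q. le q p==>EX r s. le r q&le r s&pair s (pair a b)<:Q" using that unfolding frc_def by blast+
  then have "le p p" using le_refl Pcond by blast
  from f[OF this] obtain s where "pair s (pair a b)<:Q" by blast
  from subD[OF Q(1) this] show "a<:om1" "b<:om1" by simp_all
 qed
 let ?V1 = "%q. EX a. a<:om1&(ALL r. le r q-->~frc Q r (pair a a))"
 let ?V2 = "%q. EX a b d. frc Q q (pair a b)&frc Q q (pair b d)&(ALL r. le r q-->~frc Q r (pair a d))"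
 let ?V3 = "%q. EX x a. x<:om1&a<:om1&(ALL r b. le r q-->b<:om1-->~(frc Q r (pair b a)&frc V r (pair x b)))"
 have dV: "Dfn (%e. ?V2 (e 0) | ?V3 (e 0))" by (intro dfn)
 \<comment> \<open>One condition of the filter excludes forced failures of transitivity and of
   density.\<close>
 have "EX c:G. ALL q. le q c-->~(?V2 q | ?V3 q)"
 proof (rule avoid[OF dV], rule notI)
  fix q assume q: "q : G" and v: "?V2 q | ?V3 q"
  from v show False
  proof
   assume "?V2 q"
   then obtain a b d where a: "frc Q q (pair a b)" "frc Q q (pair b d)" "!!r. le r q==>~frc Q r (pair a d)" by blast
   note o = Qoo[OF a(1)] Qoo[OF a(2)]
   have "E' (j (pair a d)) S" using trans SQ[OF o(1,2)] SQ[OF o(3,4)] a q by blast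
   then obtain p where p: "p : G" "frc Q p (pair a d)" using SQ[OF o(1,4)] by blast
   obtain r where r: "r : G" "le r p" "le r q" using Gdir p(1) q by blast
   show False using a(3)[OF r(3)] frc_mono[OF p(2) r(2)] by blast
  next
   assume "?V3 q"
   then obtain x a where a: "x<:om1" "a<:om1" "!!r b. le r q==>b<:om1==>~(frc Q r (pair b a)&frc V r (pair x b))" by blast
   obtain b where b: "b<:om1" "E' (j (pair b a)) S" "E' (j (pair x b)) D" using dense[OF a(1,2)] by blast
   obtain p p' where p: "p : G" "frc Q p (pair b a)" "p' : G" "frc V p' (pair x b)" using SQ[OF b(1) a(2)] DV[OF a(1) b(1)] b(2,3) by blast
   obtain r0 where r0: "r0 : G" "le r0 p" "le r0 p'" using Gdir p by blast
   obtain r where r: "r : G" "le r r0" "le r q" using Gdir r0 q by blast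
   have "frc Q r (pair b a)" "frc V r (pair x b)" using frc_mono p(2,4) r0(2,3) r(2) by blast+
   then show False using a(3)[OF r(3) b(1)] by blast
  qed
 qed
 then obtain c1 where c1: "c1 : G" "!!q. le q c1==>~?V2 q" "!!q. le q c1==>~?V3 q" by blast
 have suppl: "cond l p" if "pair p z<:Q" for p z using subD[OF Q(1) that] by (simp add: Cnd)
 have "EX c:G. le c c1&nobad Q c"
 proof (rule nobad_ex[OF Q(1) l(1) sub_refl om1l _ c1(1)])
  show "cond l p" if "pair p z<:Q" for p z by (rule suppl[OF that])
  fix X F assume F: "fam l F" "ALL y. E' y X-->E' y (j F)" "~N.ctbl X"
  from gq[OF F] obtain z w e p where h: "E' (j z) X" "E' (j w) X" "e<:om1" "p : G" "K p (qy z) (qy w)"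
   "E' (j (pair e (qa z))) S" "E' (j (pair e (qa w))) S" by blast
  have zw: "z<:F" "w<:F" using F(2) h(1,2) by auto
  obtain p' p'' where p: "p' : G" "frc Q p' (pair e (qa z))" "p'' : G" "frc Q p'' (pair e (qa w))"
   using SQ[OF Soo(1)[OF h(6)] Soo(2)[OF h(6)]] SQ[OF Soo(1)[OF h(7)] Soo(2)[OF h(7)]] h(6,7) by blast
  obtain r0 where r0: "r0 : G" "le r0 p'" "le r0 p''" using Gdir p by blast
  obtain r where r: "r : G" "le r r0" "le r p" using Gdir r0(1) h(4) by blast
  have "K r (qy z) (qy w)" using K_le[OF r(3)] h(5) fam_om1[OF F(1) zw(1)] fam_om1[OF F(1) zw(2)] by blast
  moreover have "frc Q r (pair e (qa z))" "frc Q r (pair e (qa w))" using frc_mono p(2,4) r0(2,3) r(2) by blast+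
  ultimately show "EX z w e p. E' (j z) X&E' (j w) X&e<:om1&p : G&K p (qy z) (qy w)&frc Q p (pair e (qa z))&frc Q p (pair e (qa w))"
   using h(1-3) r(1) by blast
 qed
 then obtain c where c: "c : G" "le c c1" "nobad Q c" by blast
 have cc: "cond l c" using Gcond[OF c(1)] .
 have "dm c<<=l" "lep (dm c) om1" using cond_dm[OF cc] fin_ctbl[OF cond_fin[OF cc]] Ord_sub[OF Ord_om Ord_om1] om_om1 lep_sub lep_trans
  unfolding ctbl_def sub_def by blast+
 then obtain b where b: "b<:l" "dm c<<=b" using bounded by blast
 obtain b1 where b1: "b1<:l" "bS<<=b1" "bD<<=b1" using max2 Q(3) V(2) by blast
 obtain b2 where b2: "b2<:l" "b<<=b2" "b1<<=b2" using max2 b(1) b1(1) by blast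
 obtain x where x: "x<:l" "b2<<=x" "om1<<=x" "okc x t c Q-->app t x = ftau t c Q x" using stages[OF cc Q(1,2) b2(1)] by blast
 have Ox: "Ord x" using x(1) l(1) Ord_mem by blast
 have xl: "x<<=l" using Ord_sub[OF Ox l(1)] x(1) by blast
 have sQ: "cond x p" if "pair p z<:Q" for p z using cond_mono[OF Q(4)[OF that]] b1(2) b2(3) x(2) sub_trans by blast
 have sV: "cond x p" if "pair p z<:V" for p z using cond_mono[OF V(3)[OF that]] b1(3) b2(3) x(2) sub_trans by blast
 have cx: "cond x c" using cc b(2) b2(2) x(2) sub_trans unfolding cond_def by blast
 have rc: "rs c x = c" using rs_id[OF cx] by simp
 note fl = Q(1) Ox xl x(3)
 have ff: "tri p a b<:ftau t c Q x<->frc Q p (pair a b)" if "cond x p" "le p c" "a<:om1" "b<:om1" for p a b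
  by (rule ftau_frc[OF fl _ cx that]) (rule sQ)
 have "okc x t c Q" unfolding okc_def
 proof (intro conjI allI impI cx)
  show "Q<<=cart (Cnd x) (cart om1 om1)" unfolding sub_def
  proof (intro allI impI)
   fix u assume u: "u<:Q"
   then obtain p z where "u = pair p z" "z<:?oo" using subD[OF Q(1)] unfolding cart[of _ "Cnd l"] by blast
   then show "u<:cart (Cnd x) ?oo" using sQ u by (simp add: Cnd)
  qed
  show "good2 x t (ftau t c Q x)" by (rule good2_stage[OF fl _ cx c(3)]) (rule sQ)
  fix p a b' d assume h: "tri p a b'<:ftau t c Q x" "tri p b' d<:ftau t c Q x"
  then have o: "a<:om1" "b'<:om1" "d<:om1" "cond x p" unfolding ftau by blast+
  show "tri p a d<:ftau t c Q x"
  proof (rule ftau_local[OF fl _ cx o(4,1,3)])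
   show "cond x p" if "pair p z<:Q" for p z by (rule sQ[OF that])
   fix q assume q: "cond x q" "le q p" "le q c"
   have L: "LE t q p" using q(2) unfolding le by blast
   have m: "tri q u w<:ftau t c Q x" if "tri p u w<:ftau t c Q x" for u w
    by (rule ftau_mono[OF fl _ that q(1) L]) (rule sQ)
   have f: "frc Q q (pair a b')" "frc Q q (pair b' d)" using ff[OF q(1,3)] o m h by blast+
   show "frc Q q (pair a d)"
   proof (rule frc_dense)
    show "cond l q" using q(2) unfolding le by blast
    fix q' assume q': "le q' q"
    have "le q' c1" using q' q(3) c(2) le_trans by blast
    from c1(2)[OF this] show "EX r. le r q'&frc Q r (pair a d)" using frc_mono f q' by blast
   qed
  qed
 qed
 then have tx: "app t x = ftau t c Q x" using x(4) by blast
 have dT: "Dfn (%e. x<:dm (p2 (e 0))&app (p2 (e 0)) x = p1 (e 0))" by (intro dfn)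
 \<comment> \<open>The generic object of coordinate \<open>x\<close>: all entries at
   \<open>x\<close> of conditions in the filter.\<close>
 obtain H where H0: "!!y. E' y H<->(EX a p. p : G&pair a p<:sep (cart om1 P) (%u. x<:dm (p2 u)&app (p2 u) x = p1 u)&y = j a)"
  using j_real by blast
 have H: "E' y H<->(EX p:G. x<:dm p&y = j (app p x))" for y
 proof -
  have e: "pair a p<:sep (cart om1 P) (%u. x<:dm (p2 u)&app (p2 u) x = p1 u)<->a<:om1&p<:P&x<:dm p&app p x = a" for a p
   by (simp add: sep[OF dT] conj_assoc)
  show ?thesis unfolding H0 e using GP cond_app Gcond by blast
 qed
 have toS: "E' (j (pair e a)) S" if h: "r : G" "le r c" "tri (rs r x) e a<:ftau t c Q x" for r e a
 proof -
  have o: "e<:om1" "a<:om1" using h(3) unfolding ftau by blast+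
  have "le (rs r x) c" using le_rs[OF h(2) Ox xl] rc by simp
  then have "frc Q (rs r x) (pair e a)" using ff[OF cond_rs(1)[OF Gcond[OF h(1)]] _ o] h(3) by blast
  then have "frc Q r (pair e a)" by (rule frc_mono[OF _ le_rs_self[OF Gcond[OF h(1)] Ox]])
  then show ?thesis using SQ[OF o] h(1) by blast
 qed
 have "EX e. E' (j e) H&E' (j (pair e a)) S&E' (j (pair e a')) S" if h: "E' (j a) H" "E' (j a') H" for a a'
 proof -
  obtain p p' where p: "p : G" "x<:dm p" "a = app p x" "p' : G" "x<:dm p'" "a' = app p' x" using h unfolding H by auto
  obtain r0 where r0: "r0 : G" "le r0 p" "le r0 p'" using Gdir p by blast
  obtain r where r: "r : G" "le r r0" "le r c" using Gdir r0(1) c(1) by blast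
  have S1: "E' (j (pair (app r x) (app u x))) S" if u: "le r u" "x<:dm u" for u
  proof -
   have "app u x<:om1" using cond_app u unfolding le by blast
   moreover have "app r x = app u x | tri (rs r x) (app r x) (app u x)<:ftau t c Q x"
    using u tx unfolding le LE_def by metis
   ultimately show ?thesis using refl toS[OF r(1,3)] by metis
  qed
  have lr: "le r p" "le r p'" using r0 r le_trans by blast+
  then have "x<:dm r" using p(2) LE_dm unfolding le by blast
  then show ?thesis using S1[OF lr(1) p(2)] S1[OF lr(2) p(5)] r(1) unfolding H p(3,6) by blast
 qed
 moreover have "EX b. E' (j b) H&E' (j (pair \<xi> b)) D" if xi: "\<xi><:om1" for \<xi>
 proof -
  let ?D = "%r. x<:dm r&frc V r (pair \<xi> (app r x))"
  have dD: "Dfn (%e. ?D (e 0))" by (intro dfn)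
  have "EX r:G. ?D r&le r c"
  proof (rule generic_below[OF dD c(1)])
   fix p assume p: "le p c"
   have pc: "cond l p" using p unfolding le by blast
   \<comment> \<open>If \<open>p\<close> has no entry at \<open>x\<close>, an arbitrary element may
     be the one to be strengthened into the dense set.\<close>
   define a where "a = (if x<:dm p then app p x else emp)"
   have a: "a<:om1" unfolding a_def using cond_app[OF pc] emp_om1 by simp
   have qc: "le (rs p x) c" using le_rs[OF p Ox xl] rc by simp
   then have "~?V3 (rs p x)" using c1(3) c(2) le_trans by blast
   then obtain r b' where r: "le r (rs p x)" "b'<:om1" "frc Q r (pair b' a)" "frc V r (pair \<xi> b')" using a xi by blast
   define r0 where "r0 = rs r x"
   have rl: "cond l r" using r(1) unfolding le by blast
   have r0: "cond x r0" "frc Q r0 (pair b' a)" "frc V r0 (pair \<xi> b')" unfolding r0_def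
   proof -
    show "cond x (rs r x)" by (rule cond_rs(1)[OF rl])
    show "frc Q (rs r x) (pair b' a)" by (rule frc_rs[OF fl _ r(3)]) (rule sQ)
    show "frc V (rs r x) (pair \<xi> b')" by (rule frc_rs[OF V(1) Ox xl x(3) _ r(4)]) (rule sV)
   qed
   have "rs (rs p x) x = rs p x" using rs_rs[of x x p] by simp
   then have r0q: "le r0 (rs p x)" unfolding r0_def using le_rs[OF r(1) Ox xl] by simp
   have r0c: "le r0 c" using r0q qc le_trans by blast
   have sx: "Ord (sc x)" "sc x<<=l" "x<<=sc x" using Ox scl[OF x(1)] Ord_sub[of "sc x" l] l(1) by (auto simp: sub_def)
   have nx: "~x<:dm r0" using cond_dm[OF r0(1)] not_self by blast
   have xs: "x<:sc x" by simp
   note u0 = ins_cond[OF cond_mono[OF r0(1) sx(3)] xs nx r(2)]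
   define u where "u = ins (pair x b') r0"
   have ur: "rs u x = r0" unfolding u_def
   proof (rule cond_eqI[OF cond_rs(1)[OF u0(1)] r0(1)])
    show "dm (rs (ins (pair x b') r0) x) = dm r0" unfolding dm_rs u0(2) by (rule seteq) (use cond_dm[OF r0(1)] in auto)
    fix y assume "y<:dm (rs (ins (pair x b') r0) x)"
    then have y: "y<:dm r0" "y<:x" unfolding dm_rs u0(2) by auto
    have "y<:dm (ins (pair x b') r0)" using y(1) unfolding u0(2) by simp
    then show "app (rs (ins (pair x b') r0) x) y = app r0 y" using cond_rs(2)[OF u0(1) _ y(2)] u0(4)[OF y(1)] by simp
   qed
   have ul: "cond l u" using cond_mono[OF u0(1) sx(2)] unfolding u_def .
   \<comment> \<open>It suffices to go below \<open>p\<close> up to and including coordinate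
     \<open>x\<close>; its later entries are put back by amalgamation.\<close>
   have "LE t u (rs p (sc x))"
   proof (rule LE_join[OF _ ul cond_rs_a[OF pc] Ox])
    show "LE t (rs u x) (rs (rs p (sc x)) x)" unfolding ur using r0q rs_rs[OF sx(3)] unfolding le by simp
    fix y assume y: "y<:dm (rs p (sc x))" "~y<:x"
    then have yx: "y = x" "x<:dm p" unfolding dm_rs by auto
    have "app (rs p (sc x)) x = a" using cond_rs(2)[OF pc yx(2) xs] yx(2) unfolding a_def by simp
    moreover have "tri r0 b' a<:app t x" unfolding tx using ff[OF r0(1) r0c r(2) a] r0(2) by blast
    ultimately show "y<:dm u&cle (app t y) (rs u y) (app u y) (app (rs p (sc x)) y)"
     unfolding yx(1) ur cle_def using u0(2,3) unfolding u_def by simp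
   qed
   then have "le u (rs p (sc x))" using ul cond_rs_a[OF pc] unfolding le by blast
   moreover have "cond (sc x) u" using u0(1) unfolding u_def .
   ultimately obtain v where v: "le v p" "le v u" "rs v (sc x) = u" using amal[OF _ pc sx(1,2)] by blast
   have xu: "x<:dm u" unfolding u_def u0(2) by simp
   then have xv: "x<:dm v" using v(3) unfolding dm_rs[of v "sc x", symmetric] using dm_rs[of v "sc x"] by auto
   have vl: "cond l v" using v(1) unfolding le by blast
   have "app v x = b'" using cond_rs(2)[OF vl xv xs] u0(3) unfolding v(3) u_def by simp
   moreover have "le v r0" using v(2) le_rs_self[OF ul Ox] ur le_trans by metis
   ultimately show "EX r. le r p&?D r" using v(1) xv frc_mono[OF r0(3)] by blast
  qed
  then obtain r where r: "r : G" "x<:dm r" "frc V r (pair \<xi> (app r x))" by blast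
  then have "E' (j (pair \<xi> (app r x))) D" using DV[OF xi cond_app[OF Gcond[OF r(1)] r(2)]] by blast
  then show ?thesis using r unfolding H by blast
 qed
 moreover have "ALL y. E' y H-->E' y (j om1)" proof (intro allI impI)
  fix y assume "E' y H"
  then obtain p where p: "p : G" "x<:dm p" "y = j (app p x)" unfolding H by blast
  then show "E' y (j om1)" using cond_app[OF Gcond[OF p(1)] p(2)] by simp
 qed
 ultimately show ?thesis by (intro exI[of _ H]) simp
qed

subsection \<open>The Cohen reals\<close>

lemma pad: assumes "fn s m two" "n<:om" "m<<=n" "b<:two"
 shows "EX s'. fn s' (sc n) two&s<<=s'&app s' n = b"
proof -
 let ?f = "%k. if k<:m then app s k else if k = n then b else emp"
 have d: "DfnT (%e. ?f (e 0))" by (intro dfn)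
 have nm: "~n<:m" using subD[OF assms(3)] not_self by blast
 have e: "emp<:two" by (simp add: two_def)
 have "fn (lam (sc n) ?f) (sc n) two" by (rule lam_fn[OF d]) (use fn_app(2)[OF assms(1)] assms(4) e in auto)
 moreover have "app (lam (sc n) ?f) n = b" using lam_app[OF d, of n "sc n"] nm by simp
 moreover have "s<<=lam (sc n) ?f"
 proof (rule subI)
  fix u assume "u<:s"
  then obtain k where k: "k<:m" "u = pair k (app s k)" using fn_mem[OF assms(1)] by blast
  then have "k<:sc n" using subD[OF assms(3)] by simp
  then show "u<:lam (sc n) ?f" unfolding lam_mem[OF d] using k by auto
 qed
 ultimately show ?thesis by blast
qed

lemma om_max: assumes "m<:om" "n<:om" shows "EX k. k<:om&m<<=k&n<<=k"
proof -
 have "Ord m" "Ord n" using assms om_Ord_mem by blast+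
 then have "m<<=n | n<<=m" using Ord_linear[of m n] Ord_sub[of m n] Ord_sub[of n m] by auto
 then show ?thesis using assms sub_refl by blast
qed

text \<open>All other entries stay literally the same, so only the Cohen coordinate \<open>i\<close>
  has to be compared in the order.\<close>

lemma upd: assumes q: "cond l q" and i: "i<:om1" and a: "a<:om1" and s: "i<:dm q==>app sv (app q i)<<=app sv a"
 shows "EX u. le u q&i<:dm u&app u i = a&(ALL y. y ~= i-->(y<:dm u<->y<:dm q)&(y<:dm q-->app u y = app q y))"
proof -
 let ?f = "%x. if x = i then a else app q x"
 have d: "DfnT (%e. ?f (e 0))" by (intro dfn)
 let ?d = "ins i (dm q)"
 define u where "u = lam ?d ?f"
 have f: "fn u ?d om1" unfolding u_def by (rule lam_fn[OF d]) (use a cond_app[OF q] in auto)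
 have ap: "app u x = ?f x" if "x<:?d" for x unfolding u_def by (rule lam_app[OF d that])
 have cu: "cond l u" by (rule condI[OF _ f]) (use cond_fin[OF q] cond_dm[OF q] subD[OF om1l i] in \<open>auto simp: sub_def\<close>)
 have du: "dm u = ?d" by (rule fn_dm[OF f])
 have "LE t u q" unfolding LE_def
 proof (intro allI impI)
  fix x assume x: "x<:dm q"
  have "tri (rs u i) (app u i) (app q i)<:app t i" if "i<:dm q"
   using t(1) i a s[OF that] cond_app[OF q that] cond_rs(1)[OF cu] ap[of i] unfolding coht_def by (simp add: cot)
  then show "x<:dm u&(app u x = app q x | tri (rs u x) (app u x) (app q x)<:app t x)"
   using x ap[of x] unfolding du by (cases "x = i") auto
 qed
 then show ?thesis unfolding le using q cu ap du by (intro exI[of _ u]) auto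
qed

abbreviation sq :: "U => U => U" where "sq p i \<equiv> app sv (app p i)"

text \<open>The present sequence at \<open>i\<close> has length at most \<open>n\<close>, so
  position \<open>n\<close> is still free.\<close>

lemma ext_at: assumes q: "cond l q" and i: "i<:om1" and n: "n<:om" "i<:dm q==>dm (sq q i)<<=n" and b: "b<:two"
 shows "EX u. le u q&i<:dm u&fn (sq u i) (sc n) two&app (sq u i) n = b &
  (ALL y. y ~= i-->(y<:dm u<->y<:dm q)&(y<:dm q-->app u y = app q y))"
proof -
 define s where "s = (if i<:dm q then sq q i else emp)"
 have "EX m. fn s m two&m<<=n"
 proof (cases "i<:dm q")
  case True
  obtain m where m: "fn (sq q i) m two" using sv_Sq[OF cond_app[OF q True]] Sq by blast
  then show ?thesis using n(2)[OF True] fn_dm[OF m] True unfolding s_def by (intro exI[of _ m]) simp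
 next
  case False
  then show ?thesis unfolding s_def by (intro exI[of _ emp]) (simp add: fn_def)
 qed
 then obtain m where m: "fn s m two" "m<<=n" by blast
 obtain s' where s': "fn s' (sc n) two" "s<<=s'" "app s' n = b" using pad[OF m(1) n(1) m(2) b] by blast
 have "s'<:Sq" using s'(1) n(1) sc_om Sq by blast
 then obtain a where a: "a<:om1" "app sv a = s'" using sv(2) by blast
 have "i<:dm q==>sq q i<<=app sv a" using s'(2) unfolding a(2) s_def by simp
 from upd[OF q i a(1) this] show ?thesis using s' a(2) by auto
qed

lemma sq_mono: assumes "le r p" "i<:dm p" "i<:om1" shows "i<:dm r" "sq p i<<=sq r i" "dm (sq p i)<<=dm (sq r i)"
proof -
 have h: "LE t r p" "cond l p" "cond l r" using assms(1) unfolding le by blast+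
 show 1: "i<:dm r" using LE_dm[OF h(1) assms(2)] .
 show 2: "sq p i<<=sq r i" using coht_LE[OF t(1) h assms(2,3)] .
 show "dm (sq p i)<<=dm (sq r i)" using Sq_fn(1)[OF sv_Sq sv_Sq 2] cond_app[OF h(2) assms(2)] cond_app[OF h(3) 1] by blast
qed

lemma sq_dm: assumes "cond l p" "i<:dm p" shows "dm (sq p i)<:om" "fn (sq p i) (dm (sq p i)) two"
proof -
 obtain m where m: "m<:om" "fn (sq p i) m two" using sv_Sq[OF cond_app[OF assms]] Sq by blast
 then show "dm (sq p i)<:om" "fn (sq p i) (dm (sq p i)) two" using fn_dm[OF m(2)] by simp_all
qed

lemma c_long: assumes p: "p : G" and i: "i<:om1" and n: "n<:om" shows "EX r:G. i<:dm r&n<<=dm (sq r i)&le r p"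
proof -
 have d: "Dfn (%e. i<:dm (e 0)&n<<=dm (sq (e 0) i))" by (intro dfn)
 have "EX r:G. (i<:dm r&n<<=dm (sq r i))&le r p"
 proof (rule generic_below[OF d p])
  fix q assume "le q p"
  then have q: "cond l q" unfolding le by blast
  have "EX k. k<:om&n<<=k&(i<:dm q-->dm (sq q i)<<=k)"
   using om_max[OF n sq_dm(1)[OF q]] n sub_refl by blast
  then obtain k where k: "k<:om" "n<<=k" "i<:dm q==>dm (sq q i)<<=k" by blast
  have "emp<:two" by (simp add: two_def)
  from ext_at[OF q i k(1,3) this] obtain u where u: "le u q" "i<:dm u" "fn (sq u i) (sc k) two" by blast
  have "n<<=dm (sq u i)" unfolding fn_dm[OF u(3)] using subD[OF k(2)] by (auto simp: sub_def)
  then show "EX r. le r q&i<:dm r&n<<=dm (sq r i)" using u by blast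
 qed
 then show ?thesis by blast
qed

text \<open>One set holding all Cohen reals at once, so that the function \<open>c\<close> from
  indices to reals is definable in the extension.\<close>

definition Gr :: U where
 "Gr = (SOME Z. ALL y. E' y Z<->(EX i u p. p : G&i<:om1&i<:dm p&u<:sq p i&y = j (pair i u)))"
definition c :: "U => U" where "c x = N.sep (N.cart N.om N.two) (%u. E' (N.pair x u) Gr)"

lemma c_dfn [dfn]: "N.DfnT s==>N.DfnT (%e. c (s e))"
 by (rule N.DfnT1[of c], unfold c_def, intro dfn)

lemma Gr: "E' y Gr<->(EX i u p. p : G&i<:om1&i<:dm p&u<:sq p i&y = j (pair i u))"
proof -
 let ?Q = "%z. EX i u p. z = pair (pair i u) p&i<:dm p&u<:sq p i"
 have d: "Dfn (%e. ?Q (e 0))" by (intro dfn)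
 let ?T = "sep (cart (cart om1 (Uni (img (app sv) om1))) P) ?Q"
 have ds: "DfnT (%e. app sv (e 0))" by (intro dfn)
 obtain Z where Z0: "!!y. E' y Z<->(EX x p. p : G&pair x p<:?T&y = j x)" using j_real by blast
 have "E' y Z<->(EX i u p. p : G&i<:om1&i<:dm p&u<:sq p i&y = j (pair i u))" for y
 proof
  assume "E' y Z"
  then obtain x p where x: "p : G" "pair x p<:?T" "y = j x" unfolding Z0 by blast
  then obtain i u where "x = pair i u" "i<:dm p" "u<:sq p i" "i<:om1" unfolding sep[OF d] by auto
  then show "EX i u p. p : G&i<:om1&i<:dm p&u<:sq p i&y = j (pair i u)" using x by blast
 next
  assume "EX i u p. p : G&i<:om1&i<:dm p&u<:sq p i&y = j (pair i u)"
  then obtain i u p where h: "p : G" "i<:om1" "i<:dm p" "u<:sq p i" "y = j (pair i u)" by blast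
  have "app p i<:om1" using cond_app[OF Gcond[OF h(1)] h(3)] .
  then have "u<:Uni (img (app sv) om1)" unfolding Uni img[OF ds] using h(4) by blast
  then have "pair (pair i u) p<:?T" unfolding sep[OF d] using h GP by simp
  then show "E' y Z" unfolding Z0 using h by blast
 qed
 then have "EX Z. ALL y. E' y Z<->(EX i u p. p : G&i<:om1&i<:dm p&u<:sq p i&y = j (pair i u))" by blast
 from someI_ex[OF this, folded Gr_def] show ?thesis by blast
qed

lemma c_mem: assumes i: "i<:om1" shows "E' u (c (j i))<->(EX p:G. i<:dm p&(EX w. w<:sq p i&u = j w))"
proof -
 have d: "N.Dfn (%e. E' (N.pair (j i) (e 0)) Gr)" by (intro dfn)
 have "E' (N.pair (j i) u) Gr<->(EX p:G. i<:dm p&(EX w. w<:sq p i&u = j w))"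
  unfolding Gr j_pair using i by auto
 moreover have "E' (j w) (N.cart N.om N.two)" if h: "p : G" "i<:dm p" "w<:sq p i" for p w
 proof -
  note s = sq_dm[OF Gcond[OF h(1)] h(2)]
  obtain k where k: "k<:dm (sq p i)" "w = pair k (app (sq p i) k)" using h(3) fn_mem[OF s(2)] by blast
  have "k<:om" using om_trans[OF s(1) k(1)] .
  then show ?thesis using fn_app(2)[OF s(2) k(1)] unfolding k(2) by (simp add: j_pair j_om[symmetric] j_two[symmetric])
 qed
 ultimately show ?thesis unfolding c_def N.sep[OF d] by blast
qed

lemma c_fn: assumes i: "i<:om1" shows "N.fn (c (j i)) N.om N.two"
  "p : G==>i<:dm p==>n<:dm (sq p i)==>N.app (c (j i)) (j n) = j (app (sq p i) n)"
proof -
 have ex: "E' (j (pair n (app (sq p i) n))) (c (j i))" if "p : G" "i<:dm p" "n<:dm (sq p i)" for n p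
  unfolding c_mem[OF i] using that fn_app(1)[OF sq_dm(2)[OF Gcond[OF that(1)] that(2)] that(3)] by blast
 have un: "z = j (app (sq p i) n)" if h: "p : G" "i<:dm p" "n<:dm (sq p i)" "E' (N.pair (j n) z) (c (j i))" for p n z
 proof -
  obtain q w where q: "q : G" "i<:dm q" "w<:sq q i" "N.pair (j n) z = j w" using h(4) unfolding c_mem[OF i] by blast
  note s = sq_dm[OF Gcond[OF q(1)] q(2)]
  obtain k where k: "k<:dm (sq q i)" "w = pair k (app (sq q i) k)" using q(3) fn_mem[OF s(2)] by blast
  have e: "n = k" "z = j (app (sq q i) k)" using q(4) unfolding k(2) by (simp_all add: j_pair)
  obtain r where r: "r : G" "le r p" "le r q" using Gdir h(1) q(1) by blast
  note sr = sq_dm[OF Gcond[OF r(1)] sq_mono(1)[OF r(2) h(2) i]]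
  have "pair n (app (sq p i) n)<:sq r i" "pair n (app (sq q i) n)<:sq r i"
   using fn_app(1)[OF sq_dm(2)[OF Gcond[OF h(1)] h(2)] h(3)] fn_app(1)[OF s(2) k(1)] subD[OF sq_mono(2)[OF r(2) h(2) i]] subD[OF sq_mono(2)[OF r(3) q(2) i]] unfolding e(1) by blast+
  then show ?thesis using e unfolding fn_pair[OF sr(2)] by simp
 qed
 show f: "N.fn (c (j i)) N.om N.two" unfolding N.fn_def
 proof (intro conjI allI impI)
  have d: "N.Dfn (%e. E' (N.pair (j i) (e 0)) Gr)" by (intro dfn)
  fix u assume "E' u (c (j i))"
  then have "E' u (N.cart N.om N.two)" unfolding c_def N.sep[OF d] by blast
  then show "EX x y. E' x N.om&E' y N.two&u = N.pair x y" unfolding N.cart by blast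
 next
  fix x assume "E' x N.om"
  then obtain n where n: "n<:om" "x = j n" unfolding j_om[symmetric] by (elim jE)
  obtain p0 where "p0 : G" using Gne by blast
  from c_long[OF this i sc_om[OF n(1)]] obtain p where p: "p : G" "i<:dm p" "sc n<<=dm (sq p i)" by blast
  have nd: "n<:dm (sq p i)" using subD[OF p(3)] by simp
  show "EX y. E' (N.pair x y) (c (j i))&(ALL z. E' (N.pair x z) (c (j i))-->z = y)"
   using ex[OF p(1,2) nd] un[OF p(1,2) nd] unfolding n(2) j_pair by blast
 qed
 assume p: "p : G" "i<:dm p" "n<:dm (sq p i)"
 show "N.app (c (j i)) (j n) = j (app (sq p i) n)" using ex[OF p] unfolding j_pair N.fn_pair[OF f] by simp
qed

text \<open>Any condition can be extended so that the two sequences differ at a position beyond both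
  of them.\<close>

lemma c_inj: assumes i: "i<:om1" "k<:om1" and e: "c (j i) = c (j k)" shows "i = k"
proof (rule ccontr)
 assume ne: "i ~= k"
 let ?C = "%p. i<:dm p&k<:dm p&(EX n. n<:dm (sq p i)&n<:dm (sq p k)&app (sq p i) n ~= app (sq p k) n)"
 have d: "Dfn (%e. ?C (e 0))" by (intro dfn)
 have tw: "emp<:two" "sc emp<:two" by (simp_all add: two_def)
 have "EX p:G. ?C p"
 proof (rule generic_dense[OF d])
  fix q assume "q<:P"
  then have q: "cond l q" using Pcond by blast
  have b: "EX n. n<:om&(x<:dm q-->dm (sq q x)<<=n)" for x using sq_dm(1)[OF q] sub_refl emp_om by blast
  obtain n1 n2 where n1: "n1<:om" "i<:dm q-->dm (sq q i)<<=n1" "n2<:om" "k<:dm q-->dm (sq q k)<<=n2" using b[of i] b[of k] by blast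
  obtain n where n: "n<:om" "n1<<=n" "n2<<=n" using om_max n1 by blast
  have "i<:dm q==>dm (sq q i)<<=n" using n1(2) n(2) sub_trans by blast
  from ext_at[OF q i(1) n(1) this tw(1)] obtain u where u: "le u q" "i<:dm u" "fn (sq u i) (sc n) two" "app (sq u i) n = emp"
   "!!y. y ~= i==>(y<:dm u<->y<:dm q)&(y<:dm q-->app u y = app q y)" by blast
  have uc: "cond l u" using u(1) unfolding le by blast
  have "dm (sq u k)<<=n" if "k<:dm u" using u(5)[of k] ne n1(4) n(3) sub_trans that by metis
  from ext_at[OF uc i(2) n(1) this tw(2)] obtain w where w: "le w u" "k<:dm w" "fn (sq w k) (sc n) two" "app (sq w k) n = sc emp"
   "!!y. y ~= k==>(y<:dm w<->y<:dm u)&(y<:dm u-->app w y = app u y)" by blast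
  have wi: "i<:dm w" "app w i = app u i" using w(5)[OF ne] u(2) by blast+
  have "?C w" unfolding wi(2) fn_dm[OF u(3)] fn_dm[OF w(3)] using wi(1) w(2) u(4) w(4) by (intro conjI exI[of _ n]) simp_all
  then show "EX r. le r q&?C r" using w(1) u(1) le_trans by blast
 qed
 then obtain p n where p: "p : G" "i<:dm p" "k<:dm p" "n<:dm (sq p i)" "n<:dm (sq p k)" "app (sq p i) n ~= app (sq p k) n" by blast
 show False using c_fn(2)[OF i(1) p(1,2,4)] c_fn(2)[OF i(2) p(1,3,5)] p(6) e by simp
qed

lemma c_dense: assumes I: "I<<=om1" "~ctbl I" and s: "s<:Sq" and Z: "N.ctbl Z"
 shows "EX i. i<:I&~E' (j i) Z&(EX p:G. i<:dm p&sq p i = s)"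
proof -
 have "N.ctbl (N.it Z (j I))" by (rule N.ctbl_sub[OF Z]) (simp add: N.sub_def)
 moreover have "E' y (j I)" if "E' y (N.it Z (j I))" for y using that by simp
 ultimately obtain C where C: "ctbl C" "!!y. E' y (N.it Z (j I))==>E' y (j C)" using cover by blast
 obtain a where a: "a<:om1" "app sv a = s" using sv(2)[OF s] by blast
 let ?C = "%p. EX i. i<:I&~i<:C&i<:dm p&sq p i = s"
 have d: "Dfn (%e. ?C (e 0))" by (intro dfn)
 have "EX p:G. ?C p"
 proof (rule generic_dense[OF d])
  fix q assume "q<:P"
  then have q: "cond l q" using Pcond by blast
  have "ctbl (un C (dm q))" using ctbl_un[OF C(1) fin_ctbl[OF cond_fin[OF q]]] .
  then have "~I<<=un C (dm q)" using I(2) ctbl_sub by blast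
  then obtain i where i: "i<:I" "~i<:C" "~i<:dm q" unfolding sub_def un by blast
  from upd[OF q subD[OF I(1) i(1)] a(1)] i(3) obtain u where "le u q" "i<:dm u" "app u i = a" by blast
  then show "EX r. le r q&?C r" using i a(2) by blast
 qed
 then obtain p i where p: "p : G" "i<:I" "~i<:C" "i<:dm p" "sq p i = s" by blast
 have "~E' (j i) Z" using C(2)[of "j i"] p(2,3) by auto
 then show ?thesis using p by blast
qed

text \<open>No finite sequence is new. Natural numbers of the model may be non-standard, so the
  induction runs inside the extension, on membership in the image of the set \<open>?T\<close> of
  all finite sequences with their lengths.\<close>

lemma seq_name: assumes x: "N.fn x N.om N.two" and n: "n<:om"
 shows "EX s. s<:Sq&dm s = n&(ALL k. k<:n-->N.app x (j k) = j (app s k))"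
proof -
 have d: "Dfn (%e. fn (p2 (e 0)) (p1 (e 0)) two)" by (intro dfn)
 let ?T = "sep (cart om Sq) (%u. fn (p2 u) (p1 u) two)"
 have T: "pair k s<:?T<->k<:om&s<:Sq&fn s k two" for k s unfolding sep[OF d] by simp
 have TE: "EX s. E' u (j ?T)-->u = N.pair (j k) (j s)&fn s k two" if "u = N.pair (j k) y" for u k y
 proof (cases "E' u (j ?T)")
  case True
  then obtain w where w: "w<:?T" "u = j w" by (elim jE)
  then obtain k' s where "w = pair k' s" "fn s k' two" unfolding sep[OF d] by (auto simp: cart)
  then show ?thesis using w that by (auto simp: j_pair)
 qed blast
 have dP: "N.Dfn (%e. E' (N.pair (e 0) (N.rs x (e 0))) (j ?T))" by (intro dfn)
 have "E' (N.pair (j n) (N.rs x (j n))) (j ?T)"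
 proof (rule N.om_induct[OF dP])
  show "E' (j n) N.om" using n by (simp add: j_om[symmetric])
  have "N.rs x N.emp = N.emp" by (rule N.seteq) (simp add: N.rs)
  moreover have "fn emp emp two" by (simp add: fn_def)
  then have "pair emp emp<:?T" unfolding T using Sq emp_om by blast
  then have "E' (N.pair N.emp N.emp) (j ?T)" using j_in[of "pair emp emp" ?T] by (simp add: j_pair j_emp)
  ultimately show "E' (N.pair N.emp (N.rs x N.emp)) (j ?T)" by simp
  fix m assume m: "E' m N.om" and ih: "E' (N.pair m (N.rs x m)) (j ?T)"
  obtain k where k: "k<:om" "m = j k" using m unfolding j_om[symmetric] by (elim jE)
  obtain s where s: "N.rs x m = j s" "fn s k two" using TE[of "N.pair m (N.rs x m)" k "N.rs x m"] ih k(2) by auto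
  have "E' (N.app x m) (j two)" using N.fn_app(2)[OF x m] j_two by simp
  then obtain b where b: "b<:two" "N.app x m = j b" by (elim jE)
  note fi = fn_ins[OF s(2) b(1) not_self]
  have "ins k k = sc k" by (rule seteq) simp
  then have "fn (ins (pair k b) s) (sc k) two" using fi(1) by simp
  then have "pair (sc k) (ins (pair k b) s)<:?T" unfolding T using sc_om[OF k(1)] Sq by blast
  then have "E' (N.pair (N.sc m) (N.ins (N.pair m (N.app x m)) (N.rs x m))) (j ?T)"
   unfolding s(1) b(2) unfolding k(2) using j_in[of "pair (sc k) (ins (pair k b) s)" ?T] by (simp add: j_pair j_sc j_ins)
  moreover have "N.ins (N.pair m (N.app x m)) (N.rs x m) = N.rs x (N.sc m)"
  proof (rule N.seteq)
   fix z
   show "E' z (N.ins (N.pair m (N.app x m)) (N.rs x m))<->E' z (N.rs x (N.sc m))"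
    unfolding N.ins N.rs N.sc using N.fn_pair[OF x, of m] m by auto
  qed
  ultimately show "E' (N.pair (N.sc m) (N.rs x (N.sc m))) (j ?T)" by simp
 qed
 then obtain s where s: "N.rs x (j n) = j s" "fn s n two" using TE[of "N.pair (j n) (N.rs x (j n))" n] by auto
 have "N.app x (j k) = j (app s k)" if k: "k<:n" for k
 proof -
  have "E' (j (pair k (app s k))) (N.rs x (j n))" unfolding s(1) using fn_app(1)[OF s(2) k] by simp
  then have "E' (N.pair (j k) (j (app s k))) x" unfolding N.rs by (simp add: j_pair)
  then show ?thesis using N.fn_pair[OF x] by simp
 qed
 moreover have "s<:Sq" using s(2) n Sq by blast
 ultimately show ?thesis using fn_dm[OF s(2)] by blast
qed

subsection \<open>The two dense sets\<close>

text \<open>Valid for all sets, as the default values on non-pairs also correspond.\<close>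

lemma j_p: "N.p1 (j z) = j (p1 z)" "N.p2 (j z) = j (p2 z)"
proof -
 have pr: "EX a b. z = pair a b&x = j a&y = j b" if h: "j z = N.pair x y" for x y
 proof -
  have "E' (N.upair x x) (j z)" "E' (N.upair x y) (j z)" unfolding h N.pair_def by simp_all
  then obtain u w where u: "N.upair x x = j u" "N.upair x y = j w" by (elim jE)
  have "E' x (j u)" "E' y (j w)" unfolding u[symmetric] by simp_all
  then obtain a b where ab: "x = j a" "y = j b" by (elim jE)
  then have "j z = j (pair a b)" using h by (simp add: j_pair)
  then show ?thesis using ab by simp
 qed
 have "N.p1 (j z) = j (p1 z)&N.p2 (j z) = j (p2 z)"
 proof (cases "EX a b. z = pair a b")
  case True
  then obtain a b where "z = pair a b" by blast
  then show ?thesis by (simp_all add: j_pair)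
 next
  case False
  have n: "~(EX x y. j z = N.pair x y)" using pr False by blast
  have "p1 z = emp" "p2 z = emp" unfolding p1_def p2_def des_def using False by auto
  moreover have "N.p1 (j z) = N.emp" "N.p2 (j z) = N.emp" unfolding N.p1_def N.p2_def N.des_def using n by auto
  ultimately show ?thesis by (simp_all add: j_emp)
 qed
 then show "N.p1 (j z) = j (p1 z)" "N.p2 (j z) = j (p2 z)" by blast+
qed

text \<open>If the reals starting like \<open>x\<close> were countable, so would be their indices,
  and \<open>c_dense\<close> would supply one more index.\<close>

lemma dense_img: assumes I: "I<<=om1" "~ctbl I" and x: "N.fn x N.om N.two" and n: "E' n N.om"
 shows "~N.ctbl (N.sep (N.img c (j I)) (%a. ALL k. E' k n-->N.app a k = N.app x k))" (is "~N.ctbl ?W")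
proof
 assume W: "N.ctbl ?W"
 have dc: "N.DfnT (%e. c (e 0))" by (intro dfn)
 have dW: "N.Dfn (%e. ALL k. E' k n-->N.app (e 0) k = N.app x k)" by (intro dfn)
 have dZ: "N.Dfn (%e. E' (c (e 0)) ?W)" by (intro dfn)
 let ?Z = "N.sep (j I) (%i. E' (c i) ?W)"
 have "N.lep ?Z ?W"
 proof (rule N.lepI[OF dc])
  show "E' (c i) ?W" if "E' i ?Z" for i using that unfolding N.sep[OF dZ] by blast
  fix a b assume "E' a ?Z" "E' b ?Z" and e: "c a = c b"
  then have "E' a (j I)" "E' b (j I)" unfolding N.sep[OF dZ] by blast+
  then obtain i k where "i<:I" "a = j i" "k<:I" "b = j k" by (elim jE)
  then show "a = b" using c_inj[of i k] subD[OF I(1)] e by simp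
 qed
 then have Z: "N.ctbl ?Z" by (rule N.ctbl_lep[OF W])
 obtain m where m: "m<:om" "n = j m" using n unfolding j_om[symmetric] by (elim jE)
 obtain s where s: "s<:Sq" "dm s = m" "!!k. k<:m==>N.app x (j k) = j (app s k)" using seq_name[OF x m(1)] by blast
 obtain i p where i: "i<:I" "~E' (j i) ?Z" "p : G" "i<:dm p" "sq p i = s" using c_dense[OF I s(1) Z] by blast
 have i1: "i<:om1" using subD[OF I(1) i(1)] .
 have "N.app (c (j i)) k = N.app x k" if k: "E' k n" for k
 proof -
  obtain k' where k': "k'<:m" "k = j k'" using k unfolding m(2) by (elim jE)
  have "N.app (c (j i)) (j k') = j (app (sq p i) k')" by (rule c_fn(2)[OF i1 i(3,4)]) (simp add: i(5) s(2) k'(1))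
  then show ?thesis using s(3)[OF k'(1)] k'(2) i(5) by simp
 qed
 moreover have "E' (c (j i)) (N.img c (j I))" unfolding N.img[OF dc] using i(1) j_in by blast
 ultimately have "E' (c (j i)) ?W" unfolding N.sep[OF dW] by blast
 then have "E' (j i) ?Z" unfolding N.sep[OF dZ] using i(1) by simp
 then show False using i(2) by blast
qed

lemma K_gp: assumes p: "p : G" and o: "i<:om1" "k<:om1" "i'<:om1" "k'<:om1" and K: "K p (pair i k) (pair i' k')"
 shows "N.gp (N.pair (c (j i)) (c (j k))) (N.pair (c (j i')) (c (j k')))"
proof -
 obtain m n where h: "i<:dm p" "k<:dm p" "i'<:dm p" "k'<:dm p" "m<:om" "n<:m" "m<<=dm (sq p i)" "m<<=dm (sq p i')"
  "rs (sq p i) m = rs (sq p i') m" "n<:dm (sq p k)" "n<:dm (sq p k')" "app (sq p k) n ~= app (sq p k') n"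
  using K unfolding K_def p1 p2 by blast
 note s = sq_dm(2)[OF Gcond[OF p]]
 have "N.app (c (j i)) x = N.app (c (j i')) x" if x: "E' x (j m)" for x
 proof -
  obtain y where y: "y<:m" "x = j y" using x by (elim jE)
  have "app (sq p i) y = app (sq p i') y" using rs_fn(2)[OF s[OF h(1)] h(7) y(1)] rs_fn(2)[OF s[OF h(3)] h(8) y(1)] h(9) by simp
  then show ?thesis unfolding y(2) using c_fn(2)[OF o(1) p h(1) subD[OF h(7) y(1)]] c_fn(2)[OF o(3) p h(3) subD[OF h(8) y(1)]] by simp
 qed
 moreover have "N.app (c (j k)) (j n) ~= N.app (c (j k')) (j n)" using c_fn(2)[OF o(2) p h(2,10)] c_fn(2)[OF o(4) p h(4,11)] h(12) by simp
 moreover have "E' (j m) N.om" "E' (j n) (j m)" using h(5,6) by (simp_all add: j_om[symmetric])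
 ultimately show ?thesis unfolding N.gp_def N.p1 N.p2 by blast
qed

text \<open>The filter has a condition whose sequences at all four indices have length at least
  \<open>m\<close>, and the relation is visible in these.\<close>

lemma gp_K: assumes o: "i<:om1" "k<:om1" "i'<:om1" "k'<:om1"
  and g: "N.gp (N.pair (c (j i)) (c (j k))) (N.pair (c (j i')) (c (j k')))"
 shows "EX p:G. K p (pair i k) (pair i' k')"
proof -
 obtain M x where M: "E' M N.om" "!!x. E' x M==>N.app (c (j i)) x = N.app (c (j i')) x" "E' x M" "N.app (c (j k)) x ~= N.app (c (j k')) x"
  using g unfolding N.gp_def N.p1 N.p2 by blast
 obtain m where m: "m<:om" "M = j m" using M(1) unfolding j_om[symmetric] by (elim jE)
 obtain n where n: "n<:m" "x = j n" using M(3) unfolding m(2) by (elim jE)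
 obtain q0 where "q0 : G" using Gne by blast
 from c_long[OF this o(1) m(1)] obtain q1 where q1: "q1 : G" "i<:dm q1" "m<<=dm (sq q1 i)" by blast
 from c_long[OF q1(1) o(2) m(1)] obtain q2 where q2: "q2 : G" "k<:dm q2" "m<<=dm (sq q2 k)" "le q2 q1" by blast
 from c_long[OF q2(1) o(3) m(1)] obtain q3 where q3: "q3 : G" "i'<:dm q3" "m<<=dm (sq q3 i')" "le q3 q2" by blast
 from c_long[OF q3(1) o(4) m(1)] obtain p where p: "p : G" "k'<:dm p" "m<<=dm (sq p k')" "le p q3" by blast
 have l: "le p q2" "le p q1" using p(4) q3(4) q2(4) le_trans by blast+
 have d: "i<:dm p" "k<:dm p" "i'<:dm p" using sq_mono(1) l p(4) q1 q2 q3 o by blast+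
 have s: "m<<=dm (sq p i)" "m<<=dm (sq p k)" "m<<=dm (sq p i')"
  using sub_trans[OF q1(3) sq_mono(3)[OF l(2) q1(2) o(1)]] sub_trans[OF q2(3) sq_mono(3)[OF l(1) q2(2) o(2)]] sub_trans[OF q3(3) sq_mono(3)[OF p(4) q3(2) o(3)]] by blast+
 note f = sq_dm(2)[OF Gcond[OF p(1)]]
 note v = c_fn(2)[OF _ p(1)]
 have "rs (sq p i) m = rs (sq p i') m"
 proof (rule fn_eqI[OF rs_fn(1)[OF f[OF d(1)] s(1)] rs_fn(1)[OF f[OF d(3)] s(3)]])
  fix y assume y: "y<:m"
  then have "j (app (sq p i) y) = j (app (sq p i') y)"
   using M(2)[of "j y"] v[OF o(1) d(1) subD[OF s(1) y]] v[OF o(3) d(3) subD[OF s(3) y]] unfolding m(2) by simp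
  then show "app (rs (sq p i) m) y = app (rs (sq p i') m) y"
   using rs_fn(2)[OF f[OF d(1)] s(1) y] rs_fn(2)[OF f[OF d(3)] s(3) y] by simp
 qed
 moreover have "app (sq p k) n ~= app (sq p k') n"
  using M(4) v[OF o(2) d(2) subD[OF s(2) n(1)]] v[OF o(4) p(2) subD[OF p(3) n(1)]] unfolding n(2) by auto
 ultimately have "K p (pair i k) (pair i' k')" unfolding K_def p1 p2
  using d p(2) m(1) n(1) s(1,3) subD[OF s(2) n(1)] subD[OF p(3) n(1)] by blast
 then show ?thesis using p(1) by blast
qed

text \<open>Through the injection \<open>c\<close>, uncountable sets of pairs of reals become sets
  of pairs of indices, to which \<open>generic_pair\<close> and \<open>MA_ext\<close> apply.\<close>

theorem lip_ext: "lip E' (N.img c (j IA)) (N.img c (j IB))"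
proof -
 have dc: "N.DfnT (%e. c (e 0))" by (intro dfn)
 let ?A = "N.img c (j IA)" and ?B = "N.img c (j IB)"
 have mem: "EX i. i<:I&y = c (j i)" if "E' y (N.img c (j I))" for y I using that unfolding N.img[OF dc] by (auto elim: jE)
 have sz: "N.sub (N.img c (j I)) (N.Fnc N.om N.two)&N.lep (N.img c (j I)) N.om1" if I: "I<<=om1" for I
 proof
  show "N.sub (N.img c (j I)) (N.Fnc N.om N.two)" unfolding N.sub_def N.Fnc using mem c_fn(1) subD[OF I] by blast
  have "N.sub (j I) N.om1" using I by (simp add: j_om1[symmetric])
  then show "N.lep (N.img c (j I)) N.om1" using N.lep_img[OF dc] N.lep_sub N.lep_trans by blast
 qed
 have oo: "N.cart N.om1 N.om1 = j (cart om1 om1)" by (simp add: j_cart j_om1)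
 show ?thesis
 proof (intro lip.intro N.zfc_axioms lip_axioms.intro)
  show "N.sub ?A (N.Fnc N.om N.two)" "N.lep ?A N.om1" "N.sub ?B (N.Fnc N.om N.two)" "N.lep ?B N.om1"
   using sz[OF IA(1)] sz[OF IB(1)] by blast+
  show "~N.ctbl (N.sep ?A (%a. ALL k. E' k n-->N.app a k = N.app x k))" if "N.fn x N.om N.two" "E' n N.om" for x n
   by (rule dense_img[OF IA that])
  show "~N.ctbl (N.sep ?B (%a. ALL k. E' k n-->N.app a k = N.app x k))" if "N.fn x N.om N.two" "E' n N.om" for x n
   by (rule dense_img[OF IB that])
 next
  fix X assume X: "N.sub X (N.cart ?A ?B)" "~N.ctbl X" "N.ic X"
  let ?F = "%u. N.pair (c (N.p1 u)) (c (N.p2 u))"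
  have dF: "N.DfnT (%e. ?F (e 0))" by (intro dfn)
  have dX: "N.Dfn (%e. E' (?F (e 0)) X)" by (intro dfn)
  let ?X = "N.sep (j (cart IA IB)) (%u. E' (?F u) X)"
  have "N.lep X ?X"
  proof (rule N.lep_surj[OF dF])
   fix y assume y: "E' y X"
   then have "E' y (N.cart ?A ?B)" by (rule N.subD[OF X(1)])
   then obtain i k where i: "i<:IA" "k<:IB" "y = N.pair (c (j i)) (c (j k))" unfolding N.cart using mem by blast
   show "EX x. E' x ?X&y = ?F x" unfolding N.sep[OF dX]
    by (rule exI[of _ "j (pair i k)"]) (use i y in \<open>simp add: j_p\<close>)
  qed
  then have uX: "~N.ctbl ?X" using X(2) N.ctbl_lep by blast
  have el: "EX i k. i<:om1&k<:om1&y = N.pair (j i) (j k)&E' (N.pair (c (j i)) (c (j k))) X" if h: "E' y ?X" for y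
  proof -
   have "E' y (j (cart IA IB))" using h unfolding N.sep[OF dX] by blast
   then obtain z where z: "z<:cart IA IB" "y = j z" by (elim jE)
   obtain i k where "i<:IA" "k<:IB" "z = pair i k" using z(1) unfolding cart by blast
   then show ?thesis using z(2) h IA(1) IB(1) subD unfolding N.sep[OF dX] by (auto simp: j_pair)
  qed
  have "EX y z. EX p:G. E' (j y) ?X&E' (j z) ?X&K p y z"
  proof (rule generic_pair[OF _ uX])
   show "E' y (j (cart IA IB))" if "E' y ?X" for y using that unfolding N.sep[OF dX] by blast
   fix y z assume y: "E' y ?X" "E' z ?X" and e: "N.p1 y = N.p1 z | N.p2 y = N.p2 z"
   obtain i k where i: "i<:om1" "k<:om1" "y = N.pair (j i) (j k)" "E' (N.pair (c (j i)) (c (j k))) X" using el[OF y(1)] by blast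
   obtain i' k' where i': "i'<:om1" "k'<:om1" "z = N.pair (j i') (j k')" "E' (N.pair (c (j i')) (c (j k'))) X" using el[OF y(2)] by blast
   have "N.pair (c (j i)) (c (j k)) = N.pair (c (j i')) (c (j k'))"
   proof -
    have "N.p1 (N.pair (c (j i)) (c (j k))) = N.p1 (N.pair (c (j i')) (c (j k'))) |
      N.p2 (N.pair (c (j i)) (c (j k))) = N.p2 (N.pair (c (j i')) (c (j k')))"
     using e unfolding i(3) i'(3) by auto
    then show ?thesis using X(3) i(4) i'(4) unfolding N.ic_def by blast
   qed
   then show "y = z" using c_inj i i' by simp
  qed
  then obtain y z p where y: "p : G" "E' (j y) ?X" "E' (j z) ?X" "K p y z" by blast
  obtain i k where i: "i<:om1" "k<:om1" "j y = N.pair (j i) (j k)" "E' (N.pair (c (j i)) (c (j k))) X" using el[OF y(2)] by blast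
  obtain i' k' where i': "i'<:om1" "k'<:om1" "j z = N.pair (j i') (j k')" "E' (N.pair (c (j i')) (c (j k'))) X" using el[OF y(3)] by blast
  have "y = pair i k" "z = pair i' k'" using i(3) i'(3) unfolding j_pair[symmetric] by simp_all
  then show "EX y z. E' y X&E' z X&N.gp y z" using K_gp[OF y(1) i(1,2) i'(1,2)] y(4) i(4) i'(4) by blast
 next
  fix S D assume S: "N.sub S (N.cart N.om1 N.om1)" "ALL a. E' a N.om1-->E' (N.pair a a) S"
   "ALL a b c. E' (N.pair a b) S-->E' (N.pair b c) S-->E' (N.pair a c) S" "N.thin N.om1 S ?A ?B"
   and D: "N.sub D (N.cart N.om1 N.om1)"
   "ALL x a. E' x N.om1-->E' a N.om1-->(EX b. E' (N.pair b a) S&E' (N.pair x b) D)"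
  have S': "E' y (j (cart om1 om1))" if "E' y S" for y using N.subD[OF S(1) that] oo by simp
  have D': "E' y (j (cart om1 om1))" if "E' y D" for y using N.subD[OF D(1) that] oo by simp
  have "EX H. (ALL y. E' y H-->E' y (j om1)) &
   (ALL a b. E' (j a) H-->E' (j b) H-->(EX e. E' (j e) H&E' (j (pair e a)) S&E' (j (pair e b)) S)) &
   (ALL x. x<:om1-->(EX b. E' (j b) H&E' (j (pair x b)) D))"
  proof (rule MA_ext[OF S' D'])
   show "E' (j (pair a a)) S" if "a<:om1" for a using S(2)[rule_format, of "j a"] that by (simp add: j_om1[symmetric] j_pair)
   show "E' (j (pair a d)) S" if "E' (j (pair a b)) S" "E' (j (pair b d)) S" for a b d
    using S(3)[rule_format, of "j a" "j b" "j d"] that by (simp add: j_pair)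
   show "EX b. b<:om1&E' (j (pair b a)) S&E' (j (pair x b)) D" if h: "x<:om1" "a<:om1" for x a
   proof -
    obtain y where y: "E' (N.pair y (j a)) S" "E' (N.pair (j x) y) D" using D(2)[rule_format, of "j x" "j a"] h by (auto simp: j_om1[symmetric])
    have "E' y (j om1)" using N.subD[OF S(1) y(1)] by (simp add: j_om1)
    then obtain b where "b<:om1" "y = j b" by (elim jE)
    then show ?thesis using y by (auto simp: j_pair)
   qed
   fix X F assume F: "fam l F" "ALL y. E' y X-->E' y (j F)" "~N.ctbl X"
   let ?f = "%u. N.pair (N.p1 (N.p2 u)) (N.pair (c (N.p1 (N.p2 (N.p2 u)))) (c (N.p2 (N.p2 (N.p2 u)))))"
   have df: "N.DfnT (%e. ?f (e 0))" by (intro dfn)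
   have fj: "?f (j z) = N.pair (j (qa z)) (N.pair (c (j (p1 (qy z)))) (c (j (p2 (qy z)))))" for z unfolding j_p qa_def qy_def ..
   have XF: "EX z. z<:F&y = j z" if "E' y X" for y using F(2) that by (auto elim: jE)
   have Fo: "qa z<:om1" "p1 (qy z)<:IA" "p2 (qy z)<:IB" "p1 (qy z)<:om1" "p2 (qy z)<:om1" if "z<:F" for z
    using F(1) that fam_om1[OF F(1) that] unfolding fam_def by blast+
   have Fi: "z = w" if "z<:F" "w<:F" "c (j (p1 (qy z))) = c (j (p1 (qy w))) | c (j (p2 (qy z))) = c (j (p2 (qy w)))" for z w
   proof -
    have "p1 (qy z) = p1 (qy w) | p2 (qy z) = p2 (qy w)" using that(3) c_inj Fo(4,5)[OF that(1)] Fo(4,5)[OF that(2)] by blast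
    then show ?thesis using F(1) that(1,2) unfolding fam_def by blast
   qed
   let ?X = "N.img ?f X"
   have X': "EX z. E' (j z) X&z<:F&y = N.pair (j (qa z)) (N.pair (c (j (p1 (qy z)))) (c (j (p2 (qy z)))))" if h: "E' y ?X" for y
   proof -
    obtain u where u: "E' u X" "y = ?f u" using h unfolding N.img[OF df] by blast
    obtain z where "z<:F" "u = j z" using XF[OF u(1)] by blast
    then show ?thesis using u fj by blast
   qed
   have "N.lep X ?X"
   proof (rule N.lepI[OF df])
    show "E' (?f u) ?X" if "E' u X" for u unfolding N.img[OF df] using that by blast
    fix u w assume uw: "E' u X" "E' w X" "?f u = ?f w"
    obtain z z' where z: "z<:F" "u = j z" "z'<:F" "w = j z'" using XF uw(1,2) by blast
    have "c (j (p1 (qy z))) = c (j (p1 (qy z')))" using uw(3) unfolding z(2,4) fj by simp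
    then show "u = w" using Fi[OF z(1,3)] z by blast
   qed
   then have uX: "~N.ctbl ?X" using F(3) N.ctbl_lep by blast
   have "N.sub ?X (N.cart N.om1 (N.cart ?A ?B))" unfolding N.sub_def
   proof (intro allI impI)
    fix y assume "E' y ?X"
    then obtain z where z: "z<:F" "y = N.pair (j (qa z)) (N.pair (c (j (p1 (qy z)))) (c (j (p2 (qy z)))))" using X' by blast
    have "E' (c (j (p1 (qy z)))) ?A" "E' (c (j (p2 (qy z)))) ?B" unfolding N.img[OF dc] using Fo[OF z(1)] j_in by blast+
    then show "E' y (N.cart N.om1 (N.cart ?A ?B))" using z(2) Fo(1)[OF z(1)] by (simp add: j_om1[symmetric])
   qed
   moreover have "N.ic2 ?X" unfolding N.ic2_def
   proof (intro allI impI)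
    fix y w assume yw: "E' y ?X" "E' w ?X" "N.p1 (N.p2 y) = N.p1 (N.p2 w) | N.p2 (N.p2 y) = N.p2 (N.p2 w)"
    obtain z where z: "z<:F" "y = N.pair (j (qa z)) (N.pair (c (j (p1 (qy z)))) (c (j (p2 (qy z)))))" using X'[OF yw(1)] by blast
    obtain v where v: "v<:F" "w = N.pair (j (qa v)) (N.pair (c (j (p1 (qy v)))) (c (j (p2 (qy v)))))" using X'[OF yw(2)] by blast
    have "z = v" using Fi[OF z(1) v(1)] yw(3) unfolding z(2) v(2) by simp
    then show "y = w" using z v by simp
   qed
   ultimately obtain y w e where h: "E' y ?X" "E' w ?X" "E' e N.om1" "E' (N.pair e (N.p1 y)) S" "E' (N.pair e (N.p1 w)) S" "N.gp (N.p2 y) (N.p2 w)"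
    using S(4) uX unfolding N.thin_def by blast
   obtain z where z: "E' (j z) X" "z<:F" "y = N.pair (j (qa z)) (N.pair (c (j (p1 (qy z)))) (c (j (p2 (qy z)))))" using X'[OF h(1)] by blast
   obtain v where v: "E' (j v) X" "v<:F" "w = N.pair (j (qa v)) (N.pair (c (j (p1 (qy v)))) (c (j (p2 (qy v)))))" using X'[OF h(2)] by blast
   obtain e' where e: "e'<:om1" "e = j e'" using h(3) unfolding j_om1[symmetric] by (elim jE)
   have "EX p:G. K p (pair (p1 (qy z)) (p2 (qy z))) (pair (p1 (qy v)) (p2 (qy v)))"
    by (rule gp_K) (use Fo[OF z(2)] Fo[OF v(2)] h(6) in \<open>simp_all add: z(3) v(3)\<close>)
   then obtain p where "p : G" "K p (qy z) (qy v)" unfolding K_def p1 p2 by blast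
   then show "EX z w e p. E' (j z) X&E' (j w) X&e<:om1&p : G&K p (qy z) (qy w)&E' (j (pair e (qa z))) S&E' (j (pair e (qa w))) S"
    using z(1) v(1) e(1) h(4,5) unfolding z(3) v(3) e(2) N.p1 j_pair by blast
  qed
  then obtain H where H: "!!y. E' y H==>E' y (j om1)"
   "!!a b. E' (j a) H==>E' (j b) H==>EX e. E' (j e) H&E' (j (pair e a)) S&E' (j (pair e b)) S"
   "!!x. x<:om1==>EX b. E' (j b) H&E' (j (pair x b)) D" by blast
  show "EX H. N.sub H N.om1&(ALL a b. E' a H-->E' b H-->(EX e. E' e H&E' (N.pair e a) S&E' (N.pair e b) S)) &
   (ALL x. E' x N.om1-->(EX b. E' b H&E' (N.pair x b) D))"
  proof (rule exI[of _ H], intro conjI allI impI)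
   show "N.sub H N.om1" unfolding N.sub_def j_om1[symmetric] using H(1) by blast
   fix a b assume h: "E' a H" "E' b H"
   obtain a' b' where a: "a = j a'" "b = j b'" using H(1)[OF h(1)] H(1)[OF h(2)] by (elim jE)
   show "EX e. E' e H&E' (N.pair e a) S&E' (N.pair e b) S" using H(2)[of a' b'] h unfolding a j_pair by blast
  next
   fix x assume "E' x N.om1"
   then obtain x' where x: "x'<:om1" "x = j x'" unfolding j_om1[symmetric] by (elim jE)
   show "EX b. E' b H&E' (N.pair x b) D" using H(3)[OF x(1)] unfolding x(2) j_pair by blast
  qed
 qed
qed

end

section \<open>Closing small sets under operations\<close>

context zfc begin

lemma lep_om1_surj: assumes M: "lep M om1" and q: "q<:M" shows "EX s. fn s om1 M&(ALL x. x<:M-->(EX a. a<:om1&app s a = x))"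
proof -
 obtain f where f: "fn f M om1" "inj f M" using M unfolding lep_def by blast
 let ?D = "%a. des (%x. x<:M&app f x = a)"
 let ?g = "%a. if ?D a<:M then ?D a else q"
 have dg: "DfnT (%e. ?g (e 0))" by (intro dfn)
 have D: "?D (app f x) = x" if "x<:M" for x
  by (rule des_eq) (use that f(2) in \<open>unfold inj_def, blast+\<close>)
 have "fn (lam om1 ?g) om1 M" by (rule lam_fn[OF dg]) (use q in simp)
 moreover have "EX a. a<:om1&app (lam om1 ?g) a = x" if x: "x<:M" for x
 proof (intro exI conjI)
  show fx: "app f x<:om1" using fn_app(2)[OF f(1) x] .
  show "app (lam om1 ?g) (app f x) = x" unfolding lam_app[OF dg fx] D[OF x] using x by simp
 qed
 ultimately show ?thesis by blast
qed

lemma lep_un: assumes "lep a om1" "lep b om1" shows "lep (un a b) om1"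
proof -
 have d: "DfnT (%e. e 0)" by (intro dfn)
 have "fin (upair a b)"
 proof -
  have "upair a b = ins a (ins b emp)" by (rule seteq) auto
  then show ?thesis by simp
 qed
 then have "lep (upair a b) om1" using fin_ctbl lep_sub Ord_sub[OF Ord_om Ord_om1] om_om1 lep_trans unfolding ctbl_def by blast
 then have "lep (Uni (img (%x. x) (upair a b))) om1" by (rule lep_Uni[OF d _ _ lep_om1_square]) (use assms in auto)
 moreover have "un a b<<=Uni (img (%x. x) (upair a b))" unfolding sub_def Uni img[OF d] by auto
 ultimately show ?thesis using lep_sub lep_trans by blast
qed

lemma ctbl_lep_om1: "ctbl a==>lep a om1"
 using lep_sub Ord_sub[OF Ord_om Ord_om1] om_om1 lep_trans unfolding ctbl_def by blast

text \<open>Closure in \<open>om\<close> many steps under a binary operation whose first argument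
  may also come from \<open>F\<close>; elements of \<open>F\<close> act as codes of further unary
  operations. Minimality serves to keep the hull inside a given closed set.\<close>

lemma hull: assumes dg: "DfnT (%e. g (e 0) (e (Suc 0)))" and F: "lep F om1"
 shows "EX M. q<:M&lep M om1&(ALL a b. a<:un F M-->b<:M-->g a b<:M) &
  (ALL Q. q<:Q-->(ALL a b. a<:un F Q-->b<:Q-->g a b<:Q)-->M<<=Q)"
proof -
 have dg1: "DfnT (%e. g (p1 (e 0)) (p2 (e 0)))" by (intro DfnT2[OF dg] dfn)
 define st where "st X = ins q (un X (img (%z. g (p1 z) (p2 z)) (cart (un F X) X)))" for X
 have dst: "DfnT s==>DfnT (%e. st (s e))" for s
  by (rule DfnT1[of st], unfold st_def, intro dfn DfnT2[OF dg])
 have st: "y<:st X<->y = q | y<:X | (EX a b. a<:un F X&b<:X&y = g a b)" for y X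
  unfolding st_def ins un[of y X] img[OF dg1] cart by (metis p1 p2)
 let ?H = "%x f. st (Uni (img (app f) x))"
 have dH: "DfnT (%e. ?H (e 0) (e (Suc 0)))" by (intro dfn dst)
 define T where "T = Rec ?H"
 have dT: "DfnT (%e. T (e 0))" unfolding T_def by (intro dfn dst)
 define V where "V n = Uni (img T n)" for n
 have V: "y<:V n<->(EX k. k<:n&y<:T k)" for y n unfolding V_def Uni img[OF dT] by blast
 have T: "T n = st (V n)" for n
 proof -
  have da: "DfnT (%e. app (lam n T) (e 0))" by (intro dfn DfnT1[OF dT])
  have "img (app (lam n T)) n = img T n"
   by (rule seteq) (unfold img[OF da] img[OF dT], use lam_app[OF dT] in metis)
  then show ?thesis unfolding V_def T_def using Rec_eq[OF dH, of n] by simp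
 qed
 have dP: "Dfn (%e. lep (V (e 0)) om1)" unfolding V_def by (intro dfn DfnT1[OF dT])
 have lst: "lep (st X) om1" if X: "lep X om1" for X
 proof -
  have "lep (cart (un F X) X) om1" using lep_cart[OF lep_un[OF F X] X] lep_om1_square lep_trans by blast
  then have "lep (img (%z. g (p1 z) (p2 z)) (cart (un F X) X)) om1" using lep_img[OF dg1] lep_trans by blast
  moreover have "lep (upair q q) om1"
  proof -
   have "upair q q = ins q emp" by (rule seteq) auto
   then show ?thesis using fin_ctbl ctbl_lep_om1 by simp
  qed
  ultimately have "lep (un (upair q q) (un X (img (%z. g (p1 z) (p2 z)) (cart (un F X) X)))) om1" using lep_un X by blast
  moreover have "st X<<=un (upair q q) (un X (img (%z. g (p1 z) (p2 z)) (cart (un F X) X)))" unfolding st_def by (auto simp: sub_def)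
  ultimately show ?thesis using lep_sub lep_trans by blast
 qed
 have lV: "lep (V n) om1" if n: "n<:om" for n
 proof (rule om_induct[OF dP n])
  have "V emp = emp" by (rule seteq) (simp add: V)
  then show "lep (V emp) om1" using fin_ctbl ctbl_lep_om1 by simp
  fix n assume "n<:om" and ih: "lep (V n) om1"
  have "V (sc n)<<=un (V n) (T n)" unfolding sub_def V un sc by blast
  then show "lep (V (sc n)) om1" using lep_un[OF ih lst[OF ih]] lep_sub lep_trans unfolding T by blast
 qed
 let ?M = "Uni (img T om)"
 have M: "y<:?M<->(EX n. n<:om&y<:T n)" for y unfolding Uni img[OF dT] by blast
 have "lep (T n) om1" if "n<:om" for n unfolding T by (rule lst[OF lV[OF that]])
 then have lM: "lep ?M om1" using lep_Uni[OF dT ctbl_lep_om1 _ lep_om1_square, of om] by (simp add: ctbl_def)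
 have qM: "q<:?M" unfolding M using T st emp_om by metis
 have cl: "g a b<:?M" if h: "a<:un F ?M" "b<:?M" for a b
 proof -
  obtain m where m: "m<:om" "b<:T m" using h(2) unfolding M by blast
  obtain n where n: "n<:om" "a<:F | a<:T n" using h(1) m(1) unfolding un M by blast
  have "EX k. k<:om&m<:k&n<:k"
  proof (cases "m<:n | m = n")
   case True
   then show ?thesis using sc_om[OF n(1)] sc by blast
  next
   case False
   then have "n<:m" using Ord_linear om_Ord_mem m(1) n(1) by blast
   then show ?thesis using sc_om[OF m(1)] sc by blast
  qed
  then obtain k where k: "k<:om" "m<:k" "n<:k" by blast
  have "b<:V k" "a<:un F (V k)" using m n k unfolding un V by blast+
  then have "g a b<:T k" unfolding T st by blast
  then show ?thesis unfolding M using k(1) by blast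
 qed
 moreover have "?M<<=Q" if Q: "q<:Q" "ALL a b. a<:un F Q-->b<:Q-->g a b<:Q" for Q
 proof -
  have dQ: "Dfn (%e. V (e 0)<<=Q)" unfolding V_def by (intro dfn DfnT1[OF dT])
  have stQ: "st X<<=Q" if X: "X<<=Q" for X
  proof (rule subI)
   fix y assume y: "y<:st X"
   have XQ: "x<:Q" if "x<:X" for x using subD[OF X that] .
   from y consider "y = q" | "y<:X" | a b where "a<:un F X" "b<:X" "y = g a b" unfolding st by blast
   then show "y<:Q"
   proof cases
    case 3
    have "a<:un F Q" using 3(1) XQ by auto
    then show ?thesis using Q(2) XQ[OF 3(2)] 3(3) by blast
   qed (use Q(1) XQ in blast)+
  qed
  have "V n<<=Q" if n: "n<:om" for n
  proof (rule om_induct[OF dQ n])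
   show "V emp<<=Q" by (simp add: sub_def V)
   fix n assume ih: "V n<<=Q"
   have "T n<<=Q" unfolding T by (rule stQ[OF ih])
   then show "V (sc n)<<=Q" using ih unfolding sub_def V sc by blast
  qed
  then have "T n<<=Q" if "n<:om" for n unfolding T using stQ that by blast
  then show ?thesis using M subD unfolding sub_def[of ?M] by blast
 qed
 ultimately show ?thesis using qM lM by (intro exI[of _ ?M]) blast
qed

definition cmp :: "U => U => U => U => bool" where "cmp Q R p q<->(EX r. r<:Q&pair r p<:R&pair r q<:R)"

lemma cmp_dfn [dfn]: "DfnT s==>DfnT t==>DfnT u==>DfnT v==>Dfn (%e. cmp (s e) (t e) (u e) (v e))"
 by (rule Dfn4[of cmp], unfold cmp_def, intro dfn)

end

subsection \<open>Martin's axiom for thin orders\<close>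

context lip begin

text \<open>Reduction to \<open>om1\<close>: a suborder \<open>M\<close> of size at most
  \<open>om1\<close> is closed under choosing lower bounds of compatible pairs, which makes it
  inherit thinness, and under meeting the dense sets. A surjection of \<open>om1\<close> onto
  \<open>M\<close> pulls the order back to a preorder.\<close>

theorem MA_thin:
 assumes Q: "q<:Q" and rf: "!!p. p<:Q==>pair p p<:R"
  and tr: "!!p q r. [|p<:Q; q<:Q; r<:Q; pair p q<:R; pair q r<:R|]==>pair p r<:R"
  and th: "thin Q R A B" and F: "lep F om1" "!!D. D<:F==>D<<=Q" "!!D p. D<:F==>p<:Q==>EX r. r<:D&pair r p<:R"
 shows "EX H. H<<=Q&H ~= emp&(ALL a b. a<:H-->b<:H-->(EX e. e<:H&pair e a<:R&pair e b<:R))&(ALL D. D<:F-->(EX p. p<:D&p<:H))"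
proof -
 \<comment> \<open>With \<open>Q\<close> itself among the dense sets the family is non-empty, and so
   is the directed set that meets it.\<close>
 define F' where "F' = ins Q F"
 have F': "D<<=Q" "!!p. p<:Q==>EX r. r<:D&pair r p<:R" if "D<:F'" for D
  using that F(2,3) rf unfolding F'_def ins by auto
 have lF': "lep F' om1"
 proof -
  have "F'<<=un F (ins Q emp)" unfolding F'_def by (auto simp: sub_def)
  moreover have "lep (ins Q emp) om1" using fin_ctbl ctbl_lep_om1 by simp
  ultimately show ?thesis using lep_un[OF F(1)] lep_sub lep_trans by blast
 qed
 \<comment> \<open>Codes for the dense sets; by Foundation they differ from all elements of
   \<open>Q\<close>, so \<open>g\<close> can tell the two kinds of first argument apart.\<close>
 define FF where "FF = img (%D. pair Q D) F'"
 have dFF: "DfnT (%e. pair Q (e 0))" by (intro dfn)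
 have FF: "x<:FF<->(EX D. D<:F'&x = pair Q D)" for x unfolding FF_def img[OF dFF] ..
 have lFF: "lep FF om1" using lep_img[OF dFF] lF' lep_trans unfolding FF_def by blast
 have nFF: "~pair Q D<:Q" for D
 proof
  assume h: "pair Q D<:Q"
  have "Q<:upair Q Q" "upair Q Q<:pair Q D" by (simp_all add: pair_def)
  then show False using h no_cycle3 by blast
 qed
 let ?P = "%x y. EX a b. x = pair a b&y<:Q&(a<:Q-->cmp Q R a b-->pair y a<:R&pair y b<:R) &
   (~a<:Q-->(EX D. D<:F'&a = pair Q D&y<:D&pair y b<:R))"
 have dP: "Dfn (%e. ?P (e 0) (e (Suc 0)))" by (intro dfn)
 have ex: "EX y. ?P x y" if x: "x<:cart (un FF Q) Q" for x
 proof -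
  obtain a b where ab: "a<:un FF Q" "b<:Q" "x = pair a b" using x unfolding cart by blast
  show ?thesis
  proof (cases "a<:Q")
   case True
   then have "EX y. y<:Q&(cmp Q R a b-->pair y a<:R&pair y b<:R)" unfolding cmp_def by blast
   then show ?thesis using ab(3) True by blast
  next
   case False
   then obtain D where D: "D<:F'" "a = pair Q D" using ab(1) FF by auto
   then obtain y where y: "y<:D" "pair y b<:R" using F'(2) ab(2) by blast
   then have "y<:Q" using F'(1)[OF D(1)] subD by blast
   then show ?thesis using ab(3) False D y by blast
  qed
 qed
 have "EX f c. fn f (cart (un FF Q) Q) c&(ALL x. x<:cart (un FF Q) Q-->?P x (app f x))" by (rule choice_fun[OF dP]) (rule ex)
 then obtain f c where f0: "fn f (cart (un FF Q) Q) c&(ALL x. x<:cart (un FF Q) Q-->?P x (app f x))" by (elim exE) (rule that)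
 have f: "?P x (app f x)" if "x<:cart (un FF Q) Q" for x by (rule mp[OF spec[OF conjunct2[OF f0]] that])
 define g where "g a b = app f (pair a b)" for a b
 have g: "g a b<:Q" "a<:Q==>cmp Q R a b==>pair (g a b) a<:R&pair (g a b) b<:R"
  "a = pair Q D==>g a b<:D&pair (g a b) b<:R" if h: "a<:un FF Q" "b<:Q" for a b D
 proof -
  have "pair a b<:cart (un FF Q) Q" using h by simp
  from f[OF this] have p: "g a b<:Q&(a<:Q-->cmp Q R a b-->pair (g a b) a<:R&pair (g a b) b<:R) &
   (~a<:Q-->(EX D. D<:F'&a = pair Q D&g a b<:D&pair (g a b) b<:R))" unfolding g_def by (elim exE conjE) (simp only: pair_inj)
  show "g a b<:Q" using p by blast
  show "a<:Q==>cmp Q R a b==>pair (g a b) a<:R&pair (g a b) b<:R" using p by simp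
  show "a = pair Q D==>g a b<:D&pair (g a b) b<:R" using p nFF[of D] by auto
 qed
 have dg: "DfnT (%e. g (e 0) (e (Suc 0)))" unfolding g_def by (intro dfn)
 obtain M where M: "q<:M" "lep M om1" "!!a b. a<:un FF M==>b<:M==>g a b<:M"
  "!!Q. q<:Q==>(ALL a b. a<:un FF Q-->b<:Q-->g a b<:Q)==>M<<=Q" using hull[OF dg lFF, of q] by blast
 have MQ: "M<<=Q" using M(4)[OF Q] g(1) by blast
 have Mc: "EX e. e<:M&pair e a<:R&pair e b<:R" if "a<:M" "b<:M" "cmp Q R a b" for a b
  using M(3)[of a b] g(2)[of a b] that subD[OF MQ] by auto
 have Md: "EX e. e<:M&e<:D&pair e b<:R" if h: "b<:M" "D<:F'" for b D
 proof -
  have "pair Q D<:FF" using h(2) FF by blast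
  then show ?thesis using M(3)[of "pair Q D" b] g(3)[of "pair Q D" b D] h(1) subD[OF MQ] by auto
 qed
 obtain s where s: "fn s om1 M" "!!x. x<:M==>EX a. a<:om1&app s a = x" using lep_om1_surj[OF M(2,1)] by blast
 have QF': "Q<:F'" by (simp add: F'_def)
 obtain d where d: "fn d om1 F'" "!!x. x<:F'==>EX a. a<:om1&app d a = x" using lep_om1_surj[OF lF' QF'] by blast
 have sM: "app s a<:M" "app s a<:Q" if "a<:om1" for a using fn_app(2)[OF s(1) that] subD[OF MQ] by blast+
 have dS: "Dfn (%e. pair (app s (p1 (e 0))) (app s (p2 (e 0)))<:R)" and dD: "Dfn (%e. app s (p2 (e 0))<:app d (p1 (e 0)))" by (intro dfn)+
 define S where "S = sep (cart om1 om1) (%z. pair (app s (p1 z)) (app s (p2 z))<:R)"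
 define D where "D = sep (cart om1 om1) (%z. app s (p2 z)<:app d (p1 z))"
 have S: "pair a b<:S<->a<:om1&b<:om1&pair (app s a) (app s b)<:R" for a b unfolding S_def sep[OF dS] by simp
 have D: "pair a b<:D<->a<:om1&b<:om1&app s b<:app d a" for a b unfolding D_def sep[OF dD] by simp
 have "thin om1 S A B" unfolding thin_def
 proof (intro allI impI)
  fix X assume X: "X<<=cart om1 (cart A B)" "~ctbl X" "ic2 X"
  let ?f = "%u. pair (app s (p1 u)) (p2 u)"
  have df: "DfnT (%e. ?f (e 0))" by (intro dfn)
  have Xe: "p1 u<:om1" "p2 u<:cart A B" if "u<:X" for u using subD[OF X(1) that] unfolding cart[of _ om1] by auto
  have "lep X (img ?f X)"
  proof (rule lepI[OF df])
   show "?f u<:img ?f X" if "u<:X" for u unfolding img[OF df] using that by blast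
   show "u = w" if "u<:X" "w<:X" "?f u = ?f w" for u w using X(3) that unfolding ic2_def by simp
  qed
  then have "~ctbl (img ?f X)" using X(2) ctbl_lep by blast
  moreover have "img ?f X<<=cart Q (cart A B)" unfolding sub_def img[OF df] using Xe sM by auto
  moreover have "ic2 (img ?f X)" using X(3) unfolding ic2_def img[OF df] by (metis p2)
  ultimately obtain y z e where h: "y<:img ?f X" "z<:img ?f X" "e<:Q" "pair e (p1 y)<:R" "pair e (p1 z)<:R" "gp (p2 y) (p2 z)"
   using th unfolding thin_def by blast
  obtain u w where u: "u<:X" "y = ?f u" "w<:X" "z = ?f w" using h(1,2) unfolding img[OF df] by blast
  have o: "p1 u<:om1" "p1 w<:om1" using Xe u by blast+
  have "cmp Q R (app s (p1 u)) (app s (p1 w))" unfolding cmp_def using h(3-5) u(2,4) by auto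
  then obtain e' where e': "e'<:M" "pair e' (app s (p1 u))<:R" "pair e' (app s (p1 w))<:R" using Mc sM(1)[OF o(1)] sM(1)[OF o(2)] by blast
  obtain a where "a<:om1" "app s a = e'" using s(2)[OF e'(1)] by blast
  then have "a<:om1&pair a (p1 u)<:S&pair a (p1 w)<:S" unfolding S using o e' by simp
  then show "EX y z e. y<:X&z<:X&e<:om1&pair e (p1 y)<:S&pair e (p1 z)<:S&gp (p2 y) (p2 z)"
   using u h(6) by auto
 qed
 moreover have "S<<=cart om1 om1" "D<<=cart om1 om1" unfolding S_def D_def sub_def sep[OF dS] sep[OF dD] by blast+
 moreover have "ALL a. a<:om1-->pair a a<:S" unfolding S using rf sM(2) by blast
 moreover have "ALL a b c. pair a b<:S-->pair b c<:S-->pair a c<:S" unfolding S using tr sM(2) by blast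
 moreover have "ALL x a. x<:om1-->a<:om1-->(EX b. pair b a<:S&pair x b<:D)"
 proof (intro allI impI)
  fix x a assume x: "x<:om1" "a<:om1"
  obtain e where e: "e<:M" "e<:app d x" "pair e (app s a)<:R" using Md[OF sM(1)[OF x(2)] fn_app(2)[OF d(1) x(1)]] by blast
  obtain b where "b<:om1" "app s b = e" using s(2)[OF e(1)] by blast
  then show "EX b. pair b a<:S&pair x b<:D" unfolding S D using x e by auto
 qed
 ultimately obtain H where H: "H<<=om1" "!!a b. a<:H==>b<:H==>EX e. e<:H&pair e a<:S&pair e b<:S" "!!x. x<:om1==>EX b. b<:H&pair x b<:D"
  using MA1[of S D] by blast
 have ds: "DfnT (%e. app s (e 0))" by (intro dfn)
 let ?H = "img (app s) H"
 have iH: "y<:?H<->(EX a. a<:H&y = app s a)" for y by (rule img[OF ds])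
 have "EX p. p<:D'&p<:?H" if h: "D'<:F'" for D'
 proof -
  obtain x where x: "x<:om1" "app d x = D'" using d(2)[OF h] by blast
  obtain b where "b<:H" "pair x b<:D" using H(3)[OF x(1)] by blast
  then show ?thesis unfolding D iH using x(2) by blast
 qed note m = this
 have "?H<<=Q" using H(1) sM(2) unfolding sub_def iH by blast
 moreover have "?H ~= emp" using m[OF QF'] emp by metis
 moreover have "EX e. e<:?H&pair e a<:R&pair e b<:R" if "a<:?H" "b<:?H" for a b
  using that H(2) unfolding iH S by metis
 ultimately show ?thesis using m by (intro exI[of _ ?H]) (auto simp: F'_def)
qed

lemma thinI: assumes h: "!!X. X<<=cart Q (cart A B)==>~ctbl X==>ic2 X==>EX y z. y<:X&z<:X&cmp Q R (p1 y) (p1 z)&gp (p2 y) (p2 z)"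
 shows "thin Q R A B"
 unfolding thin_def using h unfolding cmp_def by blast

text \<open>Dropping the labels is injective on \<open>X\<close>, so the exclusion property of the
  extension applies to what remains.\<close>

lemma AB2: assumes X: "X<<=cart Q (cart A B)" "~ctbl X" "ic2 X" shows "EX y z. y<:X&z<:X&gp (p2 y) (p2 z)"
proof -
 have d: "DfnT (%e. p2 (e 0))" by (intro dfn)
 have "lep X (img p2 X)"
 proof (rule lepI[OF d])
  show "p2 u<:img p2 X" if "u<:X" for u unfolding img[OF d] using that by blast
  show "u = w" if "u<:X" "w<:X" "p2 u = p2 w" for u w using X(3) that unfolding ic2_def by simp
 qed
 then have "~ctbl (img p2 X)" using X(2) ctbl_lep by blast
 moreover have "img p2 X<<=cart A B" unfolding sub_def img[OF d] using X(1) unfolding sub_def cart[of _ Q] by auto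
 moreover have "ic (img p2 X)" using X(3) unfolding ic_def ic2_def img[OF d] by metis
 ultimately obtain y z where "y<:img p2 X" "z<:img p2 X" "gp y z" using AB by blast
 then show ?thesis unfolding img[OF d] by blast
qed

lemma ic2_sub: "ic2 X==>Y<<=X==>ic2 Y"
 unfolding ic2_def sub_def by blast

text \<open>The labels are constant on an uncountable set or injective on one. In both cases
  uncountably many points have pairwise compatible labels, and among them two are related.\<close>

theorem knaster_thin:
 assumes rf: "!!p. p<:Q==>pair p p<:R"
  and kn: "!!W. W<<=Q==>~ctbl W==>EX Z. Z<<=W&~ctbl Z&(ALL p q. p<:Z-->q<:Z-->cmp Q R p q)"
 shows "thin Q R A B"
proof (rule thinI)
 fix X assume X: "X<<=cart Q (cart A B)" "~ctbl X" "ic2 X"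
 have d: "DfnT (%e. p1 (e 0))" by (intro dfn)
 have XQ: "p1 y<:Q" if "y<:X" for y using subD[OF X(1) that] unfolding cart[of _ Q] by auto
 have "EX Y. Y<<=X&~ctbl Y&(ALL y z. y<:Y-->z<:Y-->cmp Q R (p1 y) (p1 z))"
 proof (cases "EX q. ~ctbl (sep X (%y. p1 y = q))")
  case True
  then obtain q where q: "~ctbl (sep X (%y. p1 y = q))" by blast
  have dq: "Dfn (%e. p1 (e 0) = q)" by (intro dfn)
  have e: "y<:sep X (%y. p1 y = q)<->y<:X&p1 y = q" for y by (rule sep[OF dq])
  show ?thesis
  proof (rule exI[of _ "sep X (%y. p1 y = q)"], intro conjI q allI impI)
   show "sep X (%y. p1 y = q)<<=X" unfolding sub_def e by blast
   fix y z assume "y<:sep X (%y. p1 y = q)" "z<:sep X (%y. p1 y = q)"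
   then have "y<:X" "p1 y = q" "p1 z = q" unfolding e by blast+
   then show "cmp Q R (p1 y) (p1 z)" unfolding cmp_def using rf XQ by auto
  qed
 next
  case False
  then have "ctbl (sep X (%y. p1 y = q))" for q by blast
  from unc_injective[OF d X(2) this] obtain X1 where X1: "X1<<=X" "~ctbl X1" "!!x y. x<:X1==>y<:X1==>p1 x = p1 y==>x = y" by blast
  have i: "y<:img p1 X1<->(EX x. x<:X1&y = p1 x)" for y by (rule img[OF d])
  have "lep X1 (img p1 X1)" by (rule lepI[OF d]) (use X1(3) i in blast)+
  then have "~ctbl (img p1 X1)" using X1(2) ctbl_lep by blast
  moreover have "img p1 X1<<=Q" unfolding sub_def i using XQ subD[OF X1(1)] by blast
  ultimately obtain Z where Z: "Z<<=img p1 X1" "~ctbl Z" "!!p q. p<:Z==>q<:Z==>cmp Q R p q" using kn by blast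
  have dZ: "Dfn (%e. p1 (e 0)<:Z)" by (intro dfn)
  let ?Y = "sep X1 (%y. p1 y<:Z)"
  have Y: "y<:?Y<->y<:X1&p1 y<:Z" for y by (rule sep[OF dZ])
  have "lep Z ?Y"
  proof (rule lep_surj[OF d])
   fix y assume y: "y<:Z"
   then obtain x where "x<:X1" "y = p1 x" using subD[OF Z(1) y] unfolding i by blast
   then show "EX x. x<:?Y&y = p1 x" unfolding Y using y by blast
  qed
  then have "~ctbl ?Y" using Z(2) ctbl_lep by blast
  moreover have "?Y<<=X" unfolding sub_def Y using subD[OF X1(1)] by blast
  ultimately show ?thesis using Y Z(3) by blast
 qed
 then obtain Y where Y: "Y<<=X" "~ctbl Y" "!!y z. y<:Y==>z<:Y==>cmp Q R (p1 y) (p1 z)" by blast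
 obtain y z where "y<:Y" "z<:Y" "gp (p2 y) (p2 z)" using AB2[OF sub_trans[OF Y(1) X(1)] Y(2) ic2_sub[OF X(3) Y(1)]] by blast
 then show "EX y z. y<:X&z<:X&cmp Q R (p1 y) (p1 z)&gp (p2 y) (p2 z)" using Y subD by blast
qed

subsection \<open>Specializing Aronszajn trees\<close>

text \<open>There are only countably many basic neighbourhoods, so only countably many points of
  \<open>X\<close> have a countable one. For a related pair among the others the relation rests on
  the first \<open>m\<close> values, hence holds between all points of two uncountable
  neighbourhoods.\<close>

lemma gp_rect: assumes X: "X<<=cart Q (cart A B)" "~ctbl X" "ic2 X"
 shows "EX V W. V<<=X&W<<=X&~ctbl V&~ctbl W&(ALL y z. y<:V-->z<:W-->gp (p2 y) (p2 z))"
proof -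
 let ?a = "%y. p1 (p2 y)" and ?b = "%y. p2 (p2 y)"
 let ?N = "%y n. sep X (%z. ALL k. k<:n-->app (?a z) k = app (?a y) k&app (?b z) k = app (?b y) k)"
 have dN: "Dfn (%e. ALL k. k<:n-->app (?a (e 0)) k = app (?a y) k&app (?b (e 0)) k = app (?b y) k)" for y n by (intro dfn)
 have N: "z<:?N y n<->z<:X&(ALL k. k<:n-->app (?a z) k = app (?a y) k&app (?b z) k = app (?b y) k)" for z y n by (rule sep[OF dN])
 let ?P = "%y n. n<:om&ctbl (?N y n)"
 have dP: "Dfn (%e. ?P (e 0) (e (Suc 0)))" and dP': "Dfn (%e. EX n. ?P (e 0) n)" by (intro dfn)+
 define Bd where "Bd = sep X (%y. EX n. ?P y n)"
 have Bd: "y<:Bd<->y<:X&(EX n. ?P y n)" for y unfolding Bd_def by (rule sep[OF dP'])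
 have ab: "fn (?a y) om two" "fn (?b y) om two" if "y<:X" for y
 proof -
  have "?a y<:A" "?b y<:B" using subD[OF X(1) that] unfolding cart by auto
  then show "fn (?a y) om two" "fn (?b y) om two" using A(1) B(1) subD Fnc by blast+
 qed
 have "ctbl Bd"
 proof (rule ccontr)
  assume u: "~ctbl Bd"
  have "EX n. ?P y n" if "y<:Bd" for y using that unfolding Bd by blast
  from choice_fun[OF dP this] obtain h c where h: "!!y. y<:Bd==>app h y<:om&ctbl (?N y (app h y))" by blast
  let ?F = "%y. pair (app h y) (pair (rs (?a y) (app h y)) (rs (?b y) (app h y)))"
  have dF: "DfnT (%e. ?F (e 0))" by (intro dfn)
  have om: "n<<=om" if "n<:om" for n using om_trans[OF that] by (simp add: sub_def)
  have F: "?F y<:cart om (cart Sq Sq)" if y: "y<:Bd" for y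
  proof -
   have yX: "y<:X" using y unfolding Bd by blast
   have n: "app h y<:om" using h[OF y] by blast
   have "rs (?a y) (app h y)<:Sq" "rs (?b y) (app h y)<:Sq"
    using rs_fn(1)[OF ab(1)[OF yX] om[OF n]] rs_fn(1)[OF ab(2)[OF yX] om[OF n]] n Sq by blast+
   then show ?thesis using n by simp
  qed
  have "ctbl om" by (simp add: ctbl_def)
  then have "ctbl (cart om (cart Sq Sq))" using ctbl_cart ctbl_Sq by blast
  from unc_fiber[OF dF u this F] obtain v where v: "~ctbl (sep Bd (%y. ?F y = v))" by blast
  have dv: "Dfn (%e. ?F (e 0) = v)" by (intro dfn)
  have S: "y<:sep Bd (%y. ?F y = v)<->y<:Bd&?F y = v" for y by (rule sep[OF dv])
  obtain y where y: "y<:Bd" "?F y = v" using two_elements[OF v] unfolding S by blast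
  have yX: "y<:X" using y unfolding Bd by blast
  have n: "app h y<:om" using h[OF y(1)] by blast
  have "sep Bd (%y. ?F y = v)<<=?N y (app h y)"
  proof (rule subI)
   fix z assume "z<:sep Bd (%y. ?F y = v)"
   then have z: "z<:Bd" "?F z = ?F y" unfolding S using y(2) by simp_all
   then have zX: "z<:X" unfolding Bd by blast
   have e1: "app h z = app h y" using z(2) by simp
   have e: "rs (?a z) (app h y) = rs (?a y) (app h y)" "rs (?b z) (app h y) = rs (?b y) (app h y)" using z(2) unfolding e1 pair_inj by blast+
   have "app (?a z) k = app (?a y) k&app (?b z) k = app (?b y) k" if k: "k<:app h y" for k
    using rs_fn(2)[OF ab(1)[OF zX] om[OF n] k] rs_fn(2)[OF ab(2)[OF zX] om[OF n] k]
     rs_fn(2)[OF ab(1)[OF yX] om[OF n] k] rs_fn(2)[OF ab(2)[OF yX] om[OF n] k] e by simp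
   then show "z<:?N y (app h y)" unfolding N using zX by blast
  qed
  then show False using v h[OF y(1)] ctbl_sub by blast
 qed
 have "X<<=un (df X Bd) Bd" by (auto simp: sub_def)
 then have u: "~ctbl (df X Bd)" using \<open>ctbl Bd\<close> ctbl_un ctbl_sub X(2) by blast
 have s: "df X Bd<<=X" by (simp add: sub_def)
 obtain y z where y: "y<:df X Bd" "z<:df X Bd" "gp (p2 y) (p2 z)" using AB2[OF sub_trans[OF s X(1)] u ic2_sub[OF X(3) s]] by blast
 then obtain m k where m: "m<:om" "!!k. k<:m==>app (?a y) k = app (?a z) k" "k<:m" "app (?b y) k ~= app (?b z) k" unfolding gp_def by blast
 have "~ctbl (?N y m)" "~ctbl (?N z m)" using y(1,2) m(1) unfolding df Bd by blast+
 moreover have "gp (p2 y') (p2 z')" if h: "y'<:?N y m" "z'<:?N z m" for y' z'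
  unfolding gp_def
 proof (rule exI[of _ m], intro conjI m(1) allI impI)
  show "app (?a y') x = app (?a z') x" if "x<:m" for x using h m(2) that unfolding N by simp
  show "EX k. k<:m&app (?b y') k ~= app (?b z') k" using h m(3,4) unfolding N by (intro exI[of _ k]) simp
 qed
 moreover have "?N y m<<=X" "?N z m<<=X" unfolding sub_def N by blast+
 ultimately show ?thesis by blast
qed

end

section \<open>Uniform ultrafilters and incomparable finite sets in a tree\<close>

context zfc begin

lemma fin_sub_chain: assumes F: "fin F" "F<<=Uni C" and C: "C ~= emp" "!!X Y. X<:C==>Y<:C==>X<<=Y | Y<<=X"
 shows "EX X. X<:C&F<<=X"
proof -
 let ?P = "%F. F<<=Uni C-->(EX X. X<:C&F<<=X)"
 have d: "Dfn (%e. ?P (e 0))" by (intro dfn)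
 have "?P F"
 proof (rule fin_induct[where P="?P", OF d F(1)])
  show "?P emp" using ex_mem[OF C(1)] by auto
  fix a x assume ih: "?P a"
  show "?P (ins x a)"
  proof
   assume h: "ins x a<<=Uni C"
   then have "a<<=Uni C" by (auto simp: sub_def)
   then obtain X where X: "X<:C" "a<<=X" using ih by blast
   obtain Y where Y: "Y<:C" "x<:Y" using h unfolding sub_def ins Uni by blast
   show "EX X. X<:C&ins x a<<=X"
    using C(2)[OF X(1) Y(1)] X Y by (auto simp: sub_def)
  qed
 qed
 then show ?thesis using F(2) by blast
qed

text \<open>A uniform ultrafilter on \<open>V\<close>, presented by what is needed of it.\<close>

lemma ultra: assumes V: "~ctbl V"
 shows "EX u. (ALL X Y. X<:u-->Y<:u-->~ctbl (it X Y)) &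
  (ALL C. fin C-->(ALL X. X<:C-->X<<=V)-->ctbl (sep V (%z. ~z<:Uni C))-->(EX X. X<:C&X<:u))"
proof -
 let ?I = "%F. sep V (%z. ALL X. X<:F-->z<:X)"
 have dI: "Dfn (%e. ALL X. X<:F-->e 0<:X)" for F by (intro dfn)
 have I: "z<:?I F<->z<:V&(ALL X. X<:F-->z<:X)" for z F by (rule sep[OF dI])
 \<comment> \<open>All finite intersections, taken within \<open>V\<close>, are uncountable;
   \<open>u\<close> will be maximal with this property.\<close>
 let ?P = "%u. ALL F. fin F-->F<<=u-->~ctbl (?I F)"
 have dP: "Dfn (%e. ?P (e 0))" by (intro dfn)
 have "EX u. u<<=pw V&?P u&(ALL a. a<:pw V-->~a<:u-->~?P (ins a u))"
 proof (rule tukey[where P="?P", OF dP])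
  show "?P emp"
  proof (intro allI impI)
   fix F assume "F<<=emp"
   then have "z<:?I F<->z<:V" for z unfolding I by (auto simp: sub_def)
   then have "?I F = V" by (rule seteq)
   then show "~ctbl (?I F)" using V by simp
  qed
  show "?P X" if "?P Y" "X<<=Y" for X Y using that sub_trans by blast
  show "?P (Uni C)" if C: "C ~= emp" "!!X. X<:C==>?P X" "!!X Y. X<:C==>Y<:C==>X<<=Y | Y<<=X" for C
  proof (intro allI impI)
   fix F assume F: "fin F" "F<<=Uni C"
   obtain X where X: "X<:C" "F<<=X" using fin_sub_chain[OF F C(1,3)] by blast
   show "~ctbl (?I F)" using C(2)[OF X(1)] F(1) X(2) by blast
  qed
 qed
 then obtain u where u: "u<<=pw V" "?P u" "!!a. a<<=V==>~a<:u==>~?P (ins a u)" unfolding pw by blast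
 have "~ctbl (it X Y)" if XY: "X<:u" "Y<:u" for X Y
 proof -
  have "upair X Y = ins X (ins Y emp)" by (rule seteq) auto
  then have "fin (upair X Y)" by simp
  moreover have "upair X Y<<=u" using XY by (auto simp: sub_def)
  ultimately have "~ctbl (?I (upair X Y))" using u(2) by blast
  moreover have "?I (upair X Y)<<=it X Y" unfolding sub_def I by auto
  ultimately show ?thesis using ctbl_sub by blast
 qed
 moreover have "EX X. X<:C&X<:u" if C: "fin C" "!!X. X<:C==>X<<=V" "ctbl (sep V (%z. ~z<:Uni C))" for C
 proof (rule ccontr)
  assume n: "~?thesis"
  \<comment> \<open>If no member of the cover \<open>C\<close> were in \<open>u\<close>, each would
    be excluded by a finite part of \<open>u\<close>; the union of these finitely many parts would
    then have a countable intersection.\<close>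
  let ?Q = "%X F. fin F&F<<=u&ctbl (it X (?I F))"
  have dQ: "Dfn (%e. ?Q (e 0) (e (Suc 0)))" by (intro dfn)
  have "EX F. ?Q X F" if X: "X<:C" for X
  proof -
   have "~?P (ins X u)" using u(3)[OF C(2)[OF X]] n X by blast
   then obtain F where F: "fin F" "F<<=ins X u" "ctbl (?I F)" by blast
   let ?F = "it F u"
   have "fin ?F" by (rule fin_sub[OF F(1)]) (simp add: sub_def)
   moreover have "?F<<=u" by (simp add: sub_def)
   moreover have "it X (?I ?F)<<=?I F"
   proof (rule subI)
    fix z assume "z<:it X (?I ?F)"
    then have z: "z<:X" "z<:?I ?F" unfolding it by blast+
    have "z<:Y" if "Y<:F" for Y using iffD1[OF I z(2)] z(1) subD[OF F(2) that] that by auto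
    then show "z<:?I F" using iffD1[OF I z(2)] by (intro iffD2[OF I]) blast
   qed
   ultimately show ?thesis using F(3) ctbl_sub by blast
  qed
  from choice_fun[OF dQ this] obtain f c where f: "!!X. X<:C==>?Q X (app f X)" by blast
  have df: "DfnT (%e. app f (e 0))" by (intro dfn)
  let ?F = "Uni (img (app f) C)"
  have Fe: "Y<:?F<->(EX X. X<:C&Y<:app f X)" for Y unfolding Uni img[OF df] by blast
  have "fin ?F"
  proof (rule fin_Uni[OF fin_img[OF df C(1)]])
   fix x assume "x<:img (app f) C"
   then show "fin x" using f unfolding img[OF df] by blast
  qed
  moreover have "?F<<=u" unfolding sub_def Fe using f subD by blast
  ultimately have "~ctbl (?I ?F)" using u(2) by blast
  moreover have "?I ?F<<=un (sep V (%z. ~z<:Uni C)) (Uni (img (%X. it X (?I (app f X))) C))"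
  proof (rule subI)
   have dU: "Dfn (%e. ~e 0<:Uni C)" by (intro dfn)
   have dJ: "DfnT (%e. it (e 0) (?I (app f (e 0))))" by (intro dfn)
   fix z assume z: "z<:?I ?F"
   then have zV: "z<:V" and zF: "!!X Y. X<:C==>Y<:app f X==>z<:Y" using iffD1[OF I z] Fe by blast+
   show "z<:un (sep V (%z. ~z<:Uni C)) (Uni (img (%X. it X (?I (app f X))) C))"
   proof (cases "z<:Uni C")
    case True
    then obtain X where X: "X<:C" "z<:X" unfolding Uni by blast
    have "z<:?I (app f X)" by (rule iffD2[OF I]) (use zV zF[OF X(1)] in blast)
    then have "z<:it X (?I (app f X))" using X(2) by (simp only: it)
    then show ?thesis unfolding un Uni img[OF dJ] using X(1) by blast
   next
    case False
    then show ?thesis unfolding un sep[OF dU] using zV by blast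
   qed
  qed
  moreover have "ctbl (Uni (img (%X. it X (?I (app f X))) C))"
  proof (rule ctbl_Uni[OF _ fin_ctbl[OF C(1)]])
   show "DfnT (%e. it (e 0) (?I (app f (e 0))))" by (intro dfn)
   show "ctbl (it X (?I (app f X)))" if "X<:C" for X using f[OF that] by blast
  qed
  ultimately show False using ctbl_un[OF C(3)] ctbl_sub by blast
 qed
 ultimately show ?thesis by (intro exI[of _ u]) blast
qed

text \<open>Baumgartner's argument that the specializing order has no uncountable antichain, with two
 families instead of one: otherwise the ultrafilter yields an uncountable chain.\<close>

lemma tree_pair:
 assumes dD: "DfnT (%e. D (e 0))" and V: "~ctbl V" and W: "~ctbl W"
  and fV: "!!y. y<:V==>fin (D y)&D y<<=T" and fW: "!!y. y<:W==>fin (D y)&D y<<=T"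
  and dV: "!!y z s. y<:V==>z<:V==>s<:D y==>s<:D z==>y = z"
  and dW: "!!y z s. y<:W==>z<:W==>s<:D y==>s<:D z==>y = z"
  and lin: "!!r s t. [|r<:T; s<:T; t<:T; pair r t<:R; pair s t<:R|]==>pair r s<:R | r = s | pair s r<:R"
  and ch: "!!C. C<<=T==>(ALL s t. s<:C-->t<:C-->pair s t<:R | s = t | pair t s<:R)==>ctbl C"
 shows "EX y z. y<:V&z<:W&(ALL s t. s<:D y-->t<:D z-->~pair s t<:R&~pair t s<:R)"
proof (rule ccontr)
 assume no: "~?thesis"
 note dDs = DfnT1[OF dD]
 let ?P = "%z u. EX n f. u = pair n f&n<:om&fn f (D z) n&inj f (D z)"
 have dP: "Dfn (%e. ?P (e 0) (e (Suc 0)))" by (intro dfn dDs)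
 have ex: "EX u. ?P z u" if z: "z<:W" for z
 proof -
  obtain n f where "n<:om" "fn f (D z) n" "inj f (D z)" using fW[OF z] unfolding fin_def lep_def by blast
  then show ?thesis by blast
 qed
 from choice_fun[OF dP ex] obtain E c where E: "!!z. z<:W==>?P z (app E z)" by blast
 have d1: "DfnT (%e. p1 (app E (e 0)))" by (intro dfn)
 have "p1 (app E z)<:om" if "z<:W" for z using E[OF that] by auto
 from unc_fiber[OF d1 W _ this] obtain n where n: "n<:om" "~ctbl (sep W (%z. p1 (app E z) = n))" by (auto simp: ctbl_def)
 have dn: "Dfn (%e. p1 (app E (e 0)) = n)" by (intro dfn)
 \<comment> \<open>Uncountably many finite sets share one bound \<open>n\<close>, and
   \<open>e z\<close> numbers the nodes of \<open>D z\<close> by numbers below it, so nodes of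
   different sets can be matched by their numbers.\<close>
 define Z where "Z = sep W (%z. p1 (app E z) = n)"
 have Z: "z<:Z<->z<:W&p1 (app E z) = n" for z unfolding Z_def by (rule sep[OF dn])
 have uZ: "~ctbl Z" using n(2) unfolding Z_def .
 define e where "e z = p2 (app E z)" for z
 have de: "DfnT s==>DfnT (%x. e (s x))" for s by (rule DfnT1[of e], unfold e_def, intro dfn)
 have e: "fn (e z) (D z) n" "inj (e z) (D z)" if "z<:Z" for z using E[of z] that unfolding Z e_def by auto
 obtain u where u: "!!X Y. X<:u==>Y<:u==>~ctbl (it X Y)"
  "!!C. fin C==>(!!X. X<:C==>X<<=Z)==>ctbl (sep Z (%z. ~z<:Uni C))==>EX X. X<:C&X<:u" using ultra[OF uZ] by metis
 let ?N = "%x. sep Z (%z. EX t. t<:D z&app (e z) t = p2 x&pair (p1 x) t<:R)"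
 have dN0: "Dfn (%v. EX t. t<:D (v 0)&app (e (v 0)) t = p2 x&pair (p1 x) t<:R)" for x by (intro dfn dDs de)
 have N: "z<:?N x<->z<:Z&(EX t. t<:D z&app (e z) t = p2 x&pair (p1 x) t<:R)" for z x by (rule sep[OF dN0])
 have dN: "DfnT (%v. ?N (v 0))" by (intro dfn dDs de)
 \<comment> \<open>Nodes below \<open>D y\<close> are countably many and, by disjointness, occur in
   only countably many \<open>z\<close>. All other \<open>z\<close> have a node above a node of
   \<open>D y\<close>, so the finitely many sets \<open>?N x\<close>, one for each node of
   \<open>D y\<close> and each number below \<open>n\<close>, cover almost all of \<open>Z\<close>,
   and one of them is in the ultrafilter.\<close>
 have pick: "EX x. x<:cart (D y) n&?N x<:u" if y: "y<:V" for y
 proof -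
  let ?C = "img ?N (cart (D y) n)"
  have C: "X<:?C<->(EX x. x<:cart (D y) n&X = ?N x)" for X by (rule img[OF dN])
  have fC: "fin ?C" using fin_img[OF dN fin_cart] fV[OF y] fin_om[OF n(1)] by blast
  have sC: "X<<=Z" if "X<:?C" for X using that N unfolding C sub_def by blast
  have dU: "Dfn (%v. ~v 0<:Uni ?C)" by (intro dfn)
  let ?L = "sep Z (%z. ~z<:Uni ?C)"
  have L: "z<:?L<->z<:Z&~z<:Uni ?C" for z by (rule sep[OF dU])
  let ?Pr = "%s. sep T (%t. pair t s<:R)"
  have dPr0: "Dfn (%v. pair (v 0) s<:R)" for s by (intro dfn)
  have Pr: "t<:?Pr s<->t<:T&pair t s<:R" for t s by (rule sep[OF dPr0])
  have dPr: "DfnT (%v. ?Pr (v 0))" by (intro dfn)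
  let ?B = "Uni (img ?Pr (D y))"
  have B: "t<:?B<->(EX s. s<:D y&t<:T&pair t s<:R)" for t unfolding Uni img[OF dPr] using Pr by blast
  have DyT: "s<:T" if "s<:D y" for s using fV[OF y] that subD by blast
  have "ctbl (?Pr s)" if "s<:D y" for s by (rule ch) (use Pr lin DyT[OF that] in \<open>unfold sub_def, blast+\<close>)
  then have cB: "ctbl ?B" using ctbl_Uni[OF dPr fin_ctbl] fV[OF y] by blast
  let ?Q = "%z t. t<:D z&t<:?B"
  have dQ: "Dfn (%v. ?Q (v 0) (v (Suc 0)))" by (intro dfn dDs)
  have exL: "EX t. ?Q z t" if z: "z<:?L" for z
  proof -
   have zZ: "z<:Z" and zU: "~z<:Uni ?C" using z unfolding L by blast+
   then have zW: "z<:W" unfolding Z by blast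
   obtain s t where st: "s<:D y" "t<:D z" "pair s t<:R | pair t s<:R" using no y zW by blast
   have "~pair s t<:R"
   proof
    assume h: "pair s t<:R"
    have "pair s (app (e z) t)<:cart (D y) n" using st fn_app(2)[OF e(1)[OF zZ] st(2)] by simp
    moreover have "z<:?N (pair s (app (e z) t))" by (rule iffD2[OF N]) (use zZ st(2) h in auto)
    ultimately show False using zU C unfolding Uni by blast
   qed
   then have "t<:?B" unfolding B using st fW[OF zW] subD by blast
   then show ?thesis using st(2) by blast
  qed
  have "EX h c. fn h ?L c&(ALL z. z<:?L-->?Q z (app h z))" by (rule choice_fun[OF dQ exL])
  then obtain h c where h: "!!z. z<:?L==>?Q z (app h z)" by blast
  have dh: "DfnT (%v. app h (v 0))" by (intro dfn)
  have "lep ?L ?B"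
  proof (rule lepI[OF dh])
   show "app h z<:?B" if "z<:?L" for z using h[OF that] by blast
   fix z z' assume z: "z<:?L" "z'<:?L" "app h z = app h z'"
   have "z<:W" "z'<:W" using z unfolding L Z by blast+
   then show "z = z'" using dW h[OF z(1)] h[OF z(2)] z(3) by metis
  qed
  then have "ctbl ?L" using cB ctbl_lep by blast
  from u(2)[OF fC sC this] show ?thesis unfolding C by blast
 qed
 have dS: "Dfn (%v. v (Suc 0)<:cart (D (v 0)) n&?N (v (Suc 0))<:u)"
  by (intro dfn dDs de)
 from choice_fun[OF dS pick] obtain g c where g: "!!y. y<:V==>app g y<:cart (D y) n&?N (app g y)<:u" by blast
 have gg: "p1 (app g y)<:D y" "p2 (app g y)<:n" if "y<:V" for y using g[OF that] by (auto simp: cart)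
 have dg2: "DfnT (%v. p2 (app g (v 0)))" and dg1: "DfnT (%v. p1 (app g (v 0)))" by (intro dfn)+
 from unc_fiber[OF dg2 V fin_ctbl[OF fin_om[OF n(1)]] gg(2)] obtain i where i: "~ctbl (sep V (%y. p2 (app g y) = i))" by blast
 have di: "Dfn (%v. p2 (app g (v 0)) = i)" by (intro dfn)
 define Y where "Y = sep V (%y. p2 (app g y) = i)"
 have Y: "y<:Y<->y<:V&p2 (app g y) = i" for y unfolding Y_def by (rule sep[OF di])
 let ?C = "img (%y. p1 (app g y)) Y"
 have C: "s<:?C<->(EX y. y<:Y&s = p1 (app g y))" for s by (rule img[OF dg1])
 have "lep Y ?C"
 proof (rule lepI[OF dg1])
  show "p1 (app g y)<:?C" if "y<:Y" for y unfolding C using that by blast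
  show "y = y'" if "y<:Y" "y'<:Y" "p1 (app g y) = p1 (app g y')" for y y'
  proof -
   have "y<:V" "y'<:V" using that(1,2) unfolding Y by blast+
   then show ?thesis using dV gg(1) that(3) by metis
  qed
 qed
 moreover have "ctbl ?C"
 proof (rule ch)
  have CT: "s<:T" if "s<:?C" for s
  proof -
   obtain y where "y<:V" "s = p1 (app g y)" using \<open>s<:?C\<close> unfolding C Y by blast
   then show ?thesis using gg(1) fV subD by blast
  qed
  then show "?C<<=T" by (rule subI)
  show "ALL s t. s<:?C-->t<:?C-->pair s t<:R | s = t | pair t s<:R"
  proof (intro allI impI)
   fix s t assume s: "s<:?C" "t<:?C"
   obtain y y' where y: "y<:V" "p2 (app g y) = i" "s = p1 (app g y)" "y'<:V" "p2 (app g y') = i" "t = p1 (app g y')"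
    using s unfolding C Y by blast
   \<comment> \<open>Two sets of the ultrafilter share some \<open>z\<close>. Its node with number
     \<open>i\<close> lies above both \<open>s\<close> and \<open>t\<close>, so these are
     comparable.\<close>
   have "~ctbl (it (?N (app g y)) (?N (app g y')))" using u(1) g y(1,4) by blast
   then obtain z where z: "z<:?N (app g y)" "z<:?N (app g y')" using two_elements it by blast
   obtain a b where ab: "z<:Z" "a<:D z" "app (e z) a = i" "pair s a<:R" "b<:D z" "app (e z) b = i" "pair t b<:R"
    using iffD1[OF N z(1)] iffD1[OF N z(2)] unfolding y(2,5) y(3)[symmetric] y(6)[symmetric] by blast
   have "a = b" using e(2)[OF ab(1)] ab unfolding inj_def by blast
   moreover have "a<:T" using ab(1,2) fW subD unfolding Z by blast
   ultimately show "pair s t<:R | s = t | pair t s<:R" using lin[OF CT[OF s(1)] CT[OF s(2)]] ab by blast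
  qed
 qed
 ultimately show False using ctbl_lep i unfolding Y_def by blast
qed

end

text \<open>The order consists of finite partial specializing functions. For thinness, a
  Delta-system with equal values on the root is taken; \<open>gp_rect\<close> gives two uncountable
  sides with every cross pair related, and \<open>tree_pair\<close> finds one cross pair whose nodes
  off the root are incomparable, so that the union of its labels is again a condition.\<close>

theorem (in lip) special:
 assumes lT: "lep T om1"
  and lin: "!!r s t. [|r<:T; s<:T; t<:T; pair r t<:R; pair s t<:R|]==>pair r s<:R | r = s | pair s r<:R"
  and ch: "!!C. C<<=T==>(ALL s t. s<:C-->t<:C-->pair s t<:R | s = t | pair t s<:R)==>ctbl C"
  and irr: "!!t. t<:T==>~pair t t<:R"
 shows "EX f. fn f T om&(ALL s t. s<:T-->t<:T-->pair s t<:R-->app f s ~= app f t)"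
proof -
 define ok where "ok p<->fin (dm p)&fn p (dm p) om&dm p<<=T&(ALL s t. s<:dm p-->t<:dm p-->pair s t<:R-->app p s ~= app p t)" for p
 have dok: "Dfn (%e. ok (e 0))" unfolding ok_def by (intro dfn)
 define Q where "Q = sep (pw (cart T om)) ok"
 have Q: "p<:Q<->ok p" for p
 proof -
  have "p<<=cart T om" if h: "ok p"
  proof (rule subI)
   have f: "fn p (dm p) om" and d: "dm p<<=T" using h unfolding ok_def by blast+
   fix u assume "u<:p"
   then obtain x where "x<:dm p" "u = pair x (app p x)" using fn_mem[OF f] by blast
   then show "u<:cart T om" using fn_app(2)[OF f] subD[OF d] by simp
  qed
  then show ?thesis unfolding Q_def sep[OF dok] by auto
 qed
 have okf: "fin (dm p)" "fn p (dm p) om" "dm p<<=T" "s<:dm p==>t<:dm p==>pair s t<:R==>app p s ~= app p t"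
  if "p<:Q" for p s t using that unfolding Q ok_def by blast+
 have dL: "Dfn (%e. p2 (e 0)<<=p1 (e 0))" by (intro dfn)
 define L where "L = sep (cart Q Q) (%z. p2 z<<=p1 z)"
 have L: "pair q p<:L<->q<:Q&p<:Q&p<<=q" for q p unfolding L_def sep[OF dL] by simp
 have okI: "p<:Q" if "fin a" "fn p a om" "a<<=T" "!!s t. s<:a==>t<:a==>pair s t<:R==>app p s ~= app p t" for p a
  using that unfolding Q ok_def fn_dm[OF that(2)] by blast
 have empQ: "emp<:Q" by (rule okI[of emp]) (auto simp: fn_def)
 have ext: "p<<=q" if h: "fn p a om" "fn q b om" "a<<=b" "!!x. x<:a==>app q x = app p x" for p q a b
 proof (rule subI)
  fix u assume "u<:p"
  then obtain x where x: "x<:a" "u = pair x (app p x)" using fn_mem[OF h(1)] by blast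
  then show "u<:q" using fn_app(1)[OF h(2) subD[OF h(3) x(1)]] h(4)[OF x(1)] by simp
 qed
 have "thin Q L A B"
 proof (rule thinI)
  fix X assume X: "X<<=cart Q (cart A B)" "~ctbl X" "ic2 X"
  have XQ: "p1 y<:Q" if "y<:X" for y using subD[OF X(1) that] unfolding cart[of _ Q] by auto
  have dd: "DfnT (%e. dm (p1 (e 0)))" by (intro dfn)
  have fd: "fin (dm (p1 y))" if "y<:X" for y using okf(1)[OF XQ[OF that]] .
  from delta_system[OF dd X(2) fd] obtain X1 r where X1: "X1<<=X" "~ctbl X1" "fin r"
   "!!y z. y<:X1==>z<:X1==>y ~= z==>it (dm (p1 y)) (dm (p1 z)) = r" by blast
  have rr: "r<<=dm (p1 y)" if y: "y<:X1" for y
  proof -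
   obtain a b where ab: "a<:X1" "b<:X1" "a ~= b" using two_elements[OF X1(2)] by blast
   then obtain z where "z<:X1" "z ~= y" by metis
   then have "it (dm (p1 y)) (dm (p1 z)) = r" using X1(4)[OF y] by blast
   then show ?thesis unfolding sub_def using it by blast
  qed
  have dF: "DfnT (%e. rs (p1 (e 0)) r)" by (intro dfn)
  have "rs (p1 y) r<:Fnc r om" if y: "y<:X1" for y
   unfolding Fnc by (rule rs_fn(1)[OF okf(2)[OF XQ[OF subD[OF X1(1) y]]] rr[OF y]])
  moreover have "ctbl (Fnc r om)" using ctbl_Fnc[OF X1(3)] by (simp add: ctbl_def)
  ultimately obtain v where v: "~ctbl (sep X1 (%y. rs (p1 y) r = v))" using unc_fiber[OF dF X1(2)] by blast
  have dv: "Dfn (%e. rs (p1 (e 0)) r = v)" by (intro dfn)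
  define X2 where "X2 = sep X1 (%y. rs (p1 y) r = v)"
  have X2: "y<:X2<->y<:X1&rs (p1 y) r = v" for y unfolding X2_def by (rule sep[OF dv])
  have X2X: "X2<<=X" unfolding sub_def X2 using subD[OF X1(1)] by blast
  have uX2: "~ctbl X2" using v unfolding X2_def .
  obtain V W where VW: "V<<=X2" "W<<=X2" "~ctbl V" "~ctbl W" "!!y z. y<:V==>z<:W==>gp (p2 y) (p2 z)"
   using gp_rect[OF sub_trans[OF X2X X(1)] uX2 ic2_sub[OF X(3) X2X]] by blast
  define D where "D y = df (dm (p1 y)) r" for y
  have dD: "DfnT (%e. D (e 0))" unfolding D_def by (intro dfn)
  have De: "s<:D y<->s<:dm (p1 y)&~s<:r" for s y unfolding D_def by simp
  have D2: "fin (D y)&D y<<=T" if "y<:X2" for y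
  proof -
   have q: "p1 y<:Q" using XQ subD[OF X2X that] by blast
   have "D y<<=dm (p1 y)" unfolding D_def by (simp add: sub_def)
   then show ?thesis using fin_sub[OF okf(1)[OF q]] sub_trans okf(3)[OF q] by blast
  qed
  have disj: "y = z" if h: "y<:X2" "z<:X2" "s<:D y" "s<:D z" for y z s
  proof (rule ccontr)
   assume "y ~= z"
   then have "it (dm (p1 y)) (dm (p1 z)) = r" using X1(4) h(1,2) unfolding X2 by blast
   moreover have "s<:it (dm (p1 y)) (dm (p1 z))" "~s<:r" using h(3,4) unfolding D_def by simp_all
   ultimately show False by simp
  qed
  note sV = subD[OF VW(1)] and sW = subD[OF VW(2)]
  have "EX y z. y<:V&z<:W&(ALL s t. s<:D y-->t<:D z-->~pair s t<:R&~pair t s<:R)"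
  proof (rule tree_pair[OF dD VW(3,4)])
   show "fin (D y)&D y<<=T" if "y<:V" for y using D2 sV that by blast
   show "fin (D y)&D y<<=T" if "y<:W" for y using D2 sW that by blast
   show "y = z" if "y<:V" "z<:V" "s<:D y" "s<:D z" for y z s using disj[OF sV sV] that by blast
   show "y = z" if "y<:W" "z<:W" "s<:D y" "s<:D z" for y z s using disj[OF sW sW] that by blast
  qed (use lin ch in blast)+
  then obtain y z where y: "y<:V" "z<:W" "!!s t. s<:D y==>t<:D z==>~pair s t<:R&~pair t s<:R" by blast
  have g: "gp (p2 y) (p2 z)" using VW(5) y by blast
  have y2: "y<:X2" "z<:X2" using sV sW y by blast+
  have yQ: "p1 y<:Q" "p1 z<:Q" using XQ subD[OF X2X] y2 by blast+
  have "y ~= z" using g unfolding gp_def by auto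
  then have ir: "it (dm (p1 y)) (dm (p1 z)) = r" using X1(4) y2 unfolding X2 by blast
  have agr: "app (p1 z) x = app (p1 y) x" if x: "x<:r" for x
  proof -
   have "rs (p1 y) r = rs (p1 z) r" "r<<=dm (p1 y)" "r<<=dm (p1 z)" using y2 rr unfolding X2 by simp_all
   then show ?thesis using rs_fn(2)[OF okf(2)[OF yQ(1)] _ x] rs_fn(2)[OF okf(2)[OF yQ(2)] _ x] by metis
  qed
  let ?f = "%x. if x<:dm (p1 y) then app (p1 y) x else app (p1 z) x"
  have df: "DfnT (%e. ?f (e 0))" by (intro dfn)
  let ?d = "un (dm (p1 y)) (dm (p1 z))"
  define q where "q = lam ?d ?f"
  have fq: "fn q ?d om" unfolding q_def by (rule lam_fn[OF df]) (use fn_app(2)[OF okf(2)[OF yQ(1)]] fn_app(2)[OF okf(2)[OF yQ(2)]] in auto)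
  have aq: "app q x = ?f x" if "x<:?d" for x unfolding q_def by (rule lam_app[OF df that])
  have ay: "app q x = app (p1 y) x" if "x<:dm (p1 y)" for x using aq[of x] that by simp
  have az: "app q x = app (p1 z) x" if x: "x<:dm (p1 z)" for x
  proof (cases "x<:dm (p1 y)")
   case True
   then have "x<:r" using x unfolding ir[symmetric] by simp
   then show ?thesis using ay[OF True] agr by simp
  qed (use aq[of x] x in simp)
  have qQ: "q<:Q"
  proof (rule okI[OF fin_un[OF okf(1)[OF yQ(1)] okf(1)[OF yQ(2)]] fq])
   show "?d<<=T" using okf(3)[OF yQ(1)] okf(3)[OF yQ(2)] by (auto simp: sub_def)
   fix s t assume st: "s<:?d" "t<:?d" "pair s t<:R"
   show "app q s ~= app q t"
   proof (cases "s<:dm (p1 y)&t<:dm (p1 y) | s<:dm (p1 z)&t<:dm (p1 z)")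
    case True
    then show ?thesis using okf(4)[OF yQ(1) _ _ st(3)] okf(4)[OF yQ(2) _ _ st(3)] ay az by metis
   next
    case False
    have ri: "x<:r<->x<:dm (p1 y)&x<:dm (p1 z)" for x unfolding ir[symmetric] by simp
    have "s<:dm (p1 y)&~s<:dm (p1 z)&t<:dm (p1 z)&~t<:dm (p1 y) |
      s<:dm (p1 z)&~s<:dm (p1 y)&t<:dm (p1 y)&~t<:dm (p1 z)" using False st(1,2) unfolding un by blast
    then have "s<:D y&t<:D z | s<:D z&t<:D y" unfolding De ri by blast
    then show ?thesis using y(3) st(3) by blast
   qed
  qed
  have "p1 y<<=q" by (rule ext[OF okf(2)[OF yQ(1)] fq _ ay]) (simp add: sub_def)
  moreover have "p1 z<<=q" by (rule ext[OF okf(2)[OF yQ(2)] fq _ az]) (simp add: sub_def)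
  ultimately have "cmp Q L (p1 y) (p1 z)" unfolding cmp_def L using qQ yQ by blast
  then show "EX y z. y<:X&z<:X&cmp Q L (p1 y) (p1 z)&gp (p2 y) (p2 z)" using g y2 subD[OF X2X] by blast
 qed note th = this
 let ?D = "%t. sep Q (%p. t<:dm p)"
 have dD0: "Dfn (%e. t<:dm (e 0))" for t by (intro dfn)
 have D: "p<:?D t<->p<:Q&t<:dm p" for p t by (rule sep[OF dD0])
 have dD: "DfnT (%e. ?D (e 0))" by (intro dfn)
 have iD: "Y<:img ?D T<->(EX t. t<:T&Y = ?D t)" for Y by (rule img[OF dD])
 have dense: "EX r. r<:?D t&pair r p<:L" if h: "t<:T" "p<:Q" for t p
 proof (cases "t<:dm p")
  case True
  then show ?thesis using h D L sub_refl by blast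
 next
  case False
  note o = okf[OF h(2)]
  have da: "DfnT (%e. app p (e 0))" by (intro dfn)
  have "fin (img (app p) (dm p))" by (rule fin_img[OF da o(1)])
  \<comment> \<open>A value outside the finite range of \<open>p\<close> can be given to
    \<open>t\<close> without any conflict.\<close>
  then have "~om<<=img (app p) (dm p)" using not_fin_om fin_sub by blast
  then obtain n where n: "n<:om" "~n<:img (app p) (dm p)" unfolding sub_def by blast
  have nn: "app p x ~= n" if "x<:dm p" for x using n(2) that unfolding img[OF da] by blast
  note f = fn_ins[OF o(2) n(1) False]
  have "ins (pair t n) p<:Q"
  proof (rule okI[OF _ f(1)])
   show "fin (ins t (dm p))" using o(1) by simp
   show "ins t (dm p)<<=T" using o(3) h(1) by (auto simp: sub_def)
   fix s s' assume s: "s<:ins t (dm p)" "s'<:ins t (dm p)" "pair s s'<:R"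
   have "s = t&s' = t | s = t&s'<:dm p | s' = t&s<:dm p | s<:dm p&s'<:dm p" using s(1,2) by auto
   then show "app (ins (pair t n) p) s ~= app (ins (pair t n) p) s'"
    using irr[OF h(1)] s(3) f(2,3) nn o(4) by metis
  qed
  moreover have "p<<=ins (pair t n) p" by (simp add: sub_def)
  moreover have "t<:dm (ins (pair t n) p)" using fn_dm[OF f(1)] by simp
  ultimately show ?thesis using D L h(2) by blast
 qed
 have "EX H. H<<=Q&H ~= emp&(ALL a b. a<:H-->b<:H-->(EX e. e<:H&pair e a<:L&pair e b<:L))&(ALL Y. Y<:img ?D T-->(EX p. p<:Y&p<:H))"
 proof (rule MA_thin[OF empQ _ _ th])
  show "pair p p<:L" if "p<:Q" for p unfolding L using that by simp
  show "pair p r<:L" if "pair p q<:L" "pair q r<:L" for p q r using that sub_trans unfolding L by blast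
  show "lep (img ?D T) om1" using lep_img[OF dD] lT lep_trans by blast
  show "Y<<=Q" if "Y<:img ?D T" for Y using that D unfolding iD sub_def by blast
  show "EX r. r<:Y&pair r p<:L" if "Y<:img ?D T" "p<:Q" for Y p using that dense unfolding iD by blast
 qed
 then obtain H where H: "H<<=Q" "!!a b. a<:H==>b<:H==>EX e. e<:H&pair e a<:L&pair e b<:L" "!!Y. Y<:img ?D T==>EX p. p<:Y&p<:H" by blast
 have HT: "EX p. p<:H&t<:dm p" if t: "t<:T" for t
 proof -
  have "?D t<:img ?D T" unfolding iD using t by blast
  then show ?thesis using H(3) D by blast
 qed
 have val: "app a x = app b x" if h: "a<:H" "b<:H" "x<:dm a" "x<:dm b" for a b x
 proof -
  obtain e where e: "e<:Q" "a<:Q" "b<:Q" "a<<=e" "b<<=e" using H(2)[OF h(1,2)] unfolding L by blast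
  have "pair x (app a x)<:e" "pair x (app b x)<:e" using fn_app(1)[OF okf(2)[OF e(2)] h(3)] fn_app(1)[OF okf(2)[OF e(3)] h(4)] subD e by blast+
  then show ?thesis using fn_pair[OF okf(2)[OF e(1)]] by simp
 qed
 let ?f = "%t. des (%n. EX p. p<:H&t<:dm p&n = app p t)"
 have df: "DfnT (%e. ?f (e 0))" by (intro dfn)
 have fv: "?f t = app p t" if "p<:H" "t<:dm p" for t p
  by (rule des_eq) (use that val in blast)+
 have "fn (lam T ?f) T om"
 proof (rule lam_fn[OF df])
  fix t assume "t<:T"
  then obtain p where p: "p<:H" "t<:dm p" using HT by blast
  show "?f t<:om" unfolding fv[OF p] using fn_app(2)[OF okf(2)[OF subD[OF H(1) p(1)]] p(2)] .
 qed
 moreover have "app (lam T ?f) s ~= app (lam T ?f) t" if h: "s<:T" "t<:T" "pair s t<:R" for s t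
 proof -
  obtain p p' where p: "p<:H" "s<:dm p" "p'<:H" "t<:dm p'" using HT h by blast
  obtain e where e: "e<:H" "e<:Q" "p<<=e" "p'<<=e" using H(2)[OF p(1,3)] unfolding L by blast
  have "s<:dm e" "t<:dm e" using p(2,4) e(3,4) unfolding dm sub_def by blast+
  then show ?thesis using okf(4)[OF e(2) _ _ h(3)] fv[OF e(1)] lam_app[OF df h(1)] lam_app[OF df h(2)] by simp
 qed
 ultimately show ?thesis by blast
qed

subsection \<open>Reading the formulas in a model\<close>

context zf begin

lemma sat_subset_f [simp]: "x < d==>y < d==>sat E e ((x \<^bold>\<subseteq> y) d)<->lv e d x<<=lv e d y"
 by (simp add: subset_f_def sub_def less_SucI)

lemma sat_is_inter [simp]: "i < d==>x < d==>y < d==>sat E e (is_inter i x y d)<->lv e d i = it (lv e d x) (lv e d y)"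
 using seteq[of "lv e d i" "it (lv e d x) (lv e d y)"] by (auto simp: is_inter_def less_SucI)

lemma sat_is_succ [simp]: "s < d==>x < d==>sat E e (is_succ s x d)<->lv e d s = sc (lv e d x)"
 using seteq[of "lv e d s" "sc (lv e d x)"] by (auto simp: is_succ_def less_SucI)

lemma sat_is_restriction [simp]: "r < d==>f < d==>x < d==>sat E e (is_restriction r f x d)<->lv e d r = rs (lv e d f) (lv e d x)"
 using seteq[of "lv e d r" "rs (lv e d f) (lv e d x)"] by (auto simp: is_restriction_def rs less_SucI)

lemma sat_is_ordinal [simp]: "x < d==>sat E e (is_ordinal x d)<->Ord (lv e d x)"
 by (auto simp: is_ordinal_def Ord_def trs_def less_SucI)

lemma sat_is_limit [simp]: "x < d==>sat E e (is_limit x d)<->Lim (lv e d x)"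
 using emp_eq[of "lv e d x"] by (auto simp: is_limit_def Lim_def less_SucI)

lemma sat_is_omega [simp]: "x < d==>sat E e (is_omega x d)<->lv e d x = om"
 using omega_unique[of "lv e d x"] by (simp add: is_omega_def less_SucI)

end

context zfc begin

lemma fn_inj_rel: assumes "fn f a b"
 shows "(ALL x. x<:a-->(ALL y. y<:a-->(ALL z. pair x z<:f&pair y z<:f-->x = y)))<->inj f a"
 unfolding inj_def fn_pair[OF assms] by metis

lemma sat_inj_on_f: "f < d==>x < d==>sat E e (inj_on_f f x d) <->
  (ALL a. a<:lv e d x-->(ALL b. b<:lv e d x-->(ALL z. pair a z<:lv e d f&pair b z<:lv e d f-->a = b)))"
 by (simp add: inj_on_f_def less_SucI)

lemma sat_lepoll_f [simp]: "x < d==>y < d==>sat E e (lepoll_f x y d)<->lep (lv e d x) (lv e d y)"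
 using fn_inj_rel by (simp add: lepoll_f_def lep_def sat_inj_on_f less_SucI cong: conj_cong)

lemma sat_countable_f [simp]: "x < d==>sat E e (countable_f x d)<->ctbl (lv e d x)"
 by (simp add: countable_f_def ctbl_def less_SucI)

lemma sat_is_omega1 [simp]: "x < d==>sat E e (is_omega1 x d)<->lv e d x = om1"
 using om1_unique[of "lv e d x"] by (simp add: is_omega1_def less_SucI)

lemma sat_is_bij [simp]: "f < d==>x < d==>y < d==>sat E e (is_bij f x y d)<->bij (lv e d f) (lv e d x) (lv e d y)"
proof -
 assume "f < d" "x < d" "y < d"
 then have "sat E e (is_bij f x y d)<->fn (lv e d f) (lv e d x) (lv e d y)&inj (lv e d f) (lv e d x) &
   (ALL b. b<:lv e d y-->(EX a. a<:lv e d x&pair a b<:lv e d f))"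
  using fn_inj_rel by (simp add: is_bij_def sat_inj_on_f less_SucI cong: conj_cong)
 then show ?thesis using fn_pair[of "lv e d f" "lv e d x" "lv e d y"] unfolding bij_def by (metis (no_types))
qed

lemma sat_size_aleph1 [simp]: "x < d==>sat E e (size_aleph1 x d)<->(EX f. bij f (lv e d x) om1)"
 by (simp add: size_aleph1_def less_SucI)

lemma sat_size_le_aleph1 [simp]: "x < d==>sat E e (size_le_aleph1 x d)<->lep (lv e d x) om1"
 by (simp add: size_le_aleph1_def less_SucI)

lemma sat_is_two [simp]: "x < d==>sat E e (is_two x d)<->lv e d x = two"
proof -
 assume x: "x < d"
 have "(EX e. (ALL y. ~y<:e)&z = sc e)<->z = sc emp" "(ALL y. ~y<:z)<->z = emp" for z using emp_eq emp by metis+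
 then have "sat E e (is_two x d)<->(ALL z. z<:lv e d x<->z = emp | z = sc emp)" using x by (simp add: is_two_def less_SucI)
 also have "\<dots> <-> lv e d x = two" using seteq[of "lv e d x" two] by (auto simp: two_def)
 finally show ?thesis .
qed

lemma sat_is_cantor_space [simp]: "x < d==>sat E e (is_cantor_space x d)<->lv e d x = Fnc om two"
 using seteq[of "lv e d x" "Fnc om two"] by (auto simp: is_cantor_space_def Fnc less_SucI)

lemma sat_differ_at: "x < d==>y < d==>k < d==>sat E e (differ_at x y k d) <->
  (EX u v. pair (lv e d k) u<:lv e d x&pair (lv e d k) v<:lv e d y&u ~= v)"
 by (simp add: differ_at_def less_SucI)

lemma sat_dist_less: "x < d==>y < d==>n < d==>sat E e (dist_less x y n d) <->
  (ALL k. (EX u v. pair k u<:lv e d x&pair k v<:lv e d y&u ~= v) &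
   (ALL j. j<:k-->~(EX u v. pair j u<:lv e d x&pair j v<:lv e d y&u ~= v))-->lv e d n<:k)"
 by (simp add: dist_less_def least_difference_def sat_differ_at less_SucI)

text \<open>Distance below the radius given by \<open>n\<close> means that the first difference
  comes after \<open>n\<close>, that is, agreement on \<open>sc n\<close> and not just on
  \<open>n\<close>.\<close>

lemma sat_open: "c < d==>x < d==>lv e d c = Fnc om two==>sat E e (open_in_cantor c x d) ==>
  lv e d x<<=Fnc om two&(ALL y. y<:lv e d x-->(EX n. n<:om&(ALL z. fn z om two-->(ALL k. k<:sc n-->app z k = app y k)-->z<:lv e d x)))"
proof -
 assume c: "c < d" "x < d" "lv e d c = Fnc om two" and o: "sat E e (open_in_cantor c x d)"
 have s: "lv e d x<<=Fnc om two" using o c by (simp add: open_in_cantor_def)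
 have "EX n. n<:om&(ALL z. fn z om two-->(ALL k. k<:sc n-->app z k = app y k)-->z<:lv e d x)" if y: "y<:lv e d x" for y
 proof -
  have fy: "fn y om two" using subD[OF s y] Fnc by simp
  obtain n where n: "n<:om" "!!z. z<:Fnc om two==>(ALL k. (EX u v. pair k u<:y&pair k v<:z&u ~= v) &
   (ALL j. j<:k-->~(EX u v. pair j u<:y&pair j v<:z&u ~= v))-->n<:k)==>z<:lv e d x"
   using o c y by (simp add: open_in_cantor_def sat_dist_less less_SucI) blast
  have "z<:lv e d x" if z: "fn z om two" "ALL k. k<:sc n-->app z k = app y k" for z
  proof (rule n(2))
   show "z<:Fnc om two" using z(1) Fnc by simp
   show "ALL k. (EX u v. pair k u<:y&pair k v<:z&u ~= v)&(ALL j. j<:k-->~(EX u v. pair j u<:y&pair j v<:z&u ~= v))-->n<:k"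
   proof (intro allI impI)
    fix k assume "(EX u v. pair k u<:y&pair k v<:z&u ~= v)&(ALL j. j<:k-->~(EX u v. pair j u<:y&pair j v<:z&u ~= v))"
    then have k: "k<:om" "app y k ~= app z k" unfolding fn_pair[OF fy] fn_pair[OF z(1)] by auto
    then have "~k<:sc n" using z(2) by metis
    then show "n<:k" using Ord_linear[OF om_Ord_mem[OF k(1)] om_Ord_mem[OF n(1)]] by auto
   qed
  qed
  then show ?thesis using n(1) by blast
 qed
 then show ?thesis using s by blast
qed

lemma aleph1_denseI: assumes c: "c < d" "x < d" "lv e d c = Fnc om two" and s: "lv e d x<<=Fnc om two" "lep (lv e d x) om1"
  and D: "!!y n. fn y om two==>n<:om==>~ctbl (sep (lv e d x) (%a. ALL k. k<:n-->app a k = app y k))"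
 shows "sat E e (aleph1_dense c x d)"
proof -
 have "EX f. bij f (it (lv e d x) u) om1" if o: "sat E (case_nat u e) (open_in_cantor c d (Suc d))" "EX y. y<:u" for u
 proof -
  let ?e = "case_nat u e"
  have l: "lv ?e (Suc d) c = Fnc om two" "lv ?e (Suc d) d = u" using c by simp_all
  note op = sat_open[OF _ _ l(1) o(1), unfolded l(2)]
  obtain y where y: "y<:u" using o(2) by blast
  have cl: "c < Suc d" "d < Suc d" using c by simp_all
  note op = op[OF cl]
  have fy: "fn y om two" using op y subD Fnc by blast
  obtain n where n: "n<:om" "!!z. fn z om two==>(ALL k. k<:sc n-->app z k = app y k)==>z<:u" using op y by blast
  have ds: "Dfn (%v. ALL k. k<:sc n-->app (v 0) k = app y k)" by (intro dfn)
  have "sep (lv e d x) (%a. ALL k. k<:sc n-->app a k = app y k)<<=it (lv e d x) u"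
   unfolding sub_def sep[OF ds] it using n(2) s(1) subD Fnc by blast
  then have "~ctbl (it (lv e d x) u)" using D[OF fy sc_om[OF n(1)]] ctbl_sub by blast
  moreover have "lep (it (lv e d x) u) om1" using s(2) lep_sub[of "it (lv e d x) u" "lv e d x"] lep_trans by (auto simp: sub_def)
  ultimately show ?thesis using unc_bij_om1 by blast
 qed
 then show ?thesis using c s(1) by (simp add: aleph1_dense_def less_SucI)
qed

end

section \<open>The two axioms and the failure of the third in the extension\<close>

context lip begin

text \<open>The graph of the map over \<open>A\<close> is uncountable and injective in both
  coordinates, so it contains a related pair: arguments agreeing up to \<open>m\<close> whose values
  differ before \<open>m\<close>.\<close>

lemma not_BA_Lip: "~sat E e (BA_Lip 0)"
proof
 assume "sat E e (BA_Lip 0)"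
 \<comment> \<open>The space, the two sets and the map have levels 0 to 3, so the matrix of the
   formula is read below four quantifiers.\<close>
 then obtain f where f: "sat E (case_nat f (case_nat B (case_nat A (case_nat (Fnc om two) e))))
   ((lipschitz_f 0 3 \<^bold>\<and> inj_on_f 3 1 \<^bold>\<and> (\<^bold>\<forall>x\<^bold>\<in>1. \<^bold>\<forall>y. rel 3 x y \<^bold>\<longrightarrow> y \<^bold>\<in> 2)) 4)"
 proof -
  let ?e = "case_nat B (case_nat A (case_nat (Fnc om two) e))"
  have l: "lv ?e (Suc (Suc (Suc 0))) 0 = Fnc om two" "lv ?e (Suc (Suc (Suc 0))) (Suc 0) = A" "lv ?e (Suc (Suc (Suc 0))) (Suc (Suc 0)) = B" by simp_all
  have "sat E ?e (aleph1_dense 0 (Suc 0) (Suc (Suc (Suc 0))))" by (rule aleph1_denseI) (use A in \<open>simp_all add: l\<close>)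
  moreover have "sat E ?e (aleph1_dense 0 (Suc (Suc 0)) (Suc (Suc (Suc 0))))" by (rule aleph1_denseI) (use B in \<open>simp_all add: l\<close>)
  ultimately show ?thesis using \<open>sat E e (BA_Lip 0)\<close> that by (simp add: BA_Lip_def eval_nat_numeral less_SucI) blast
 qed
 let ?C = "Fnc om two"
 have ff: "fn f ?C ?C" using f by (simp add: lipschitz_f_def eval_nat_numeral less_SucI)
 have fi: "!!x y z. x<:A==>y<:A==>pair x z<:f==>pair y z<:f==>x = y"
  using f by (simp add: sat_inj_on_f eval_nat_numeral less_SucI) blast
 have fB: "!!x y. x<:A==>pair x y<:f==>y<:B"
  using f by (simp add: eval_nat_numeral less_SucI)
 have fl0: "ALL x. x<:?C-->(ALL y. y<:?C-->(ALL u v. pair x u<:f&pair y v<:f-->(ALL k. k<:om-->rs x k = rs y k-->rs u k = rs v k)))"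
  using f by (simp add: lipschitz_f_def eq_restriction_def eval_nat_numeral less_SucI)
 have fl: "!!x y u v k. x<:?C==>y<:?C==>pair x u<:f==>pair y v<:f==>k<:om==>rs x k = rs y k==>rs u k = rs v k"
  using fl0 by blast
 have AC: "x<:?C" if "x<:A" for x using subD[OF A(1) that] .
 have fx: "pair x (app f x)<:f" "app f x<:B" "fn (app f x) om two" if "x<:A" for x
  using fn_app[OF ff AC[OF that]] fB[OF that] Fnc by blast+
 have dX: "DfnT (%e. pair (e 0) (app f (e 0)))" by (intro dfn)
 let ?X = "img (%x. pair x (app f x)) A"
 have X: "y<:?X<->(EX x. x<:A&y = pair x (app f x))" for y by (rule img[OF dX])
 have "lep A ?X" by (rule lepI[OF dX]) (auto simp: X)
 moreover have "~ctbl A"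
 proof -
  have d0: "DfnT (%e. emp)" by (intro dfn)
  have "fn (lam om (%_. emp)) om two" by (rule lam_fn[OF d0]) (simp add: two_def)
  from A(3)[OF this emp_om] have "~ctbl (sep A (%a. ALL k. k<:emp-->app a k = app (lam om (%_. emp)) k))" .
  moreover have "Dfn (%e. ALL k. k<:emp-->app (e 0) k = app (lam om (%_. emp)) k)" by (intro dfn)
  note s = sep[OF this]
  have "sep A (%a. ALL k. k<:emp-->app a k = app (lam om (%_. emp)) k)<<=A" unfolding sub_def s by blast
  ultimately show ?thesis using ctbl_sub by blast
 qed
 ultimately have "~ctbl ?X" using ctbl_lep by blast
 moreover have "?X<<=cart A B" unfolding sub_def X using fx(2) by auto
 moreover have "ic ?X" unfolding ic_def
 proof (intro allI impI)
  fix y z assume yz: "y<:?X" "z<:?X" "p1 y = p1 z | p2 y = p2 z"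
  obtain a b where ab: "a<:A" "y = pair a (app f a)" "b<:A" "z = pair b (app f b)" using yz(1,2) unfolding X by blast
  have "a = b" using yz(3) fi[OF ab(1,3) fx(1)[OF ab(1)]] fx(1)[OF ab(3)] unfolding ab(2,4) by auto
  then show "y = z" using ab by simp
 qed
 ultimately obtain y z where yz: "y<:?X" "z<:?X" "gp y z" using AB by blast
 obtain a b where ab: "a<:A" "y = pair a (app f a)" "b<:A" "z = pair b (app f b)" using yz(1,2) unfolding X by blast
 obtain m k where m: "m<:om" "!!k. k<:m==>app a k = app b k" "k<:m" "app (app f a) k ~= app (app f b) k"
  using yz(3) unfolding gp_def ab(2,4) p1 p2 by blast
 have mo: "m<<=om" using om_trans[OF m(1)] by (simp add: sub_def)
 have fab: "fn a om two" "fn b om two" using AC ab(1,3) Fnc by blast+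
 have "rs a m = rs b m"
  by (rule fn_eqI[OF rs_fn(1)[OF fab(1) mo] rs_fn(1)[OF fab(2) mo]]) (use rs_fn(2)[OF fab(1) mo] rs_fn(2)[OF fab(2) mo] m(2) in simp)
 then have "rs (app f a) m = rs (app f b) m" using fl[OF AC[OF ab(1)] AC[OF ab(3)] fx(1)[OF ab(1)] fx(1)[OF ab(3)] m(1)] by blast
 then show False using rs_fn(2)[OF fx(3)[OF ab(1)] mo m(3)] rs_fn(2)[OF fx(3)[OF ab(3)] mo m(3)] m(4) by simp
qed

lemma sat_MA: "sat E e (MA_Knaster 0)"
proof -
 have "EX G. G<<=P&(EX p. p<:G)&(ALL p. p<:G-->(ALL q. q<:P-->pair p q<:R-->q<:G)) &
   (ALL p. p<:G-->(ALL q. q<:G-->(EX r. r<:G&pair r p<:R&pair r q<:R)))&(ALL D. D<:F-->(EX p. p<:D&p<:G))"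
  if h: "lep F om1" "ALL D. D<:F-->D<<=P&(ALL p. p<:P-->(EX q. q<:D&pair q p<:R))" "ALL p. p<:P-->pair p p<:R"
   "ALL p. p<:P-->(ALL q. q<:P-->(ALL r. r<:P-->pair p q<:R&pair q r<:R-->pair p r<:R))"
   "ALL W. W<<=P&~ctbl W-->(EX Z. Z<<=W&~ctbl Z&(ALL p. p<:Z-->(ALL q. q<:Z-->(EX r. r<:P&pair r p<:R&pair r q<:R))))"
   "q0<:P" for P R F q0
 proof -
  note P = h(6)
  have rf: "!!p. p<:P==>pair p p<:R" using h(3) by blast
  have tr: "!!p q r. p<:P==>q<:P==>r<:P==>pair p q<:R==>pair q r<:R==>pair p r<:R" using h(4) by blast
  have kn: "!!W. W<<=P==>~ctbl W==>EX Z. Z<<=W&~ctbl Z&(ALL p. p<:Z-->(ALL q. q<:Z-->(EX r. r<:P&pair r p<:R&pair r q<:R)))" using h(5) by blast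
  have F: "lep F om1" "!!D. D<:F==>D<<=P&(ALL p. p<:P-->(EX q. q<:D&pair q p<:R))" using h(1,2) by blast+
  have "thin P R A B"
  proof (rule knaster_thin)
   show "pair p p<:R" if "p<:P" for p by (rule rf[OF that])
   show "EX Z. Z<<=W&~ctbl Z&(ALL p q. p<:Z-->q<:Z-->cmp P R p q)" if "W<<=P" "~ctbl W" for W
    using kn[OF that] unfolding cmp_def by simp
  qed
  note th = this
  have "EX H. H<<=P&H ~= emp&(ALL a b. a<:H-->b<:H-->(EX e. e<:H&pair e a<:R&pair e b<:R))&(ALL D. D<:F-->(EX p. p<:D&p<:H))"
  proof (rule MA_thin[OF P _ _ th F(1)])
   show "pair p r<:R" if "p<:P" "q<:P" "r<:P" "pair p q<:R" "pair q r<:R" for p q r by (rule tr[OF that])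
   show "D<<=P" if "D<:F" for D using F(2)[OF that] by blast
   show "EX q. q<:D&pair q p<:R" if "D<:F" "p<:P" for D p using F(2)[OF that(1)] that(2) by blast
  qed (rule rf)
  then obtain H where H: "H<<=P" "H ~= emp" "!!a b. a<:H==>b<:H==>EX e. e<:H&pair e a<:R&pair e b<:R"
   "!!D. D<:F==>EX p. p<:D&p<:H" by blast
  \<comment> \<open>\<open>MA_thin\<close> yields a directed set only; the filter is its upward
    closure.\<close>
  let ?G = "sep P (%q. EX h. h<:H&pair h q<:R)"
  have dG: "Dfn (%e. EX h. h<:H&pair h (e 0)<:R)" by (intro dfn)
  have G: "q<:?G<->q<:P&(EX h. h<:H&pair h q<:R)" for q by (rule sep[OF dG])
  have HG: "h<:?G" if "h<:H" for h unfolding G using that rf subD[OF H(1) that] by blast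
  have "EX r. r<:?G&pair r p<:R&pair r q<:R" if h: "p<:?G" "q<:?G" for p q
  proof -
   obtain a b where a: "p<:P" "a<:H" "pair a p<:R" "q<:P" "b<:H" "pair b q<:R" using h unfolding G by blast
   obtain c where c: "c<:H" "pair c a<:R" "pair c b<:R" using H(3)[OF a(2,5)] by blast
   have "pair c p<:R" "pair c q<:R" using tr a c subD[OF H(1)] by blast+
   then show ?thesis using HG[OF c(1)] by blast
  qed
  moreover have "q<:?G" if h: "p<:?G" "q<:P" "pair p q<:R" for p q
  proof -
   obtain a where a: "p<:P" "a<:H" "pair a p<:R" using h(1) unfolding G by blast
   have "pair a q<:R" using tr[OF subD[OF H(1) a(2)] a(1) h(2) a(3) h(3)] .
   then show ?thesis unfolding G using h(2) a(2) by blast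
  qed
  moreover have "?G<<=P" unfolding sub_def G by blast
  moreover have "EX p. p<:?G" using ex_mem[OF H(2)] HG by blast
  moreover have "EX p. p<:D&p<:?G" if "D<:F" for D using H(4)[OF that] HG by blast
  ultimately show ?thesis by (intro exI[of _ ?G]) blast
 qed
 note main = this
 show ?thesis
  apply (simp add: MA_Knaster_def partial_order_f_def knaster_def compatible_f_def dense_f_def filter_f_def less_SucI eval_nat_numeral)
  apply (intro allI impI)
  apply (elim conjE exE)
  apply (rule main)
  apply assumption+
  done
qed

text \<open>Predecessors form a chain, so every height is below \<open>om1\<close>; as levels are
  countable, the tree has at most \<open>om1\<close> many nodes, as \<open>special\<close> demands.
  Different values on comparable nodes amount to injectivity on chains.\<close>

lemma sat_Aronszajn: "sat E e (Aronszajn_special 0)"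
proof -
 have "EX f. fn f T om&(ALL C. C<<=T&(ALL s. s<:C-->(ALL t. t<:C-->pair s t<:R | s = t | pair t s<:R)) -->
   (ALL x. x<:C-->(ALL y. y<:C-->(EX z. pair x z<:f&pair y z<:f)-->x = y)))"
  if h: "ALL t. t<:T-->~pair t t<:R"
   "ALL r. r<:T-->(ALL s. s<:T-->(ALL t. t<:T-->pair r s<:R&pair s t<:R-->pair r t<:R))"
   "ALL t. t<:T-->(EX D. (ALL s. s<:D<->s<:T&pair s t<:R)&D<<=T &
    (ALL s. s<:D-->(ALL t. t<:D-->pair s t<:R | s = t | pair t s<:R)) &
    (ALL X. X<<=D&(EX y. y<:X)-->(EX m. m<:X&(ALL s. s<:X-->m = s | pair m s<:R))))"
   "ALL a. a<:om1-->(EX L. (ALL t. t<:L<->t<:T&Ord a&(EX D. (ALL s. s<:D<->s<:T&pair s t<:R)&(EX f. bij f D a &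
    (ALL r. r<:D-->(ALL s. s<:D-->(ALL u v. pair r u<:f&pair s v<:f-->(pair r s<:R<->u<:v)))))))&ctbl L)"
   "ALL C. C<<=T&(ALL s. s<:C-->(ALL t. t<:C-->pair s t<:R | s = t | pair t s<:R))-->ctbl C" for T R
 proof -
  have irr: "!!t. t<:T==>~pair t t<:R" using h(1) by blast
  have tr: "!!r s t. r<:T==>s<:T==>t<:T==>pair r s<:R==>pair s t<:R==>pair r t<:R" using h(2) by blast
  note pd = mp[OF spec[OF h(3)]] and lv = mp[OF spec[OF h(4)]]
  have ch: "!!C. C<<=T==>(ALL s. s<:C-->(ALL t. t<:C-->pair s t<:R | s = t | pair t s<:R))==>ctbl C"
   by (rule mp[OF spec[OF h(5)]]) (rule conjI)
  let ?n = "%t a. Ord a&(EX D. (ALL s. s<:D<->s<:T&pair s t<:R)&(EX f. bij f D a &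
    (ALL r. r<:D-->(ALL s. s<:D-->(ALL u v. pair r u<:f&pair s v<:f-->(pair r s<:R<->u<:v))))))"
  have dn: "Dfn (%e. ?n (e 0) a)" for a by (intro dfn)
  let ?L = "%a. sep T (%t. ?n t a)"
  have L: "t<:?L a<->t<:T&?n t a" for t a by (rule sep[OF dn])
  have dL: "DfnT (%e. ?L (e 0))" by (intro dfn)
  have lin: "pair r s<:R | r = s | pair s r<:R" if rst: "r<:T" "s<:T" "t<:T" "pair r t<:R" "pair s t<:R" for r s t
  proof -
   from pd[OF rst(3)] obtain D where "ALL s. s<:D<->s<:T&pair s t<:R"
    "ALL s. s<:D-->(ALL t. t<:D-->pair s t<:R | s = t | pair t s<:R)" by (elim exE conjE) (rule that)
   then show ?thesis using rst by blast
  qed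
  have nh: "EX a. a<:om1&?n t a" if t: "t<:T" for t
  proof -
   from pd[OF t] obtain D where D0: "(ALL s. s<:D<->s<:T&pair s t<:R)&D<<=T &
    (ALL s. s<:D-->(ALL t. t<:D-->pair s t<:R | s = t | pair t s<:R)) &
    (ALL X. X<<=D&(EX y. y<:X)-->(EX m. m<:X&(ALL s. s<:X-->m = s | pair m s<:R)))" by (elim exE) (rule that)
   have D: "!!s. s<:D<->s<:T&pair s t<:R"
    "!!s t. s<:D==>t<:D==>pair s t<:R | s = t | pair t s<:R"
    "!!X. X<<=D==>EX y. y<:X==>EX m. m<:X&(ALL s. s<:X-->m = s | pair m s<:R)"
    using D0 by blast+
   have DT: "s<:T" if "s<:D" for s using that D(1) by blast
   have dR: "Dfn (%e. pair (e 0) (e (Suc 0))<:R)" by (intro dfn)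
   have "EX \<theta> f. Ord \<theta> & bij f D \<theta> & (ALL x y. x<:D-->y<:D-->(pair x y<:R<->app f x<:app f y))"
   proof (rule order_type[OF dR])
    show "pair x y<:R | x = y | pair y x<:R" if "x<:D" "y<:D" for x y using D(2) that by blast
    show "~pair x x<:R" if "x<:D" for x using irr DT that by blast
    show "pair x z<:R" if "x<:D" "y<:D" "z<:D" "pair x y<:R" "pair y z<:R" for x y z using tr DT that by blast
    show "EX m. m<:X&(ALL y. y<:X-->~pair y m<:R)" if X: "X<<=D" "X ~= emp" for X
    proof -
     obtain m where m: "m<:X" "!!s. s<:X==>m = s | pair m s<:R" using D(3)[OF X(1) ex_mem[OF X(2)]] by blast
     have "~pair y m<:R" if y: "y<:X" for y
     proof
      assume ym: "pair y m<:R"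
      have mT: "m<:T" "y<:T" using DT subD[OF X(1)] m(1) y by blast+
      have "pair m m<:R" using m(2)[OF y] ym tr[OF mT(1,2,1)] by blast
      then show False using irr[OF mT(1)] by blast
     qed
     then show ?thesis using m(1) by blast
    qed
   qed
   then obtain a f where a: "Ord a" "bij f D a" "!!x y. x<:D==>y<:D==>pair x y<:R<->app f x<:app f y" by blast
   have "D<<=T" using DT by (rule subI)
   then have "ctbl D" using ch D(2) by blast
   then have ca: "ctbl a" using bij_lep(2)[OF a(2)] ctbl_lep by blast
   have "a<:om1"
   proof (rule ccontr)
    assume "~a<:om1"
    then have "om1<<=a" using Ord_not_mem[OF a(1) Ord_om1] by blast
    then show False using ca unc_om1 ctbl_sub by blast
   qed
   moreover have "?n t a"
   proof (rule conjI[OF a(1)], rule exI[of _ D], rule conjI, intro allI, rule D(1), rule exI[of _ f], intro conjI a(2) allI impI)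
    have f: "fn f D a" using a(2) unfolding bij_def by blast
    show "pair r s<:R<->u<:v" if "r<:D" "s<:D" "pair r u<:f&pair s v<:f" for r s u v
     using that a(3) unfolding fn_pair[OF f] by simp
   qed
   ultimately show ?thesis by blast
  qed
  have cL: "lep (?L a) om1" if a: "a<:om1" for a
  proof -
   from lv[OF a] obtain L where l: "ALL t. t<:L<->t<:T&?n t a" "ctbl L" by (elim exE conjE) (rule that)
   have "t<:?L a<->t<:L" for t using trans[OF L spec[OF l(1), symmetric]] .
   then have "?L a = L" by (rule seteq)
   then show ?thesis using l(2) ctbl_lep_om1 by simp
  qed
  have "lep (Uni (img ?L om1)) om1" by (rule lep_Uni[OF dL lep_refl cL lep_om1_square])
  moreover have "T<<=Uni (img ?L om1)"
  proof (rule subI)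
   fix t assume t: "t<:T"
   obtain a where a: "a<:om1" "?n t a" using nh[OF t] by blast
   have "t<:?L a" by (rule iffD2[OF L]) (use t a(2) in blast)
   moreover have "?L a<:img ?L om1" by (rule iffD2[OF img[OF dL]]) (use a(1) in blast)
   ultimately show "t<:Uni (img ?L om1)" by (intro iffD2[OF Uni]) blast
  qed
  ultimately have lT: "lep T om1" using lep_sub lep_trans by blast
  have "EX f. fn f T om&(ALL s t. s<:T-->t<:T-->pair s t<:R-->app f s ~= app f t)"
  proof (rule special[OF lT])
   show "pair r s<:R | r = s | pair s r<:R" if "r<:T" "s<:T" "t<:T" "pair r t<:R" "pair s t<:R" for r s t
    by (rule lin[OF that])
   show "ctbl C" if "C<<=T" "ALL s t. s<:C-->t<:C-->pair s t<:R | s = t | pair t s<:R" for C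
    using ch that by blast
  qed (rule irr)
  then obtain f where f: "fn f T om" "!!s t. s<:T==>t<:T==>pair s t<:R==>app f s ~= app f t" by blast
  have "x = y" if C: "C<<=T" "ALL s. s<:C-->(ALL t. t<:C-->pair s t<:R | s = t | pair t s<:R)" "x<:C" "y<:C" "pair x z<:f" "pair y z<:f" for C x y z
  proof -
   have xy: "x<:T" "y<:T" using subD[OF C(1)] C(3,4) by blast+
   have "app f x = app f y" using C(5,6) unfolding fn_pair[OF f(1)] by simp
   then show ?thesis using C(2-4) f(2)[OF xy] f(2)[OF xy(2,1)] by metis
  qed
  then show ?thesis using f(1) by (intro exI[of _ f]) blast
 qed
 note main = this
 show ?thesis
  apply (simp add: Aronszajn_special_def aronszajn_tree_def tree_f_def is_predecessors_def chain_f_def is_level_def node_height_def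
    special_tree_def sat_inj_on_f less_SucI eval_nat_numeral)
  apply (intro allI impI)
  apply (elim conjE exE)
  apply (rule main)
  apply assumption+
  done
qed

end

subsection \<open>The independence result\<close>

context zfc begin

text \<open>Two rows of an injective pairing function on \<open>om1\<close> are disjoint uncountable
  sets of indices.\<close>

lemma coh_exists: "EX sv IA IB. coh E sv IA IB"
proof -
 have "emp<:Sq" unfolding Sq by (rule exI[of _ emp]) (simp add: fn_def)
 from lep_om1_surj[OF ctbl_lep_om1[OF ctbl_Sq] this] obtain sv where sv: "fn sv om1 Sq" "!!s. s<:Sq==>EX a. a<:om1&app sv a = s" by blast
 obtain f where f: "fn f (cart om1 om1) om1" "inj f (cart om1 om1)" using lep_om1_square unfolding lep_def by blast
 have d: "DfnT (%e. app f (pair (e 0) z))" for z by (intro dfn)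
 let ?I = "%z. img (%x. app f (pair x z)) om1"
 have I: "y<:?I z<->(EX x. x<:om1&y = app f (pair x z))" for y z by (rule img[OF d])
 have inj: "x = x'&z = z'" if h: "x<:om1" "z<:om1" "x'<:om1" "z'<:om1" "app f (pair x z) = app f (pair x' z')" for x z x' z'
 proof -
  have "pair x z = pair x' z'" using f(2)[unfolded inj_def, rule_format, of "pair x z" "pair x' z'"] h by simp
  then show ?thesis by simp
 qed
 have 1: "?I z<<=om1&~ctbl (?I z)" if z: "z<:om1" for z
 proof
  show "?I z<<=om1" unfolding sub_def I using fn_app(2)[OF f(1)] z by auto
  have "lep om1 (?I z)" by (rule lepI[OF d]) (use inj[OF _ z _ z] I in blast)+
  then show "~ctbl (?I z)" using unc_om1 ctbl_lep by blast
 qed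
 have "~y<:?I (sc emp)" if "y<:?I emp" for y
  using that inj[OF _ emp_om1(1) _ emp_om1(2)] unfolding I by auto
 then have "coh E sv (?I emp) (?I (sc emp))"
  using sv 1[OF emp_om1(1)] 1[OF emp_om1(2)] by (intro coh.intro zfc_axioms coh_axioms.intro) blast+
 then show ?thesis by blast
qed

lemma lip_exists: "EX E' A B. lip E' A B"
proof -
 obtain sv IA IB where "coh E sv IA IB" using coh_exists by blast
 then interpret c: coh E sv IA IB .
 from c.iteration obtain l t where i: "Ord l" "om1<:l" "ALL x. x<:l-->sc x<:l"
  "ALL f. fn f om1 l-->(EX b. b<:l&(ALL x. x<:om1-->app f x<<=b))" "c.coht t" "valid l t" "c.good l t"
  "ALL p S b. cond l p-->S<<=cart (Cnd l) (cart om1 om1)-->lep S om1-->b<:l -->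
   (EX x. x<:l&b<<=x&om1<<=x&(c.okc x t p S-->app t x = c.ftau t p S x))" by (elim exE conjE) (rule that)
 have it: "iter E sv IA IB l t"
 proof (intro iter.intro iter_axioms.intro c.coh_axioms)
  show "EX x. x<:l&b<<=x&om1<<=x&(c.okc x t p S-->app t x = c.ftau t p S x)"
   if "cond l p" "S<<=cart (Cnd l) (cart om1 om1)" "lep S om1" "b<:l" for p S b
   using i(8) that by blast
 qed (use i in blast)+
 define R where "R = sep (cart (Cnd l) (Cnd l)) (%z. LE t (p1 z) (p2 z))"
 have d: "Dfn (%e. LE t (p1 (e 0)) (p2 (e 0)))" by (intro dfn)
 have R: "pair q p<:R<->cond l q&cond l p&LE t q p" for q p unfolding R_def sep[OF d] by (simp add: Cnd)
 have fo: "forcing E (Cnd l) R"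
 proof (intro forcing.intro zfc_axioms forcing_axioms.intro)
  show "pair p p<:R" if "p<:Cnd l" for p using that LE_refl unfolding R Cnd by blast
  show "pair p r<:R" if "pair p q<:R" "pair q r<:R" for p q r
   using that LE_trans[OF i(6,1)] unfolding R by blast
 qed
 have "emp<:Cnd l" unfolding Cnd by (rule cond_emp)
 from forcing.generic_extension[OF fo this] obtain G E' j where "gext E (Cnd l) R G E' j" by blast
 then have "iext E sv IA IB l t (Cnd l) R G E' j" using it by (intro iext.intro iext_axioms.intro) (simp_all add: R_def)
 from iext.lip_ext[OF this] show ?thesis by blast
qed

end

theorem theorem1p7:
  assumes "consistent ZFC"
  shows "\<not> ZFC \<union> {MA_Knaster 0, Aronszajn_special 0} \<turnstile> BA_Lip 0"
proof
 assume p: "ZFC \<union> {MA_Knaster 0, Aronszajn_special 0} \<turnstile> BA_Lip 0"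
 obtain E :: "U => U => bool" where E: "!!p e. p : ZFC==>sat E e p" using countable_model_ZFC[OF assms] by blast
 have "zfc E"
  by (intro zfc.intro zf.intro zfc_axioms.intro E) (auto simp: ZF_def ZFC_def)
 then obtain E' A B where "lip E' A B" using zfc.lip_exists by blast
 then interpret lip E' A B .
 \<comment> \<open>Soundness and the failure of the conclusion hold in every environment, so an
   arbitrary one is taken.\<close>
 fix e
 have "sat E' e (BA_Lip 0)"
 proof (rule soundness[OF p])
  fix q assume "q : ZFC \<union> {MA_Knaster 0, Aronszajn_special 0}"
  then consider "q : ZF" | "q = Choice 0" | "q = MA_Knaster 0" | "q = Aronszajn_special 0" unfolding ZFC_def ZF_def by blast
  then show "sat E' e q" using ZF choice sat_MA sat_Aronszajn by cases simp_all
 qed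
 then show False using not_BA_Lip by blast
qed

end
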